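(* There is an algorithm which, given an instance of the linear exchange (Arrow-Debreu) market with $n$ agents whose utilities $u_{ij}$ are integers in $\{0,1,\ldots,U\}$ (and which satisfies the standing assumptions listed in the context), computes an equilibrium price vector in time $O(n^{10}\log^2(nU))$.
   Context: Linear exchange market: there are $n$ agents; agent $i$ owns exactly one unit of good $i$ (so there are $n$ goods). Agent $i$ has a linear utility $\sum_j u_{ij}x_{ij}$, where $x_{ij}\ge 0$ is the amount of good $j$ it receives. Standing assumptions: (a) for every $i$ there is $j$ with $u_{ij}>0$; (b) for every $j$ there is $i$ with $u_{ij}>0$; (c) (irreducibility) for every nonempty proper subset $P$ of agents there are $i\in P$, $j\notin P$ with $u_{ij}>0$; (d) each $u_{ij}$ is an integer between $0$ and $U$. An equilibrium is a vector $p=(p_1,\ldots,p_n)$ of positive prices together with allocations $x_{ij}\ge 0$ such that: every good is completely sold ($\sum_i x_{ij}=1$ for all $j$); every agent spends its entire budget ($\sum_j x_{ij}p_j=p_i$ for all $i$); and agents buy only goods of maximum utility per unit of money ($x_{ij}>0\Rightarrow u_{ij}/p_j=\max_\ell u_{i\ell}/p_\ell$). An equilibrium price vector is the price part of an equilibrium. *)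

theory Defs
  imports Complex_Main "HOL-Library.Log_Nat"
begin

section \<open>Linear exchange markets\<close>

text \<open>
  Agents and goods are both indexed by \<open>{..<n}\<close>; agent \<open>i\<close> owns one unit of good \<open>i\<close>.
  Values of \<open>u\<close>, \<open>p\<close>, \<open>x\<close> at indices \<open>\<ge> n\<close> are irrelevant.
\<close>

definition linear_market :: "nat \<Rightarrow> nat \<Rightarrow> (nat \<Rightarrow> nat \<Rightarrow> nat) \<Rightarrow> bool" where
  "linear_market n U u \<longleftrightarrow>
     0 < n \<and>
     (\<forall>i<n. \<exists>j<n. 0 < u i j) \<and>
     (\<forall>j<n. \<exists>i<n. 0 < u i j) \<and>
     (\<forall>P. P \<noteq> {} \<and> P \<subset> {..<n} \<longrightarrow> (\<exists>i\<in>P. \<exists>j\<in>{..<n} - P. 0 < u i j)) \<and>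
     (\<forall>i<n. \<forall>j<n. u i j \<le> U)"

definition equilibrium ::
  "nat \<Rightarrow> (nat \<Rightarrow> nat \<Rightarrow> nat) \<Rightarrow> (nat \<Rightarrow> real) \<Rightarrow> (nat \<Rightarrow> nat \<Rightarrow> real) \<Rightarrow> bool" where
  "equilibrium n u p x \<longleftrightarrow>
     (\<forall>i<n. 0 < p i) \<and>
     (\<forall>i<n. \<forall>j<n. 0 \<le> x i j) \<and>
     (\<forall>j<n. (\<Sum>i<n. x i j) = 1) \<and>
     (\<forall>i<n. (\<Sum>j<n. x i j * p j) = p i) \<and>
     (\<forall>i<n. \<forall>j<n. 0 < x i j \<longrightarrow>
        real (u i j) / p j = Max ((\<lambda>l. real (u i l) / p l) ` {..<n}))"

definition equilibrium_prices :: "nat \<Rightarrow> (nat \<Rightarrow> nat \<Rightarrow> nat) \<Rightarrow> (nat \<Rightarrow> real) \<Rightarrow> bool" where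
  "equilibrium_prices n u p \<longleftrightarrow> (\<exists>x. equilibrium n u p x)"


section \<open>Random access machines under the logarithmic cost criterion\<close>

text \<open>
  The model of Aho, Hopcroft and Ullman (The Design and Analysis of Computer Algorithms,
  Chapter 1): registers holding arbitrary integers, direct and indirect addressing, a read-only
  input tape and a write-only output tape.  Every executed instruction is charged the total bit
  length of all integers it handles, register addresses included; so arithmetic on \<open>L\<close>-bit
  integers, multiplication and division included, costs \<open>O(L)\<close>.  The textbook machine has a single
  accumulator and jumps; here instructions name their operands and control flow is structured,
  which changes running times by at most a constant factor.  A program is a fixed finite object,
  so only a fixed finite number of integer constants and of direct addresses occurs in it.
\<close>

datatype loc = Direct nat | Indirect nat

datatype operand = Const int | Reg loc

datatype arith_op = ADD | SUB | MUL | DIV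

datatype test = Gtz operand | Eqz operand

datatype prog =
    Nop
  | Move loc operand
  | Arith arith_op loc operand operand
  | Input loc
  | Output operand
  | Seq prog prog
  | Cond test prog prog
  | Loop test prog

record state =
  reg :: "nat \<Rightarrow> int"
  inp :: "int list"
  outp :: "int list"

definition len :: "int \<Rightarrow> nat" where
  "len c = max 1 (floorlog 2 (nat \<bar>c\<bar>))"

fun valid_loc :: "(nat \<Rightarrow> int) \<Rightarrow> loc \<Rightarrow> bool" where
  "valid_loc r (Direct i) \<longleftrightarrow> True"
| "valid_loc r (Indirect i) \<longleftrightarrow> 0 \<le> r i"

fun addr :: "(nat \<Rightarrow> int) \<Rightarrow> loc \<Rightarrow> nat" where
  "addr r (Direct i) = i"
| "addr r (Indirect i) = nat (r i)"

fun loc_cost :: "(nat \<Rightarrow> int) \<Rightarrow> loc \<Rightarrow> nat" where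
  "loc_cost r (Direct i) = len (int i)"
| "loc_cost r (Indirect i) = len (int i) + len (r i)"

fun valid_operand :: "(nat \<Rightarrow> int) \<Rightarrow> operand \<Rightarrow> bool" where
  "valid_operand r (Const c) \<longleftrightarrow> True"
| "valid_operand r (Reg l) \<longleftrightarrow> valid_loc r l"

fun operand_val :: "(nat \<Rightarrow> int) \<Rightarrow> operand \<Rightarrow> int" where
  "operand_val r (Const c) = c"
| "operand_val r (Reg l) = r (addr r l)"

fun operand_cost :: "(nat \<Rightarrow> int) \<Rightarrow> operand \<Rightarrow> nat" where
  "operand_cost r (Const c) = len c"
| "operand_cost r (Reg l) = loc_cost r l + len (r (addr r l))"

text \<open>\<open>DIV\<close> rounds towards minus infinity, and division by \<open>0\<close> yields \<open>0\<close>.\<close>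

fun arith_val :: "arith_op \<Rightarrow> int \<Rightarrow> int \<Rightarrow> int" where
  "arith_val ADD a b = a + b"
| "arith_val SUB a b = a - b"
| "arith_val MUL a b = a * b"
| "arith_val DIV a b = a div b"

fun test_operand :: "test \<Rightarrow> operand" where
  "test_operand (Gtz a) = a"
| "test_operand (Eqz a) = a"

fun test_val :: "(nat \<Rightarrow> int) \<Rightarrow> test \<Rightarrow> bool" where
  "test_val r (Gtz a) \<longleftrightarrow> 0 < operand_val r a"
| "test_val r (Eqz a) \<longleftrightarrow> operand_val r a = 0"

text \<open>
  \<open>exec c s t s'\<close>: started in \<open>s\<close>, program \<open>c\<close> halts in \<open>s'\<close> after time \<open>t\<close>.  There is no
  such \<open>t\<close> and \<open>s'\<close> if \<open>c\<close> diverges, uses a negative address or reads beyond the end of the input.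
\<close>

inductive exec :: "prog \<Rightarrow> state \<Rightarrow> nat \<Rightarrow> state \<Rightarrow> bool" where
  Nop: "exec Nop s 0 s"
| Move: "\<lbrakk> valid_loc (reg s) d; valid_operand (reg s) a; v = operand_val (reg s) a \<rbrakk> \<Longrightarrow>
    exec (Move d a) s
      (operand_cost (reg s) a + loc_cost (reg s) d)
      (s\<lparr> reg := (reg s)(addr (reg s) d := v) \<rparr>)"
| Arith: "\<lbrakk> valid_loc (reg s) d; valid_operand (reg s) a; valid_operand (reg s) b;
      v = arith_val f (operand_val (reg s) a) (operand_val (reg s) b) \<rbrakk> \<Longrightarrow>
    exec (Arith f d a b) s
      (operand_cost (reg s) a + operand_cost (reg s) b + loc_cost (reg s) d + len v)
      (s\<lparr> reg := (reg s)(addr (reg s) d := v) \<rparr>)"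
| Input: "\<lbrakk> valid_loc (reg s) d; inp s = v # vs \<rbrakk> \<Longrightarrow>
    exec (Input d) s
      (len v + loc_cost (reg s) d)
      (s\<lparr> reg := (reg s)(addr (reg s) d := v), inp := vs \<rparr>)"
| Output: "valid_operand (reg s) a \<Longrightarrow>
    exec (Output a) s
      (operand_cost (reg s) a)
      (s\<lparr> outp := outp s @ [operand_val (reg s) a] \<rparr>)"
| Seq: "\<lbrakk> exec c1 s t1 s1; exec c2 s1 t2 s2 \<rbrakk> \<Longrightarrow> exec (Seq c1 c2) s (t1 + t2) s2"
| Cond: "\<lbrakk> valid_operand (reg s) (test_operand b);
      exec (if test_val (reg s) b then c1 else c2) s t s' \<rbrakk> \<Longrightarrow>
    exec (Cond b c1 c2) s (operand_cost (reg s) (test_operand b) + t) s'"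
| Loop_exit: "\<lbrakk> valid_operand (reg s) (test_operand b); \<not> test_val (reg s) b \<rbrakk> \<Longrightarrow>
    exec (Loop b c) s (operand_cost (reg s) (test_operand b)) s"
| Loop_step: "\<lbrakk> valid_operand (reg s) (test_operand b); test_val (reg s) b;
      exec c s t1 s1; exec (Loop b c) s1 t2 s2 \<rbrakk> \<Longrightarrow>
    exec (Loop b c) s (operand_cost (reg s) (test_operand b) + t1 + t2) s2"

lemma exec_deterministic:
  "exec c s t s' \<Longrightarrow> exec c s t' s'' \<Longrightarrow> t' = t \<and> s'' = s'"
proof (induction arbitrary: t' s'' rule: exec.induct)
  case (Seq c1 s t1 s1 c2 t2 s2)
  from Seq.prems show ?case
    by cases (use Seq.IH in blast)
next
  case (Cond s b c1 c2 t s')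
  from Cond.prems show ?case
    by cases (use Cond.IH in blast)
next
  case (Loop_exit s b c)
  from Loop_exit.prems show ?case
    by cases (use Loop_exit.hyps in auto)
next
  case (Loop_step s b c t1 s1 t2 s2)
  from Loop_step.prems show ?case
    by cases (use Loop_step.hyps Loop_step.IH in blast)+
qed (erule exec.cases; simp)+

text \<open>
  \<open>runs c xs t ys\<close>: on input \<open>xs\<close>, with all registers initially \<open>0\<close>, program \<open>c\<close> halts
  after time \<open>t\<close> with output \<open>ys\<close>.
\<close>

definition runs :: "prog \<Rightarrow> int list \<Rightarrow> nat \<Rightarrow> int list \<Rightarrow> bool" where
  "runs c xs t ys \<longleftrightarrow>
     (\<exists>s'. exec c \<lparr> reg = (\<lambda>_. 0), inp = xs, outp = [] \<rparr> t s' \<and> outp s' = ys)"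


section \<open>Encoding of instances and of price vectors\<close>

text \<open>The number of agents, followed by the utilities in row-major order.\<close>

definition encode_market :: "nat \<Rightarrow> (nat \<Rightarrow> nat \<Rightarrow> nat) \<Rightarrow> int list" where
  "encode_market n u = int n # concat (map (\<lambda>i. map (\<lambda>j. int (u i j)) [0..<n]) [0..<n])"

text \<open>A vector of \<open>n\<close> rational numbers, each given by its numerator and its denominator.\<close>

definition encodes_vector :: "nat \<Rightarrow> int list \<Rightarrow> (nat \<Rightarrow> real) \<Rightarrow> bool" where
  "encodes_vector n ys p \<longleftrightarrow>
     length ys = 2 * n \<and>
     (\<forall>i<n. ys ! (2 * i + 1) \<noteq> 0 \<and>
            p i = real_of_int (ys ! (2 * i)) / real_of_int (ys ! (2 * i + 1)))"

end

theory Submission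
 imports Defs "HOL-Analysis.Brouwer_Fixpoint" "Jordan_Normal_Form.Determinant"
begin

text \<open>
  For prices \<open>p\<close> let every agent spend its income on one best good and let \<open>z\<close> be the resulting relative
  excess demand.  Every equilibrium \<open>q\<close> satisfies \<open>\<Sum>j. q j * z j \<ge> 0\<close>, so \<open>z\<close> cuts off the
  current prices.  The algorithm maintains a simplicial cone around \<open>q\<close>, queries the sum of its
  generators and moves every generator towards the one of largest value under \<open>z\<close>; this shrinks the
  cone, whose volume cannot fall below that of a small simplex around \<open>q\<close>.  Hence the cut soon becomes
  shallow, that is \<open>\<Sum>j. q j * z j\<close> is tiny, and then all agents nearly optimise at \<open>p\<close> along the
  flows of \<open>q\<close>.  A gap in the ratios of best to second best goods separates the equalities that hold at
  a nearby equilibrium, whose prices, relative to a representative of each component, have small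
  numerators and denominators and are recovered by continued fractions.  All of this is written in
  a small imperative language that is compiled to the machine.
\<close>

text \<open>Existence of an equilibrium is proved as well, since the algorithm is analysed relative
  to an unknown \<open>q\<close>. The cone is stored as integer points with coordinate sum
  \<open>M\<close>. Rounding makes it impossible to keep \<open>q\<close> inside exactly, so the
  invariant follows a small simplex of n points around \<open>q\<close> through their approximate
  barycentric coordinates. These form a stochastic matrix whose determinant is at most n! but grows
  by the factor 1 + 1/(16 n^2) with each cut, from about 2^(-170 n x), where x = n^2 L and L is the
  bit length of n U; this allows O(n^3 x) rounds only. The n^2 in x is the price of Cramer's rule
  for n + n^2 unknowns, prices and flows. A cut may stretch entries by 1 + 1/n^2, so they reach O(n
  x) bits, and n^2 operations on them per round give n^5 x * n x = n^10 L^2. As generators may leave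
  the positive orthant, a queried price may be tiny or negative; then a coordinate cut replaces the
  excess demand. The equilibrium finally returned need not be \<open>q\<close>: nearly optimal
  prices determine price ratios inside components only.\<close>

section \<open>Equilibria as money flows\<close>

text \<open>Here \<open>f i j\<close> stands for \<open>x i j * p j\<close>, the money that agent i
  spends on good j. In these variables budgets and market clearing are linear, and optimality is
  cross-multiplied so that no price is divided by.\<close>

definition meq :: "nat => (nat => nat => nat) => (nat => real) => (nat => nat => real) => bool" where
 "meq n u p f \<longleftrightarrow>
   (\<forall>i<n. 0 < p i) \<and> (\<forall>i<n. \<forall>j<n. 0 \<le> f i j) \<and>
   (\<forall>j<n. (\<Sum>i<n. f i j) = p j) \<and> (\<forall>i<n. (\<Sum>j<n. f i j) = p i) \<and>
   (\<forall>i<n. \<forall>j<n. 0 < f i j --> (\<forall>l<n. u i l * p j \<le> u i j * p l))"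

lemma meqD:
 assumes "meq n u p f"
 shows meq_pos: "\<And>i. i < n ==> 0 < p i" and meq_nonneg: "\<And>i j. i < n ==> j < n ==> 0 \<le> f i j"
  and meq_sold: "\<And>j. j < n ==> (\<Sum>i<n. f i j) = p j" and meq_spent: "\<And>i. i < n ==> (\<Sum>j<n. f i j) = p i"
  and meq_best: "\<And>i j l. i < n ==> j < n ==> 0 < f i j ==> l < n ==> u i l * p j \<le> u i j * p l"
 using assms unfolding meq_def by blast+

lemma marketD:
 assumes "linear_market n U u"
 shows market_nonempty: "0 < n" and market_likes: "\<And>i. i < n ==> \<exists>j<n. 0 < u i j"
  and market_bound: "\<And>i j. i < n ==> j < n ==> u i j \<le> U"
 using assms unfolding linear_market_def by blast+

lemma meq_imp_equilibrium_prices: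
 assumes "meq n u p f" shows "equilibrium_prices n u p"
proof -
 have pos: "\<And>i. i < n ==> 0 < p i" using assms by (auto simp: meq_def)
 have "equilibrium n u p (\<lambda>i j. f i j / p j)"
  unfolding equilibrium_def
 proof (intro conjI allI impI)
  fix i j assume ij: "i < n" "j < n"
  show "0 \<le> f i j / p j" using assms ij by (auto simp: meq_def intro!: divide_nonneg_pos)
  assume "0 < f i j / p j"
  then have "0 < f i j" using pos[OF ij(2)] by (simp add: zero_less_divide_iff)
  then have *: "\<And>l. l < n ==> u i l * p j \<le> u i j * p l" using assms ij by (auto simp: meq_def)
  show "real (u i j) / p j = Max ((\<lambda>l. real (u i l) / p l) ` {..<n})"
   by (rule Max_eqI[symmetric]) (use ij * pos in \<open>auto simp: field_simps\<close>)
 next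
  fix j assume "j < n"
  then show "(\<Sum>i<n. f i j / p j) = 1" using assms pos[of j]
   by (simp add: meq_def less_le flip: sum_divide_distrib)
 next
  fix i assume "i < n"
  then have "(\<Sum>j<n. f i j / p j * p j) = (\<Sum>j<n. f i j)"
   by (intro sum.cong) (use pos in \<open>auto simp: less_le\<close>)
  then show "(\<Sum>j<n. f i j / p j * p j) = p i" using assms \<open>i < n\<close> by (simp add: meq_def)
 qed (use pos in auto)
 then show ?thesis by (auto simp: equilibrium_prices_def)
qed

lemma market_irreducible:
 assumes "linear_market n U u" "P \<noteq> {}" "P \<subset> {..<n}"
 shows "\<exists>i\<in>P. \<exists>j\<in>{..<n} - P. 0 < u i j"
proof -
 have "\<forall>P. P \<noteq> {} \<and> P \<subset> {..<n} --> (\<exists>i\<in>P. \<exists>j\<in>{..<n} - P. 0 < u i j)"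
  using assms(1) unfolding linear_market_def by (elim conjE)
 then show ?thesis using assms(2,3) by blast
qed

section \<open>Existence of an equilibrium\<close>

text \<open>The dimension n is a term and not a type, so points are functions of which only the
  first n values matter. Compactness comes from refining the subsequence one coordinate at a
  time.\<close>

lemma convergent_subsequence_coordinatewise:
 fixes X :: "nat => nat => real"
 assumes "\<And>m i. i < n ==> a \<le> X m i \<and> X m i \<le> b"
 shows "\<exists>r l. strict_mono r \<and> (\<forall>i<n. (\<lambda>m. X (r m) i) \<longlonglongrightarrow> l i)"
 using assms
proof (induction n)
 case 0
 show ?case by (rule exI[of _ id]) (auto simp: strict_mono_def)
next
 case (Suc n)
 then obtain r l where r: "strict_mono r" "\<And>i. i < n ==> (\<lambda>m. X (r m) i) \<longlonglongrightarrow> l i"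
  by (metis less_SucI)
 have "bounded (range (\<lambda>m. X (r m) n))"
 proof -
  have "range (\<lambda>m. X (r m) n) \<subseteq> {a..b}" using Suc.prems[of n] by auto
  then show ?thesis using compact_imp_bounded[OF compact_Icc] bounded_subset by blast
 qed
 then obtain l' r' where r': "strict_mono r'" "((\<lambda>m. X (r m) n) \<circ> r') \<longlonglongrightarrow> l'"
  using bounded_imp_convergent_subsequence by metis
 have "\<forall>i<Suc n. (\<lambda>m. X ((r \<circ> r') m) i) \<longlonglongrightarrow> (l(n := l')) i"
 proof (intro allI impI)
  fix i assume "i < Suc n"
  then consider "i = n" | "i < n" by linarith
  then show "(\<lambda>m. X ((r \<circ> r') m) i) \<longlonglongrightarrow> (l(n := l')) i"
  proof cases
   case 1 then show ?thesis using r'(2) by (simp add: comp_def)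
  next
   case 2 then show ?thesis using LIMSEQ_subseq_LIMSEQ[OF r(2) r'(1)] by (simp add: comp_def)
  qed
 qed
 then show ?case using strict_mono_o[OF r(1) r'(1)] by blast
qed

text \<open>Brouwer's theorem for a cube of variable dimension, with sequential continuity. On ever
  finer grids Kuhn's lemma yields cells in which, for each coordinate i, one corner is not moved
  down and another is not moved up in direction i. In the limit the corners merge and both
  inequalities hold at one point.\<close>

lemma brouwer_cube_coordinatewise:
 fixes f :: "(nat => real) => nat => real"
 assumes ran: "\<And>x i. (\<And>i. i < n ==> 0 \<le> x i \<and> x i \<le> 1) ==> i < n ==> 0 \<le> f x i \<and> f x i \<le> 1"
  and cont: "\<And>X x i. (\<And>m i. i < n ==> 0 \<le> X m i \<and> X m i \<le> 1) ==>
   (\<And>i. i < n ==> (\<lambda>m. X m i) \<longlonglongrightarrow> x i) ==> i < n ==> (\<lambda>m. f (X m) i) \<longlonglongrightarrow> f x i"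
 shows "\<exists>x. \<forall>i<n. 0 \<le> x i \<and> x i \<le> 1 \<and> f x i = x i"
proof -
 define sc :: "nat => (nat => nat) => nat => real" where "sc p g i = real (g i) / real (Suc p)" for p g i
 \<comment> \<open>The two boundary cases are forced by Kuhn's lemma. Label 0 still implies
   \<open>sc p g i \<le> f (sc p g) i\<close> and label 1 the reverse inequality, because f maps the
   cube into itself.\<close>
 define lab where "lab p g i = (if g i = 0 then 0 else if g i = Suc p then 1
   else if sc p g i \<le> f (sc p g) i then 0 else (1::nat))" for p g i
 define \<Phi> where "\<Phi> p q r s \<longleftrightarrow> (\<forall>i<n. q i < Suc p) \<and> (\<forall>i<n. (\<forall>j<n. q j \<le> r i j \<and> r i j \<le> q j + 1) \<and>
   (\<forall>j<n. q j \<le> s i j \<and> s i j \<le> q j + 1) \<and> lab p (r i) i = 0 \<and> lab p (s i) i = 1)" for p q r s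
 have "\<exists>q r s. \<Phi> p q r s" for p
 proof -
  have 1: "0 < Suc p" by simp
  have 2: "\<forall>x. (\<forall>i<n. x i \<le> Suc p) --> (\<forall>i<n. lab p x i = (0::nat) \<or> lab p x i = 1)"
   by (auto simp: lab_def)
  have 3: "\<forall>x. (\<forall>i<n. x i \<le> Suc p) --> (\<forall>i<n. x i = 0 --> lab p x i = 0)"
   by (auto simp: lab_def)
  have 4: "\<forall>x. (\<forall>i<n. x i \<le> Suc p) --> (\<forall>i<n. x i = Suc p --> lab p x i = 1)"
   by (auto simp: lab_def)
  obtain q where q: "\<forall>i<n. q i < Suc p" and rs: "\<forall>i<n. \<exists>r s. (\<forall>j<n. q j \<le> r j \<and> r j \<le> q j + 1) \<and>
    (\<forall>j<n. q j \<le> s j \<and> s j \<le> q j + 1) \<and> lab p r i \<noteq> lab p s i"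
   using kuhn_lemma[OF 1 2 3 4] by blast
  have "\<forall>i. \<exists>r s. i < n --> (\<forall>j<n. q j \<le> r j \<and> r j \<le> q j + 1) \<and>
    (\<forall>j<n. q j \<le> s j \<and> s j \<le> q j + 1) \<and> lab p r i = 0 \<and> lab p s i = 1"
  proof
   fix i
   show "\<exists>r s. i < n --> (\<forall>j<n. q j \<le> r j \<and> r j \<le> q j + 1) \<and>
    (\<forall>j<n. q j \<le> s j \<and> s j \<le> q j + 1) \<and> lab p r i = 0 \<and> lab p s i = 1"
   proof (cases "i < n")
    case True
    then obtain r s where *: "\<forall>j<n. q j \<le> r j \<and> r j \<le> q j + 1"
     "\<forall>j<n. q j \<le> s j \<and> s j \<le> q j + 1" "lab p r i \<noteq> lab p s i" using rs by blast
    have "lab p r i = 0 \<or> lab p r i = 1" "lab p s i = 0 \<or> lab p s i = 1"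
     by (auto simp: lab_def)
    then show ?thesis using * by metis
   qed auto
  qed
  then have "\<exists>r s. \<forall>i. i < n --> (\<forall>j<n. q j \<le> r i j \<and> r i j \<le> q j + 1) \<and>
    (\<forall>j<n. q j \<le> s i j \<and> s i j \<le> q j + 1) \<and> lab p (r i) i = 0 \<and> lab p (s i) i = 1"
   by (simp only: choice_iff)
  then show ?thesis using q unfolding \<Phi>_def by blast
 qed
 then have "\<forall>p. \<exists>q r s. \<Phi> p q r s" ..
 then have "\<exists>Q R S. \<forall>p. \<Phi> p (Q p) (R p) (S p)" by (simp only: choice_iff)
 then obtain Q R S where QRS: "\<Phi> p (Q p) (R p) (S p)" for p by (elim exE) (rule that, erule spec)
 have Q: "Q p i < Suc p" if "i < n" for p i
  using conjunct1[OF QRS[of p, unfolded \<Phi>_def]] that by blast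
 note RS = mp[OF spec[OF conjunct2[OF QRS[unfolded \<Phi>_def]]]]
 have R: "Q p j \<le> R p i j \<and> R p i j \<le> Q p j + 1" if "i < n" "j < n" for p i j
  using conjunct1[OF RS[OF that(1)]] that(2) by blast
 have S: "Q p j \<le> S p i j \<and> S p i j \<le> Q p j + 1" if "i < n" "j < n" for p i j
  using conjunct1[OF conjunct2[OF RS[OF that(1)]]] that(2) by blast
 have lr: "lab p (R p i) i = 0" if "i < n" for p i using conjunct2[OF conjunct2[OF RS[OF that]]] by (rule conjunct1)
 have ls: "lab p (S p i) i = 1" if "i < n" for p i using conjunct2[OF conjunct2[OF RS[OF that]]] by (rule conjunct2)
 have cube: "0 \<le> sc p (T p) j \<and> sc p (T p) j \<le> 1"
  if T: "\<And>p j. j < n ==> Q p j \<le> T p j \<and> T p j \<le> Q p j + 1" and j: "j < n" for T p j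
 proof -
  have "T p j \<le> Suc p" using T[OF j, of p] Q[OF j, of p] by linarith
  then have "real (T p j) \<le> real (Suc p)" by (rule of_nat_mono)
  then show ?thesis by (simp add: sc_def)
 qed
 have "\<exists>r l. strict_mono r \<and> (\<forall>i<n. (\<lambda>m. sc (r m) (Q (r m)) i) \<longlonglongrightarrow> l i)"
  by (rule convergent_subsequence_coordinatewise[of n 0 "\<lambda>m. sc m (Q m)" 1])
   (simp add: cube[where T = Q])
 then obtain h x where h: "strict_mono h" and x: "\<And>i. i < n ==> (\<lambda>m. sc (h m) (Q (h m)) i) \<longlonglongrightarrow> x i" by blast
 have inv0: "(\<lambda>m. 1 / real (Suc (h m))) \<longlonglongrightarrow> 0"
  using LIMSEQ_subseq_LIMSEQ[OF LIMSEQ_Suc[OF lim_inverse_n'] h] by (simp add: comp_def)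
 have near: "(\<lambda>m. sc (h m) (T (h m)) j) \<longlonglongrightarrow> x j"
  if T: "\<And>p j. j < n ==> Q p j \<le> T p j \<and> T p j \<le> Q p j + 1" and j: "j < n" for T j
 proof (rule tendsto_sandwich[OF _ _ x[OF j]])
  show "\<forall>\<^sub>F m in sequentially. sc (h m) (Q (h m)) j \<le> sc (h m) (T (h m)) j"
   using T[OF j] by (auto simp: sc_def divide_right_mono)
  show "\<forall>\<^sub>F m in sequentially. sc (h m) (T (h m)) j \<le> sc (h m) (Q (h m)) j + 1 / real (Suc (h m))"
  proof (intro always_eventually allI)
   fix m
   have "real (T (h m) j) \<le> real (Q (h m) j + 1)" using T[OF j, of "h m"] by (intro of_nat_mono) auto
   then show "sc (h m) (T (h m)) j \<le> sc (h m) (Q (h m)) j + 1 / real (Suc (h m))"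
    unfolding sc_def add_divide_distrib[symmetric] by (intro divide_right_mono) auto
  qed
  show "(\<lambda>m. sc (h m) (Q (h m)) j + 1 / real (Suc (h m))) \<longlonglongrightarrow> x j"
   using tendsto_add[OF x[OF j] inv0] by simp
 qed
 have "0 \<le> x i \<and> x i \<le> 1 \<and> f x i = x i" if i: "i < n" for i
 proof -
  have R': "\<And>p j. j < n ==> Q p j \<le> R p i j \<and> R p i j \<le> Q p j + 1"
   and S': "\<And>p j. j < n ==> Q p j \<le> S p i j \<and> S p i j \<le> Q p j + 1" using R S i by auto
  have QQ: "\<And>p j. j < n ==> Q p j \<le> Q p j \<and> Q p j \<le> Q p j + 1" by simp
  have le: "sc p (R p i) i \<le> f (sc p (R p i)) i" for p
   using lr[OF i, of p] ran[of "sc p (R p i)" i, OF cube[OF R']] i by (auto simp: lab_def sc_def split: if_splits)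
  have ge: "f (sc p (S p i)) i \<le> sc p (S p i) i" for p
   using ls[OF i, of p] ran[of "sc p (S p i)" i, OF cube[OF S']] i by (auto simp: lab_def sc_def split: if_splits)
  have fR: "(\<lambda>m. f (sc (h m) (R (h m) i)) i) \<longlonglongrightarrow> f x i"
   by (rule cont[of "\<lambda>m. sc (h m) (R (h m) i)" x i]) (use cube[OF R'] near[OF R'] i in auto)
  have fS: "(\<lambda>m. f (sc (h m) (S (h m) i)) i) \<longlonglongrightarrow> f x i"
   by (rule cont[of "\<lambda>m. sc (h m) (S (h m) i)" x i]) (use cube[OF S'] near[OF S'] i in auto)
  have "x i \<le> f x i" by (rule LIMSEQ_le[OF near[OF R' i] fR]) (use le in auto)
  moreover have "f x i \<le> x i" by (rule LIMSEQ_le[OF fS near[OF S' i]]) (use ge in auto)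
  moreover have "0 \<le> x i" by (rule LIMSEQ_le_const[OF x[OF i]]) (use cube[OF QQ i] in auto)
  moreover have "x i \<le> 1" by (rule LIMSEQ_le_const2[OF x[OF i]]) (use cube[OF QQ i] in auto)
  ultimately show ?thesis by auto
 qed
 then show ?thesis by blast
qed

text \<open>Demand for best goods jumps, so it is smoothed: agents spend in proportion to a growing
  power of utility per unit of money. Each smoothed economy has a fixed point by Brouwer, and a
  limit of these fixed points is an equilibrium.\<close>

lemma market_flow_exists:
 assumes m: "linear_market n U u" shows "\<exists>p f. meq n u p f"
proof -
 have n: "0 < n" and ne: "\<And>i. i < n ==> \<exists>j<n. 0 < u i j" using m by (auto simp: linear_market_def)
 \<comment> \<open>The summand \<open>1 / real (Suc t)\<close> keeps the ratio defined at price 0;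
   the exponent \<open>Suc t\<close> in \<open>s\<close> concentrates the shares on the best goods
   as t grows.\<close>
 define a where "a t p i j = real (u i j) / (p j + 1 / real (Suc t))" for t p i and j :: nat
 define s where "s t p i j = a t p i j ^ Suc t / (\<Sum>l<n. a t p i l ^ Suc t)" for t p i and j :: nat
 \<comment> \<open>A retraction of the cube to the simplex: missing mass is spread evenly, which
   makes the total at least 1, and then the total is normalised. Points of sum 1 are left alone, in
   particular the fixed points found below.\<close>
 define \<tau> where "\<tau> x = (\<lambda>i::nat. (x i + max 0 (1 - (\<Sum>j<n. x j)) / real n) /
   (\<Sum>k<n. x k + max 0 (1 - (\<Sum>j<n. x j)) / real n))" for x
 define g where "g t x = (\<lambda>j. \<Sum>i<n. \<tau> x i * s t (\<tau> x) i j)" for t x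
 have den: "1 \<le> (\<Sum>k<n. x k + max 0 (1 - (\<Sum>j<n. x j)) / real n)" for x :: "nat => real"
  using n by (simp add: sum.distrib)
 have tau0: "0 \<le> \<tau> x i" if "\<And>i. i < n ==> 0 \<le> x i" "i < n" for x i
  unfolding \<tau>_def by (intro divide_nonneg_pos add_nonneg_nonneg) (use that den[of x] in auto)
 have tau1: "(\<Sum>i<n. \<tau> x i) = 1" for x
  using den[of x] by (simp add: \<tau>_def flip: sum_divide_distrib)
 have a0: "0 \<le> a t p i j" if "\<And>i. i < n ==> 0 \<le> p i" "j < n" for t p i j
  unfolding a_def using that by (intro divide_nonneg_nonneg add_nonneg_nonneg) auto
 have apos: "0 < a t p i j" if "\<And>i. i < n ==> 0 \<le> p i" "j < n" "0 < u i j" for t p i j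
  unfolding a_def using that by (intro divide_pos_pos add_nonneg_pos) auto
 have spos: "0 < (\<Sum>l<n. a t p i l ^ Suc t)" if p: "\<And>i. i < n ==> 0 \<le> p i" and i: "i < n" for t p i
 proof -
  obtain j where j: "j < n" "0 < u i j" using ne[OF i] by blast
  show ?thesis
   by (rule sum_pos2[of _ j]) (use j apos[of p, OF p] a0[of p, OF p] in \<open>auto intro!: zero_le_power zero_less_power simp del: power_Suc\<close>)
 qed
 have s0: "0 \<le> s t p i j" if "\<And>i. i < n ==> 0 \<le> p i" "i < n" "j < n" for t p i j
  unfolding s_def using that spos[of p i t] a0[of p j t i] by (intro divide_nonneg_pos zero_le_power) auto
 have s1: "(\<Sum>j<n. s t p i j) = 1" if "\<And>i. i < n ==> 0 \<le> p i" "i < n" for t p i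
  using spos[of p i t] that unfolding s_def by (simp flip: sum_divide_distrib)
 have s_le1: "s t p i j \<le> 1" if "\<And>i. i < n ==> 0 \<le> p i" "i < n" "j < n" for t p i j
  using member_le_sum[of j "{..<n}" "s t p i"] s0[of p i _ t] s1[of p i t] that by auto
 have g0: "0 \<le> g t x j" if "\<And>i. i < n ==> 0 \<le> x i" "j < n" for t x j
  unfolding g_def using that by (intro sum_nonneg mult_nonneg_nonneg tau0 s0) auto
 have g1: "(\<Sum>j<n. g t x j) = 1" if x: "\<And>i. i < n ==> 0 \<le> x i" for t x
 proof -
  have "(\<Sum>j<n. g t x j) = (\<Sum>i<n. \<tau> x i * (\<Sum>j<n. s t (\<tau> x) i j))"
   unfolding g_def sum_distrib_left by (rule sum.swap)
  also have "\<dots> = (\<Sum>i<n. \<tau> x i)"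
   by (rule sum.cong) (use s1[of "\<tau> x" _ t] tau0 x in auto)
  finally show ?thesis by (simp add: tau1)
 qed
 have "\<exists>x. \<forall>i<n. 0 \<le> x i \<and> x i \<le> 1 \<and> g t x i = x i" for t
 proof (rule brouwer_cube_coordinatewise)
  fix x :: "nat => real" and i assume x: "\<And>i. i < n ==> 0 \<le> x i \<and> x i \<le> 1" and i: "i < n"
  then show "0 \<le> g t x i \<and> g t x i \<le> 1"
   using member_le_sum[of i "{..<n}" "g t x"] g0[of x _ t] g1[of x t] by auto
 next
  fix X and x :: "nat => real" and i assume X: "\<And>m i. i < n ==> 0 \<le> X m i \<and> X m i \<le> (1::real)"
   and lim: "\<And>i. i < n ==> (\<lambda>m. X m i) \<longlonglongrightarrow> x i" and i: "i < n"
  have x: "\<And>i. i < n ==> 0 \<le> x i" by (rule LIMSEQ_le_const[OF lim]) (use X in auto)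
  have tl: "(\<lambda>m. \<tau> (X m) j) \<longlonglongrightarrow> \<tau> x j" if j: "j < n" for j
   unfolding \<tau>_def using den[of x] n j by (intro tendsto_intros lim) auto
  have al: "(\<lambda>m. a t (\<tau> (X m)) k j) \<longlonglongrightarrow> a t (\<tau> x) k j" if j: "j < n" for j k
  proof -
   have "0 < \<tau> x j + 1 / real (Suc t)" using tau0[of x j] x j by (intro add_nonneg_pos) auto
   then show ?thesis unfolding a_def by (intro tendsto_intros tl j) auto
  qed
  show "(\<lambda>m. g t (X m) i) \<longlonglongrightarrow> g t x i"
   unfolding g_def s_def
  proof (intro tendsto_intros tl al i)
   fix k assume "k \<in> {..<n}"
   then show "(\<Sum>l<n. a t (\<tau> x) k l ^ Suc t) \<noteq> 0" using spos[of "\<tau> x" k t] tau0[of x] x by auto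
  qed auto
 qed
 then obtain x where x: "\<And>t i. i < n ==> 0 \<le> x t i \<and> x t i \<le> 1 \<and> g t (x t) i = x t i" by metis
 have x0: "\<And>t i. i < n ==> 0 \<le> x t i" using x by auto
 have xs: "(\<Sum>i<n. x t i) = 1" for t
  using g1[of "x t" t] x by (metis (no_types, lifting) lessThan_iff sum.cong)
 have tx: "\<tau> (x t) i = x t i" for t i by (simp add: \<tau>_def xs)
 have fx: "x t j = (\<Sum>i<n. x t i * s t (x t) i j)" if "j < n" for t j
 proof -
  have "\<tau> (x t) = x t" using tx by auto
  then show ?thesis using x[OF that, of t] unfolding g_def by simp
 qed
 \<comment> \<open>Prices and all n^2 shares in one sequence, so that a single subsequence makes
   everything converge.\<close>
 define Y where "Y t k = (if k < n then x t k else s t (x t) ((k - n) div n) ((k - n) mod n))" for t k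
 have "\<exists>r l. strict_mono r \<and> (\<forall>i<n + n * n. (\<lambda>m. Y (r m) i) \<longlonglongrightarrow> l i)"
 proof (rule convergent_subsequence_coordinatewise[of _ 0 _ 1])
  fix m k assume k: "k < n + n * n"
  show "0 \<le> Y m k \<and> Y m k \<le> 1"
  proof (cases "k < n")
   case False
   then have "(k - n) div n < n" "(k - n) mod n < n" using k n by (auto simp: less_mult_imp_div_less)
   then show ?thesis using False s0[of "x m"] s_le1[of "x m"] x0 by (auto simp: Y_def)
  qed (use x in \<open>auto simp: Y_def\<close>)
 qed
 then obtain r l where r: "strict_mono r" and l: "\<And>i. i < n + n * n ==> (\<lambda>m. Y (r m) i) \<longlonglongrightarrow> l i" by blast
 define p where "p = l"
 define S where "S i j = l (n + (i * n + j))" for i j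
 have pl: "(\<lambda>m. x (r m) i) \<longlonglongrightarrow> p i" if "i < n" for i
  using l[of i] that by (simp add: Y_def p_def)
 have Sl: "(\<lambda>m. s (r m) (x (r m)) i j) \<longlonglongrightarrow> S i j" if "i < n" "j < n" for i j
 proof -
  have "i * n + j < Suc i * n" using that by simp
  also have "\<dots> \<le> n * n" using that by (intro mult_right_mono) auto
  finally have "i * n + j < n * n" .
  then show ?thesis using l[of "n + (i * n + j)"] that by (simp add: Y_def S_def)
 qed
 have p0: "0 \<le> p i" if "i < n" for i by (rule LIMSEQ_le_const[OF pl[OF that]]) (use x0 that in auto)
 have S0: "0 \<le> S i j" if "i < n" "j < n" for i j
  by (rule LIMSEQ_le_const[OF Sl[OF that]]) (use s0[of "x _"] x0 that in auto)
 have p1: "(\<Sum>i<n. p i) = 1"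
 proof -
  have "(\<lambda>m. \<Sum>i<n. x (r m) i) \<longlonglongrightarrow> (\<Sum>i<n. p i)" by (intro tendsto_sum pl) auto
  then show ?thesis using xs LIMSEQ_unique[OF _ tendsto_const] by simp
 qed
 have S1: "(\<Sum>j<n. S i j) = 1" if i: "i < n" for i
 proof -
  have "(\<lambda>m. \<Sum>j<n. s (r m) (x (r m)) i j) \<longlonglongrightarrow> (\<Sum>j<n. S i j)" by (intro tendsto_sum Sl i) auto
  then show ?thesis using s1[of "x _"] x0 i LIMSEQ_unique[OF _ tendsto_const] by simp
 qed
 have pS: "p j = (\<Sum>i<n. p i * S i j)" if j: "j < n" for j
 proof (rule LIMSEQ_unique[OF pl[OF j]])
  have "(\<lambda>m. \<Sum>i<n. x (r m) i * s (r m) (x (r m)) i j) \<longlonglongrightarrow> (\<Sum>i<n. p i * S i j)"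
   by (intro tendsto_sum tendsto_mult pl Sl j) auto
  then show "(\<lambda>m. x (r m) j) \<longlonglongrightarrow> (\<Sum>i<n. p i * S i j)" using fx[OF j] by simp
 qed
 \<comment> \<open>Good k, of positive limit price, loses strictly against j, so its share is
   eventually below \<open>c ^ r m\<close> for some \<open>c < 1\<close>. The limit price of j may
   be 0 here; this case is what proves prices positive.\<close>
 have mbb: "S i k = 0" if i: "i < n" and k: "k < n" and j: "j < n" and pk: "0 < p k" and uj: "0 < u i j"
  and less: "u i k * p j < u i j * p k" for i j k
 proof -
  have inv: "(\<lambda>m. 1 / real (Suc (r m))) \<longlonglongrightarrow> 0"
   using LIMSEQ_subseq_LIMSEQ[OF LIMSEQ_Suc[OF lim_inverse_n'] r] by (simp add: comp_def)
  define \<rho> where "\<rho> m = real (u i k) * (x (r m) j + 1 / real (Suc (r m))) / (u i j * (x (r m) k + 1 / real (Suc (r m))))" for m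
  have "\<rho> \<longlonglongrightarrow> u i k * (p j + 0) / (u i j * (p k + 0))"
   unfolding \<rho>_def by (intro tendsto_intros pl inv j k) (use pk uj in auto)
  moreover have "u i k * (p j + 0) / (u i j * (p k + 0)) < 1" using less pk uj by (simp add: field_simps)
  ultimately obtain c where c: "c < 1" "\<forall>\<^sub>F m in sequentially. \<rho> m < c" "0 < c"
  proof -
   assume *: "\<And>c. c < 1 ==> \<forall>\<^sub>F m in sequentially. \<rho> m < c ==> 0 < c ==> thesis"
    and lim: "\<rho> \<longlonglongrightarrow> u i k * (p j + 0) / (u i j * (p k + 0))" and lt: "u i k * (p j + 0) / (u i j * (p k + 0)) < 1"
   obtain c where c: "u i k * (p j + 0) / (u i j * (p k + 0)) < c" "c < 1" using dense[OF lt] by blast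
   have "0 \<le> u i k * (p j + 0) / (u i j * (p k + 0))" using p0[OF j] p0[OF k] by simp
   then show thesis using *[of c] c order_tendstoD(2)[OF lim c(1)] by linarith
  qed
  have bd: "s (r m) (x (r m)) i k \<le> c ^ r m" if "\<rho> m < c" for m
  proof -
   let ?a = "a (r m) (x (r m)) i" and ?t = "r m"
   have ap: "0 < ?a j" using apos[of "x ?t" j i] x0 j uj by auto
   have rho: "?a k = \<rho> m * ?a j"
   proof -
    have "0 < x ?t j + 1 / real (Suc ?t)" "0 < x ?t k + 1 / real (Suc ?t)"
     using x0[OF j, of ?t] x0[OF k, of ?t] by (auto intro: add_nonneg_pos)
    then show ?thesis unfolding a_def \<rho>_def using uj by simp
   qed
   have rho0: "0 \<le> \<rho> m" unfolding \<rho>_def using x0[OF j, of ?t] x0[OF k, of ?t]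
    by (intro divide_nonneg_nonneg mult_nonneg_nonneg add_nonneg_nonneg) auto
   have "?a j ^ Suc ?t \<le> (\<Sum>l<n. ?a l ^ Suc ?t)"
    using a0[of "x ?t"] x0 j by (intro member_le_sum) (auto intro!: zero_le_power simp del: power_Suc)
   then have "s ?t (x ?t) i k \<le> ?a k ^ Suc ?t / ?a j ^ Suc ?t"
    unfolding s_def using ap a0[of "x ?t" k ?t i] x0 k by (intro divide_left_mono mult_pos_pos zero_less_power zero_le_power spos) (auto simp: i)
   also have "\<dots> = \<rho> m ^ Suc ?t" using ap unfolding rho power_mult_distrib by simp
   also have "\<dots> \<le> c ^ Suc ?t" using rho0 that by (intro power_mono) auto
   also have "\<dots> \<le> c ^ ?t" using c by (intro power_decreasing) auto
   finally show ?thesis .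
  qed
  have "(\<lambda>m. c ^ r m) \<longlonglongrightarrow> 0"
   using LIMSEQ_subseq_LIMSEQ[OF LIMSEQ_realpow_zero r, of c] c by (simp add: comp_def)
  then have "S i k \<le> 0"
   by (rule tendsto_le[OF sequentially_bot _ Sl[OF i k]]) (use c(2) bd in \<open>auto elim: eventually_mono\<close>)
  then show ?thesis using S0[OF i k] by simp
 qed
 \<comment> \<open>Otherwise irreducibility gives an agent a of positive price who likes a good of
   price 0. By \<open>mbb\<close> it spends nothing on goods of positive price, and on goods of
   price 0 nobody with money can spend anything; but the shares of a sum to 1.\<close>
 have ppos: "0 < p i" if "i < n" for i
 proof (rule ccontr)
  assume "\<not> 0 < p i"
  then have pi: "p i = 0" using p0[OF that] by simp
  define P where "P = {i. i < n \<and> 0 < p i}"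
  have "P \<noteq> {}"
  proof
   assume "P = {}"
   then have "p i = 0" if "i < n" for i using p0[OF that] that by (auto simp: P_def less_le)
   then have "(\<Sum>i<n. p i) = 0" by simp
   then show False using p1 by simp
  qed
  moreover have "P \<subset> {..<n}"
  proof (rule psubsetI)
   show "P \<subseteq> {..<n}" by (rule subsetI) (simp add: P_def)
   have "i \<in> {..<n}" "i \<notin> P" using that pi by (simp_all add: P_def)
   then show "P \<noteq> {..<n}" by metis
  qed
  ultimately have "\<exists>a\<in>P. \<exists>j\<in>{..<n} - P. 0 < u a j" by (rule market_irreducible[OF m])
  then obtain a j where aj: "a \<in> P" "j \<in> {..<n} - P" "0 < u a j" by (elim bexE)
  have pj: "p j = 0" using aj(2) p0[of j] by (simp add: P_def)
  have z: "S a k = 0" if "k < n" "0 < p k" for k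
   using mbb[of a k j] that aj pj by (auto simp: P_def)
  have "S a k = 0" if "k < n" for k
  proof (cases "0 < p k")
   case False
   then have "p k = 0" using p0[OF that] by simp
   then have "(\<Sum>i<n. p i * S i k) = 0" using pS[OF that] by simp
   then have "\<forall>i\<in>{..<n}. p i * S i k = 0" using p0 S0 that
    by (subst (asm) sum_nonneg_eq_0_iff) auto
   then have "p a * S a k = 0" using aj(1) by (simp only: P_def mem_Collect_eq lessThan_iff Ball_def)
   then show ?thesis using aj by (auto simp: P_def)
  qed (use z that in auto)
  then have "(\<Sum>k<n. S a k) = 0" by simp
  then show False using S1[of a] aj by (auto simp: P_def)
 qed
 have "meq n u p (\<lambda>i j. p i * S i j)"
  unfolding meq_def
 proof (intro conjI allI impI)
  fix i j assume "i < n" "j < n" then show "0 \<le> p i * S i j" using p0 S0 by simp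
 next
  fix i j q assume *: "i < n" "j < n" "0 < p i * S i j" "q < n"
  show "real (u i q) * p j \<le> real (u i j) * p q"
  proof (rule ccontr)
   assume c: "\<not> real (u i q) * p j \<le> real (u i j) * p q"
   have "0 < u i q"
   proof (rule ccontr)
    assume "\<not> 0 < u i q"
    then show False using c ppos[OF *(4)] by simp
   qed
   then have "S i j = 0" using mbb[of i j q] * ppos c by auto
   then show False using * by simp
  qed
 qed (use ppos S1 pS[symmetric] in \<open>auto simp flip: sum_distrib_left\<close>)
 then show ?thesis by blast
qed

section \<open>Lower bounds on equilibrium prices\<close>

lemma meq_flow_le:
 assumes "meq n u p f" "i < n" "j < n" shows "f i j \<le> p j"
proof -
 have "f i j \<le> (\<Sum>i<n. f i j)"
  using assms(2,3) meq_nonneg[OF assms(1)] by (intro member_le_sum) auto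
 then show ?thesis using meq_sold[OF assms(1,3)] by simp
qed

text \<open>As \<open>u i j\<close> is at least 1 and utilities are at most U, every good bought by
  i costs at most U times the price of j, and the whole income goes to at most n such goods.\<close>

lemma price_le_of_utility_pos:
 assumes p: "meq n u p f" and U: "\<And>i j. i < n ==> j < n ==> u i j \<le> U"
  and ij: "i < n" "j < n" "0 < u i j"
 shows "p i \<le> real (n * U) * p j"
proof -
 have pj: "0 < p j" by (rule meq_pos[OF p ij(2)])
 have "f i k \<le> real U * p j" if k: "k < n" for k
 proof (cases "0 < f i k")
  case True
  have "u i j * p k \<le> u i k * p j" by (rule meq_best[OF p ij(1) k True ij(2)])
  also have "\<dots> \<le> real U * p j" using U[OF ij(1) k] pj by (intro mult_right_mono) auto
  finally have "u i j * p k \<le> real U * p j" .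
  moreover have "1 * p k \<le> u i j * p k" using ij meq_pos[OF p k] by (intro mult_right_mono) auto
  ultimately show ?thesis using meq_flow_le[OF p ij(1) k] by linarith
 next
  case False
  then have "f i k \<le> 0" by simp
  also have "0 \<le> real U * p j" using pj by simp
  finally show ?thesis .
 qed
 then have "(\<Sum>k<n. f i k) \<le> (\<Sum>k<n. real U * p j)" by (intro sum_mono) auto
 then show ?thesis using meq_spent[OF p ij(1)] by simp
qed

text \<open>From the dearest good, irreducibility reaches all goods in at most n - 1 rounds, each
  losing a factor n U by the previous lemma. One more factor pays for the dearest price being at
  least 1/n.\<close>

lemma price_lower_bound:
 assumes m: "linear_market n U u" and p: "meq n u p f" and s: "(\<Sum>j<n. p j) = 1" and j: "j < n"
 shows "1 \<le> real (n * U) ^ n * p j"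
proof -
 define W where "W = real (n * U)"
 have U: "\<And>i j. i < n ==> j < n ==> u i j \<le> U" by (rule market_bound[OF m])
 have n: "0 < n" using j by auto
 note pos = meq_pos[OF p]
 have "0 < U" using market_likes[OF m n] U[OF n] by (metis gr0I leD)
 then have "1 \<le> n * U" using n by (metis One_nat_def Suc_leI nat_0_less_mult_iff)
 then have W1: "1 \<le> W" unfolding W_def by (metis of_nat_1 of_nat_mono)
 have nW: "real n \<le> W" unfolding W_def using \<open>0 < U\<close> by (intro of_nat_mono) simp
 define M where "M = Max (p ` {..<n})"
 have M: "\<And>i. i < n ==> p i \<le> M" unfolding M_def by (intro Max_ge) auto
 have "M \<in> p ` {..<n}" unfolding M_def using n by (intro Max_in) auto
 then obtain i0 where i0: "i0 < n" "p i0 = M" by auto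
 \<comment> \<open>Goods whose price is within \<open>W ^ k\<close> of the maximum; these sets grow
   strictly until they contain every good.\<close>
 define P where "P k = {i. i < n \<and> M \<le> W ^ k * p i}" for k
 have fin: "finite (P k)" for k by (simp add: P_def)
 have mono: "P k \<subseteq> P (Suc k)" for k
 proof
  fix i assume "i \<in> P k"
  then have i: "i < n" "M \<le> W ^ k * p i" by (auto simp: P_def)
  have "1 * (W ^ k * p i) \<le> W * (W ^ k * p i)" using W1 pos[OF i(1)] by (intro mult_right_mono) auto
  then show "i \<in> P (Suc k)" using i by (simp add: P_def mult.assoc)
 qed
 have "min n (Suc k) \<le> card (P k)" for k
 proof (induction k)
  case 0
  have "i0 \<in> P 0" using i0 by (simp add: P_def)
  then have "1 \<le> card (P 0)" using fin[of 0] by (metis One_nat_def Suc_leI card_gt_0_iff empty_iff)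
  then show ?case by simp
 next
  case (Suc k)
  show ?case
  proof (cases "P k = {..<n}")
   case True
   then have "card (P (Suc k)) \<ge> n" using card_mono[OF fin mono[of k]] by simp
   then show ?thesis by simp
  next
   case False
   have ne: "P k \<noteq> {}" using Suc n by (metis Zero_neq_Suc card.empty le_zero_eq min_def not_gr_zero)
   have "P k \<subset> {..<n}" using False by (auto simp: P_def)
   from market_irreducible[OF m ne this]
   obtain i j where ij: "i \<in> P k" "j \<in> {..<n} - P k" "0 < u i j" by (elim bexE)
   then have lt: "i < n" "j < n" by (auto simp: P_def)
   have "M \<le> W ^ k * p i" using ij by (simp add: P_def)
   also have "\<dots> \<le> W ^ k * (W * p j)"
    using price_le_of_utility_pos[OF p U lt ij(3)] W1 unfolding W_def by (intro mult_left_mono) auto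
   finally have "j \<in> P (Suc k)" using lt by (simp add: P_def ac_simps)
   then have "P k \<subset> P (Suc k)" using ij mono by auto
   then have "card (P k) < card (P (Suc k))" by (rule psubset_card_mono[OF fin])
   then show ?thesis using Suc by simp
  qed
 qed
 from this[of "n - 1"] have "n \<le> card (P (n - 1))" using n by simp
 moreover have "P (n - 1) \<subseteq> {..<n}" by (auto simp: P_def)
 ultimately have "P (n - 1) = {..<n}" by (intro card_seteq) auto
 then have "M \<le> W ^ (n - 1) * p j" using j by (auto simp: P_def)
 then have "W * M \<le> W * (W ^ (n - 1) * p j)" using W1 by (intro mult_left_mono) auto
 also have "\<dots> = W ^ n * p j" using n by (metis Suc_pred' mult.assoc power_Suc)
 finally have "W * M \<le> W ^ n * p j" .
 moreover have "1 \<le> W * M"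
 proof -
  have "(\<Sum>j<n. p j) \<le> (\<Sum>j<n. M)" by (intro sum_mono M) auto
  then have "1 \<le> real n * M" using s by simp
  also have "\<dots> \<le> W * M" using nW pos[OF i0(1)] i0 by (intro mult_right_mono) auto
  finally show ?thesis .
 qed
 ultimately show ?thesis by (simp add: W_def)
qed

section \<open>Excess demand separates prices from equilibria\<close>

definition demand_excess :: "nat => (nat => real) => (nat => nat) => nat => real" where
 "demand_excess n p b j = (\<Sum>i | i < n \<and> b i = j. p i) / p j - 1"

definition best_goods :: "nat => (nat => nat => nat) => (nat => real) => (nat => nat) => bool" where
 "best_goods n u p b \<longleftrightarrow> (\<forall>i<n. b i < n \<and> (\<forall>l<n. u i l * p (b i) \<le> u i (b i) * p l))"

lemma best_goods_pos:
 assumes m: "linear_market n U u" and p: "\<And>i. i < n ==> 0 < p i" and b: "best_goods n u p b" and i: "i < n"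
 shows "0 < u i (b i)"
proof -
 obtain j where j: "j < n" "0 < u i j" using market_likes[OF m i] by blast
 have "0 < u i j * p (b i)" using j p b i by (simp add: best_goods_def)
 also have "\<dots> \<le> u i (b i) * p j" using b i j by (auto simp: best_goods_def)
 finally show ?thesis using p[OF j(1)] by (metis gr0I less_irrefl mult_zero_left of_nat_0)
qed

text \<open>With \<open>r = q / p\<close>, each unit of money spent in the equilibrium \<open>q\<close> contributes
  \<open>t - 1 - ln t \<ge> (sqrt t - 1)\<^sup>2\<close> for \<open>t = r j / r i\<close>; the logarithms cancel because
  expenditure and income balance.\<close>

lemma equilibrium_value_of_excess:
 assumes m: "linear_market n U u" and q: "meq n u q f" and p: "\<And>i. i < n ==> 0 < p i"
  and b: "best_goods n u p b" and ij: "i < n" "j < n"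
 defines "r \<equiv> \<lambda>j. q j / p j"
 shows "f i j * ((sqrt (r j / r i) - 1)\<^sup>2 + (r (b i) - r j) / r i) \<le> (\<Sum>j<n. q j * demand_excess n p b j)"
  and "0 < f i j ==> r j \<le> r (b i)"
proof -
 note qpos = meq_pos[OF q]
 have rpos: "\<And>i. i < n ==> 0 < r i" using p qpos by (simp add: r_def)
 have bn: "\<And>i. i < n ==> b i < n" using b by (auto simp: best_goods_def)
 note f0 = meq_nonneg[OF q]
 \<comment> \<open>Good j is best for i at the prices q and \<open>b i\<close> is best at p;
   multiplying the two optimality inequalities leaves only the ratios r.\<close>
 have rle: "r j \<le> r (b i)" if "i < n" "j < n" "0 < f i j" for i j
 proof -
  note B = bn[OF that(1)]
  have ub: "0 < real (u i (b i))" using best_goods_pos[OF m p b that(1)] by simp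
  have 1: "u i (b i) * q j \<le> u i j * q (b i)" by (rule meq_best[OF q that B])
  have 2: "u i j * p (b i) \<le> u i (b i) * p j" using b that unfolding best_goods_def by blast
  have "u i (b i) * (q j * p (b i)) \<le> u i j * q (b i) * p (b i)"
   using mult_right_mono[OF 1 less_imp_le[OF p[OF B]]] by (simp add: ac_simps)
  also have "\<dots> \<le> u i (b i) * (q (b i) * p j)"
   using mult_right_mono[OF 2 less_imp_le[OF qpos[OF B]]] by (simp add: ac_simps)
  finally have "q j * p (b i) \<le> q (b i) * p j" using ub by simp
  then show ?thesis using p[OF that(2)] p[OF B] by (simp add: r_def field_simps)
 qed
 then show "0 < f i j ==> r j \<le> r (b i)" using ij by auto
 define T where "T i j = r (b i) / r i - 1 - (ln (r j) - ln (r i))" for i j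
 have Tge: "(sqrt (r j / r i) - 1)\<^sup>2 + (r (b i) - r j) / r i \<le> T i j" if "i < n" "j < n" for i j
 proof -
  define t where "t = r j / r i"
  have t: "0 < t" unfolding t_def using rpos[OF that(1)] rpos[OF that(2)] by simp
  \<comment> \<open>The logarithm is estimated at the square root of t instead of t; this yields a
    square, and so a quantitative bound on how far t is from 1.\<close>
  have "ln (sqrt t) \<le> sqrt t - 1" using t by (intro ln_le_minus_one) auto
  moreover have "ln (sqrt t) = ln t / 2" using t by (simp add: ln_sqrt)
  moreover have "(sqrt t - 1)\<^sup>2 = t - 2 * sqrt t + 1"
   using t by (simp add: power2_diff)
  ultimately have "(sqrt t - 1)\<^sup>2 \<le> t - 1 - ln t" by linarith
  moreover have "ln t = ln (r j) - ln (r i)" unfolding t_def by (rule ln_divide_pos[OF rpos[OF that(2)] rpos[OF that(1)]])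
  moreover have "r (b i) / r i = t + (r (b i) - r j) / r i" by (simp add: t_def diff_divide_distrib)
  ultimately show ?thesis by (simp add: T_def t_def)
 qed
 have "(\<Sum>j<n. q j * demand_excess n p b j) = (\<Sum>i<n. \<Sum>j<n. f i j * T i j)"
 proof -
  have "(\<Sum>j<n. q j * demand_excess n p b j) = (\<Sum>j<n. (\<Sum>i | i < n \<and> b i = j. p i * r j)) - (\<Sum>j<n. q j)"
   unfolding sum_subtractf[symmetric] demand_excess_def r_def sum_distrib_right[symmetric]
   by (intro sum.cong) (auto simp: field_simps)
  also have "(\<Sum>j<n. (\<Sum>i | i < n \<and> b i = j. p i * r j)) = (\<Sum>j<n. (\<Sum>i | i \<in> {..<n} \<and> b i = j. p i * r (b i)))"
   by (intro sum.cong) auto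
  also have "\<dots> = (\<Sum>i<n. p i * r (b i))" using bn by (intro sum.group) auto
  also have "\<dots> = (\<Sum>i<n. (\<Sum>j<n. f i j) * (r (b i) / r i))"
  proof (intro sum.cong refl)
   fix i assume "i \<in> {..<n}"
   then show "p i * r (b i) = (\<Sum>j<n. f i j) * (r (b i) / r i)"
    using meq_spent[OF q, of i] qpos[of i] p[of i] by (simp add: r_def)
  qed
  also have "\<dots> = (\<Sum>i<n. \<Sum>j<n. f i j * (r (b i) / r i))" by (simp only: sum_distrib_right)
  finally have 1: "(\<Sum>j<n. q j * demand_excess n p b j) = (\<Sum>i<n. \<Sum>j<n. f i j * (r (b i) / r i)) - (\<Sum>j<n. q j)" .
  have 2: "(\<Sum>i<n. \<Sum>j<n. f i j) = (\<Sum>j<n. q j)" by (intro sum.cong) (auto simp: meq_spent[OF q])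
  have "(\<Sum>i<n. \<Sum>j<n. f i j * ln (r i)) = (\<Sum>i<n. q i * ln (r i))"
   by (intro sum.cong) (auto simp: meq_spent[OF q] simp flip: sum_distrib_right)
  moreover have "(\<Sum>i<n. \<Sum>j<n. f i j * ln (r j)) = (\<Sum>j<n. q j * ln (r j))"
   by (subst sum.swap, intro sum.cong) (auto simp: meq_sold[OF q] simp flip: sum_distrib_right)
  ultimately show ?thesis
   unfolding 1 2[symmetric] T_def right_diff_distrib sum_subtractf by simp
 qed
 moreover have "f i j * T i j \<le> (\<Sum>i<n. \<Sum>j<n. f i j * T i j)"
 proof -
  have nn: "0 \<le> f i j * T i j" if "i < n" "j < n" for i j
  proof (cases "0 < f i j")
   case True
   have "0 \<le> (sqrt (r j / r i) - 1)\<^sup>2 + (r (b i) - r j) / r i"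
    using rle[OF that True] rpos[OF that(1)] by simp
   then show ?thesis using Tge[OF that] True by simp
  qed (use f0[OF that] in simp)
  have "f i j * T i j \<le> (\<Sum>j<n. f i j * T i j)" using ij nn by (intro member_le_sum) auto
  also have "\<dots> \<le> (\<Sum>i<n. \<Sum>j<n. f i j * T i j)"
   using ij by (intro member_le_sum[of i _ "\<lambda>i. \<Sum>j<n. f i j * T i j"] sum_nonneg nn) auto
  finally show ?thesis .
 qed
 moreover have "f i j * ((sqrt (r j / r i) - 1)\<^sup>2 + (r (b i) - r j) / r i) \<le> f i j * T i j"
  using Tge[OF ij] f0[OF ij] by (intro mult_left_mono)
 ultimately show "f i j * ((sqrt (r j / r i) - 1)\<^sup>2 + (r (b i) - r j) / r i) \<le> (\<Sum>j<n. q j * demand_excess n p b j)"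
  by linarith
qed

text \<open>Agent 0 spends money on some good, and for that edge the lower bound of the previous
  lemma consists of nonnegative terms.\<close>

lemma equilibrium_value_of_excess_nonneg:
 assumes m: "linear_market n U u" and q: "meq n u q f" and p: "\<And>i. i < n ==> 0 < p i"
  and b: "best_goods n u p b"
 shows "0 \<le> (\<Sum>j<n. q j * demand_excess n p b j)"
proof -
 note n = market_nonempty[OF m]
 have "\<exists>j<n. 0 < f 0 j"
 proof (rule ccontr)
  assume "\<not> (\<exists>j<n. 0 < f 0 j)"
  then have "f 0 j \<le> 0" if "j < n" for j using that by (meson not_less)
  then have "(\<Sum>j<n. f 0 j) \<le> 0" by (intro sum_nonpos) simp
  then show False using meq_spent[OF q n] meq_pos[OF q n] by simp
 qed
 then obtain j where j: "j < n" "0 < f 0 j" by (elim exE conjE)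
 have "0 \<le> q (b 0) / p (b 0) - q j / p j"
  using equilibrium_value_of_excess(2)[OF m q p b n j(1,2)] by simp
 moreover have "0 \<le> q 0 / p 0" using p[OF n] meq_pos[OF q n] by simp
 ultimately have "0 \<le> (q (b 0) / p (b 0) - q j / p j) / (q 0 / p 0)" by (rule divide_nonneg_nonneg)
 then have "0 \<le> f 0 j * ((sqrt ((q j / p j) / (q 0 / p 0)) - 1)\<^sup>2 + (q (b 0) / p (b 0) - q j / p j) / (q 0 / p 0))"
  using j(2) by (intro mult_nonneg_nonneg[OF less_imp_le] add_nonneg_nonneg[OF zero_le_power2])
 also have "\<dots> \<le> (\<Sum>j<n. q j * demand_excess n p b j)"
  by (rule equilibrium_value_of_excess(1)[OF m q p b n j(1)])
 finally show ?thesis .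
qed

section \<open>Determinants and Cramer's rule\<close>

lemma abs_signof: "\<bar>signof p\<bar> = (1::'a::linordered_idom)"
 by (simp add: sign_def)

lemma abs_det_le:
 fixes A :: "'a::linordered_idom mat"
 assumes A: "A \<in> carrier_mat N N" and B: "\<And>i j. i < N ==> j < N ==> \<bar>A $$ (i, j)\<bar> \<le> B"
 shows "\<bar>det A\<bar> \<le> fact N * B ^ N"
proof -
 have "\<bar>det A\<bar> \<le> (\<Sum>p | p permutes {0..<N}. \<bar>signof p * (\<Prod>i = 0..<N. A $$ (i, p i))\<bar>)"
  unfolding det_def'[OF A] by (rule sum_abs)
 also have "\<dots> \<le> (\<Sum>p | p permutes {0..<N}. B ^ N)"
 proof (rule sum_mono)
  fix p assume "p \<in> {p. p permutes {0..<N}}"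
  then have p: "p i < N" if "i < N" for i
   using that permutes_in_image[of p "{0..<N}" i] by simp
  have "\<bar>signof p * (\<Prod>i = 0..<N. A $$ (i, p i))\<bar> = (\<Prod>i = 0..<N. \<bar>A $$ (i, p i)\<bar>)"
   by (simp only: abs_mult abs_signof abs_prod mult_1)
  also have "\<dots> \<le> (\<Prod>i = 0..<N. B)"
   by (rule prod_mono) (simp add: B p)
  finally show "\<bar>signof p * (\<Prod>i = 0..<N. A $$ (i, p i))\<bar> \<le> B ^ N" by simp
 qed
 also have "\<dots> = fact N * B ^ N" by (simp add: card_permutations[OF refl])
 finally show ?thesis .
qed

text \<open>Cramer's rule for the normal equations \<open>R\<^sup>T R x = R\<^sup>T c\<close>.\<close>

lemma cramer_common_denominator:
 fixes rows :: "((nat => int) \<times> int) set" and x :: "nat => real"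
 assumes fin: "finite rows" and W: "\<And>\<rho> a. \<rho> \<in> rows ==> a < N ==> \<bar>fst \<rho> a\<bar> \<le> W"
  and sol: "\<And>\<rho>. \<rho> \<in> rows ==> (\<Sum>a<N. of_int (fst \<rho> a) * x a) = of_int (snd \<rho>)"
  and uniq: "\<And>y a. (\<And>\<rho>. \<rho> \<in> rows ==> (\<Sum>a<N. of_int (fst \<rho> a) * y a) = 0) ==> a < N ==> y a = (0::real)"
 shows "\<exists>\<Delta>::int. 0 < \<Delta> \<and> \<Delta> \<le> fact N * (int (card rows) * W\<^sup>2) ^ N \<and> (\<forall>a<N. \<exists>k::int. of_int \<Delta> * x a = of_int k)"
proof -
 define Q where "Q = mat N N (\<lambda>(a, b). \<Sum>\<rho>\<in>rows. fst \<rho> a * fst \<rho> b)"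
 have Q: "Q \<in> carrier_mat N N" by (simp add: Q_def)
 have Qe: "Q $$ (a, b) = (\<Sum>\<rho>\<in>rows. fst \<rho> a * fst \<rho> b)" if "a < N" "b < N" for a b
  using that by (simp add: Q_def)
 define QR where "QR = map_mat real_of_int Q"
 have QR: "QR \<in> carrier_mat N N" using Q by (simp add: QR_def)
 have QRe: "QR $$ (a, b) = (\<Sum>\<rho>\<in>rows. of_int (fst \<rho> a) * of_int (fst \<rho> b))" if "a < N" "b < N" for a b
  using that Q by (simp add: QR_def Qe)
 \<comment> \<open>A kernel vector of the Gram matrix makes the sum of squares of all its row
   products vanish; it then solves the homogeneous system and is 0 by uniqueness.\<close>
 have "det QR \<noteq> 0"
 proof
  assume "det QR = 0"
  then obtain v where v: "v \<in> carrier_vec N" "v \<noteq> 0\<^sub>v N" "QR *\<^sub>v v = 0\<^sub>v N"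
   using det_0_iff_vec_prod_zero[OF QR] by blast
  have row: "(\<Sum>b<N. QR $$ (a, b) * v $ b) = 0" if "a < N" for a
  proof -
   have "(QR *\<^sub>v v) $ a = 0" using v(3) that by simp
   then show ?thesis using that v(1) QR by (simp add: scalar_prod_def lessThan_atLeast0)
  qed
  have "0 = (\<Sum>a<N. v $ a * (\<Sum>b<N. QR $$ (a, b) * v $ b))" by (simp add: row)
  also have "\<dots> = (\<Sum>a<N. \<Sum>b<N. \<Sum>\<rho>\<in>rows. (of_int (fst \<rho> a) * v $ a) * (of_int (fst \<rho> b) * v $ b))"
   unfolding sum_distrib_left by (intro sum.cong refl) (simp add: QRe sum_distrib_left sum_distrib_right ac_simps)
  also have "\<dots> = (\<Sum>a<N. \<Sum>\<rho>\<in>rows. \<Sum>b<N. (of_int (fst \<rho> a) * v $ a) * (of_int (fst \<rho> b) * v $ b))"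
   by (intro sum.cong refl sum.swap)
  also have "\<dots> = (\<Sum>\<rho>\<in>rows. \<Sum>a<N. \<Sum>b<N. (of_int (fst \<rho> a) * v $ a) * (of_int (fst \<rho> b) * v $ b))"
   by (rule sum.swap)
  also have "\<dots> = (\<Sum>\<rho>\<in>rows. (\<Sum>a<N. of_int (fst \<rho> a) * v $ a)\<^sup>2)"
   by (simp only: power2_eq_square sum_product)
  finally have "(\<Sum>\<rho>\<in>rows. (\<Sum>a<N. of_int (fst \<rho> a) * v $ a)\<^sup>2) = 0" by simp
  then have "\<forall>\<rho>\<in>rows. (\<Sum>a<N. of_int (fst \<rho> a) * v $ a)\<^sup>2 = 0"
   by (subst (asm) sum_nonneg_eq_0_iff) (auto simp: fin)
  then have "v $ a = 0" if "a < N" for a using that by (intro uniq[of "\<lambda>a. v $ a"]) simp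
  then have "v = 0\<^sub>v N" using v(1) by (intro eq_vecI) auto
  then show False using v(2) by simp
 qed
 moreover have "det QR = of_int (det Q)" unfolding QR_def by (simp add: of_int_hom.hom_det)
 ultimately have d0: "det Q \<noteq> 0" by simp
 have QB: "\<bar>Q $$ (a, b)\<bar> \<le> int (card rows) * W\<^sup>2" if "a < N" "b < N" for a b
 proof -
  have "\<bar>Q $$ (a, b)\<bar> \<le> (\<Sum>\<rho>\<in>rows. \<bar>fst \<rho> a * fst \<rho> b\<bar>)" unfolding Qe[OF that] by (rule sum_abs)
  also have "\<dots> \<le> (\<Sum>\<rho>\<in>rows. W\<^sup>2)"
  proof (rule sum_mono)
   fix \<rho> assume "\<rho> \<in> rows"
   then have "\<bar>fst \<rho> a\<bar> * \<bar>fst \<rho> b\<bar> \<le> W * W" using W that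
    by (intro mult_mono W order_trans[OF abs_ge_zero W, of \<rho> a]) auto
   then show "\<bar>fst \<rho> a * fst \<rho> b\<bar> \<le> W\<^sup>2" by (simp add: abs_mult power2_eq_square)
  qed
  finally show ?thesis by simp
 qed
 \<comment> \<open>Multiplying the normal equations by the adjugate, which is integral, gives
   integers on the right-hand side.\<close>
 have detx: "\<exists>k::int. of_int (det Q) * x a = of_int k" if a: "a < N" for a
 proof -
  define A where "A = adj_mat Q"
  have A: "A \<in> carrier_mat N N" "A * Q = det Q \<cdot>\<^sub>m 1\<^sub>m N" using adj_mat[OF Q] by (auto simp: A_def)
  have AQ: "(\<Sum>b<N. A $$ (a, b) * Q $$ (b, c)) = (if a = c then det Q else 0)" if c: "c < N" for c
  proof -
   have "(A * Q) $$ (a, c) = (\<Sum>b<N. A $$ (a, b) * Q $$ (b, c))"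
    using a c A(1) Q by (simp add: scalar_prod_def lessThan_atLeast0)
   then show ?thesis unfolding A(2) using a c by auto
  qed
  have Qx: "(\<Sum>c<N. of_int (Q $$ (b, c)) * x c) = of_int (\<Sum>\<rho>\<in>rows. fst \<rho> b * snd \<rho>)" if b: "b < N" for b
  proof -
   have "(\<Sum>c<N. of_int (Q $$ (b, c)) * x c) = (\<Sum>c<N. \<Sum>\<rho>\<in>rows. of_int (fst \<rho> b) * (of_int (fst \<rho> c) * x c))"
    by (intro sum.cong refl) (simp add: Qe b sum_distrib_left sum_distrib_right ac_simps)
   also have "\<dots> = (\<Sum>\<rho>\<in>rows. of_int (fst \<rho> b) * (\<Sum>c<N. of_int (fst \<rho> c) * x c))"
    by (subst sum.swap) (simp only: sum_distrib_left)
   also have "\<dots> = (\<Sum>\<rho>\<in>rows. of_int (fst \<rho> b) * of_int (snd \<rho>))"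
    by (intro sum.cong refl) (simp only: sol)
   finally show ?thesis by simp
  qed
  have "of_int (det Q) * x a = (\<Sum>c<N. of_int (if a = c then det Q else 0) * x c)"
   using a by (simp add: if_distrib[of real_of_int] if_distrib[of "\<lambda>t. t * _"] sum.delta cong: if_cong)
  also have "\<dots> = (\<Sum>c<N. of_int (\<Sum>b<N. A $$ (a, b) * Q $$ (b, c)) * x c)"
   by (intro sum.cong refl) (simp only: AQ lessThan_iff)
  also have "\<dots> = (\<Sum>c<N. \<Sum>b<N. of_int (A $$ (a, b)) * (of_int (Q $$ (b, c)) * x c))"
   by (simp add: sum_distrib_left sum_distrib_right ac_simps)
  also have "\<dots> = (\<Sum>b<N. of_int (A $$ (a, b)) * (\<Sum>c<N. of_int (Q $$ (b, c)) * x c))"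
   by (subst sum.swap) (simp only: sum_distrib_left)
  also have "\<dots> = of_int (\<Sum>b<N. A $$ (a, b) * (\<Sum>\<rho>\<in>rows. fst \<rho> b * snd \<rho>))"
   by (simp add: Qx)
  finally show ?thesis by blast
 qed
 have "\<exists>k::int. of_int \<bar>det Q\<bar> * x a = of_int k" if aN: "a < N" for a
 proof -
  obtain k :: int where k: "of_int (det Q) * x a = of_int k"
   using detx[OF aN] by blast
  show ?thesis
  proof (cases "det Q < 0")
   case True
   then have "of_int \<bar>det Q\<bar> * x a = of_int (- k)" using k by simp
   then show ?thesis by blast
  next
   case False
   then have "of_int \<bar>det Q\<bar> * x a = of_int k" using k by simp
   then show ?thesis by blast
  qed
 qed
 moreover have "\<bar>det Q\<bar> \<le> fact N * (int (card rows) * W\<^sup>2) ^ N" by (rule abs_det_le[OF Q QB])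
 ultimately show ?thesis using d0 by (intro exI[of _ "\<bar>det Q\<bar>"]) auto
qed

section \<open>One cut of the cone\<close>

text \<open>Weierstrass' product inequality. This form and the next one handle the factors below and
  above 1 in \<open>cut_growth\<close>.\<close>

lemma one_minus_sum_le_prod:
 fixes t :: "'b => real"
 assumes "finite S" "\<And>k. k \<in> S ==> 0 \<le> t k \<and> t k \<le> 1"
 shows "1 - sum t S \<le> (\<Prod>k\<in>S. 1 - t k)"
 using assms
proof (induction S rule: finite_induct)
 case (insert a S)
 have P: "0 \<le> (\<Prod>k\<in>S. 1 - t k)" "(\<Prod>k\<in>S. 1 - t k) \<le> 1"
  using insert by (auto intro!: prod_nonneg prod_le_1)
 have "1 - (t a + sum t S) \<le> (\<Prod>k\<in>S. 1 - t k) - t a" using insert by simp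
 also have "\<dots> \<le> (\<Prod>k\<in>S. 1 - t k) - t a * (\<Prod>k\<in>S. 1 - t k)"
  using P insert.prems[of a] by (simp add: mult_left_le)
 finally show ?case using insert by (simp add: algebra_simps)
qed auto

lemma one_plus_sum_le_prod:
 fixes t :: "'b => real"
 assumes "finite S" "\<And>k. k \<in> S ==> 0 \<le> t k"
 shows "1 + sum t S \<le> (\<Prod>k\<in>S. 1 + t k)"
 using assms
proof (induction S rule: finite_induct)
 case (insert a S)
 have "1 \<le> (\<Prod>k\<in>S. 1 + t k)" using insert by (intro prod_ge_1) auto
 then have "t a * 1 \<le> t a * (\<Prod>k\<in>S. 1 + t k)" using insert.prems[of a] by (intro mult_left_mono) auto
 moreover have "1 + sum t S \<le> (\<Prod>k\<in>S. 1 + t k)" using insert by simp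
 ultimately show ?case using insert by (simp add: algebra_simps)
qed auto

text \<open>This is how the coefficients of a fixed point change when the generators move relative
  to generator r. The determinant follows by row operations, one index at a time; row m has to be
  added to row r before it is scaled.\<close>

lemma det_mix_into_row:
 fixes L :: "nat => nat => 'a::idom"
 assumes r: "r < n"
 shows "det (mat n n (\<lambda>(k, l). if k = r then L r l + (\<Sum>i\<in>{..<n} - {r}. \<tau> i * L i l) else s k * L k l))
  = (\<Prod>k\<in>{..<n} - {r}. s k) * det (mat n n (\<lambda>(k, l). L k l))"
proof -
 define F where "F m = mat n n (\<lambda>(k, l). if k = r then L r l + (\<Sum>i\<in>{..<m} - {r}. \<tau> i * L i l)
  else if k < m then s k * L k l else L k l)" for m
 have F: "F m \<in> carrier_mat n n" for m by (simp add: F_def)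
 have "m \<le> n ==> det (F m) = (\<Prod>k\<in>{..<m} - {r}. s k) * det (F 0)" for m
 proof (induction m)
  case (Suc m)
  show ?case
  proof (cases "m = r")
   case True
   have "{..<Suc m} - {r} = {..<m} - {r}" using True by auto
   moreover have "F (Suc m) = F m" unfolding F_def using True calculation by (intro eq_matI) auto
   ultimately show ?thesis using Suc by simp
  next
   case False
   have e: "{..<Suc m} - {r} = insert m ({..<m} - {r})" using False by auto
   have "F (Suc m) = multrow m (s m) (addrow (\<tau> m) r m (F m))"
    unfolding F_def e using False r Suc.prems by (intro eq_matI) (auto simp: less_Suc_eq)
   then have "det (F (Suc m)) = s m * det (F m)"
    using False r Suc.prems det_multrow[of m n "addrow (\<tau> m) r m (F m)" "s m"] det_addrow[of m n r "F m" "\<tau> m"] F[of m]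
    by simp
   then show ?thesis using Suc e by (simp add: ac_simps)
  qed
 qed simp
 from this[of n] have "det (F n) = (\<Prod>k\<in>{..<n} - {r}. s k) * det (F 0)" by simp
 moreover have "F n = mat n n (\<lambda>(k, l). if k = r then L r l + (\<Sum>i\<in>{..<n} - {r}. \<tau> i * L i l) else s k * L k l)"
  unfolding F_def by (intro eq_matI) auto
 moreover have "F 0 = mat n n (\<lambda>(k, l). L k l)" unfolding F_def by (intro eq_matI) auto
 ultimately show ?thesis by simp
qed

text \<open>Needed for the initial simplex, whose coefficient matrix is triangular up to multiples
  of its first row.\<close>

lemma det_add_first_row:
 fixes L :: "nat => nat => 'a::idom"
 assumes n: "0 < n"
 shows "det (mat n n (\<lambda>(k, l). if k = 0 then L 0 l else L k l + t * L 0 l)) = det (mat n n (\<lambda>(k, l). L k l))"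
proof -
 define F where "F m = mat n n (\<lambda>(k, l). if 0 < k \<and> k < m then L k l + t * L 0 l else L k l)" for m
 have F: "F m \<in> carrier_mat n n" for m by (simp add: F_def)
 have "m \<le> n ==> det (F m) = det (F 0)" for m
 proof (induction m)
  case (Suc m)
  show ?case
  proof (cases "m = 0")
   case True
   have "F (Suc m) = F m" unfolding F_def using True by (intro eq_matI) auto
   then show ?thesis using Suc by simp
  next
   case False
   have "F (Suc m) = addrow t m 0 (F m)"
    unfolding F_def using False n Suc.prems by (intro eq_matI) (auto simp: less_Suc_eq)
   then show ?thesis using False n Suc det_addrow[of 0 n m "F m" t] F[of m] by simp
  qed
 qed simp
 from this[of n] have "det (F n) = det (F 0)" by simp
 moreover have "F n = mat n n (\<lambda>(k, l). if k = 0 then L 0 l else L k l + t * L 0 l)"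
  unfolding F_def by (intro eq_matI) auto
 moreover have "F 0 = mat n n (\<lambda>(k, l). L k l)" unfolding F_def by (intro eq_matI) auto
 ultimately show ?thesis by simp
qed

text \<open>With \<open>\<tau> = a k / (c * a r)\<close> this is
  \<open>(V k - \<tau> * V r) / (1 - \<tau>)\<close> rounded down. Rows of negative value move
  towards row r, rows of positive value away from it. For c = 1 the new row would have value 0; a
  large c damps the step so that the rows of positive value do not undo the gain.\<close>

definition cut_row :: "nat => int => (nat => nat => int) => (nat => int) => nat => nat => nat => int" where
 "cut_row n c V a r k j = (c * a r * V k j - a k * V r j) div (c * a r - a k)"

text \<open>Coordinate 0 takes up what rounding lost, so the coordinate sum remains exactly
  M.\<close>

definition cut_step :: "nat => int => int => (nat => nat => int) => (nat => int) => nat => nat => nat => int" where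
 "cut_step n c M V a r k j = (if k = r then V r j else
   cut_row n c V a r k j + (if j = 0 then M - (\<Sum>i<n. cut_row n c V a r k i) else 0))"

text \<open>The points \<open>Y l\<close> are, up to \<open>\<epsilon> / M\<close>, convex combinations of the rows of \<open>V / M\<close>; the
  coefficient matrix has determinant at least \<open>D\<close>.  Rounding only moves the points.\<close>

definition cone_inv :: "nat => int => (nat => nat => real) => real => real => (nat => nat => int) => (nat => nat => real) => bool" where
 "cone_inv n M Y \<epsilon> D V \<Lambda> \<longleftrightarrow>
   (\<forall>k<n. (\<Sum>j<n. V k j) = M) \<and>
   (\<forall>l<n. (\<forall>k<n. 0 \<le> \<Lambda> l k) \<and> (\<Sum>k<n. \<Lambda> l k) = 1 \<and>
    (\<forall>j<n. \<bar>(\<Sum>k<n. \<Lambda> l k * V k j) - M * Y l j\<bar> \<le> \<epsilon>)) \<and>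
   D \<le> \<bar>det (mat n n (\<lambda>(k, l). \<Lambda> l k))\<bar>"

text \<open>All coefficients lie between 0 and 1, so the Leibniz formula bounds the determinant.
  This is the ceiling that the growing determinant eventually hits.\<close>

lemma cone_inv_det_le:
 assumes "cone_inv n M Y \<epsilon> D V \<Lambda>" shows "D \<le> fact n"
proof -
 have "\<bar>\<Lambda> l k\<bar> \<le> 1" if "l < n" "k < n" for l k
 proof -
  have 0: "\<And>k. k < n ==> 0 \<le> \<Lambda> l k" and 1: "(\<Sum>k<n. \<Lambda> l k) = 1"
   using assms that by (auto simp: cone_inv_def)
  have "\<Lambda> l k \<le> (\<Sum>k<n. \<Lambda> l k)" using 0 that by (intro member_le_sum) auto
  then show ?thesis using 0[OF that(2)] 1 by simp
 qed
 then have "\<bar>det (mat n n (\<lambda>(k, l). \<Lambda> l k))\<bar> \<le> fact n * 1 ^ n" by (intro abs_det_le) auto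
 then show ?thesis using assms by (auto simp: cone_inv_def)
qed

text \<open>The unrounded row has sum M. Rounding down costs each coordinate at most 1, and the
  total loss, at most n, returns in coordinate 0.\<close>

lemma cut_row_error:
 assumes d: "0 < c * a r - a k" and Vk: "(\<Sum>j<n. V k j) = M" and Vr: "(\<Sum>j<n. V r j) = M"
  and k: "k \<noteq> r" and j: "j < n"
 shows "\<bar>real_of_int (cut_step n c M V a r k j) - (c * a r * V k j - a k * V r j) / (c * a r - a k)\<bar> \<le> n"
proof -
 define d where "d = c * a r - a k"
 define w where "w j = c * a r * V k j - a k * V r j" for j
 have d0: "real_of_int d \<noteq> 0" using d by (simp add: d_def flip: of_int_mult of_int_diff)
 define e where "e j = real_of_int (w j) / d - real_of_int (w j div d)" for j
 have e: "0 \<le> e j \<and> e j \<le> 1" for j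
 proof -
  have "real_of_int (w j div d) = of_int \<lfloor>real_of_int (w j) / real_of_int d\<rfloor>" by (simp add: floor_divide_of_int_eq)
  then show ?thesis unfolding e_def by linarith
 qed
 have "(\<Sum>j<n. real_of_int (w j) / d) = M"
 proof -
  have "(\<Sum>j<n. w j) = c * a r * (\<Sum>j<n. V k j) - a k * (\<Sum>j<n. V r j)"
   by (simp add: w_def sum_subtractf sum_distrib_left)
  also have "\<dots> = d * M" by (simp add: Vk Vr d_def algebra_simps)
  finally have "(\<Sum>j<n. real_of_int (w j)) = real_of_int (d * M)" by (simp flip: of_int_sum)
  then show ?thesis using d0 by (simp flip: sum_divide_distrib)
 qed
 then have "real_of_int M - (\<Sum>j<n. real_of_int (w j div d)) = (\<Sum>j<n. e j)"
  by (simp add: e_def sum_subtractf)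
 moreover have "0 \<le> (\<Sum>j<n. e j)" using e by (intro sum_nonneg) auto
 moreover have "(\<Sum>j<n. e j) \<le> (\<Sum>j<n. 1)" using e by (intro sum_mono) auto
 moreover have "1 \<le> n" using j by simp
 moreover have "real_of_int (cut_step n c M V a r k j) - w j / d = (if j = 0 then M - (\<Sum>j<n. real_of_int (w j div d)) else 0) - e j"
  using k by (simp add: cut_step_def cut_row_def w_def d_def e_def)
 ultimately have "\<bar>real_of_int (cut_step n c M V a r k j) - w j / d\<bar> \<le> n"
  using e[of j] by (auto simp: abs_le_iff)
 then show ?thesis by (simp add: w_def d_def)
qed

lemma cut_step_row_sum:
 assumes "(\<Sum>j<n. V r j) = M" "0 < n"
 shows "(\<Sum>j<n. cut_step n c M V a r k j) = M"
 using assms by (cases "k = r") (simp_all add: cut_step_def sum.distrib sum.delta)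

text \<open>Let A be the sum of the nonnegative \<open>\<tau> k\<close> with k other than r, and -B
  that of the negative ones. Since \<open>\<tau> r = 1 / c\<close> while the total is at most
  1/(4c), B exceeds A by 3/(4c), and the product is at least (1 - A)(1 + B). As A is at most n/c,
  the choice c = 8 n^2 bounds A^2 by 1/(8c), small enough to leave a gain of 1/(2c).\<close>

lemma cut_growth:
 fixes \<tau> :: "nat => real"
 assumes n: "0 < n" and c: "c = 8 * real n ^ 2" and le: "\<And>k. k < n ==> \<tau> k \<le> 1 / c" and r: "r < n" "\<tau> r = 1 / c"
  and s: "(\<Sum>k<n. \<tau> k) \<le> 1 / (4 * c)"
 shows "1 + 1 / (16 * real n ^ 2) \<le> (\<Prod>k\<in>{..<n} - {r}. 1 - \<tau> k)"
proof -
 define S where "S = {..<n} - {r}"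
 define A where "A = (\<Sum>k\<in>{k\<in>S. 0 \<le> \<tau> k}. \<tau> k)"
 define B where "B = (\<Sum>k\<in>{k\<in>S. \<tau> k < 0}. - \<tau> k)"
 have fS: "finite S" by (simp add: S_def)
 have n1: "1 \<le> real n" using n by simp
 then have n2: "1 \<le> real n ^ 2" by (rule one_le_power)
 have c8: "8 \<le> c" using n2 by (simp add: c)
 have split: "S = {k\<in>S. 0 \<le> \<tau> k} \<union> {k\<in>S. \<tau> k < 0}" by auto
 have "(\<Sum>k<n. \<tau> k) = \<tau> r + sum \<tau> S" unfolding S_def using r by (subst sum.remove[of _ r]) auto
 also have "sum \<tau> S = A - B"
  unfolding A_def B_def sum_negf by (subst split, subst sum.union_disjoint) (auto simp: fS)
 finally have AB: "A + 3 / (4 * c) \<le> B" using s r c8 by (simp add: field_simps)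
 have A0: "0 \<le> A" unfolding A_def by (intro sum_nonneg) auto
 have "A \<le> (\<Sum>k\<in>{k\<in>S. 0 \<le> \<tau> k}. 1 / c)" unfolding A_def using le by (intro sum_mono) (auto simp: S_def)
 also have "\<dots> \<le> (\<Sum>k<n. 1 / c)" using c8 by (intro sum_mono2) (auto simp: S_def)
 finally have "A \<le> real n / c" by simp
 then have A1: "A \<le> 1 / (8 * real n)" using n1 by (simp add: c power2_eq_square)
 have "1 / (8 * real n) \<le> 1 / 8" using n1 by (intro divide_left_mono) auto
 then have A2: "A \<le> 1 / 8" using A1 by simp
 have "A * A \<le> (1 / (8 * real n)) * (1 / (8 * real n))" using A0 A1 by (intro mult_mono) auto
 also have "\<dots> = 1 / (8 * c)" by (simp add: c power2_eq_square)
 finally have A3: "A * A \<le> 1 / (8 * c)" .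
 have A4: "A * (3 / (4 * c)) \<le> 1 / 8 * (3 / (4 * c))" using A2 c8 by (intro mult_right_mono) auto
 have "1 + 1 / (16 * real n ^ 2) = 1 + 1 / (2 * c)" by (simp add: c)
 also have "\<dots> \<le> 1 + 3 / (4 * c) - A * A - A * (3 / (4 * c))"
 proof -
  have "1 / (2 * c) = 16 * (1 / (32 * c))" "3 / (4 * c) = 24 * (1 / (32 * c))" "1 / (8 * c) = 4 * (1 / (32 * c))" by auto
  moreover have "0 < 1 / (32 * c)" using c8 by simp
  ultimately show ?thesis using A3 A4 by linarith
 qed
 also have "\<dots> = (1 - A) * (1 + (A + 3 / (4 * c)))"
 proof -
  have "1 + t - A * A - A * t = (1 - A) * (1 + (A + t))" for t by (simp add: algebra_simps)
  then show ?thesis .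
 qed
 also have "\<dots> \<le> (1 - A) * (1 + B)" using AB A2 by (intro mult_left_mono) auto
 also have "\<dots> \<le> (\<Prod>k\<in>{k\<in>S. 0 \<le> \<tau> k}. 1 - \<tau> k) * (\<Prod>k\<in>{k\<in>S. \<tau> k < 0}. 1 - \<tau> k)"
 proof (rule mult_mono)
  have t1: "\<tau> k \<le> 1" if "k \<in> S" for k
   using le[of k] that c8 by (auto simp: S_def intro: order_trans[of _ "1 / c"])
  show "1 - A \<le> (\<Prod>k\<in>{k\<in>S. 0 \<le> \<tau> k}. 1 - \<tau> k)"
   unfolding A_def using t1 fS by (intro one_minus_sum_le_prod) auto
  show "1 + B \<le> (\<Prod>k\<in>{k\<in>S. \<tau> k < 0}. 1 - \<tau> k)"
   unfolding B_def using one_plus_sum_le_prod[of "{k\<in>S. \<tau> k < 0}" "\<lambda>k. - \<tau> k"] fS by simp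
  show "0 \<le> (\<Prod>k\<in>{k\<in>S. 0 \<le> \<tau> k}. 1 - \<tau> k)" using t1 by (intro prod_nonneg) auto
  show "0 \<le> 1 + B" using AB A0 c8 by (simp add: add_nonneg_nonneg order_trans[OF _ AB])
 qed
 also have "\<dots> = (\<Prod>k\<in>S. 1 - \<tau> k)"
  by (subst (3) split, subst prod.union_disjoint) (auto simp: fS)
 finally show ?thesis by (simp add: S_def)
qed

text \<open>The points Y keep their position and are rewritten in the new rows. Their coefficients
  remain nonnegative because their value under Z is nonnegative; the hypothesis on Y secures this in
  spite of the drift \<open>\<epsilon>\<close>.\<close>

lemma cone_inv_step:
 assumes I: "cone_inv n M Y \<epsilon> D V \<Lambda>" and n: "0 < n"
  and a: "\<And>k. k < n ==> a k = (\<Sum>j<n. V k j * Z j)" and r: "r < n" "\<And>k. k < n ==> a k \<le> a r" and ar: "0 < a r"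
  and c: "c = 8 * int n ^ 2" and s: "4 * (\<Sum>k<n. a k) \<le> a r"
  and Y: "\<And>l. l < n ==> \<epsilon> * (\<Sum>j<n. \<bar>Z j\<bar>) \<le> M * (\<Sum>j<n. Y l j * Z j)" and D: "0 \<le> D"
 shows "\<exists>\<Lambda>'. cone_inv n M Y (\<epsilon> + n) (D * (1 + 1 / (16 * real n ^ 2))) (cut_step n c M V a r) \<Lambda>'"
proof -
 define \<tau> where "\<tau> k = real_of_int (a k) / (c * a r)" for k
 \<comment> \<open>Read off from \<open>V k = (1 - \<tau> k) * V' k + \<tau> k * V r\<close>, where
   V' k is the new row before rounding.\<close>
 define L where "L l k = (if k = r then \<Lambda> l r + (\<Sum>i\<in>{..<n} - {r}. \<tau> i * \<Lambda> l i) else (1 - \<tau> k) * \<Lambda> l k)" for l k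
 have Vs: "\<And>k. k < n ==> (\<Sum>j<n. V k j) = M" using I by (simp add: cone_inv_def)
 have L0: "\<And>l k. l < n ==> k < n ==> 0 \<le> \<Lambda> l k" and L1: "\<And>l. l < n ==> (\<Sum>k<n. \<Lambda> l k) = 1"
  and Le: "\<And>l j. l < n ==> j < n ==> \<bar>(\<Sum>k<n. \<Lambda> l k * V k j) - M * Y l j\<bar> \<le> \<epsilon>"
  and Ld: "D \<le> \<bar>det (mat n n (\<lambda>(k, l). \<Lambda> l k))\<bar>"
  using I by (auto simp: cone_inv_def)
 have "1 \<le> int n ^ 2" using n by (intro one_le_power) auto
 then have c8: "8 \<le> c" by (simp add: c)
 have car: "0 < c * a r" using c8 ar by simp
 then have carR: "0 < real_of_int c * real_of_int (a r)" by (metis of_int_0_less_iff of_int_mult)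
 have tr: "\<tau> r = 1 / c" using ar c8 by (simp add: \<tau>_def)
 have tle: "\<tau> k \<le> 1 / c" if "k < n" for k
 proof -
  have "real_of_int (a k) \<le> real_of_int (a r)" using r(2)[OF that] by simp
  then have "\<tau> k \<le> real_of_int (a r) / (c * a r)" unfolding \<tau>_def using carR by (intro divide_right_mono) auto
  then show ?thesis using tr by (simp add: \<tau>_def)
 qed
 have c1: "1 / real_of_int c \<le> 1" using c8 by simp
 have d: "0 < c * a r - a k" if "k < n" for k
 proof -
  have "a k \<le> 1 * a r" using r(2)[OF that] by simp
  also have "\<dots> < c * a r" using c8 ar by (intro mult_strict_right_mono) auto
  finally show ?thesis by simp
 qed
 \<comment> \<open>The value of the combination of rows differs from M times the value of
   \<open>Y l\<close> by at most \<open>\<epsilon>\<close> times the sum of all |Z j|.\<close>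
 have dotnn: "0 \<le> (\<Sum>k<n. \<Lambda> l k * a k)" if l: "l < n" for l
 proof -
  have "(\<Sum>k<n. \<Lambda> l k * a k) = (\<Sum>k<n. \<Sum>j<n. \<Lambda> l k * V k j * Z j)"
   by (intro sum.cong refl) (simp add: a sum_distrib_left ac_simps)
  also have "\<dots> = (\<Sum>j<n. (\<Sum>k<n. \<Lambda> l k * V k j) * Z j)"
   by (subst sum.swap) (simp only: sum_distrib_right)
  finally have 1: "(\<Sum>k<n. \<Lambda> l k * a k) = (\<Sum>j<n. (\<Sum>k<n. \<Lambda> l k * V k j) * Z j)" .
  have "\<bar>(\<Sum>j<n. (\<Sum>k<n. \<Lambda> l k * V k j) * Z j) - (\<Sum>j<n. M * Y l j * Z j)\<bar>
    \<le> (\<Sum>j<n. \<bar>((\<Sum>k<n. \<Lambda> l k * V k j) - M * Y l j) * Z j\<bar>)"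
   unfolding sum_subtractf[symmetric] left_diff_distrib[symmetric] by (rule sum_abs)
  also have "\<dots> \<le> (\<Sum>j<n. \<epsilon> * \<bar>Z j\<bar>)"
   unfolding abs_mult by (intro sum_mono) (auto intro!: mult_right_mono Le l)
  also have "\<dots> \<le> (\<Sum>j<n. M * Y l j * Z j)" using Y[OF l] by (simp add: sum_distrib_left ac_simps)
  finally show ?thesis unfolding 1 by linarith
 qed
 have Lsplit: "(\<Sum>k<n. f k) = f r + (\<Sum>k\<in>{..<n} - {r}. f k)" for f :: "nat => real"
  using r by (subst sum.remove[of _ r]) auto
 \<comment> \<open>The coefficient of row r is a nonnegative multiple of the old one plus a positive
   multiple of the value of the point; here the cut is used.\<close>
 have Lr: "L l r = \<Lambda> l r * (1 - \<tau> r) + (\<Sum>k<n. \<Lambda> l k * a k) / (c * a r)" for l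
  unfolding Lsplit L_def \<tau>_def by (simp add: add_divide_distrib sum_divide_distrib algebra_simps)
 have "cone_inv n M Y (\<epsilon> + n) (D * (1 + 1 / (16 * real n ^ 2))) (cut_step n c M V a r) L"
  unfolding cone_inv_def
 proof (intro conjI allI impI)
  fix k assume "k < n" then show "(\<Sum>j<n. cut_step n c M V a r k j) = M"
   using cut_step_row_sum[of V r n M] Vs r n by simp
 next
  fix l k assume l: "l < n" and k: "k < n"
  show "0 \<le> L l k"
  proof (cases "k = r")
   case True
   show ?thesis unfolding True Lr using L0[OF l r(1)] dotnn[OF l] carR tr c1
    by (intro add_nonneg_nonneg mult_nonneg_nonneg divide_nonneg_nonneg) auto
  next
   case False
   then show ?thesis using L0[OF l k] tle[OF k] c1 by (auto simp: L_def)
  qed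
 next
  fix l assume l: "l < n"
  show "(\<Sum>k<n. L l k) = 1"
  proof -
   have "(\<Sum>k\<in>{..<n} - {r}. L l k) = (\<Sum>k\<in>{..<n} - {r}. \<Lambda> l k) - (\<Sum>k\<in>{..<n} - {r}. \<tau> k * \<Lambda> l k)"
    unfolding sum_subtractf[symmetric] by (intro sum.cong) (auto simp: L_def algebra_simps)
   then have "(\<Sum>k<n. L l k) = (\<Sum>k<n. \<Lambda> l k)" unfolding Lsplit by (simp add: L_def)
   then show ?thesis using L1[OF l] by simp
  qed
 next
  fix l j assume l: "l < n" and j: "j < n"
  define e where "e k = real_of_int (cut_step n c M V a r k j) - (c * a r * V k j - a k * V r j) / (c * a r - a k)" for k
  have e: "\<bar>e k\<bar> \<le> n" if "k < n" "k \<noteq> r" for k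
   unfolding e_def using cut_row_error[OF d[OF that(1)] Vs[OF that(1)] Vs[OF r(1)] that(2) j] by simp
  have tm: "L l k * cut_step n c M V a r k j = \<Lambda> l k * V k j - \<tau> k * \<Lambda> l k * V r j + L l k * e k"
   if k: "k < n" "k \<noteq> r" for k
  proof -
   have gen: "L' * x = lam * v + L' * y" if "(1 - t) * A = v" "x = A + y" "L' = (1 - t) * lam" for t A v x y L' lam :: real
   proof -
    have "L' * A = lam * ((1 - t) * A)" using that(3) by simp
    moreover have "L' * x = L' * A + L' * y" using that(2) by (simp only: distrib_left)
    ultimately show ?thesis using that(1) by simp
   qed
   have "real_of_int 0 < real_of_int (c * a r - a k)" using d[OF k(1)] by (simp only: of_int_less_iff)
   then have dR: "0 < real_of_int c * a r - a k" by simp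
   have "(1 - \<tau> k) * ((c * a r * V k j - a k * V r j) / (c * a r - a k)) = V k j - \<tau> k * V r j"
   proof -
    have gen: "(1 - x / y) * ((y * v - x * w) / (y - x)) = v - x / y * w" if "0 < y" "0 < y - x" for x y v w :: real
     using that by (simp add: field_simps)
    show ?thesis using gen[OF carR dR, of "V k j" "V r j"] by (simp add: \<tau>_def)
   qed
   moreover have "real_of_int (cut_step n c M V a r k j) = (c * a r * V k j - a k * V r j) / (c * a r - a k) + e k"
    by (simp add: e_def)
   moreover have "L l k = (1 - \<tau> k) * \<Lambda> l k" using k by (simp add: L_def)
   ultimately have "L l k * cut_step n c M V a r k j = \<Lambda> l k * (V k j - \<tau> k * V r j) + L l k * e k"
    by (rule gen)
   then show ?thesis by (simp add: right_diff_distrib ac_simps)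
  qed
  have "(\<Sum>k<n. L l k * cut_step n c M V a r k j) = L l r * V r j + (\<Sum>k\<in>{..<n} - {r}. \<Lambda> l k * V k j - \<tau> k * \<Lambda> l k * V r j + L l k * e k)"
  proof -
   have "(\<Sum>k\<in>{..<n} - {r}. L l k * cut_step n c M V a r k j) = (\<Sum>k\<in>{..<n} - {r}. \<Lambda> l k * V k j - \<tau> k * \<Lambda> l k * V r j + L l k * e k)"
    by (rule sum.cong[OF refl], rule tm) auto
   then show ?thesis unfolding Lsplit by (simp only: cut_step_def if_True simp_thms)
  qed
  also have "\<dots> = (\<Sum>k<n. \<Lambda> l k * V k j) + (\<Sum>k\<in>{..<n} - {r}. L l k * e k)"
   unfolding Lsplit by (simp add: L_def sum.distrib sum_subtractf sum_distrib_right distrib_right)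
  finally have 1: "(\<Sum>k<n. L l k * cut_step n c M V a r k j) = (\<Sum>k<n. \<Lambda> l k * V k j) + (\<Sum>k\<in>{..<n} - {r}. L l k * e k)" .
  have "\<bar>\<Sum>k\<in>{..<n} - {r}. L l k * e k\<bar> \<le> (\<Sum>k\<in>{..<n} - {r}. \<bar>L l k * e k\<bar>)" by (rule sum_abs)
  also have "\<dots> \<le> (\<Sum>k\<in>{..<n} - {r}. \<Lambda> l k * (1 - \<tau> k) * n)"
  proof (rule sum_mono)
   fix k assume k: "k \<in> {..<n} - {r}"
   have Lk: "L l k = \<Lambda> l k * (1 - \<tau> k)" using k by (simp add: L_def)
   have nn: "0 \<le> \<Lambda> l k * (1 - \<tau> k)" using k L0[OF l, of k] tle[of k] c1 by (intro mult_nonneg_nonneg) auto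
   have "\<bar>L l k * e k\<bar> = \<Lambda> l k * (1 - \<tau> k) * \<bar>e k\<bar>" unfolding Lk abs_mult[of _ "e k"] by (simp only: abs_of_nonneg[OF nn])
   also have "\<dots> \<le> \<Lambda> l k * (1 - \<tau> k) * n" using e[of k] k nn by (intro mult_left_mono) auto
   finally show "\<bar>L l k * e k\<bar> \<le> \<Lambda> l k * (1 - \<tau> k) * n" .
  qed
  \<comment> \<open>The coefficients of the moved rows sum to at most 1, so rounding errors of at
    most n per row shift a point by at most n.\<close>
  also have "\<dots> \<le> real n"
  proof -
   have "(\<Sum>k\<in>{..<n} - {r}. \<Lambda> l k * (1 - \<tau> k)) = (\<Sum>k<n. \<Lambda> l k) - L l r"
    unfolding Lsplit by (simp add: L_def right_diff_distrib sum_subtractf mult.commute)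
   also have "\<dots> \<le> 1"
   proof -
    have "0 \<le> L l r" unfolding Lr using L0[OF l r(1)] dotnn[OF l] carR tr c1
     by (intro add_nonneg_nonneg mult_nonneg_nonneg divide_nonneg_nonneg) auto
    then show ?thesis using L1[OF l] by simp
   qed
   finally have "(\<Sum>k\<in>{..<n} - {r}. \<Lambda> l k * (1 - \<tau> k)) * real n \<le> 1 * real n" by (intro mult_right_mono) auto
   then show ?thesis by (simp only: sum_distrib_right mult_1)
  qed
  finally show "\<bar>(\<Sum>k<n. L l k * cut_step n c M V a r k j) - M * Y l j\<bar> \<le> \<epsilon> + n"
   unfolding 1 using Le[OF l j] by linarith
 next
  have "det (mat n n (\<lambda>(k, l). L l k)) = (\<Prod>k\<in>{..<n} - {r}. 1 - \<tau> k) * det (mat n n (\<lambda>(k, l). \<Lambda> l k))"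
   unfolding L_def by (rule det_mix_into_row[OF r(1), of "\<lambda>k l. \<Lambda> l k"])
  moreover have "1 + 1 / (16 * real n ^ 2) \<le> (\<Prod>k\<in>{..<n} - {r}. 1 - \<tau> k)"
  proof (rule cut_growth[OF n _ _ r(1)])
   show "real_of_int c = 8 * real n ^ 2" by (simp add: c)
   have "real_of_int (4 * (\<Sum>k<n. a k)) \<le> real_of_int (a r)" using s by (simp only: of_int_le_iff)
   then have "4 * (\<Sum>k<n. real_of_int (a k)) / (c * a r) \<le> a r / (c * a r)" using carR by (intro divide_right_mono) auto
   then show "(\<Sum>k<n. \<tau> k) \<le> 1 / (4 * real_of_int c)" using ar by (simp add: \<tau>_def sum_divide_distrib[symmetric])
  qed (use tr tle in auto)
  ultimately have "D * (1 + 1 / (16 * real n ^ 2)) \<le> \<bar>det (mat n n (\<lambda>(k, l). \<Lambda> l k))\<bar> * \<bar>\<Prod>k\<in>{..<n} - {r}. 1 - \<tau> k\<bar>"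
   using Ld D by (intro mult_mono) auto
  then show "D * (1 + 1 / (16 * real n ^ 2)) \<le> \<bar>det (mat n n (\<lambda>(k, l). L l k))\<bar>"
   using \<open>det (mat n n (\<lambda>(k, l). L l k)) = _\<close> by (simp add: abs_mult ac_simps)
 qed
 then show ?thesis by blast
qed

text \<open>The tracked points are p itself and, for every other index l, p pulled by
  \<open>\<rho>\<close> towards the l-th unit vector. The initial rows are M times unit vectors, so
  coordinates and coefficients agree; removing \<open>1 - \<rho>\<close> times the first point
  leaves a triangular matrix.\<close>

lemma cone_inv_init:
 assumes n: "0 < n" and p: "\<And>i. i < n ==> 0 \<le> p i" and s: "(\<Sum>i<n. p i) = 1" and \<rho>: "0 \<le> \<rho>" "\<rho> \<le> (1::real)"
 defines "Y \<equiv> \<lambda>l k. if l = 0 then p k else (1 - \<rho>) * p k + (if l = k then \<rho> else 0)"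
 shows "cone_inv n M Y 0 (p 0 * \<rho> ^ (n - 1)) (\<lambda>k j. if k = j then M else 0) Y"
 unfolding cone_inv_def
proof (intro conjI allI impI)
 fix l j assume "j < n"
 have "(\<Sum>k<n. Y l k * real_of_int (if k = j then M else 0)) = (\<Sum>k<n. if k = j then Y l j * M else 0)"
  by (intro sum.cong) auto
 then show "\<bar>(\<Sum>k<n. Y l k * real_of_int (if k = j then M else 0)) - M * Y l j\<bar> \<le> 0"
  using \<open>j < n\<close> by (simp add: sum.delta)
next
 fix l assume l: "l < n"
 show "(\<Sum>k<n. Y l k) = 1"
  by (cases "l = 0") (use l s in \<open>simp_all add: Y_def sum.distrib flip: sum_distrib_left\<close>)
next
 define C :: "nat => nat => real" where "C l k = (if l = 0 then p k else if l = k then \<rho> else 0)" for l k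
 have "(\<lambda>(l, k). Y l k) = (\<lambda>(k, l). if k = 0 then C 0 l else C k l + (1 - \<rho>) * C 0 l)"
  by (intro ext) (auto simp: Y_def C_def)
 then have "det (mat n n (\<lambda>(l, k). Y l k)) = det (mat n n (\<lambda>(k, l). C k l))"
  using det_add_first_row[OF n, of C "1 - \<rho>"] by simp
 also have "\<dots> = p 0 * \<rho> ^ (n - 1)"
 proof -
  have "det (mat n n (\<lambda>(k, l). C k l)) = prod_list (diag_mat (mat n n (\<lambda>(k, l). C k l)))"
   by (rule det_upper_triangular) (auto simp: C_def)
  also have "\<dots> = (\<Prod>i = 0..<n. C i i)" by (simp add: prod_list_diag_prod)
  also have "\<dots> = C 0 0 * (\<Prod>i = Suc 0..<n. C i i)" using n by (simp add: prod.atLeast_Suc_lessThan)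
  also have "(\<Prod>i = Suc 0..<n. C i i) = \<rho> ^ (n - 1)" by (simp add: C_def)
  finally show ?thesis by (simp add: C_def)
 qed
 finally have "det (mat n n (\<lambda>(l, k). Y l k)) = p 0 * \<rho> ^ (n - 1)" .
 moreover have "mat n n (\<lambda>(k, l). Y l k) = transpose_mat (mat n n (\<lambda>(l, k). Y l k))" by (intro eq_matI) auto
 ultimately have "det (mat n n (\<lambda>(k, l). Y l k)) = p 0 * \<rho> ^ (n - 1)" by (simp add: det_transpose[of _ n])
 then show "p 0 * \<rho> ^ (n - 1) \<le> \<bar>det (mat n n (\<lambda>(k, l). Y l k))\<bar>" by simp
qed (use p \<rho> in \<open>auto simp: Y_def sum.delta\<close>)

section \<open>Rationality of equilibria\<close>

text \<open>As a bipartite graph between agents and goods the support has no cycle. The linear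
  formulation states directly what is used: a flow with this support is determined by its row and
  column sums.\<close>

definition support_forest :: "nat => (nat => nat => real) => bool" where
 "support_forest n f \<longleftrightarrow> (\<forall>g :: nat => nat => real.
   (\<forall>i<n. \<forall>j<n. \<not> 0 < f i j --> g i j = 0) \<and> (\<forall>i<n. (\<Sum>j<n. g i j) = 0) \<and> (\<forall>j<n. (\<Sum>i<n. g i j) = 0)
   --> (\<forall>i<n. \<forall>j<n. g i j = 0))"

text \<open>A nonzero circulation g on the support has a negative entry, as its rows sum to 0.
  Adding the largest multiple of g that keeps the flow nonnegative kills an edge and preserves
  prices and optimality.\<close>

lemma meq_reduce_support:
 assumes f: "meq n u q f" and nf: "\<not> support_forest n f"
 shows "\<exists>f'. meq n u q f' \<and> {(i, j). i < n \<and> j < n \<and> 0 < f' i j} \<subset> {(i, j). i < n \<and> j < n \<and> 0 < f i j}"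
proof -
 let ?D = "{(i, j). i < n \<and> j < n}"
 have fD: "finite ?D" by (rule finite_subset[of _ "{..<n} \<times> {..<n}"]) auto
 obtain g i0 j0 where g: "\<And>i j. i < n ==> j < n ==> \<not> 0 < f i j ==> g i j = 0"
  "\<And>i. i < n ==> (\<Sum>j<n. g i j) = (0::real)" "\<And>j. j < n ==> (\<Sum>i<n. g i j) = 0"
  and ij0: "i0 < n" "j0 < n" "g i0 j0 \<noteq> 0"
  using nf unfolding support_forest_def by blast
 define S where "S = {(i, j). i < n \<and> j < n \<and> g i j < 0}"
 have "\<exists>j1<n. g i0 j1 < 0"
 proof (rule ccontr)
  assume "\<not> (\<exists>j1<n. g i0 j1 < 0)"
  then have "\<And>j. j < n ==> 0 \<le> g i0 j" by (meson not_less)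
  then have "\<forall>j\<in>{..<n}. g i0 j = 0" using g(2)[OF ij0(1)] by (subst (asm) sum_nonneg_eq_0_iff) auto
  then show False using ij0 by auto
 qed
 then have Sne: "S \<noteq> {}" using ij0 by (auto simp: S_def)
 have fS: "finite S" by (rule finite_subset[OF _ fD]) (auto simp: S_def)
 define \<theta> where "\<theta> = (\<lambda>(i, j). f i j / - g i j)"
 define t where "t = Min (\<theta> ` S)"
 have "t \<in> \<theta> ` S" unfolding t_def using fS Sne by (intro Min_in) auto
 then obtain i1 j1 where ij1: "(i1, j1) \<in> S" "t = f i1 j1 / - g i1 j1" by (auto simp: \<theta>_def)
 have tle: "t \<le> f i j / - g i j" if "(i, j) \<in> S" for i j
  unfolding t_def using that fS by (intro Min_le) (auto simp: \<theta>_def image_iff intro!: bexI[of _ "(i, j)"])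
 have Spos: "0 < f i j" if "(i, j) \<in> S" for i j using that g(1)[of i j] by (force simp: S_def)
 have g1: "g i1 j1 < 0" "i1 < n" "j1 < n" using ij1(1) by (auto simp: S_def)
 have t0: "0 < t" unfolding ij1(2) using Spos[OF ij1(1)] g1 by (intro divide_pos_pos) auto
 define f' where "f' i j = f i j + t * g i j" for i j
 have nn: "0 \<le> f' i j" if "i < n" "j < n" for i j
 proof (cases "g i j < 0")
  case True
  then have ng: "0 < - g i j" by simp
  have "(i, j) \<in> S" using True that by (simp add: S_def)
  from tle[OF this] have "t * - g i j \<le> f i j" by (simp only: pos_le_divide_eq[OF ng])
  then show ?thesis by (simp add: f'_def)
 next
  case False
  then show ?thesis using t0 meq_nonneg[OF f that] by (simp add: f'_def)
 qed
 have sub: "0 < f i j" if "i < n" "j < n" "0 < f' i j" for i j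
  using that g(1)[of i j] meq_nonneg[OF f that(1,2)] by (cases "0 < f i j") (auto simp: f'_def)
 have f10: "f' i1 j1 = 0" using g1 ij1(2) by (simp add: f'_def)
 have "{(i, j). i < n \<and> j < n \<and> 0 < f' i j} \<subset> {(i, j). i < n \<and> j < n \<and> 0 < f i j}"
 proof (rule psubsetI)
  show "{(i, j). i < n \<and> j < n \<and> 0 < f' i j} \<subseteq> {(i, j). i < n \<and> j < n \<and> 0 < f i j}"
   using sub by blast
  have "(i1, j1) \<in> {(i, j). i < n \<and> j < n \<and> 0 < f i j}" using Spos[OF ij1(1)] g1(2,3) by simp
  moreover have "(i1, j1) \<notin> {(i, j). i < n \<and> j < n \<and> 0 < f' i j}" using f10 by simp
  ultimately show "{(i, j). i < n \<and> j < n \<and> 0 < f' i j} \<noteq> {(i, j). i < n \<and> j < n \<and> 0 < f i j}" by metis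
 qed
 moreover have "meq n u q f'"
  unfolding meq_def
 proof (intro conjI allI impI)
  fix i assume "i < n" then show "0 < q i" by (rule meq_pos[OF f])
 next
  fix i j assume "i < n" "j < n" then show "0 \<le> f' i j" by (rule nn)
 next
  fix i j l assume ij: "i < n" "j < n" "0 < f' i j" and l: "l < n"
  then show "u i l * q j \<le> u i j * q l" by (intro meq_best[OF f _ _ sub])
 next
  fix j assume "j < n" then show "(\<Sum>i<n. f' i j) = q j"
   using meq_sold[OF f] g(3) by (simp add: f'_def sum.distrib flip: sum_distrib_left)
 next
  fix i assume "i < n" then show "(\<Sum>j<n. f' i j) = q i"
   using meq_spent[OF f] g(2) by (simp add: f'_def sum.distrib flip: sum_distrib_left)
 qed
 ultimately show ?thesis by blast
qed

lemma meq_forest_exists: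
 assumes "meq n u q f" shows "\<exists>f. meq n u q f \<and> support_forest n f"
proof -
 define c where "c f = card {(i, j). i < n \<and> j < n \<and> (0::real) < f i j}" for f
 obtain f0 where f0: "meq n u q f0" "\<And>f. meq n u q f ==> c f0 \<le> c f"
  using ex_has_least_nat[of "meq n u q" f c] assms by blast
 have "support_forest n f0"
 proof (rule ccontr)
  assume "\<not> support_forest n f0"
  then obtain f' where f': "meq n u q f'" "{(i, j). i < n \<and> j < n \<and> 0 < f' i j} \<subset> {(i, j). i < n \<and> j < n \<and> 0 < f0 i j}"
   using meq_reduce_support[OF f0(1)] by blast
  have "finite {(i, j). i < n \<and> j < n \<and> 0 < f0 i j}"
   by (rule finite_subset[of _ "{..<n} \<times> {..<n}"]) auto
  then have "c f' < c f0" unfolding c_def using f'(2) by (rule psubset_card_mono)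
  then show False using f0(2)[OF f'(1)] by simp
 qed
 then show ?thesis using f0 by blast
qed

lemma sum_prices_flows:
 fixes h :: "nat => 'a::comm_monoid_add"
 shows "(\<Sum>a<n + n * n. h a) = (\<Sum>j<n. h j) + (\<Sum>i<n. \<Sum>j<n. h (n + (i * n + j)))"
proof -
 have "(\<Sum>a<n + n * n. h a) = (\<Sum>j<n. h j) + (\<Sum>a = n..<n + n * n. h a)"
  by (subst sum.union_disjoint[symmetric]) (auto intro!: sum.cong)
 also have "(\<Sum>a = n..<n + n * n. h a) = (\<Sum>b<n * n. h (n + b))"
  using sum.shift_bounds_nat_ivl[of h 0 n "n * n"] by (simp add: lessThan_atLeast0 add.commute)
 also have "\<dots> = (\<Sum>i<n. \<Sum>b = i * n..<i * n + n. h (n + b))" by (rule sum.nat_group[symmetric])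
 also have "\<dots> = (\<Sum>i<n. \<Sum>j<n. h (n + (i * n + j)))"
 proof (rule sum.cong[OF refl])
  fix i show "(\<Sum>b = i * n..<i * n + n. h (n + b)) = (\<Sum>j<n. h (n + (i * n + j)))"
   using sum.shift_bounds_nat_ivl[of "\<lambda>b. h (n + b)" 0 "i * n" n] by (simp add: lessThan_atLeast0 add.commute)
 qed
 finally show ?thesis .
qed

text \<open>The unknowns of the linear system as one vector: first n prices, then n^2 flows, row by
  row.\<close>

definition pf_vec :: "nat => (nat => 'a) => (nat => nat => 'a) => nat => 'a" where
 "pf_vec n \<alpha> \<gamma> a = (if a < n then \<alpha> a else \<gamma> ((a - n) div n) ((a - n) mod n))"

lemma pf_vec_simps [simp]:
 "j < n ==> pf_vec n \<alpha> \<gamma> j = \<alpha> j" "j < n ==> pf_vec n \<alpha> \<gamma> (n + (i * n + j)) = \<gamma> i j"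
 by (auto simp: pf_vec_def)

abbreviation component :: "nat => (nat \<times> nat) set => nat => nat set" where
 "component n E j \<equiv> {k. k < n \<and> (j, k) \<in> (E \<union> E\<inverse>)\<^sup>*}"

text \<open>If \<open>x\<close> solves the homogeneous system and \<open>t = x / p\<close>, then \<open>t\<close> is constant along the edges
  of \<open>E\<close>: the quadratic form \<open>\<Sum>i. p i * (t i - T i)\<^sup>2\<close> vanishes, where \<open>T i\<close> is the common value
  of \<open>t\<close> on the goods adjacent to \<open>i\<close>.\<close>

lemma rational_flow:
 fixes p :: "nat => real" and U :: nat
 assumes pos: "\<And>i. i < n ==> 0 < p i" and f0: "\<And>i j. i < n ==> j < n ==> 0 \<le> f i j"
  and sold: "\<And>j. j < n ==> (\<Sum>i<n. f i j) = p j" and spent: "\<And>i. i < n ==> (\<Sum>j<n. f i j) = p i"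
  and E: "E \<subseteq> {..<n} \<times> {..<n}" "\<And>i j. i < n ==> j < n ==> 0 < f i j ==> (i, j) \<in> E"
  and uE: "\<And>i j. (i, j) \<in> E ==> 0 < u i j" and U: "\<And>i j. i < n ==> j < n ==> u i j \<le> U" and U1: "1 \<le> U"
  and ratio: "\<And>i j k. (i, j) \<in> E ==> (i, k) \<in> E ==> real (u i j) * p k = real (u i k) * p j"
  and norm: "\<And>j. j < n ==> (\<Sum>k\<in>component n E j. p k) = 1"
  and forest: "support_forest n f"
 shows "\<exists>\<Delta>::int. 0 < \<Delta> \<and> \<Delta> \<le> fact (n + n * n) * (int (n ^ 3 + n ^ 2 + 3 * n) * (int U)\<^sup>2) ^ (n + n * n) \<and>
  (\<forall>j<n. \<exists>k::int. of_int \<Delta> * p j = of_int k) \<and> (\<forall>i<n. \<forall>j<n. \<exists>k::int. of_int \<Delta> * f i j = of_int k)"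
proof -
 define N where "N = n + n * n"
 define z :: "nat => int" where "z = (\<lambda>_. 0)"
 define zz :: "nat => nat => int" where "zz = (\<lambda>_ _. 0)"
 \<comment> \<open>The five families of equations: equal utility per unit of money along E, budgets,
   market clearing, zero flow off the support, and price sum 1 in each component. Counting them
   gives \<open>n ^ 3 + n ^ 2 + 3 * n\<close>.\<close>
 define r1 where "r1 = (\<lambda>(i, j, k). (pf_vec n (\<lambda>a. (if a = k then int (u i j) else 0) - (if a = j then int (u i k) else 0)) zz, 0::int))"
 define r2 where "r2 = (\<lambda>i. (pf_vec n (\<lambda>a. if a = i then -1 else (0::int)) (\<lambda>i' j'. if i' = i then 1 else 0), 0::int))"
 define r3 where "r3 = (\<lambda>j. (pf_vec n (\<lambda>a. if a = j then -1 else (0::int)) (\<lambda>i' j'. if j' = j then 1 else 0), 0::int))"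
 define r4 where "r4 = (\<lambda>(i, j). (pf_vec n z (\<lambda>i' j'. if i' = i then if j' = j then 1 else 0 else 0), 0::int))"
 define r5 where "r5 = (\<lambda>j. (pf_vec n (\<lambda>a. if a \<in> component n E j then 1 else (0::int)) zz, 1::int))"
 define I1 where "I1 = {(i, j, k). (i, j) \<in> E \<and> (i, k) \<in> E}"
 define I4 where "I4 = {(i, j). i < n \<and> j < n \<and> \<not> 0 < f i j}"
 define rows where "rows = r1 ` I1 \<union> (r2 ` {..<n} \<union> (r3 ` {..<n} \<union> (r4 ` I4 \<union> r5 ` {..<n})))"
 have I1: "I1 \<subseteq> {..<n} \<times> {..<n} \<times> {..<n}" using E(1) by (auto simp: I1_def)
 have I4: "I4 \<subseteq> {..<n} \<times> {..<n}" by (auto simp: I4_def)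
 have fin1: "finite I1" "finite I4" using I1 I4 by (auto intro: finite_subset)
 have fin: "finite rows" using fin1 by (simp add: rows_def)
 have c1: "card I1 \<le> n ^ 3" using card_mono[OF _ I1] by (simp add: card_cartesian_product power3_eq_cube)
 have c4: "card I4 \<le> n ^ 2" using card_mono[OF _ I4] by (simp add: card_cartesian_product power2_eq_square)
 have im: "card (r1 ` I1) \<le> card I1" "card (r2 ` {..<n}) \<le> n" "card (r3 ` {..<n}) \<le> n" "card (r4 ` I4) \<le> card I4"
  "card (r5 ` {..<n}) \<le> n"
  using fin1 card_image_le[of "{..<n}"] by (auto intro: card_image_le)
 have crd: "card rows \<le> n ^ 3 + n ^ 2 + 3 * n"
  unfolding rows_def using im c1 c4
   card_Un_le[of "r1 ` I1" "r2 ` {..<n} \<union> (r3 ` {..<n} \<union> (r4 ` I4 \<union> r5 ` {..<n}))"]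
   card_Un_le[of "r2 ` {..<n}" "r3 ` {..<n} \<union> (r4 ` I4 \<union> r5 ` {..<n})"]
   card_Un_le[of "r3 ` {..<n}" "r4 ` I4 \<union> r5 ` {..<n}"] card_Un_le[of "r4 ` I4" "r5 ` {..<n}"]
  by linarith
 have dot: "(\<Sum>a<N. of_int (pf_vec n \<alpha> \<gamma> a) * y a) = (\<Sum>j<n. of_int (\<alpha> j) * y j) + (\<Sum>i<n. \<Sum>j<n. of_int (\<gamma> i j) * y (n + (i * n + j)))"
  for \<alpha> \<gamma> and y :: "nat => real"
  unfolding N_def sum_prices_flows by (intro arg_cong2[where f = "(+)"] sum.cong refl) auto
 have d1: "(\<Sum>a<N. of_int (fst (r1 (i, j, k)) a) * y a) = real (u i j) * y k - real (u i k) * y j"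
  if "(i, j, k) \<in> I1" for i j k and y :: "nat => real"
 proof -
  have "(\<Sum>a<N. of_int (fst (r1 (i, j, k)) a) * y a) = (\<Sum>a<n. (if a = k then real (u i j) * y k else 0) - (if a = j then real (u i k) * y j else 0))"
   unfolding r1_def prod.case fst_conv dot by (simp add: zz_def) (intro sum.cong, auto)
  then show ?thesis using that I1 by (auto simp: sum_subtractf sum.delta)
 qed
 have d2: "(\<Sum>a<N. of_int (fst (r2 i) a) * y a) = (\<Sum>j<n. y (n + (i * n + j))) - y i" if "i < n" for i and y :: "nat => real"
 proof -
  have "(\<Sum>a<N. of_int (fst (r2 i) a) * y a) = (\<Sum>a<n. if a = i then - y i else 0) + (\<Sum>i'<n. if i' = i then \<Sum>j<n. y (n + (i * n + j)) else 0)"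
   unfolding r2_def fst_conv dot by (intro arg_cong2[where f = "(+)"] sum.cong refl) auto
  then show ?thesis using that by (simp add: sum.delta)
 qed
 have d3: "(\<Sum>a<N. of_int (fst (r3 j) a) * y a) = (\<Sum>i<n. y (n + (i * n + j))) - y j" if "j < n" for j and y :: "nat => real"
 proof -
  have "(\<Sum>a<N. of_int (fst (r3 j) a) * y a) = (\<Sum>a<n. if a = j then - y j else 0) + (\<Sum>i<n. \<Sum>j'<n. if j' = j then y (n + (i * n + j)) else 0)"
   unfolding r3_def fst_conv dot by (intro arg_cong2[where f = "(+)"] sum.cong refl) auto
  then show ?thesis using that by (simp add: sum.delta)
 qed
 have d4: "(\<Sum>a<N. of_int (fst (r4 (i, j)) a) * y a) = y (n + (i * n + j))" if "(i, j) \<in> I4" for i j and y :: "nat => real"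
 proof -
  have ij: "i < n" "j < n" using that I4 by auto
  have "(\<Sum>j'<n. of_int (if i' = i then if j' = j then 1 else 0 else 0) * y (n + (i' * n + j'))) = (if i' = i then y (n + (i * n + j)) else 0)" for i'
  proof (cases "i' = i")
   case True
   have "(\<Sum>j'<n. of_int (if i' = i then if j' = j then 1 else 0 else 0) * y (n + (i' * n + j'))) = (\<Sum>j'<n. if j' = j then y (n + (i * n + j)) else 0)"
    by (rule sum.cong[OF refl]) (simp add: True)
   then show ?thesis using True ij by (simp add: sum.delta)
  qed simp
  then show ?thesis unfolding r4_def prod.case fst_conv dot using ij by (simp add: z_def sum.delta)
 qed
 have d5: "(\<Sum>a<N. of_int (fst (r5 j) a) * y a) = (\<Sum>k\<in>component n E j. y k)" for j and y :: "nat => real"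
 proof -
  have "(\<Sum>a<N. of_int (fst (r5 j) a) * y a) = (\<Sum>a<n. if a \<in> component n E j then y a else 0)"
   unfolding r5_def fst_conv dot by (simp add: zz_def) (intro sum.cong, auto)
  also have "\<dots> = (\<Sum>k\<in>{..<n} \<inter> component n E j. y k)" by (subst sum.inter_restrict) auto
  also have "{..<n} \<inter> component n E j = component n E j" by auto
  finally show ?thesis .
 qed
 have sgood: "\<exists>j<n. 0 < f i j" if i: "i < n" for i
 proof (rule ccontr)
  assume "\<not> (\<exists>j<n. 0 < f i j)"
  then have "\<And>j. j < n ==> f i j \<le> 0" by (meson not_less)
  then have "(\<Sum>j<n. f i j) \<le> 0" by (intro sum_nonpos) simp
  then show False using spent[OF i] pos[OF i] by simp
 qed
 have "\<exists>\<Delta>::int. 0 < \<Delta> \<and> \<Delta> \<le> fact N * (int (card rows) * (int U)\<^sup>2) ^ N \<and> (\<forall>a<N. \<exists>k::int. of_int \<Delta> * pf_vec n p f a = of_int k)"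
 proof (rule cramer_common_denominator[OF fin])
  fix \<rho> a assume \<rho>: "\<rho> \<in> rows" and a: "a < N"
  have U0: "0 \<le> int (u i j)" "int (u i j) \<le> int U" if "(i, j) \<in> E" for i j using U that E(1) by auto
  consider i j k where "\<rho> = r1 (i, j, k)" "(i, j) \<in> E" "(i, k) \<in> E" | i where "\<rho> = r2 i" | j where "\<rho> = r3 j"
   | i j where "\<rho> = r4 (i, j)" | j where "\<rho> = r5 j"
   using \<rho> unfolding rows_def I1_def by (elim UnE imageE) auto
  then show "\<bar>fst \<rho> a\<bar> \<le> int U"
  proof cases
   case 1
   have "0 \<le> int (u i j)" "int (u i j) \<le> int U" "0 \<le> int (u i k)" "int (u i k) \<le> int U" using U0 1 by auto
   then show ?thesis unfolding 1(1) r1_def by (simp add: pf_vec_def zz_def)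
  qed (use U1 in \<open>auto simp: r2_def r3_def r4_def r5_def pf_vec_def z_def zz_def\<close>)
 next
  fix \<rho> assume "\<rho> \<in> rows"
  then consider i j k where "\<rho> = r1 (i, j, k)" "(i, j, k) \<in> I1" | i where "\<rho> = r2 i" "i < n" | j where "\<rho> = r3 j" "j < n"
   | i j where "\<rho> = r4 (i, j)" "(i, j) \<in> I4" | j where "\<rho> = r5 j" "j < n"
   unfolding rows_def by (elim UnE imageE) auto
  then show "(\<Sum>a<N. of_int (fst \<rho> a) * pf_vec n p f a) = of_int (snd \<rho>)"
  proof cases
   case 1
   then have "j < n" "k < n" "(i, j) \<in> E" "(i, k) \<in> E" using I1 by (auto simp: I1_def)
   then show ?thesis unfolding 1(1) d1[OF 1(2)] using ratio by (simp add: r1_def)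
  next
   case 2 then show ?thesis unfolding 2(1) d2[OF 2(2)] using spent by (simp add: r2_def)
  next
   case 3 then show ?thesis unfolding 3(1) d3[OF 3(2)] using sold by (simp add: r3_def)
  next
   case 4
   then have "i < n" "j < n" "f i j = 0" using f0[of i j] by (auto simp: I4_def)
   then show ?thesis unfolding 4(1) d4[OF 4(2)] by (simp add: r4_def)
  next
   case 5
   have "(\<Sum>k\<in>component n E j. pf_vec n p f k) = (\<Sum>k\<in>component n E j. p k)" by (intro sum.cong) auto
   then show ?thesis unfolding 5(1) d5 using norm[OF 5(2)] by (simp add: r5_def)
  qed
 next
  fix y :: "nat => real" and a
  assume y: "\<And>\<rho>. \<rho> \<in> rows ==> (\<Sum>a<N. of_int (fst \<rho> a) * y a) = 0" and a: "a < N"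
  define g where "g i j = y (n + (i * n + j))" for i j
  have y1: "real (u i j) * y k = real (u i k) * y j" if "(i, j) \<in> E" "(i, k) \<in> E" for i j k
  proof -
   have "(i, j, k) \<in> I1" using that by (simp add: I1_def)
   then show ?thesis using y[of "r1 (i, j, k)"] d1[of i j k y] by (simp add: rows_def)
  qed
  have y2: "(\<Sum>j<n. g i j) = y i" if "i < n" for i using y[of "r2 i"] d2[OF that, of y] that by (simp add: rows_def g_def)
  have y3: "(\<Sum>i<n. g i j) = y j" if "j < n" for j using y[of "r3 j"] d3[OF that, of y] that by (simp add: rows_def g_def)
  have y4: "g i j = 0" if "i < n" "j < n" "\<not> 0 < f i j" for i j
  proof -
   have "(i, j) \<in> I4" using that by (simp add: I4_def)
   then show ?thesis using y[of "r4 (i, j)"] d4[of i j y] by (simp add: rows_def g_def)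
  qed
  have y5: "(\<Sum>k\<in>component n E j. y k) = 0" if "j < n" for j
  proof -
   have "(\<Sum>a<N. of_int (fst (r5 j) a) * y a) = 0" by (rule y) (use that in \<open>simp add: rows_def\<close>)
   then show ?thesis unfolding d5 .
  qed
  define t where "t j = y j / p j" for j
  have yt: "y j = t j * p j" if "j < n" for j using pos[OF that] by (simp add: t_def)
  have tE: "t j = t k" if "(i, j) \<in> E" "(i, k) \<in> E" for i j k
  proof -
   have jk: "j < n" "k < n" using that E(1) by auto
   have uj: "0 < real (u i j)" using uE[OF that(1)] by simp
   have "real (u i j) * y k * p j = real (u i k) * p j * y j" using y1[OF that] by simp
   also have "\<dots> = real (u i j) * (y j * p k)" using ratio[OF that] by simp
   finally have "y k * p j = y j * p k" using uj by simp
   then show ?thesis using pos[OF jk(1)] pos[OF jk(2)] by (simp add: t_def field_simps)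
  qed
  \<comment> \<open>Every agent buys something, so the chosen good exists, and by \<open>tE\<close>
    any other edge of E at i gives the same value.\<close>
  define T where "T i = t (SOME j. j < n \<and> 0 < f i j)" for i
  have TE: "t j = T i" if "(i, j) \<in> E" for i j
  proof -
   have i: "i < n" using that E(1) by auto
   have "(SOME j. j < n \<and> 0 < f i j) < n \<and> 0 < f i (SOME j. j < n \<and> 0 < f i j)"
    using sgood[OF i] by (intro someI_ex[of "\<lambda>j. j < n \<and> 0 < f i j"]) simp
   then have "(i, SOME j. j < n \<and> 0 < f i j) \<in> E" using E(2) i by blast
   then show ?thesis unfolding T_def using tE that by blast
  qed
  have fT: "f i j * h (T i) = f i j * h (t j)" if "i < n" "j < n" for i j and h :: "real => real"
  proof (cases "0 < f i j")
   case True then show ?thesis using TE[OF E(2)[OF that True]] by simp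
  next
   case False then show ?thesis using f0[OF that] by simp
  qed
  have gT: "g i j * T i = g i j * t j" if "i < n" "j < n" for i j
  proof (cases "0 < f i j")
   case True then show ?thesis using TE[OF E(2)[OF that True]] by simp
  next
   case False then show ?thesis using y4[OF that] by simp
  qed
  define Q where "Q = (\<Sum>i<n. p i * (t i)\<^sup>2)"
  have "(\<Sum>i<n. p i * (T i)\<^sup>2) = (\<Sum>i<n. \<Sum>j<n. f i j * (T i)\<^sup>2)"
   by (rule sum.cong[OF refl]) (simp add: spent flip: sum_distrib_right)
  also have "\<dots> = (\<Sum>i<n. \<Sum>j<n. f i j * (t j)\<^sup>2)"
   by (rule sum.cong[OF refl], rule sum.cong[OF refl], rule fT[where h = "\<lambda>x. x\<^sup>2"]) auto
  also have "\<dots> = (\<Sum>j<n. \<Sum>i<n. f i j * (t j)\<^sup>2)" by (rule sum.swap)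
  also have "\<dots> = Q" unfolding Q_def by (rule sum.cong[OF refl]) (simp add: sold flip: sum_distrib_right)
  finally have Q1: "(\<Sum>i<n. p i * (T i)\<^sup>2) = Q" .
  have "p i * t i * T i = (\<Sum>j<n. g i j * T i)" if "i < n" for i
   unfolding sum_distrib_right[symmetric] y2[OF that] by (simp only: yt[OF that] ac_simps)
  then have "(\<Sum>i<n. p i * t i * T i) = (\<Sum>i<n. \<Sum>j<n. g i j * T i)" by simp
  also have "\<dots> = (\<Sum>i<n. \<Sum>j<n. g i j * t j)"
   by (rule sum.cong[OF refl], rule sum.cong[OF refl], rule gT) auto
  also have "\<dots> = (\<Sum>j<n. \<Sum>i<n. g i j * t j)" by (rule sum.swap)
  also have "\<dots> = Q"
  proof -
   have "(\<Sum>i<n. g i j * t j) = p j * (t j)\<^sup>2" if "j < n" for j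
    unfolding sum_distrib_right[symmetric] y3[OF that] by (simp only: yt[OF that] power2_eq_square ac_simps)
   then show ?thesis by (simp add: Q_def)
  qed
  finally have Q2: "(\<Sum>i<n. p i * t i * T i) = Q" .
  have "(\<Sum>i<n. p i * (t i - T i)\<^sup>2) = Q - 2 * (\<Sum>i<n. p i * t i * T i) + (\<Sum>i<n. p i * (T i)\<^sup>2)"
   unfolding Q_def sum_distrib_left sum_subtractf[symmetric] sum.distrib[symmetric]
   by (rule sum.cong[OF refl]) (simp add: power2_eq_square algebra_simps)
  then have "(\<Sum>i<n. p i * (t i - T i)\<^sup>2) = 0" using Q1 Q2 by simp
  then have "\<forall>i\<in>{..<n}. p i * (t i - T i)\<^sup>2 = 0"
  proof (subst (asm) sum_nonneg_eq_0_iff)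
   fix i assume "i \<in> {..<n}"
   then show "0 \<le> p i * (t i - T i)\<^sup>2" using less_imp_le[OF pos[of i]] by (intro mult_nonneg_nonneg) auto
  qed auto
  then have tT: "t i = T i" if "i < n" for i using pos[OF that] that by force
  have edge: "t i = t j" if "(i, j) \<in> E \<union> E\<inverse>" for i j
   using that TE tT E(1) by auto
  have comp: "t i = t j" if "(i, j) \<in> (E \<union> E\<inverse>)\<^sup>*" for i j
   using that by (induction rule: rtrancl_induct) (auto simp: edge)
  \<comment> \<open>t is constant on a component whose prices sum to 1, so the homogeneous
    normalisation equation makes it 0. With all price unknowns zero, the forest property makes the
    flow unknowns zero too.\<close>
  have t0: "t j = 0" if "j < n" for j
  proof -
   have "(\<Sum>k\<in>component n E j. y k) = (\<Sum>k\<in>component n E j. t j * p k)"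
   proof (rule sum.cong[OF refl])
    fix k assume "k \<in> component n E j"
    then have "k < n" "t j = t k" using comp[of j k] by auto
    then show "y k = t j * p k" using yt by simp
   qed
   then have "0 = (\<Sum>k\<in>component n E j. t j * p k)" using y5[OF that] by simp
   also have "\<dots> = t j" by (simp add: norm[OF that] flip: sum_distrib_left)
   finally show ?thesis by simp
  qed
  then have y0: "y j = 0" if "j < n" for j using yt that by simp
  have "\<forall>i<n. \<forall>j<n. g i j = 0"
   using forest unfolding support_forest_def using y2 y3 y4 y0 by auto
  moreover have "y a = g ((a - n) div n) ((a - n) mod n)" if "\<not> a < n" using that by (simp add: g_def)
  moreover have "(a - n) div n < n \<and> (a - n) mod n < n" if "\<not> a < n"
  proof -
   have "a - n < n * n" using a that by (simp add: N_def)
   moreover from this have "0 < n" by (cases n) auto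
   ultimately show ?thesis by (simp add: less_mult_imp_div_less)
  qed
  ultimately show "y a = 0" using y0 by (cases "a < n") auto
 qed
 then obtain \<Delta> :: int where D: "0 < \<Delta>" "\<Delta> \<le> fact N * (int (card rows) * (int U)\<^sup>2) ^ N"
  "\<And>a. a < N ==> \<exists>k::int. of_int \<Delta> * pf_vec n p f a = of_int k" by blast
 have "\<Delta> \<le> fact N * (int (n ^ 3 + n ^ 2 + 3 * n) * (int U)\<^sup>2) ^ N"
 proof (rule order_trans[OF D(2)], intro mult_left_mono power_mono mult_right_mono)
  show "int (card rows) \<le> int (n ^ 3 + n ^ 2 + 3 * n)" using crd by (simp only: of_nat_le_iff)
 qed auto
 moreover have "\<exists>k::int. of_int \<Delta> * p j = of_int k" if "j < n" for j
  using D(3)[of j] that by (simp add: N_def)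
 moreover have "\<exists>k::int. of_int \<Delta> * f i j = of_int k" if "i < n" "j < n" for i j
 proof -
  have "i * n + j < Suc i * n" using that by simp
  also have "\<dots> \<le> n * n" using that by (intro mult_right_mono) auto
  finally show ?thesis using D(3)[of "n + (i * n + j)"] that by (simp add: N_def)
 qed
 ultimately show ?thesis using D(1) unfolding N_def by blast
qed

section \<open>From nearly optimal prices to an exact equilibrium\<close>

lemma power_one_plus_le:
 fixes x :: real
 assumes "0 \<le> x" "real m * x \<le> 1" shows "(1 + x) ^ m \<le> 1 + 2 * (real m * x)"
proof -
 have "(1 + x) ^ m \<le> exp x ^ m" using assms by (intro power_mono) (auto simp: exp_ge_add_one_self)
 also have "\<dots> = exp (real m * x)" by (simp add: exp_of_nat_mult)
 also have "\<dots> \<le> 1 + real m * x + (real m * x)\<^sup>2" using assms by (intro exp_bound) auto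
 also have "(real m * x)\<^sup>2 \<le> real m * x" using assms by (simp add: power2_eq_square mult_left_le)
 finally show ?thesis by linarith
qed

text \<open>Reachability in a finite relation needs no more steps than the relation has pairs, here
  at most n^2, and each step costs one factor e.\<close>

lemma multiplicative_path_bound:
 fixes \<rho> :: "nat => real"
 assumes R: "R \<subseteq> {..<n} \<times> {..<n}" and e: "1 \<le> e" and step: "\<And>a b. (a, b) \<in> R ==> \<rho> b \<le> e * \<rho> a"
  and pos: "\<And>i. i < n ==> 0 < \<rho> i" and j: "(j, k) \<in> R\<^sup>*" "j < n"
 shows "\<rho> k \<le> e ^ (n * n) * \<rho> j"
proof -
 have fin: "finite R" using R by (rule finite_subset) auto
 have "card R \<le> n * n" using card_mono[OF _ R] by (simp add: card_cartesian_product)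
 moreover obtain m where "m \<le> card R" "(j, k) \<in> R ^^ m"
  using j(1) unfolding rtrancl_finite_eq_relpow[OF fin] by blast
 ultimately have m: "m \<le> n * n" "(j, k) \<in> R ^^ m" by auto
 have "(j, k) \<in> R ^^ m ==> \<rho> k \<le> e ^ m * \<rho> j" for m
 proof (induction m arbitrary: k)
  case (Suc m)
  then obtain l where l: "(j, l) \<in> R ^^ m" "(l, k) \<in> R" by auto
  have "\<rho> k \<le> e * \<rho> l" by (rule step[OF l(2)])
  also have "\<dots> \<le> e * (e ^ m * \<rho> j)" using Suc.IH[OF l(1)] e by (intro mult_left_mono) auto
  finally show ?case by simp
 qed simp
 then have "\<rho> k \<le> e ^ m * \<rho> j" using m by blast
 also have "\<dots> \<le> e ^ (n * n) * \<rho> j"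
  using e m(1) pos[OF j(2)] by (intro mult_right_mono power_increasing) auto
 finally show ?thesis .
qed

definition tight_edges :: "nat => (nat => nat => nat) => (nat \<times> nat) set => (nat => nat => real) => (nat => real) => (nat \<times> nat) set" where
 "tight_edges n u G f p = {(i, j) \<in> G. \<exists>k<n. 0 < f i k \<and> real (u i j) * p k = real (u i k) * p j}"

text \<open>Prices may be rescaled on each class of goods connected by money flow.  A rescaling with
  as many connected pairs as possible makes the tight edges connect everything that \<open>G\<close> connects:
  otherwise a class could be rescaled until another edge becomes tight.\<close>

lemma connecting_rescaling:
 assumes G: "G \<subseteq> {..<n} \<times> {..<n}" and fG: "\<And>i j. i < n ==> j < n ==> 0 < f i j ==> (i, j) \<in> G"
  and q: "meq n u q f" and uG: "\<And>i j. (i, j) \<in> G ==> 0 < u i j"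
 shows "\<exists>s. (\<forall>i<n. (0::real) < s i) \<and> (\<forall>i<n. \<forall>j<n. 0 < f i j --> s i = s j) \<and>
  (let T = tight_edges n u G f (\<lambda>j. q j * s j) in G \<subseteq> (T \<union> T\<inverse>)\<^sup>*)"
proof -
 define good :: "(nat => real) => bool" where "good s \<longleftrightarrow> (\<forall>i<n. 0 < s i) \<and> (\<forall>i<n. \<forall>j<n. 0 < f i j --> s i = s j)" for s
 define T where "T s = tight_edges n u G f (\<lambda>j. q j * s j)" for s
 define C where "C s = (T s \<union> (T s)\<inverse>)\<^sup>*" for s
 define P where "P s = C s \<inter> {..<n} \<times> {..<n}" for s
 have fin: "finite ({..<n} \<times> {..<n})" by simp
 have "good (\<lambda>_. 1)" by (simp add: good_def)
 moreover have "\<forall>s. good s --> card (P s) < Suc (card ({..<n} \<times> {..<n}))"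
  using card_mono[OF fin, of "P _"] by (auto simp: P_def less_Suc_eq_le)
 ultimately obtain s where s: "good s" "\<And>s'. good s' ==> card (P s') \<le> card (P s)"
  using ex_has_greatest_nat[of good "\<lambda>_. 1" "\<lambda>s. card (P s)"] by (metis (no_types, lifting) less_imp_le)
 have spos: "\<And>i. i < n ==> 0 < s i" and sf: "\<And>i j. i < n ==> j < n ==> 0 < f i j ==> s i = s j"
  using s(1) by (auto simp: good_def)
 have symC: "(b, a) \<in> C s'" if "(a, b) \<in> C s'" for a b s'
 proof -
  have "sym (T s' \<union> (T s')\<inverse>)" by (auto simp: sym_def)
  then show ?thesis using that unfolding C_def by (meson sym_rtrancl symD)
 qed
 have transC: "(a, c) \<in> C s'" if "(a, b) \<in> C s'" "(b, c) \<in> C s'" for a b c s'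
  using that unfolding C_def by (rule rtrancl_trans)
 have fT: "(i, k) \<in> T s'" if "i < n" "k < n" "0 < f i k" for i k s'
  using that fG unfolding T_def tight_edges_def by auto
 have TC: "(i, k) \<in> C s'" if "(i, k) \<in> T s'" for i k s' using that by (auto simp: C_def)
 have "G \<subseteq> C s"
 proof (rule subrelI, rule ccontr)
  fix i j assume ij: "(i, j) \<in> G" and nC: "(i, j) \<notin> C s"
  have lt: "i < n" "j < n" using G ij by auto
  obtain k where k: "k < n" "0 < f i k"
  proof -
   have "\<exists>k<n. 0 < f i k"
   proof (rule ccontr)
    assume "\<not> (\<exists>k<n. 0 < f i k)"
    then have "\<And>k. k < n ==> f i k \<le> 0" by (meson not_less)
    then have "(\<Sum>k<n. f i k) \<le> 0" by (intro sum_nonpos) simp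
    then show False using meq_spent[OF q lt(1)] meq_pos[OF q lt(1)] by simp
   qed
   then show thesis using that by blast
  qed
  have ik: "(i, k) \<in> C s" by (rule TC[OF fT[OF lt(1) k]])
  have up: "0 < real (u i j)" "0 < real (u i k)" using uG[OF ij] uG[OF fG[OF lt(1) k]] by auto
  \<comment> \<open>The factor that turns (i, j) into a tie with the good k bought by i. Only the
    class of j is rescaled, and k lies in another class; pairs already tied lie in one class and
    remain tied.\<close>
  define c where "c = real (u i j) * (q k * s k) / (real (u i k) * (q j * s j))"
  have cpos: "0 < c" unfolding c_def using up meq_pos[OF q] spos lt k by (intro divide_pos_pos mult_pos_pos) auto
  define s' where "s' l = (if (j, l) \<in> C s then s l * c else s l)" for l
  have good': "good s'"
   unfolding good_def
  proof (intro conjI allI impI)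
   fix l assume "l < n" then show "0 < s' l" using spos cpos by (simp add: s'_def)
  next
   fix a b assume ab: "a < n" "b < n" "0 < f a b"
   have "(a, b) \<in> C s" by (rule TC[OF fT[OF ab]])
   then have "(j, a) \<in> C s \<longleftrightarrow> (j, b) \<in> C s" using symC transC by blast
   then show "s' a = s' b" using sf[OF ab] by (simp add: s'_def)
  qed
  have TT: "T s \<subseteq> T s'"
  proof (rule subrelI)
   fix a b assume ab: "(a, b) \<in> T s"
   then obtain l where l: "(a, b) \<in> G" "l < n" "0 < f a l" "real (u a b) * (q l * s l) = real (u a l) * (q b * s b)"
    by (auto simp: T_def tight_edges_def)
   have a: "a < n" using l(1) G by auto
   have "(l, b) \<in> C s" using symC[OF TC[OF fT[OF a l(2,3)]]] TC[OF ab] transC by blast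
   then have "(j, l) \<in> C s \<longleftrightarrow> (j, b) \<in> C s" using symC transC by blast
   then have "real (u a b) * (q l * s' l) = real (u a l) * (q b * s' b)" using l(4) by (auto simp: s'_def)
   then show "(a, b) \<in> T s'" using l by (auto simp: T_def tight_edges_def)
  qed
  then have CC: "C s \<subseteq> C s'" unfolding C_def by (intro rtrancl_mono) auto
  have "(j, k) \<notin> C s" using nC ik symC transC by blast
  then have sk: "s' k = s k" by (simp add: s'_def)
  have sj: "s' j = s j * c" by (simp add: s'_def C_def)
  have "real (u i j) * (q k * s' k) = real (u i k) * (q j * s' j)"
   unfolding sk sj c_def using up meq_pos[OF q lt(2)] spos[OF lt(2)] by simp
  then have "(i, j) \<in> T s'" using ij k by (auto simp: T_def tight_edges_def)
  then have "(i, j) \<in> P s'" using TC lt by (auto simp: P_def)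
  moreover have "(i, j) \<notin> P s" using nC by (simp add: P_def)
  moreover have "P s \<subseteq> P s'" using CC by (auto simp: P_def)
  ultimately have "P s \<subset> P s'" by blast
  moreover have "finite (P s')" by (rule finite_subset[OF _ fin]) (auto simp: P_def)
  ultimately have "card (P s) < card (P s')" by (intro psubset_card_mono)
  then show False using s(2)[OF good'] by simp
 qed
 then show ?thesis using spos sf unfolding C_def T_def Let_def by blast
qed

text \<open>A relative error below 1/M between integers of size at most M is an absolute error below
  1.\<close>

lemma of_int_eq_if_close:
 fixes a b :: int and r M :: real
 assumes "real_of_int a \<le> r * b" "real_of_int b \<le> r * a" "real_of_int a \<le> M" "real_of_int b \<le> M" "1 \<le> r" "(r - 1) * M < 1"
 shows "a = b"
proof -
 have "real_of_int a - b \<le> (r - 1) * b" using assms(1) by (simp add: left_diff_distrib)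
 also have "\<dots> \<le> (r - 1) * M" using assms by (intro mult_left_mono) auto
 finally have 1: "real_of_int a - b < 1" using assms(6) by simp
 have "real_of_int b - a \<le> (r - 1) * a" using assms(2) by (simp add: left_diff_distrib)
 also have "\<dots> \<le> (r - 1) * M" using assms by (intro mult_left_mono) auto
 finally have 2: "real_of_int b - a < 1" using assms(6) by simp
 show ?thesis using 1 2 by linarith
qed

text \<open>The bound of \<open>rational_flow\<close> on the common denominator. It bounds the
  numerators as well, since prices normalised per component are at most 1.\<close>

definition rational_bound :: "nat => nat => int" where
 "rational_bound n U = fact (n + n * n) * (int (n ^ 3 + n ^ 2 + 3 * n) * (int U)\<^sup>2) ^ (n + n * n)"

text \<open>The flows of q run inside G, so q can be rescaled by classes until ties connect all of
  G. Normalised per component, its prices are then integers over a common denominator and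
  proportional to p up to small powers of \<open>1 + \<epsilon>\<close>. For each edge of G this
  forces two bounded integers to be equal, so all of G becomes tied; outside G the gap outweighs
  every change. Finally each component is scaled so that its representative \<open>lab j\<close>
  keeps the price it has in p.\<close>

theorem equilibrium_near_good_prices:
 fixes p :: "nat => real"
 assumes m: "linear_market n U u" and q: "meq n u q f" and forest: "support_forest n f"
  and p: "\<And>i. i < n ==> 0 < p i" and b: "best_goods n u p b"
  and \<delta>: "(\<Sum>j<n. q j * demand_excess n p b j) \<le> \<kappa>\<^sup>2 * \<phi>" and \<phi>: "\<And>i j. i < n ==> j < n ==> 0 < f i j ==> \<phi> \<le> f i j" "0 < \<phi>"
  and \<kappa>: "0 \<le> \<kappa>" "4 * \<kappa> \<le> \<epsilon>" and \<epsilon>: "0 < \<epsilon>" "8 * real n ^ 2 * \<epsilon> * (real U * of_int (rational_bound n U)) < 1"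
  and G: "G = {(i, j). i < n \<and> j < n \<and> u i (b i) * p j \<le> (1 + \<epsilon>) * (u i j * p (b i))}"
  and gap: "\<And>i j. i < n ==> j < n ==> (i, j) \<notin> G ==> (1 + 10 * real n ^ 2 * \<epsilon>) * (u i j * p (b i)) < u i (b i) * p j"
  and lab: "\<And>i j. (i, j) \<in> G ==> lab i = lab j" "\<And>j. j < n ==> (j, lab j) \<in> (G \<union> G\<inverse>)\<^sup>*"
 shows "\<exists>p' f' N. meq n u p' f' \<and> (\<forall>j<n. (0::int) < N j \<and> N j \<le> rational_bound n U \<and> lab j < n \<and>
  p' j = p (lab j) * N j / N (lab j) \<and> \<bar>p j / p (lab j) - N j / N (lab j)\<bar> \<le> 8 * real n ^ 2 * \<epsilon> * (p j / p (lab j)))"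
proof -
 have n: "0 < n" by (rule market_nonempty[OF m])
 have n1: "1 \<le> real n ^ 2" using n by (intro one_le_power) auto
 have U1: "1 \<le> U"
 proof -
  obtain j where "j < n" "0 < u 0 j" using market_likes[OF m n] by blast
  then show ?thesis using market_bound[OF m n, of j] by simp
 qed
 have B1: "1 \<le> rational_bound n U"
 proof -
  have "0 < n ^ 3 + n ^ 2 + 3 * n" using n by simp
  then have "0 < int (n ^ 3 + n ^ 2 + 3 * n)" by (simp only: of_nat_0_less_iff)
  then have "0 < rational_bound n U" unfolding rational_bound_def using U1
   by (intro mult_pos_pos fact_gt_zero zero_less_power) auto
  then show ?thesis by simp
 qed
 have UB1: "1 \<le> real U * of_int (rational_bound n U)"
 proof -
  have "1 * 1 \<le> real U * of_int (rational_bound n U)" using U1 B1 by (intro mult_mono) auto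
  then show ?thesis by simp
 qed
 have "8 * real n ^ 2 * \<epsilon> * 1 \<le> 8 * real n ^ 2 * \<epsilon> * (real U * of_int (rational_bound n U))"
  using UB1 \<epsilon>(1) by (intro mult_left_mono) auto
 then have e8: "8 * real n ^ 2 * \<epsilon> < 1" using \<epsilon>(2) by simp
 have nn: "\<epsilon> \<le> real n ^ 2 * \<epsilon>" using n1 \<epsilon>(1) by simp
 have e1: "\<epsilon> \<le> 1 / 8" using nn e8 by simp
 have k4: "\<kappa> \<le> 1 / 32" using \<kappa> e1 by simp
 have kk: "\<kappa>\<^sup>2 \<le> \<kappa> / 32" using mult_left_mono[OF k4 \<kappa>(1)] by (simp add: power2_eq_square)
 define r where "r j = q j / p j" for j
 note qpos = meq_pos[OF q]
 have bg: "0 < u i (b i)" if "i < n" for i by (rule best_goods_pos[OF m p b that])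
 have bn: "b i < n" if "i < n" for i using b that by (simp add: best_goods_def)
 have bb: "u i l * p (b i) \<le> u i (b i) * p l" if "i < n" "l < n" for i l using b that by (simp add: best_goods_def)
 have rpos: "0 < r i" if "i < n" for i using p[OF that] qpos[OF that] by (simp add: r_def)
 have qr: "q i = r i * p i" if "i < n" for i using p[OF that] by (simp add: r_def)
 \<comment> \<open>Positive flows are at least \<open>\<phi>\<close>, so at most
   \<open>\<kappa>\<^sup>2\<close> remains for the bracket in
   \<open>equilibrium_value_of_excess\<close>. Its square keeps r j / r i near 1, its second term
   keeps \<open>r (b i)\<close> near \<open>r j\<close>.\<close>
 have fr: "r j \<le> (1 + \<epsilon>) * r i \<and> r i \<le> (1 + \<epsilon>) * r j \<and> r (b i) \<le> (1 + \<epsilon>) * r j"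
  if ij: "i < n" "j < n" and f: "0 < f i j" for i j
 proof -
  define t where "t = r j / r i"
  define w where "w = (r (b i) - r j) / r i"
  have t0: "0 < t" using rpos ij by (simp add: t_def)
  have "r j \<le> r (b i)" unfolding r_def by (rule equilibrium_value_of_excess(2)[OF m q p b ij f])
  then have w0: "0 \<le> w" unfolding w_def using rpos[OF ij(1)] by (intro divide_nonneg_nonneg) auto
  have "f i j * ((sqrt t - 1)\<^sup>2 + w) \<le> (\<Sum>j<n. q j * demand_excess n p b j)"
   unfolding t_def w_def r_def by (rule equilibrium_value_of_excess(1)[OF m q p b ij])
  also have "\<dots> \<le> \<kappa>\<^sup>2 * \<phi>" by (rule \<delta>)
  also have "\<dots> \<le> \<kappa>\<^sup>2 * f i j" using \<phi>(1)[OF ij f] by (intro mult_left_mono) auto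
  finally have "f i j * ((sqrt t - 1)\<^sup>2 + w) \<le> f i j * \<kappa>\<^sup>2" by (simp only: mult.commute)
  then have tw: "(sqrt t - 1)\<^sup>2 + w \<le> \<kappa>\<^sup>2" using f by (simp only: mult_le_cancel_left_pos)
  have "(sqrt t - 1)\<^sup>2 \<le> \<kappa>\<^sup>2" using tw w0 by linarith
  then have st: "\<bar>sqrt t - 1\<bar> \<le> \<kappa>" using \<kappa>(1) by (metis abs_le_square_iff abs_of_nonneg)
  have t: "t = (sqrt t)\<^sup>2" using t0 by simp
  have "(sqrt t)\<^sup>2 \<le> (1 + \<kappa>)\<^sup>2" using st t0 by (intro power_mono) auto
  then have tu: "t \<le> 1 + \<epsilon>" using t kk \<kappa> by (simp add: power2_eq_square algebra_simps)
  have "(1 - \<kappa>)\<^sup>2 \<le> (sqrt t)\<^sup>2" using st k4 by (intro power_mono) auto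
  moreover have "(1 - \<kappa>)\<^sup>2 = 1 - 2 * \<kappa> + \<kappa>\<^sup>2" by (simp add: power2_diff)
  ultimately have tl: "1 - 2 * \<kappa> \<le> t" using t zero_le_power2[of \<kappa>] by linarith
  have "1 \<le> (1 + 4 * \<kappa>) * (1 - 2 * \<kappa>)" using kk \<kappa>(1) by (simp add: power2_eq_square algebra_simps)
  also have "\<dots> \<le> (1 + \<epsilon>) * t" using tl \<kappa> k4 by (intro mult_mono) auto
  finally have tl': "1 \<le> (1 + \<epsilon>) * t" .
  have rj: "r j = t * r i" using rpos[OF ij(1)] by (simp add: t_def)
  have A: "r j \<le> (1 + \<epsilon>) * r i" unfolding rj using tu rpos[OF ij(1)] by (intro mult_right_mono) auto
  have B: "r i \<le> (1 + \<epsilon>) * r j" unfolding rj using mult_right_mono[OF tl', of "r i"] rpos[OF ij(1)] by simp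
  have "w \<le> \<kappa>\<^sup>2" using tw zero_le_power2[of "sqrt t - 1"] by linarith
  then have "r (b i) - r j \<le> \<kappa>\<^sup>2 * r i" unfolding w_def using rpos[OF ij(1)] by (simp add: divide_le_eq)
  also have "\<dots> \<le> \<kappa>\<^sup>2 * ((1 + \<epsilon>) * r j)" using B by (intro mult_left_mono) auto
  also have "\<dots> \<le> \<epsilon> * r j"
  proof -
   have "\<kappa>\<^sup>2 * (1 + \<epsilon>) \<le> \<kappa> / 32 * 2" using kk e1 \<epsilon>(1) \<kappa>(1) by (intro mult_mono) auto
   also have "\<dots> \<le> \<epsilon>" using \<kappa> by simp
   finally show ?thesis using rpos[OF ij(2)] by (simp only: mult.assoc[symmetric]) (intro mult_right_mono, auto)
  qed
  finally have "r (b i) \<le> (1 + \<epsilon>) * r j" by (simp add: distrib_right)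
  then show ?thesis using A B by blast
 qed
 have Gsub: "G \<subseteq> {..<n} \<times> {..<n}" by (auto simp: G)
 have GD: "i < n \<and> j < n \<and> u i (b i) * p j \<le> (1 + \<epsilon>) * (u i j * p (b i))" if "(i, j) \<in> G" for i j
  using that by (simp add: G)
 \<comment> \<open>A good bought at q is best there, and by \<open>fr\<close> passing from q to p
   costs it at most the factor \<open>1 + \<epsilon>\<close> against \<open>b i\<close>.\<close>
 have fG: "(i, j) \<in> G" if ij: "i < n" "j < n" and f: "0 < f i j" for i j
 proof -
  have "u i (b i) * q j \<le> u i j * q (b i)" by (rule meq_best[OF q ij f bn[OF ij(1)]])
  also have "\<dots> = u i j * p (b i) * r (b i)" by (simp add: qr[OF bn[OF ij(1)]])
  also have "\<dots> \<le> u i j * p (b i) * ((1 + \<epsilon>) * r j)"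
   using fr[OF ij f] p[OF bn[OF ij(1)]] by (intro mult_left_mono) auto
  finally have "(u i (b i) * p j) * r j \<le> ((1 + \<epsilon>) * (u i j * p (b i))) * r j" by (simp add: qr[OF ij(2)] ac_simps)
  then have "u i (b i) * p j \<le> (1 + \<epsilon>) * (u i j * p (b i))" using rpos[OF ij(2)] by (simp only: mult_le_cancel_right_pos)
  then show ?thesis using ij by (simp add: G)
 qed
 have uG: "0 < u i j" if "(i, j) \<in> G" for i j
 proof -
  have "0 < real (u i (b i)) * p j" using bg p GD[OF that] by simp
  also have "\<dots> \<le> (1 + \<epsilon>) * (u i j * p (b i))" using GD[OF that] by simp
  finally show ?thesis by (cases "u i j = 0") auto
 qed
 obtain s where s: "\<And>i. i < n ==> 0 < s i" "\<And>i j. i < n ==> j < n ==> 0 < f i j ==> s i = s j"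
  and GT: "let T = tight_edges n u G f (\<lambda>j. q j * s j) in G \<subseteq> (T \<union> T\<inverse>)\<^sup>*"
  using connecting_rescaling[OF Gsub fG q uG] by blast
 define ps where "ps j = q j * s j" for j
 define T where "T = tight_edges n u G f ps"
 define R where "R = T \<union> T\<inverse>"
 have TG: "T \<subseteq> G" by (auto simp: T_def tight_edges_def)
 have GR: "G \<subseteq> R\<^sup>*" using GT by (simp add: Let_def R_def T_def ps_def[abs_def])
 have psp: "0 < ps j" if "j < n" for j using s(1)[OF that] qpos[OF that] by (simp add: ps_def)
 have symR: "(k, j) \<in> R\<^sup>*" if "(j, k) \<in> R\<^sup>*" for j k
 proof -
  have "sym R" by (auto simp: sym_def R_def)
  then show ?thesis using that by (meson sym_rtrancl symD)
 qed
 have compR: "(G \<union> G\<inverse>)\<^sup>* \<subseteq> R\<^sup>*"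
 proof -
  have "G \<union> G\<inverse> \<subseteq> R\<^sup>*" using GR symR by auto
  then have "(G \<union> G\<inverse>)\<^sup>* \<subseteq> (R\<^sup>*)\<^sup>*" by (rule rtrancl_mono)
  then show ?thesis by simp
 qed
 have Rsub: "R \<subseteq> {..<n} \<times> {..<n}" using TG Gsub by (auto simp: R_def)
 have Rn: "k < n" if "(j, k) \<in> R\<^sup>*" "j < n" for j k
  using that by (induction rule: rtrancl_induct) (use Rsub in auto)
 have labR: "lab j = lab k" if "(j, k) \<in> R\<^sup>*" for j k
  using that
 proof (induction rule: rtrancl_induct)
  case (step y z)
  then have "(y, z) \<in> G \<or> (z, y) \<in> G" using TG by (auto simp: R_def)
  then have "lab y = lab z" using lab(1)[of y z] lab(1)[of z y] by auto
  then show ?case using step by simp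
 qed simp
 have labc: "(j, lab j) \<in> R\<^sup>*" if "j < n" for j using lab(2)[OF that] compR by blast
 have labn: "lab j < n" if "j < n" for j by (rule Rn[OF labc[OF that] that])
 define k0 where "k0 i = (SOME k. k < n \<and> 0 < f i k)" for i
 have k0: "k0 i < n \<and> 0 < f i (k0 i)" if i: "i < n" for i
 proof -
  have "\<exists>k<n. 0 < f i k"
  proof (rule ccontr)
   assume "\<not> (\<exists>k<n. 0 < f i k)"
   then have "\<And>k. k < n ==> f i k \<le> 0" by (meson not_less)
   then have "(\<Sum>k<n. f i k) \<le> 0" by (intro sum_nonpos) simp
   then show False using meq_spent[OF q i] qpos[OF i] by simp
  qed
  then show ?thesis unfolding k0_def by (rule someI_ex)
 qed
 have fps: "u i j * ps k = u i k * ps j" if "i < n" "j < n" "k < n" "0 < f i j" "0 < f i k" for i j k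
 proof -
  have "u i j * q k \<le> u i k * q j" by (rule meq_best[OF q that(1,3,5,2)])
  moreover have "u i k * q j \<le> u i j * q k" by (rule meq_best[OF q that(1,2,4,3)])
  ultimately have "u i j * q k = u i k * q j" by simp
  then show ?thesis using s(2)[OF that(1,2,4)] s(2)[OF that(1,3,5)] by (simp add: ps_def)
 qed
 \<comment> \<open>Utility per unit of money of agent i at the prices \<open>ps\<close>; by
   construction all edges of T attain it.\<close>
 define \<beta> where "\<beta> i = u i (k0 i) / ps (k0 i)" for i
 have tb: "real (u i j) = \<beta> i * ps j" if ijT: "(i, j) \<in> T" for i j
 proof -
  have ij: "i < n" "j < n" using ijT TG Gsub by auto
  obtain k where k: "k < n" "0 < f i k" "real (u i j) * ps k = real (u i k) * ps j"
   using ijT unfolding T_def tight_edges_def by blast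
  have K: "k0 i < n" "0 < f i (k0 i)" using k0[OF ij(1)] by auto
  have "u i k * ps (k0 i) = u i (k0 i) * ps k" by (rule fps[OF ij(1) k(1) K(1) k(2) K(2)])
  then have uk: "real (u i k) = \<beta> i * ps k" unfolding \<beta>_def using psp[OF K(1)] by (simp add: field_simps)
  have "real (u i j) * ps k = \<beta> i * ps j * ps k" using k(3) uk by simp
  then show ?thesis using psp[OF k(1)] by simp
 qed
 have fT: "(i, j) \<in> T" if "i < n" "j < n" "0 < f i j" for i j
  unfolding T_def tight_edges_def using fG[OF that] that by blast
 have k0T: "(i, k0 i) \<in> T" if "i < n" for i using fT k0[OF that] that by blast
 define \<rho> where "\<rho> j = ps j / p j" for j
 have rs: "\<rho> j = r j * s j" if "j < n" for j by (simp add: \<rho>_def ps_def r_def)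
 have \<rho>pos: "0 < \<rho> j" if "j < n" for j using psp[OF that] p[OF that] by (simp add: \<rho>_def)
 have psr: "ps j = \<rho> j * p j" if "j < n" for j using p[OF that] by (simp add: \<rho>_def)
 define A where "A i = real (u i (b i)) / p (b i)" for i
 define a where "a i j = real (u i j) / p j" for i j
 have Apos: "0 < A i" if "i < n" for i using bg[OF that] p[OF bn[OF that]] by (simp add: A_def)
 have aA: "a i j \<le> A i" if "i < n" "j < n" for i j
  unfolding a_def A_def using bb[OF that] p[OF that(2)] p[OF bn[OF that(1)]] by (simp add: field_simps)
 have Aa: "A i \<le> (1 + \<epsilon>) * a i j" if "(i, j) \<in> G" for i j
 proof -
  have ij: "i < n" "j < n" using GD[OF that] by auto
  have "u i (b i) * p j \<le> (1 + \<epsilon>) * (u i j * p (b i))" using GD[OF that] by blast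
  then show ?thesis unfolding a_def A_def using p[OF ij(2)] p[OF bn[OF ij(1)]] by (simp add: field_simps)
 qed
 have cross: "x \<le> (1 + \<epsilon>) * y" if "i < n" "(i, k) \<in> G" "j < n" "a i j * y = a i k * x" "0 \<le> x" "0 \<le> y" for i j k x y
 proof -
  have "A i * x \<le> (1 + \<epsilon>) * a i k * x" using Aa[OF that(2)] that by (intro mult_right_mono) auto
  also have "\<dots> = (1 + \<epsilon>) * (a i j * y)" using that(4) by simp
  also have "\<dots> \<le> (1 + \<epsilon>) * (A i * y)" using aA[OF that(1,3)] that \<epsilon>(1) by (intro mult_left_mono mult_right_mono) auto
  finally have "A i * x \<le> A i * ((1 + \<epsilon>) * y)" by (simp only: ac_simps)
  then show ?thesis using Apos[OF that(1)] by (simp only: mult_le_cancel_left_pos)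
 qed
 \<comment> \<open>One factor \<open>1 + \<epsilon>\<close> compares j with a good k bought by i,
   the other compares k with i along the flow.\<close>
 define e where "e = (1 + \<epsilon>)\<^sup>2"
 have e_ge: "1 \<le> e" using \<epsilon>(1) by (simp add: e_def)
 have stepT: "\<rho> j \<le> e * \<rho> i \<and> \<rho> i \<le> e * \<rho> j" if "(i, j) \<in> T" for i j
 proof -
  have ijG: "(i, j) \<in> G" using that TG by auto
  have ij: "i < n" "j < n" using GD[OF ijG] by auto
  define k where "k = k0 i"
  have k: "k < n" "0 < f i k" using k0[OF ij(1)] by (auto simp: k_def)
  have kG: "(i, k) \<in> G" by (rule fG[OF ij(1) k])
  have ar: "a i l = \<beta> i * \<rho> l" if "(i, l) \<in> T" for l unfolding a_def tb[OF that] \<rho>_def by simp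
  have ak: "a i j * \<rho> k = a i k * \<rho> j" using ar[OF \<open>(i, j) \<in> T\<close>] ar[OF fT[OF ij(1) k]] by simp
  have 1: "\<rho> j \<le> (1 + \<epsilon>) * \<rho> k" by (rule cross[OF ij(1) kG ij(2) ak]) (use \<rho>pos ij k in \<open>auto intro: less_imp_le\<close>)
  have 2: "\<rho> k \<le> (1 + \<epsilon>) * \<rho> j" by (rule cross[OF ij(1) ijG k(1) ak[symmetric]]) (use \<rho>pos ij k in \<open>auto intro: less_imp_le\<close>)
  have sk: "s i = s k" by (rule s(2)[OF ij(1) k])
  have 3: "\<rho> k \<le> (1 + \<epsilon>) * \<rho> i" "\<rho> i \<le> (1 + \<epsilon>) * \<rho> k"
   using fr[OF ij(1) k] s(1)[OF k(1)] unfolding rs[OF k(1)] rs[OF ij(1)] sk by (simp_all add: mult_right_mono flip: mult.assoc)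
  have "\<rho> j \<le> (1 + \<epsilon>) * ((1 + \<epsilon>) * \<rho> i)" using 1 3(1) \<epsilon>(1) by (intro order_trans[OF 1] mult_left_mono) auto
  moreover have "\<rho> i \<le> (1 + \<epsilon>) * ((1 + \<epsilon>) * \<rho> j)" using 2 3(2) \<epsilon>(1) by (intro order_trans[OF 3(2)] mult_left_mono) auto
  ultimately show ?thesis by (simp add: e_def power2_eq_square mult.assoc)
 qed
 define E0 where "E0 = e ^ (n * n)"
 have path: "\<rho> k \<le> E0 * \<rho> j" if "(j, k) \<in> R\<^sup>*" "j < n" for j k
  unfolding E0_def by (rule multiplicative_path_bound[OF Rsub e_ge _ \<rho>pos that]) (use stepT in \<open>auto simp: R_def\<close>)
 have E0_ge: "1 \<le> E0" unfolding E0_def using e_ge by (rule one_le_power)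
 have E0e: "E0 = (1 + \<epsilon>) ^ (2 * n * n)" unfolding E0_def e_def by (simp add: power_mult[symmetric] mult.assoc)
 have pw: "(1 + \<epsilon>) ^ k \<le> 1 + 2 * (real k * \<epsilon>)" if "real k \<le> 6 * real n ^ 2" for k
 proof (rule power_one_plus_le)
  have "real k * \<epsilon> \<le> 6 * real n ^ 2 * \<epsilon>" using that \<epsilon>(1) by (intro mult_right_mono) auto
  also have "\<dots> \<le> 8 * real n ^ 2 * \<epsilon>" using \<epsilon>(1) by simp
  finally show "real k * \<epsilon> \<le> 1" using e8 by linarith
 qed (use \<epsilon>(1) in auto)
 have nsq: "real (2 * n * n) = 2 * real n ^ 2" "real (2 * n * n + 1) = 2 * real n ^ 2 + 1"
  "real (2 * n * n + (2 * n * n + 1)) = 4 * real n ^ 2 + 1" by (simp_all add: power2_eq_square)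
 have nsq1: "real (2 * n * n + 1) \<le> 6 * real n ^ 2" unfolding nsq using n1 by linarith
 have nsq2: "real (2 * n * n + (2 * n * n + 1)) \<le> 6 * real n ^ 2" unfolding nsq using n1 by linarith
 \<comment> \<open>The constants 8 and 10 of the hypotheses are made to absorb
   \<open>E0 - 1\<close>, \<open>(1 + \<epsilon>) * E0\<close> and
   \<open>E0 * (E0 * (1 + \<epsilon>))\<close>, with at most 4 n^2 + 1 factors
   \<open>1 + \<epsilon>\<close>.\<close>
 have E01: "E0 - 1 \<le> 8 * real n ^ 2 * \<epsilon>"
 proof -
  have "E0 \<le> 1 + 2 * (real (2 * n * n) * \<epsilon>)" unfolding E0e by (rule pw) (simp only: nsq, simp)
  also have "\<dots> \<le> 1 + 8 * real n ^ 2 * \<epsilon>" unfolding nsq using \<epsilon>(1) by simp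
  finally show ?thesis by simp
 qed
 have E02: "(1 + \<epsilon>) * E0 \<le> 1 + 8 * real n ^ 2 * \<epsilon>"
 proof -
  have "(1 + \<epsilon>) * E0 = (1 + \<epsilon>) ^ (2 * n * n + 1)" by (simp add: E0e)
  also have "\<dots> \<le> 1 + 2 * (real (2 * n * n + 1) * \<epsilon>)" by (rule pw[OF nsq1])
  also have "\<dots> = 1 + 4 * (real n ^ 2 * \<epsilon>) + 2 * \<epsilon>" unfolding nsq by (simp add: algebra_simps)
  also have "\<dots> \<le> 1 + 8 * real n ^ 2 * \<epsilon>" using nn \<epsilon>(1) by linarith
  finally show ?thesis .
 qed
 have E03: "E0 * (E0 * (1 + \<epsilon>)) \<le> 1 + 10 * real n ^ 2 * \<epsilon>"
 proof -
  have "E0 * (E0 * (1 + \<epsilon>)) = (1 + \<epsilon>) ^ (2 * n * n + (2 * n * n + 1))" unfolding power_add E0e by simp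
  also have "\<dots> \<le> 1 + 2 * (real (2 * n * n + (2 * n * n + 1)) * \<epsilon>)" by (rule pw[OF nsq2])
  also have "\<dots> = 1 + 8 * (real n ^ 2 * \<epsilon>) + 2 * \<epsilon>" unfolding nsq by (simp add: algebra_simps)
  also have "\<dots> \<le> 1 + 10 * real n ^ 2 * \<epsilon>" using nn \<epsilon>(1) by linarith
  finally show ?thesis .
 qed
 define \<sigma> where "\<sigma> j = (\<Sum>k\<in>component n T j. ps k)" for j
 have compeq: "component n T j = component n T k" if "(j, k) \<in> R\<^sup>*" for j k
  using that symR rtrancl_trans[of _ _ R] unfolding R_def by blast
 have \<sigma>eq: "\<sigma> j = \<sigma> k" if "(j, k) \<in> R\<^sup>*" for j k unfolding \<sigma>_def compeq[OF that] ..
 have fc: "finite (component n T j)" for j by simp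
 have \<sigma>pos: "0 < \<sigma> j" if "j < n" for j
  unfolding \<sigma>_def using psp that fc by (intro sum_pos) auto
 have TR: "(i, j) \<in> R\<^sup>*" if "(i, j) \<in> T" for i j using that by (auto simp: R_def)
 define p2 where "p2 j = ps j / \<sigma> j" for j
 define f2 where "f2 i j = f i j * s i / \<sigma> i" for i j
 have p2pos: "0 < p2 j" if "j < n" for j using psp[OF that] \<sigma>pos[OF that] by (simp add: p2_def)
 have f0: "0 \<le> f i j" if "i < n" "j < n" for i j by (rule meq_nonneg[OF q that])
 have f2pos: "0 < f2 i j \<longleftrightarrow> 0 < f i j" if "i < n" "j < n" for i j
  using s(1)[OF that(1)] \<sigma>pos[OF that(1)] by (simp add: f2_def zero_less_divide_iff zero_less_mult_iff)
 have f2c: "f2 i j = f i j * s j / \<sigma> j" if "i < n" "j < n" for i j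
 proof (cases "0 < f i j")
  case True
  then show ?thesis using s(2)[OF that True] \<sigma>eq[OF TR[OF fT[OF that True]]] by (simp add: f2_def)
 next
  case False
  then have "f i j = 0" using f0[OF that] by simp
  then show ?thesis by (simp add: f2_def)
 qed
 have f2n: "0 \<le> f2 i j" if "i < n" "j < n" for i j
  unfolding f2_def using f0[OF that] s(1)[OF that(1)] \<sigma>pos[OF that(1)] by simp
 have sold2: "(\<Sum>i<n. f2 i j) = p2 j" if j: "j < n" for j
 proof -
  have "(\<Sum>i<n. f2 i j) = (\<Sum>i<n. f i j * (s j / \<sigma> j))" by (rule sum.cong[OF refl]) (simp add: f2c j)
  also have "\<dots> = q j * (s j / \<sigma> j)" by (simp only: sum_distrib_right[symmetric] meq_sold[OF q j])
  finally show ?thesis by (simp add: p2_def ps_def)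
 qed
 have spent2: "(\<Sum>j<n. f2 i j) = p2 i" if i: "i < n" for i
 proof -
  have "(\<Sum>j<n. f2 i j) = (\<Sum>j<n. f i j * (s i / \<sigma> i))" by (simp add: f2_def)
  also have "\<dots> = q i * (s i / \<sigma> i)" by (simp only: sum_distrib_right[symmetric] meq_spent[OF q i])
  finally show ?thesis by (simp add: p2_def ps_def)
 qed
 have p2sum: "(\<Sum>k\<in>component n T j. p2 k) = 1" if j: "j < n" for j
 proof -
  have "(\<Sum>k\<in>component n T j. p2 k) = (\<Sum>k\<in>component n T j. ps k / \<sigma> j)"
  proof (rule sum.cong[OF refl])
   fix k assume "k \<in> component n T j"
   then have "(j, k) \<in> R\<^sup>*" by (simp add: R_def)
   then show "p2 k = ps k / \<sigma> j" using \<sigma>eq by (simp add: p2_def)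
  qed
  then show ?thesis using \<sigma>pos[OF j] by (simp add: \<sigma>_def sum_divide_distrib[symmetric])
 qed
 have ratio2: "real (u i j) * p2 k = real (u i k) * p2 j" if "(i, j) \<in> T" "(i, k) \<in> T" for i j k
 proof -
  have "(j, k) \<in> R\<^sup>*" using TR[OF that(1)] TR[OF that(2)] symR rtrancl_trans by metis
  then have "\<sigma> j = \<sigma> k" by (rule \<sigma>eq)
  then show ?thesis unfolding tb[OF that(1)] tb[OF that(2)] p2_def by simp
 qed
 have "support_forest n f2" using forest f2pos unfolding support_forest_def by simp
 then have "\<exists>\<Delta>::int. 0 < \<Delta> \<and> \<Delta> \<le> rational_bound n U \<and>
  (\<forall>j<n. \<exists>k::int. of_int \<Delta> * p2 j = of_int k) \<and> (\<forall>i<n. \<forall>j<n. \<exists>k::int. of_int \<Delta> * f2 i j = of_int k)"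
  unfolding rational_bound_def
  by (intro rational_flow[where u = u and E = T] p2pos f2n sold2 spent2 p2sum ratio2 market_bound[OF m] U1)
   (use TG Gsub uG fT f2pos in auto)
 then obtain \<Delta> :: int where \<Delta>: "0 < \<Delta>" "\<Delta> \<le> rational_bound n U" "\<forall>j<n. \<exists>k::int. of_int \<Delta> * p2 j = of_int k" by blast
 then obtain N :: "nat => int" where N: "\<And>j. j < n ==> of_int \<Delta> * p2 j = of_int (N j)" by metis
 have Np: "0 < N j" if "j < n" for j
 proof -
  have "0 < real_of_int (N j)" unfolding N[OF that, symmetric] using \<Delta>(1) p2pos[OF that] by simp
  then show ?thesis by simp
 qed
 have NB: "N j \<le> rational_bound n U" if "j < n" for j
 proof -
  have "p2 j \<le> (\<Sum>k\<in>component n T j. p2 k)" using that p2pos fc by (intro member_le_sum) (auto intro: less_imp_le)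
  then have "p2 j \<le> 1" using p2sum[OF that] by simp
  then have "real_of_int (N j) \<le> of_int \<Delta> * 1" unfolding N[OF that, symmetric] using \<Delta>(1) by (intro mult_left_mono) auto
  then show ?thesis using \<Delta>(2) by simp
 qed
 have p2r: "p2 j = \<rho> j * p j / \<sigma> j" if "j < n" for j by (simp add: p2_def psr[OF that])
 \<comment> \<open>The integers x and y below are at most U times \<open>rational_bound n U\<close>
   and agree up to the factor \<open>(1 + \<epsilon>) * E0\<close>; the smallness of
   \<open>\<epsilon>\<close> makes them equal, which is an exact tie.\<close>
 have tightG: "u i j * p2 (k0 i) = u i (k0 i) * p2 j" if ijG: "(i, j) \<in> G" for i j
 proof -
  have ij: "i < n" "j < n" using GD[OF ijG] by auto
  define k where "k = k0 i"
  have k: "k < n" "0 < f i k" using k0[OF ij(1)] by (auto simp: k_def)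
  have kG: "(i, k) \<in> G" by (rule fG[OF ij(1) k])
  have jk: "(j, k) \<in> R\<^sup>*"
  proof -
   have "(i, j) \<in> R\<^sup>*" "(i, k) \<in> R\<^sup>*" using ijG kG GR by auto
   then show ?thesis using symR rtrancl_trans by metis
  qed
  have sg: "\<sigma> j = \<sigma> k" by (rule \<sigma>eq[OF jk])
  define x where "x = int (u i j) * N k"
  define y where "y = int (u i k) * N j"
  have xy: "real_of_int x = of_int \<Delta> * (a i j * \<rho> k) * (p j * p k / \<sigma> k)" "real_of_int y = of_int \<Delta> * (a i k * \<rho> j) * (p j * p k / \<sigma> k)"
   unfolding x_def y_def using p[OF ij(2)] p[OF k(1)]
   by (simp_all add: N[OF k(1), symmetric] N[OF ij(2), symmetric] p2r[OF k(1)] p2r[OF ij(2)] sg a_def)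
  have c0: "0 \<le> p j * p k / \<sigma> k" using p[OF ij(2)] p[OF k(1)] \<sigma>pos[OF k(1)] by simp
  have le1: "a i j' * \<rho> k' \<le> ((1 + \<epsilon>) * E0) * (a i k' * \<rho> j')" if "(i, k') \<in> G" "j' < n" "(j', k') \<in> R\<^sup>*" for j' k'
  proof -
   have k': "k' < n" using GD[OF that(1)] by auto
   have a0: "0 \<le> a i j'" using p[OF that(2)] by (simp add: a_def)
   have "a i j' * \<rho> k' \<le> A i * (E0 * \<rho> j')"
    using aA[OF ij(1) that(2)] path[OF that(3,2)] \<rho>pos[OF k'] Apos[OF ij(1)] by (intro mult_mono) auto
   also have "\<dots> \<le> (1 + \<epsilon>) * a i k' * (E0 * \<rho> j')"
    using Aa[OF that(1)] E0_ge \<rho>pos[OF that(2)] by (intro mult_right_mono) auto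
   finally show ?thesis by (simp only: ac_simps)
  qed
  have le: "real_of_int x \<le> ((1 + \<epsilon>) * E0) * y" "real_of_int y \<le> ((1 + \<epsilon>) * E0) * x"
  proof -
   have "of_int \<Delta> * (a i j * \<rho> k) * (p j * p k / \<sigma> k) \<le> of_int \<Delta> * (((1 + \<epsilon>) * E0) * (a i k * \<rho> j)) * (p j * p k / \<sigma> k)"
    using le1[OF kG ij(2) jk] \<Delta>(1) c0 by (intro mult_right_mono mult_left_mono) auto
   then show "real_of_int x \<le> ((1 + \<epsilon>) * E0) * y" unfolding xy by (simp only: ac_simps)
   have "of_int \<Delta> * (a i k * \<rho> j) * (p j * p k / \<sigma> k) \<le> of_int \<Delta> * (((1 + \<epsilon>) * E0) * (a i j * \<rho> k)) * (p j * p k / \<sigma> k)"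
    using le1[OF ijG k(1) symR[OF jk]] \<Delta>(1) c0 by (intro mult_right_mono mult_left_mono) auto
   then show "real_of_int y \<le> ((1 + \<epsilon>) * E0) * x" unfolding xy by (simp only: ac_simps)
  qed
  have bd: "real_of_int x \<le> real U * of_int (rational_bound n U)" "real_of_int y \<le> real U * of_int (rational_bound n U)"
   unfolding x_def y_def using market_bound[OF m ij] market_bound[OF m ij(1) k(1)] NB[OF k(1)] NB[OF ij(2)] Np[OF k(1)] Np[OF ij(2)]
   by (simp_all, (intro mult_mono, auto)+)
  have "((1 + \<epsilon>) * E0 - 1) * (real U * of_int (rational_bound n U)) \<le> 8 * real n ^ 2 * \<epsilon> * (real U * of_int (rational_bound n U))"
   using E02 UB1 by (intro mult_right_mono) auto
  then have lt: "((1 + \<epsilon>) * E0 - 1) * (real U * of_int (rational_bound n U)) < 1" using \<epsilon>(2) by linarith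
  have "1 * 1 \<le> (1 + \<epsilon>) * E0" using \<epsilon>(1) E0_ge by (intro mult_mono) auto
  then have "x = y" using le bd lt by (intro of_int_eq_if_close[of x "(1 + \<epsilon>) * E0" y]) auto
  then have "real (u i j) * of_int (N k) = real (u i k) * of_int (N j)"
  proof -
   have "real_of_int x = real_of_int y" using \<open>x = y\<close> by simp
   then show ?thesis by (simp add: x_def y_def)
  qed
  then have "real (u i j) * (of_int \<Delta> * p2 k) = real (u i k) * (of_int \<Delta> * p2 j)" unfolding N[OF k(1)] N[OF ij(2)] .
  then have "of_int \<Delta> * (u i j * p2 k) = of_int \<Delta> * (u i k * p2 j)" by (simp only: ac_simps)
  then show ?thesis using \<Delta>(1) by (simp add: k_def)
 qed
 define c where "c j = p (lab j) / p2 (lab j)" for j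
 have cpos: "0 < c j" if "j < n" for j using p[OF labn[OF that]] p2pos[OF labn[OF that]] by (simp add: c_def)
 have ceq: "c j = c k" if "(j, k) \<in> R\<^sup>*" for j k using labR[OF that] by (simp add: c_def)
 define p' where "p' j = p2 j * c j" for j
 define f' where "f' i j = f2 i j * c i" for i j
 have p'pos: "0 < p' j" if "j < n" for j using p2pos[OF that] cpos[OF that] by (simp add: p'_def)
 have p'r: "p' j = p j * (\<rho> j / \<rho> (lab j))" if j: "j < n" for j
 proof -
  have "\<sigma> (lab j) = \<sigma> j" using \<sigma>eq[OF labc[OF j]] by simp
  then show ?thesis unfolding p'_def c_def p2r[OF j] p2r[OF labn[OF j]] using \<sigma>pos[OF j] p[OF labn[OF j]] by simp
 qed
 have p'up: "p' j \<le> E0 * p j" and p'lo: "p j \<le> E0 * p' j" if j: "j < n" for j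
 proof -
  have pl: "0 < \<rho> (lab j)" "0 < \<rho> j" using \<rho>pos labn j by auto
  have "\<rho> j / \<rho> (lab j) \<le> E0" using path[OF symR[OF labc[OF j]] labn[OF j]] pl by (simp add: divide_le_eq)
  then have "p j * (\<rho> j / \<rho> (lab j)) \<le> p j * E0" using p[OF j] by (intro mult_left_mono) auto
  then show "p' j \<le> E0 * p j" unfolding p'r[OF j] by (simp only: mult.commute)
  have "1 \<le> E0 * (\<rho> j / \<rho> (lab j))" using path[OF labc[OF j] j] pl by (simp add: le_divide_eq)
  then have "p j * 1 \<le> p j * (E0 * (\<rho> j / \<rho> (lab j)))" using p[OF j] by (intro mult_left_mono) auto
  then show "p j \<le> E0 * p' j" unfolding p'r[OF j] by (simp only: ac_simps mult_1_right)
 qed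
 have "meq n u p' f'"
  unfolding meq_def
 proof (intro conjI allI impI)
  fix i assume "i < n" then show "0 < p' i" by (rule p'pos)
 next
  fix i j assume "i < n" "j < n" then show "0 \<le> f' i j" using f2n cpos[of i] by (simp add: f'_def)
 next
  fix i assume "i < n" then show "(\<Sum>j<n. f' i j) = p' i" by (simp only: f'_def p'_def sum_distrib_right[symmetric] spent2)
 next
  fix j assume j: "j < n"
  have "f' i j = f2 i j * c j" if i: "i < n" for i
  proof (cases "0 < f i j")
   case True then show ?thesis using ceq[OF TR[OF fT[OF i j True]]] by (simp add: f'_def)
  next
   case False then show ?thesis using f2pos[OF i j] f2n[OF i j] by (simp add: f'_def)
  qed
  then have "(\<Sum>i<n. f' i j) = (\<Sum>i<n. f2 i j * c j)" by simp
  then show "(\<Sum>i<n. f' i j) = p' j" by (simp only: p'_def sum_distrib_right[symmetric] sold2[OF j])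
 next
  fix i j l assume ij: "i < n" "j < n" and f'p: "0 < f' i j" and l: "l < n"
  have fp: "0 < f i j"
  proof (rule ccontr)
   assume "\<not> 0 < f i j"
   then have "f2 i j = 0" using f2pos[OF ij] f2n[OF ij] by simp
   then show False using f'p by (simp add: f'_def)
  qed
  have ijG: "(i, j) \<in> G" by (rule fG[OF ij fp])
  show "u i l * p' j \<le> u i j * p' l"
  proof (cases "(i, l) \<in> G")
   case True
   have kp: "0 < p2 (k0 i)" using k0[OF ij(1)] p2pos by blast
   have t: "u i l * p2 (k0 i) = u i (k0 i) * p2 l" "u i j * p2 (k0 i) = u i (k0 i) * p2 j"
    by (rule tightG[OF True], rule tightG[OF ijG])
   have "(u i l * p2 j) * p2 (k0 i) = (u i l * p2 (k0 i)) * p2 j" by (simp only: ac_simps)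
   also have "\<dots> = (u i j * p2 (k0 i)) * p2 l" unfolding t by (simp only: ac_simps)
   also have "\<dots> = (u i j * p2 l) * p2 (k0 i)" by (simp only: ac_simps)
   finally have "(u i l * p2 j) * p2 (k0 i) = (u i j * p2 l) * p2 (k0 i)" .
   then have "u i l * p2 j = u i j * p2 l" using kp by (simp only: mult_cancel_right) simp
   moreover have "(j, l) \<in> R\<^sup>*"
   proof -
    have "(i, j) \<in> R\<^sup>*" "(i, l) \<in> R\<^sup>*" using ijG True GR by auto
    then show ?thesis using symR rtrancl_trans by metis
   qed
   then have "c j = c l" by (rule ceq)
   ultimately have "u i l * p' j = u i j * p' l" unfolding p'_def mult.assoc[symmetric] by simp
   then show ?thesis by simp
  next
   case False
   \<comment> \<open>The factor by which an edge outside G loses against the best good at p.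
     Replacing p by p' costs \<open>E0\<close> for each of two prices, and the chosen good itself
     may be worse than best by \<open>1 + \<epsilon>\<close>.\<close>
   define g where "g = 1 + 10 * real n ^ 2 * \<epsilon>"
   have g0: "0 < g" unfolding g_def using \<epsilon>(1) by (simp add: add_pos_nonneg)
   have pb: "0 < p (b i)" by (rule p[OF bn[OF ij(1)]])
   have "g * (u i l * p (b i)) * p j \<le> u i (b i) * p l * p j"
    using gap[OF ij(1) l False] p[OF ij(2)] unfolding g_def by (intro mult_right_mono) auto
   also have "\<dots> = (u i (b i) * p j) * p l" by simp
   also have "\<dots> \<le> (1 + \<epsilon>) * (u i j * p (b i)) * p l" using GD[OF ijG] p[OF l] by (intro mult_right_mono) auto
   finally have "(g * (u i l * p j)) * p (b i) \<le> ((1 + \<epsilon>) * (u i j * p l)) * p (b i)" by (simp only: ac_simps)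
   then have 1: "g * (u i l * p j) \<le> (1 + \<epsilon>) * (u i j * p l)" using pb by (simp only: mult_le_cancel_right_pos)
   have "g * (u i l * p' j) \<le> g * (u i l * (E0 * p j))" using p'up[OF ij(2)] g0 by (intro mult_left_mono) auto
   also have "\<dots> = E0 * (g * (u i l * p j))" by (simp only: ac_simps)
   also have "\<dots> \<le> E0 * ((1 + \<epsilon>) * (u i j * p l))" using 1 E0_ge by (intro mult_left_mono) auto
   also have "\<dots> \<le> E0 * ((1 + \<epsilon>) * (u i j * (E0 * p' l)))" using p'lo[OF l] E0_ge \<epsilon>(1) by (intro mult_left_mono) auto
   also have "\<dots> = (E0 * (E0 * (1 + \<epsilon>))) * (u i j * p' l)" by (simp only: ac_simps)
   also have "\<dots> \<le> g * (u i j * p' l)" unfolding g_def using E03 p'pos[OF l] by (intro mult_right_mono) auto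
   finally show ?thesis using g0 by (simp only: mult_le_cancel_left_pos)
  qed
 qed
 moreover have "p' j = p (lab j) * N j / N (lab j)" "\<bar>p j / p (lab j) - N j / N (lab j)\<bar> \<le> 8 * real n ^ 2 * \<epsilon> * (p j / p (lab j))"
  if j: "j < n" for j
 proof -
  have "real_of_int (N j) / N (lab j) = p2 j / p2 (lab j)"
   unfolding N[OF j, symmetric] N[OF labn[OF j], symmetric] using \<Delta>(1) by simp
  then have "p (lab j) * (real_of_int (N j) / N (lab j)) = p (lab j) * (p2 j / p2 (lab j))" by (rule arg_cong)
  then show 1: "p' j = p (lab j) * N j / N (lab j)" by (simp add: p'_def c_def ac_simps)
  have pl: "0 < p (lab j)" by (rule p[OF labn[OF j]])
  have E1: "0 \<le> E0 - 1" using E0_ge by simp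
  have "p j - p' j \<le> (E0 - 1) * p j"
  proof (cases "p' j \<le> p j")
   case True
   have "p j - p' j \<le> (E0 - 1) * p' j" using p'lo[OF j] by (simp add: left_diff_distrib)
   also have "\<dots> \<le> (E0 - 1) * p j" by (rule mult_left_mono[OF True E1])
   finally show ?thesis .
  next
   case False
   moreover have "0 \<le> (E0 - 1) * p j" using E1 p[OF j] by simp
   ultimately show ?thesis by linarith
  qed
  moreover have "p' j - p j \<le> (E0 - 1) * p j" using p'up[OF j] by (simp add: left_diff_distrib)
  ultimately have "\<bar>p j - p' j\<bar> \<le> (E0 - 1) * p j" by (simp add: abs_le_iff)
  also have "\<dots> \<le> 8 * real n ^ 2 * \<epsilon> * p j" using E01 p[OF j] by (intro mult_right_mono) auto
  finally have "\<bar>p j - p' j\<bar> / p (lab j) \<le> 8 * real n ^ 2 * \<epsilon> * p j / p (lab j)" using pl by (intro divide_right_mono) auto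
  moreover have "p j / p (lab j) - N j / N (lab j) = (p j - p' j) / p (lab j)"
   unfolding 1 using pl by (simp add: diff_divide_distrib)
  then have "\<bar>p j - p' j\<bar> / p (lab j) = \<bar>p j / p (lab j) - N j / N (lab j)\<bar>" using pl by simp
  ultimately show "\<bar>p j / p (lab j) - N j / N (lab j)\<bar> \<le> 8 * real n ^ 2 * \<epsilon> * (p j / p (lab j))" by simp
 qed
 ultimately show ?thesis using Np NB labn by blast
qed

section \<open>Continued fractions\<close>

text \<open>The extended Euclidean algorithm on (a, b) after t divisions: r0, r1 are consecutive
  remainders and h0/k0, h1/k1 consecutive convergents, starting from the formal fractions 0/1 and
  1/0. \<open>sg\<close> is the alternating sign. The identity for b controls the approximation
  quality, the last line the number of steps.\<close>

definition euclid_inv :: "int => int => int => nat => int => int => int => int => int => int => bool" where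
 "euclid_inv a b K t r0 r1 h0 h1 k0 k1 \<longleftrightarrow>
   (\<exists>sg\<in>{1, -1}. a * k1 - b * h1 = - sg * r1 \<and> a * k0 - b * h0 = sg * r0) \<and> r0 * k1 + r1 * k0 = b \<and>
   0 \<le> r0 \<and> 0 \<le> r1 \<and> 0 \<le> h0 \<and> 0 \<le> h1 \<and> 0 \<le> k0 \<and> 0 \<le> k1 \<and> k1 \<le> K \<and> k0 \<le> K \<and> r0 \<le> a + b \<and> r1 \<le> a + b \<and>
   (if t = 0 then r0 = a \<and> r1 = b \<and> k0 = 1 \<and> k1 = 0 else 1 \<le> k1 \<and> r1 < r0 \<and> 2 ^ (t - 1) * (r0 * r1) \<le> a * b)"

text \<open>The division-free form of |a/b - h/k| \<le> 1/(k K) for positive b and K.\<close>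

definition good_convergent :: "int => int => int => int => int => bool" where
 "good_convergent a b K h k \<longleftrightarrow> 1 \<le> k \<and> k \<le> K \<and> \<bar>a * k - b * h\<bar> * K \<le> b"

lemma euclid_inv_init: "0 \<le> a ==> 0 \<le> b ==> 1 \<le> K ==> euclid_inv a b K 0 a b 0 1 1 0"
 by (simp add: euclid_inv_def)

text \<open>Both b h0 and b h1 differ from a times a denominator only by a remainder.\<close>

lemma euclid_inv_h_bound:
 assumes "euclid_inv a b K t r0 r1 h0 h1 k0 k1" "0 < b" "0 \<le> a" shows "h0 \<le> a * K + (a + b)" "h1 \<le> a * K + (a + b)"
proof -
 from assms(1) obtain sg where sg: "sg \<in> {1, -1::int}" "a * k1 - b * h1 = - sg * r1" "a * k0 - b * h0 = sg * r0"
  unfolding euclid_inv_def by blast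
 have r: "0 \<le> r0" "0 \<le> r1" "r0 \<le> a + b" "r1 \<le> a + b" "0 \<le> h0" "0 \<le> h1" "k1 \<le> K" "k0 \<le> K" using assms(1) unfolding euclid_inv_def by blast+
 have "a * k0 \<le> a * K" "a * k1 \<le> a * K" using r assms(3) by (auto intro: mult_left_mono)
 moreover have "1 * h0 \<le> b * h0" "1 * h1 \<le> b * h1" using r assms(2) by (intro mult_right_mono; simp)+
 then have "h0 \<le> b * h0" "h1 \<le> b * h1" by simp_all
 ultimately show "h0 \<le> a * K + (a + b)" "h1 \<le> a * K + (a + b)" using sg r by auto
qed

text \<open>Once the remainders decrease, the quotient is at least 1, so the new remainder is at
  most half of r0 and the product of consecutive remainders halves.\<close>

lemma euclid_inv_step:
 assumes I: "euclid_inv a b K t r0 r1 h0 h1 k0 k1" and r1: "0 < r1" and K: "(r0 div r1) * k1 + k0 \<le> K" and ab: "0 \<le> a" "0 \<le> b"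
 shows "euclid_inv a b K (Suc t) r1 (r0 - (r0 div r1) * r1) h1 ((r0 div r1) * h1 + h0) k1 ((r0 div r1) * k1 + k0)"
proof -
 define q where "q = r0 div r1"
 define r2 where "r2 = r0 - q * r1"
 from I obtain sg where sg: "sg \<in> {1, -1::int}" "a * k1 - b * h1 = - sg * r1" "a * k0 - b * h0 = sg * r0"
  unfolding euclid_inv_def by blast
 have r: "r0 * k1 + r1 * k0 = b" "0 \<le> r0" "0 \<le> r1" "0 \<le> h0" "0 \<le> h1" "0 \<le> k0" "0 \<le> k1" "k1 \<le> K" "r0 \<le> a + b" "r1 \<le> a + b"
  using I unfolding euclid_inv_def by blast+
 have r2: "r2 = r0 mod r1" by (simp add: r2_def q_def minus_div_mult_eq_mod)
 have r2b: "0 \<le> r2" "r2 < r1" "r2 \<le> r0" using r1 r(2) by (simp_all add: r2 zmod_le_nonneg_dividend)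
 have q0: "0 \<le> q" using r1 r(2) by (simp add: q_def pos_imp_zdiv_nonneg_iff)
 have s1: "a * (q * k1 + k0) - b * (q * h1 + h0) = - (- sg) * r2"
 proof -
  have "a * (q * k1 + k0) - b * (q * h1 + h0) = q * (a * k1 - b * h1) + (a * k0 - b * h0)" by (simp add: algebra_simps)
  also have "\<dots> = - (- sg) * r2" unfolding sg r2_def by (simp add: algebra_simps)
  finally show ?thesis .
 qed
 have s2: "a * k1 - b * h1 = (- sg) * r1" using sg(2) by simp
 have b': "r1 * (q * k1 + k0) + r2 * k1 = b" unfolding r2_def r(1)[symmetric] by (simp add: algebra_simps)
 have last: "1 \<le> q * k1 + k0 \<and> 2 ^ t * (r1 * r2) \<le> a * b"
 proof (cases "t = 0")
  case True
  then have e: "r0 = a" "r1 = b" "k0 = 1" "k1 = 0" using I unfolding euclid_inv_def by auto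
  have "r1 * r2 \<le> b * a" using r2b e ab by (auto intro: mult_left_mono)
  then show ?thesis using True e by (simp add: mult.commute)
 next
  case False
  then have e: "1 \<le> k1" "r1 < r0" "2 ^ (t - 1) * (r0 * r1) \<le> a * b" using I unfolding euclid_inv_def by auto
  have q1: "1 \<le> q" using e(2) r1 by (simp add: q_def pos_imp_zdiv_pos_iff int_one_le_iff_zero_less)
  have "1 * 1 \<le> q * k1" using q1 e(1) by (intro mult_mono) auto
  moreover have "1 * r1 \<le> q * r1" using q1 r1 by (intro mult_right_mono) auto
  then have "2 * r2 \<le> r0" using r2b r2_def by linarith
  then have "2 ^ (t - 1) * ((2 * r2) * r1) \<le> 2 ^ (t - 1) * (r0 * r1)" using r1 by (intro mult_left_mono mult_right_mono) auto
  moreover have "2 ^ t * (r1 * r2) = 2 ^ (t - 1) * ((2 * r2) * r1)" using False by (cases t) (auto simp: ac_simps)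
  ultimately show ?thesis using e(3) r(6) by linarith
 qed
 have nn: "0 \<le> q * h1 + h0" "0 \<le> q * k1 + k0" using q0 r by auto
 have sgm: "- sg \<in> {1, -1}" using sg(1) by auto
 show ?thesis
  unfolding euclid_inv_def q_def[symmetric] r2_def[symmetric]
  using s1 s2 sgm b' last nn r r2b K[folded q_def] by (auto simp del: minus_mult_minus)
qed

text \<open>If the next denominator exceeds K, then
  \<open>r1 * K \<le> r0 * k1 + r1 * k0 = b\<close>. If t is large, the halving product forces r1 =
  0. At t = 0 none of the stopping conditions can hold, which excludes the formal fraction
  1/0.\<close>

lemma euclid_inv_final:
 assumes I: "euclid_inv a b K t r0 r1 h0 h1 k0 k1" and a: "0 < a" and b: "0 < b" and K: "1 \<le> K"
  and d: "r1 = 0 \<or> K < (r0 div r1) * k1 + k0 \<or> a * b < 2 ^ (t - 1)"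
 shows "good_convergent a b K h1 k1"
proof -
 from I obtain sg where sg: "sg \<in> {1, -1::int}" "a * k1 - b * h1 = - sg * r1" unfolding euclid_inv_def by blast
 have r: "r0 * k1 + r1 * k0 = b" "0 \<le> r0" "0 \<le> r1" "0 \<le> k0" "0 \<le> k1" "k1 \<le> K" using I unfolding euclid_inv_def by blast+
 have rk: "r1 * K \<le> b \<and> 1 \<le> k1"
 proof (cases "t = 0")
  case True
  then have e: "r0 = a" "r1 = b" "k0 = 1" "k1 = 0" using I unfolding euclid_inv_def by auto
  have "1 * 1 \<le> a * b" using a b by (intro mult_mono) auto
  then show ?thesis using e d b True K by auto
 next
  case False
  then have e: "1 \<le> k1" "r1 < r0" "2 ^ (t - 1) * (r0 * r1) \<le> a * b" using I unfolding euclid_inv_def by auto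
  from d have "r1 = 0 \<or> K < (r0 div r1) * k1 + k0"
  proof (elim disjE)
   assume "a * b < 2 ^ (t - 1)"
   then have "2 ^ (t - 1) * (r0 * r1) < 2 ^ (t - 1) * 1" using e(3) by linarith
   then have "r0 * r1 < 1" by (simp only: mult_less_cancel_left_pos zero_less_power zero_less_numeral)
   moreover have "0 \<le> r0 * r1" using r by simp
   ultimately have "r0 * r1 = 0" by linarith
   then show ?thesis using e(2) r by auto
  qed auto
  then have "r1 * K \<le> b"
  proof
   assume k: "K < (r0 div r1) * k1 + k0"
   have "0 \<le> r0 mod r1" using r by (cases "r1 = 0") auto
   then have "r1 * (r0 div r1) \<le> r0" using minus_mult_div_eq_mod[of r0 r1] by linarith
   then have "r1 * (r0 div r1) * k1 \<le> r0 * k1" using r by (intro mult_right_mono)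
   moreover have "r1 * K \<le> r1 * ((r0 div r1) * k1 + k0)" using k r by (intro mult_left_mono) auto
   ultimately show ?thesis using r(1) by (simp add: algebra_simps)
  qed (use b in auto)
  then show ?thesis using e by simp
 qed
 moreover have "\<bar>a * k1 - b * h1\<bar> = r1" using sg r by auto
 ultimately show ?thesis using r by (simp add: good_convergent_def)
qed

text \<open>Two fractions with small denominators that are both close to \<open>a / b\<close> coincide.\<close>

lemma good_convergent_unique:
 fixes a b K h k N D :: int and \<eta> :: real
 assumes g: "good_convergent a b K h k" and b: "0 < b" and D: "0 < D" "4 * D \<le> K"
  and c: "\<bar>real_of_int a / b - N / D\<bar> \<le> \<eta>" and \<eta>: "real_of_int K * D * \<eta> \<le> 1 / 4"
 shows "real_of_int h / k = N / D"
proof -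
 have k: "1 \<le> k" "k \<le> K" "\<bar>a * k - b * h\<bar> * K \<le> b" using g by (auto simp: good_convergent_def)
 have K: "0 < K" using k by simp
 have "real_of_int (\<bar>a * k - b * h\<bar> * K) \<le> real_of_int b" using k(3) by (simp only: of_int_le_iff)
 then have 0: "\<bar>real_of_int a * k - b * h\<bar> * K \<le> b" by simp
 have bm: "\<bar>b * y\<bar> = b * \<bar>y\<bar>" for y :: real using b by (simp add: abs_mult)
 have e: "real_of_int a * k - b * h = b * (real_of_int a / b * k - h)" using b by (simp add: right_diff_distrib)
 have "b * (\<bar>real_of_int a / b * k - h\<bar> * K) \<le> b * 1" using 0 unfolding e bm by (simp only: mult.assoc mult_1_right)
 then have 1: "\<bar>real_of_int a / b * k - h\<bar> * K \<le> 1" using b by simp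
 have 2: "D * \<bar>real_of_int a / b * k - h\<bar> \<le> 1 / 4"
 proof -
  have "real_of_int (4 * D) \<le> K" using D(2) by (simp only: of_int_le_iff)
  then have "real_of_int (4 * D) * \<bar>real_of_int a / b * k - h\<bar> \<le> K * \<bar>real_of_int a / b * k - h\<bar>" by (intro mult_right_mono) auto
  then show ?thesis using 1 by (simp add: mult.commute)
 qed
 have 3: "(real_of_int D * k) * \<bar>real_of_int a / b - N / D\<bar> \<le> 1 / 4"
 proof -
  have "(real_of_int D * k) * \<bar>real_of_int a / b - N / D\<bar> \<le> (real_of_int D * K) * \<eta>"
   using D k c by (intro mult_mono) auto
  then show ?thesis using \<eta> by (simp add: mult.commute)
 qed
 \<comment> \<open>The integer \<open>N * k - D * h\<close> is a combination of the two
   approximation errors y and z, and each part is at most 1/4.\<close>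
 define y where "y = real_of_int a / b * k - h"
 define z where "z = real_of_int a / b - N / D"
 have "real_of_int N * k - D * h = D * y - (D * k) * z"
  using D(1) by (simp add: y_def z_def algebra_simps)
 then have "\<bar>real_of_int N * k - D * h\<bar> \<le> \<bar>D * y\<bar> + \<bar>(D * k) * z\<bar>" by (simp only: abs_triangle_ineq4)
 also have "\<dots> = D * \<bar>y\<bar> + (D * k) * \<bar>z\<bar>"
  using D(1) k(1) by (simp add: abs_mult)
 finally have "\<bar>real_of_int N * k - D * h\<bar> < 1" using 2 3 unfolding y_def[symmetric] z_def[symmetric] of_int_mult by linarith
 then have "\<bar>real_of_int (N * k - D * h)\<bar> < 1" by simp
 then have "N * k = D * h" by linarith
 then have "real_of_int N * k = D * h" by (simp only: of_int_mult[symmetric])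
 then show ?thesis using D k by (simp add: field_simps)
qed

section \<open>Sizes of prices, flows and denominators\<close>

locale sized_market =
 fixes n U L :: nat and u :: "nat => nat => nat"
 assumes market: "linear_market n U u" and size: "n * U < 2 ^ L"
begin

text \<open>The unit of all exponents: Cramer determinants for n + n^2 unknowns with coefficients of
  O(L) bits have O(n^2 L) bits.\<close>

definition x :: nat where "x = n * n * L"

lemma n0: "0 < n" by (rule market_nonempty[OF market])

lemma U0: "0 < U"
proof -
 obtain j where "j < n" "0 < u 0 j" using market_likes[OF market n0] by blast
 then show ?thesis using market_bound[OF market n0, of j] by simp
qed

lemma L0: "0 < L" using size n0 U0 by (cases L) auto

lemma Lx: "L \<le> x" using n0 by (simp add: x_def)

lemma nLx: "n * L \<le> x" using n0 by (simp add: x_def)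

lemma x0: "1 \<le> x" using n0 L0 by (simp add: x_def)

lemma pow_L: "(2::'a::linordered_semidom) ^ L \<le> 2 ^ x" using Lx by (intro power_increasing) auto

lemma n_less: "real n < 2 ^ x" and U_less: "real U < 2 ^ x" and nU_less: "real (n * U) < 2 ^ L"
proof -
 have "n * 1 \<le> n * U" "1 * U \<le> n * U" using U0 n0 by (intro mult_le_mono; simp)+
 then have "n < 2 ^ L" "U < 2 ^ L" using size by linarith+
 then have "real n < 2 ^ L" "real U < 2 ^ L" using less_imp_of_nat_less by fastforce+
 then show "real n < 2 ^ x" "real U < 2 ^ x" using pow_L[where 'a = real] by linarith+
 show "real (n * U) < 2 ^ L" using size less_imp_of_nat_less[OF size, where 'a = real] by simp
qed

lemma x_less: "real x < 2 ^ x"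
 using less_imp_of_nat_less[OF less_exp[of x], where 'a = real] by simp

lemma two_pow: "(2::real) ^ k \<le> 2 ^ (k * x)"
 using x0 by (intro power_increasing) auto

text \<open>With N = n + n^2 unknowns the bound is at most the N-th power of N times the base, since
  N! \<le> N^N. That product is below 2^(9 L), and N is at most 2 n^2, which gives 18 n^2 L.\<close>

lemma rational_bound_le: "rational_bound n U \<le> 2 ^ (18 * x)"
proof -
 define N where "N = n + n * n"
 define Bs where "Bs = real (n ^ 3 + n ^ 2 + 3 * n) * (real U)\<^sup>2"
 have nn: "n \<le> n * n" "n * n \<le> n * n * n" using n0 by simp_all
 have "real N \<le> 2 * real n ^ 2" unfolding N_def using nn(1)
  by (simp add: power2_eq_square flip: of_nat_mult)
 moreover have "real (n ^ 3 + n ^ 2 + 3 * n) \<le> 5 * real n ^ 3"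
 proof -
  have "n ^ 3 + n ^ 2 + 3 * n \<le> 5 * n ^ 3" unfolding power2_eq_square power3_eq_cube using nn by linarith
  then have "real (n ^ 3 + n ^ 2 + 3 * n) \<le> real (5 * n ^ 3)" by (simp only: of_nat_le_iff)
  then show ?thesis by simp
 qed
 then have "Bs \<le> 5 * real n ^ 3 * (real U)\<^sup>2" unfolding Bs_def by (intro mult_right_mono) auto
 ultimately have "real N * Bs \<le> (2 * real n ^ 2) * (5 * real n ^ 3 * (real U)\<^sup>2)"
  by (intro mult_mono) (auto simp: Bs_def)
 also have "\<dots> = 10 * (real n ^ 3 * (real (n * U))\<^sup>2)" by (simp add: power2_eq_square power3_eq_cube)
 also have "\<dots> \<le> 2 ^ (4 * L) * ((2 ^ L) ^ 3 * (2 ^ L)\<^sup>2)"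
 proof -
  have "n * 1 \<le> n * U" using U0 by (intro mult_left_mono) auto
  then have "real n \<le> real (n * U)" by (simp only: of_nat_le_iff mult_1_right)
  then have nl: "real n \<le> 2 ^ L" by (rule order_trans[OF _ less_imp_le[OF nU_less]])
  have "(2::real) ^ 4 \<le> 2 ^ (4 * L)" using L0 by (intro power_increasing) auto
  then have "(10::real) \<le> 2 ^ (4 * L)" by simp
  moreover have "real n ^ 3 \<le> (2 ^ L) ^ 3" using nl by (intro power_mono) auto
  moreover have "(real (n * U))\<^sup>2 \<le> (2 ^ L)\<^sup>2" using nU_less by (intro power_mono) auto
  ultimately show ?thesis by (intro mult_mono) auto
 qed
 also have "\<dots> = 2 ^ (9 * L)" by (simp flip: power_mult power_add)
 finally have NB: "real N * Bs \<le> 2 ^ (9 * L)" .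
 have "real_of_int (rational_bound n U) = fact N * Bs ^ N"
  unfolding rational_bound_def N_def[symmetric] Bs_def by simp
 also have "\<dots> \<le> real N ^ N * Bs ^ N"
  by (intro mult_right_mono) (simp_all add: fact_le_power Bs_def flip: of_nat_power)
 also have "\<dots> = (real N * Bs) ^ N" by (simp add: power_mult_distrib)
 also have "\<dots> \<le> (2 ^ (9 * L)) ^ N" using NB by (intro power_mono) (auto simp: Bs_def)
 also have "\<dots> \<le> 2 ^ (18 * x)"
 proof -
  have "9 * L * N \<le> 9 * L * (2 * (n * n))" using nn by (intro mult_left_mono) (auto simp: N_def)
  then show ?thesis unfolding power_mult[symmetric] by (intro power_increasing) (auto simp: x_def ac_simps)
 qed
 finally have "real_of_int (rational_bound n U) \<le> real_of_int (2 ^ (18 * x))" by simp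
 then show ?thesis by (simp only: of_int_le_iff)
qed

end

text \<open>The equilibrium q is fixed for the analysis; the program never sees it.\<close>

locale sized_equilibrium = sized_market +
 fixes q :: "nat => real" and f :: "nat => nat => real"
 assumes eq: "meq n u q f" and forest: "support_forest n f" and qsum: "(\<Sum>j<n. q j) = 1"
begin

lemmas qpos = meq_pos[OF eq]

lemma q_ge: "j < n ==> 1 \<le> 2 ^ x * q j"
proof -
 assume j: "j < n"
 have "1 \<le> real (n * U) ^ n * q j" by (rule price_lower_bound[OF market eq qsum j])
 also have "\<dots> \<le> (2 ^ L) ^ n * q j" using nU_less qpos[OF j] by (intro mult_right_mono power_mono) auto
 also have "\<dots> \<le> 2 ^ x * q j"
  unfolding power_mult[symmetric] using qpos[OF j] nLx by (intro mult_right_mono power_increasing) (auto simp: mult.commute)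
 finally show ?thesis .
qed

text \<open>Normalised per component of the support, flows are multiples of 1/\<Delta> with \<Delta>
  at most 2^(18 x). Undoing the normalisation multiplies by the price sum of the component, which is
  at least q i and hence at least 2^(-x).\<close>

lemma flow_ge:
 assumes i: "i < n" and j: "j < n" and fp: "0 < f i j" shows "1 \<le> 2 ^ (19 * x) * f i j"
proof -
 define E where "E = {(i, j). i < n \<and> j < n \<and> 0 < f i j}"
 define R where "R = E \<union> E\<inverse>"
 define \<sigma> where "\<sigma> j = (\<Sum>k\<in>component n E j. q k)" for j
 define p' where "p' j = q j / \<sigma> j" for j
 define f' where "f' i j = f i j / \<sigma> i" for i j
 have symR: "(k, j) \<in> R\<^sup>*" if "(j, k) \<in> R\<^sup>*" for j k
 proof -
  have "sym R" unfolding R_def by (rule sym_Un_converse)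
  then show ?thesis using that sym_rtrancl symD by metis
 qed
 have compeq: "component n E j = component n E k" if "(j, k) \<in> R\<^sup>*" for j k
  using that symR rtrancl_trans[of _ _ R] unfolding R_def by blast
 have \<sigma>eq: "\<sigma> j = \<sigma> k" if "(j, k) \<in> R\<^sup>*" for j k unfolding \<sigma>_def compeq[OF that] ..
 have \<sigma>q: "q j \<le> \<sigma> j" if "j < n" for j
  unfolding \<sigma>_def using that qpos by (intro member_le_sum) (auto intro: less_imp_le)
 have \<sigma>pos: "0 < \<sigma> j" if "j < n" for j using \<sigma>q[OF that] qpos[OF that] by simp
 have ER: "(i, j) \<in> R\<^sup>*" if "i < n" "j < n" "0 < f i j" for i j using that by (auto simp: R_def E_def)
 have f0: "0 \<le> f i j" if "i < n" "j < n" for i j by (rule meq_nonneg[OF eq that])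
 have f'c: "f' i j = f i j / \<sigma> j" if "i < n" "j < n" for i j
 proof (cases "0 < f i j")
  case True then show ?thesis using \<sigma>eq[OF ER[OF that True]] by (simp add: f'_def)
 next
  case False then show ?thesis using f0[OF that] by (simp add: f'_def)
 qed
 have f'pos: "0 < f' i j \<longleftrightarrow> 0 < f i j" if "i < n" "j < n" for i j
  using \<sigma>pos[OF that(1)] by (simp add: f'_def zero_less_divide_iff)
 have c1: "0 < p' i" if "i < n" for i using qpos[OF that] \<sigma>pos[OF that] by (simp add: p'_def)
 have c2: "0 \<le> f' i j" if "i < n" "j < n" for i j using f0[OF that] \<sigma>pos[OF that(1)] by (simp add: f'_def)
 have c3: "(\<Sum>i<n. f' i j) = p' j" if "j < n" for j
  using that by (simp add: f'c p'_def sum_divide_distrib[symmetric] meq_sold[OF eq])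
 have c4: "(\<Sum>j<n. f' i j) = p' i" if "i < n" for i
  using that by (simp add: f'_def p'_def sum_divide_distrib[symmetric] meq_spent[OF eq])
 have uE: "0 < u i j" if "(i, j) \<in> E" for i j
 proof -
  have ij: "i < n" "j < n" "0 < f i j" using that by (auto simp: E_def)
  obtain l where l: "l < n" "0 < u i l" using market_likes[OF market ij(1)] by blast
  have "0 < u i l * q j" using l qpos[OF ij(2)] by simp
  also have "\<dots> \<le> u i j * q l" using meq_best[OF eq ij(1,2,3) l(1)] .
  finally show ?thesis by (cases "u i j = 0") auto
 qed
 have ratio: "real (u i j) * p' k = real (u i k) * p' j" if "(i, j) \<in> E" "(i, k) \<in> E" for i j k
 proof -
  have ij: "i < n" "j < n" "0 < f i j" "k < n" "0 < f i k" using that by (auto simp: E_def)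
  have "(j, k) \<in> R\<^sup>*" using symR[OF ER[OF ij(1-3)]] ER[OF ij(1,4,5)] by (rule rtrancl_trans)
  then have s: "\<sigma> j = \<sigma> k" by (rule \<sigma>eq)
  have "u i k * q j = u i j * q k" using meq_best[OF eq ij(1,2,3,4)] meq_best[OF eq ij(1,4,5,2)] by simp
  then show ?thesis using s by (simp add: p'_def)
 qed
 have norm: "(\<Sum>k\<in>component n E j. p' k) = 1" if j: "j < n" for j
 proof -
  have "(\<Sum>k\<in>component n E j. p' k) = (\<Sum>k\<in>component n E j. q k / \<sigma> j)"
  proof (rule sum.cong[OF refl])
   fix k assume "k \<in> component n E j"
   then have "(j, k) \<in> R\<^sup>*" by (simp add: R_def)
   then show "p' k = q k / \<sigma> j" using \<sigma>eq by (simp add: p'_def)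
  qed
  then show ?thesis using \<sigma>pos[OF j] by (simp add: \<sigma>_def sum_divide_distrib[symmetric])
 qed
 have fo: "support_forest n f'" using forest f'pos unfolding support_forest_def by simp
 have "\<exists>\<Delta>::int. 0 < \<Delta> \<and> \<Delta> \<le> rational_bound n U \<and>
  (\<forall>j<n. \<exists>k::int. of_int \<Delta> * p' j = of_int k) \<and> (\<forall>i<n. \<forall>j<n. \<exists>k::int. of_int \<Delta> * f' i j = of_int k)"
  unfolding rational_bound_def
  by (intro rational_flow[where u = u and E = E] c1 c2 c3 c4 norm ratio uE fo market_bound[OF market])
   (use U0 f'pos in \<open>auto simp: E_def\<close>)
 then obtain \<Delta> :: int and k :: int where \<Delta>: "0 < \<Delta>" "\<Delta> \<le> rational_bound n U" and k: "of_int \<Delta> * f' i j = of_int k"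
  using i j by blast
 have "0 < real_of_int k" unfolding k[symmetric] using \<Delta>(1) f'pos[OF i j] fp by simp
 then have k1: "1 \<le> real_of_int k" by simp
 have \<Delta>b: "real_of_int \<Delta> \<le> 2 ^ (18 * x)"
 proof -
  have "real_of_int \<Delta> \<le> real_of_int (2 ^ (18 * x))" using \<Delta>(2) rational_bound_le by (simp only: of_int_le_iff)
  then show ?thesis by simp
 qed
 have "1 \<le> of_int \<Delta> * f' i j" using k k1 by simp
 also have "\<dots> \<le> 2 ^ (18 * x) * f' i j" using \<Delta>b c2[OF i j] by (intro mult_right_mono)
 finally have "\<sigma> i * 1 \<le> \<sigma> i * (2 ^ (18 * x) * f' i j)" using \<sigma>pos[OF i] by (intro mult_left_mono) auto
 also have "\<dots> = 2 ^ (18 * x) * f i j" using \<sigma>pos[OF i] by (simp add: f'_def)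
 finally have "q i \<le> 2 ^ (18 * x) * f i j" using \<sigma>q[OF i] by simp
 then have "2 ^ x * q i \<le> 2 ^ x * (2 ^ (18 * x) * f i j)" by (intro mult_left_mono) auto
 then have "1 \<le> 2 ^ x * (2 ^ (18 * x) * f i j)" using q_ge[OF i] by linarith
 then show ?thesis by (simp flip: power_add mult.assoc)
qed

end

section \<open>The main iteration\<close>

text \<open>For a k \<le> 0 the unrounded row is a convex combination of two old rows. For a k > 0
  the absolute weights sum to at most 1 + 2/(7 n^2), because the denominator is at least 7 n^2 a r.
  The remaining 5/(7 n^2) pays for the rounding error n, thanks to
  \<open>2 * real n ^ 3 \<le> H\<close>.\<close>

lemma cut_step_bound:
 assumes n: "0 < n" and V: "\<And>k j. k < n ==> j < n ==> \<bar>real_of_int (V k j)\<bar> \<le> H" and H: "2 * real n ^ 3 \<le> H"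
  and s: "\<And>k. k < n ==> (\<Sum>j<n. V k j) = M" and r: "r < n" "0 < a r" "\<And>k. k < n ==> a k \<le> a r"
  and kj: "k < n" "j < n" and c: "c = 8 * int n ^ 2"
 shows "\<bar>real_of_int (cut_step n c M V a r k j)\<bar> \<le> H * (1 + 1 / real n ^ 2)"
proof -
 have n2: "1 \<le> real n ^ 2" using n by (intro one_le_power) auto
 have n3: "0 < real n ^ 3" using n by simp
 have H0: "0 \<le> H" using H n3 by linarith
 show ?thesis
 proof (cases "k = r")
  case True
  have "\<bar>real_of_int (cut_step n c M V a r k j)\<bar> \<le> H * 1" using V[OF r(1) kj(2)] True by (simp add: cut_step_def)
  also have "\<dots> \<le> H * (1 + 1 / real n ^ 2)" using H0 by (intro mult_left_mono) auto
  finally show ?thesis .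
 next
  case False
  define ar where "ar = real_of_int (a r)"
  define ak where "ak = real_of_int (a k)"
  define cc where "cc = 8 * real n ^ 2"
  define d where "d = cc * ar - ak"
  have cr: "real_of_int c = cc" by (simp add: c cc_def)
  have ar: "0 < ar" "ak \<le> ar" using r(2) r(3)[OF kj(1)] by (simp_all add: ar_def ak_def)
  have "1 * ar \<le> real n ^ 2 * ar" using n2 ar by (intro mult_right_mono) auto
  then have d7: "7 * (real n ^ 2 * ar) \<le> d" unfolding d_def cc_def using ar by linarith
  then have d0: "0 < d" using n2 ar by (smt (verit) mult_pos_pos)
  have d1: "0 < c * a r - a k"
  proof -
   have "real_of_int (c * a r - a k) = d" by (simp add: cr d_def ar_def ak_def)
   then show ?thesis using d0 by (metis of_int_0_less_iff)
  qed
  note e = cut_row_error[OF d1 s[OF kj(1)] s[OF r(1)] False kj(2)]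
  define w where "w = cc * ar * V k j - ak * V r j"
  have e': "\<bar>real_of_int (cut_step n c M V a r k j) - w / d\<bar> \<le> n"
   using e by (simp add: w_def d_def cr ar_def ak_def)
  have "\<bar>w\<bar> \<le> \<bar>cc * ar * V k j\<bar> + \<bar>ak * V r j\<bar>" unfolding w_def by (rule abs_triangle_ineq4)
  also have "\<dots> = cc * ar * \<bar>real_of_int (V k j)\<bar> + \<bar>ak\<bar> * \<bar>real_of_int (V r j)\<bar>" using ar by (simp add: abs_mult cc_def)
  also have "\<dots> \<le> cc * ar * H + \<bar>ak\<bar> * H"
   using V[OF kj] V[OF r(1) kj(2)] ar by (intro add_mono mult_left_mono) (auto simp: cc_def)
  also have "\<dots> = (cc * ar + \<bar>ak\<bar>) * H" by (simp add: distrib_right)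
  finally have w: "\<bar>w\<bar> \<le> (cc * ar + \<bar>ak\<bar>) * H" .
  have g: "cc * ar + \<bar>ak\<bar> \<le> (1 + 2 / (7 * real n ^ 2)) * d"
  proof (cases "ak \<le> 0")
   case True
   have "1 * d \<le> (1 + 2 / (7 * real n ^ 2)) * d" using d0 by (intro mult_right_mono) auto
   then show ?thesis using True by (simp add: d_def)
  next
   case False
   have "2 / (7 * real n ^ 2) * (7 * (real n ^ 2 * ar)) \<le> 2 / (7 * real n ^ 2) * d" using d7 by (intro mult_left_mono) auto
   moreover have "2 / (7 * real n ^ 2) * (7 * (real n ^ 2 * ar)) = 2 * ar" using n by simp
   ultimately have "d + 2 * ar \<le> (1 + 2 / (7 * real n ^ 2)) * d" by (simp add: distrib_right)
   then show ?thesis using False ar by (simp add: d_def)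
  qed
  have "\<bar>w\<bar> \<le> ((1 + 2 / (7 * real n ^ 2)) * d) * H" using w mult_right_mono[OF g H0] by linarith
  also have "\<dots> = (H * (1 + 2 / (7 * real n ^ 2))) * d" by (simp only: ac_simps)
  finally have wd: "\<bar>w / d\<bar> \<le> H * (1 + 2 / (7 * real n ^ 2))" using d0 by (simp add: pos_divide_le_eq)
  have "real n \<le> H * (5 / (7 * real n ^ 2))"
  proof -
   have "real n \<le> 10 / 7 * real n" by simp
   also have "\<dots> = (2 * real n ^ 3) * (5 / (7 * real n ^ 2))" using n by (simp add: power2_eq_square power3_eq_cube)
   also have "\<dots> \<le> H * (5 / (7 * real n ^ 2))" using H by (intro mult_right_mono) auto
   finally show ?thesis .
  qed
  moreover have "H * (1 + 2 / (7 * real n ^ 2)) + H * (5 / (7 * real n ^ 2)) = H * (1 + 1 / real n ^ 2)"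
   using n by (simp add: field_simps)
  ultimately show ?thesis using e' wd by linarith
 qed
qed

lemma two_le_power: "0 < m ==> (2::real) \<le> (1 + 1 / real m) ^ m"
proof -
 assume m: "0 < m"
 have "- 1 \<le> 1 / real m" by (rule order_trans[of _ 0]) auto
 from Bernoulli_inequality[OF this, of m] show ?thesis using m by simp
qed

context sized_equilibrium
begin

text \<open>The fixed-point scale. It has to dominate the drift accumulated over all rounds,
  weighted with directions of size up to \<open>2 ^ (182 * x)\<close>; see
  \<open>drift_bound\<close>.\<close>

definition M :: int where "M = 2 ^ (210 * x)"

text \<open>Every 16 n^2 cuts double the determinant, and 250 n x doublings exceed the ratio of n!
  to the initial determinant; see \<open>main_end\<close>.\<close>

definition rounds :: nat where "rounds = 4000 * n ^ 3 * x"

text \<open>Chosen with \<open>2 ^ (170 * x) * \<rho> = 1 / 2\<close>: entries of an excess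
  direction are at least \<open>1 - 2 ^ (170 * x)\<close>, so pulling q by \<open>\<rho>\<close>
  towards a unit vector lowers its value from at least 1 to no less than 1/2.\<close>

definition \<rho> :: real where "\<rho> = 1 / 2 ^ (170 * x + 1)"

definition Y :: "nat => nat => real" where
 "Y = (\<lambda>l k. if l = 0 then q k else (1 - \<rho>) * q k + (if l = k then \<rho> else 0))"

definition main_inv :: "(nat => nat => int) => nat => bool" where
 "main_inv V t \<longleftrightarrow> (\<exists>\<Lambda>. cone_inv n M Y (real (t * n)) (q 0 * \<rho> ^ (n - 1) * (1 + 1 / (16 * real n ^ 2)) ^ t) V \<Lambda>) \<and>
   (\<forall>k<n. \<forall>j<n. \<bar>real_of_int (V k j)\<bar> \<le> M * (1 + 1 / real n ^ 2) ^ t)"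

text \<open>The queried share of good j0 is at most 2^(-10 x), or even negative, whereas equilibrium
  shares are at least 2^(-x). The direction Z is 2^(10 x) times coordinate j0 minus the coordinate
  sum, so it separates the two by a wide margin.\<close>

definition low_direction :: "(nat => int) => nat => (nat => int) => bool" where
 "low_direction P j0 Z \<longleftrightarrow> j0 < n \<and> P j0 * 2 ^ (10 * x) \<le> n * M \<and> (\<forall>j<n. Z j = (if j = j0 then 2 ^ (10 * x) - 1 else - 1))"

text \<open>Z is the excess demand scaled by \<open>2 ^ (170 * x)\<close> and rounded, with an
  offset: rounding down and adding 2 puts Z between 1 and 2 above the exact value, which keeps the
  value at q at least 1.\<close>

definition high_direction :: "(nat => int) => (nat => nat) => (nat => int) => bool" where
 "high_direction P b Z \<longleftrightarrow> (\<forall>j<n. n * M < P j * 2 ^ (10 * x)) \<and> best_goods n u (\<lambda>j. real_of_int (P j)) b \<and>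
   (\<forall>j<n. Z j = (2 ^ (170 * x) * (\<Sum>i | i < n \<and> b i = j. P i)) div P j + 2 - 2 ^ (170 * x))"

lemma \<rho>: "0 < \<rho>" "\<rho> \<le> 1 / 2" "2 ^ (170 * x) * \<rho> = 1 / 2"
 by (simp_all add: \<rho>_def)

lemma M0: "0 < M" "0 < real_of_int M" by (simp_all add: M_def)

lemma q0_pos: "0 < q 0" by (rule qpos[OF n0])

lemma main_init: "main_inv (\<lambda>k j. if k = j then M else 0) 0"
proof -
 have "cone_inv n M Y 0 (q 0 * \<rho> ^ (n - 1)) (\<lambda>k j. if k = j then M else 0) Y"
  unfolding Y_def by (rule cone_inv_init) (use n0 qpos qsum \<rho> in \<open>auto intro: less_imp_le\<close>)
 then show ?thesis unfolding main_inv_def using M0 by auto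
qed

lemma main_row_sum: "main_inv V t ==> k < n ==> (\<Sum>j<n. V k j) = M"
 unfolding main_inv_def cone_inv_def by blast

lemma main_total:
 assumes "main_inv V t" and P: "\<And>j. j < n ==> P j = (\<Sum>k<n. V k j)"
 shows "(\<Sum>j<n. P j) = n * M"
proof -
 have "(\<Sum>j<n. P j) = (\<Sum>j<n. \<Sum>k<n. V k j)" by (simp add: P)
 also have "\<dots> = (\<Sum>k<n. \<Sum>j<n. V k j)" by (rule sum.swap)
 also have "\<dots> = n * M" using main_row_sum[OF assms(1)] by simp
 finally show ?thesis .
qed

lemma main_a_sum:
 assumes P: "\<And>j. j < n ==> P j = (\<Sum>k<n. V k j)" and a: "\<And>k. k < n ==> a k = (\<Sum>j<n. V k j * Z j)"
 shows "(\<Sum>k<n. a k) = (\<Sum>j<n. P j * Z j :: int)"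
proof -
 have "(\<Sum>k<n. a k) = (\<Sum>k<n. \<Sum>j<n. V k j * Z j)" by (simp add: a)
 also have "\<dots> = (\<Sum>j<n. \<Sum>k<n. V k j * Z j)" by (rule sum.swap)
 also have "\<dots> = (\<Sum>j<n. P j * Z j)" by (simp add: P sum_distrib_right)
 finally show ?thesis .
qed

text \<open>The drift is at most n per round. All polynomial factors together fit into 18 x bits, so
  the product stays below 2^(200 x).\<close>

lemma drift_bound:
 assumes t: "t \<le> rounds" and Z: "\<And>j. j < n ==> \<bar>real_of_int (Z j)\<bar> \<le> 2 ^ (182 * x)"
 shows "real (t * n) * (\<Sum>j<n. \<bar>real_of_int (Z j)\<bar>) \<le> M / 2"
proof -
 have "(\<Sum>j<n. \<bar>real_of_int (Z j)\<bar>) \<le> (\<Sum>j<n. 2 ^ (182 * x))" by (intro sum_mono) (use Z in auto)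
 then have 1: "(\<Sum>j<n. \<bar>real_of_int (Z j)\<bar>) \<le> n * 2 ^ (182 * x)" by simp
 have "real (t * n) \<le> real (rounds * n)" using t by (simp only: of_nat_le_iff mult_le_mono1)
 then have 2: "real (t * n) \<le> 4000 * (real n ^ 3 * real x) * real n" by (simp add: rounds_def)
 have "real (t * n) * (\<Sum>j<n. \<bar>real_of_int (Z j)\<bar>) \<le> (4000 * (real n ^ 3 * real x) * real n) * (n * 2 ^ (182 * x))"
  by (rule mult_mono[OF 2 1]) (auto intro: sum_nonneg)
 also have "\<dots> = 4000 * (real n ^ 3 * real x * (real n * (n * 2 ^ (182 * x))))" by simp
 also have "\<dots> \<le> 2 ^ (12 * x) * ((2 ^ x) ^ 3 * 2 ^ x * (2 ^ x * (2 ^ x * 2 ^ (182 * x))))"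
  using two_pow[of 12] n_less x_less by (intro mult_mono power_mono) auto
 also have "\<dots> = 2 ^ (200 * x)" by (simp flip: power_mult power_add)
 also have "\<dots> \<le> 2 ^ (210 * x - 1)" using x0 by (intro power_increasing) auto
 also have "\<dots> = M / 2" using x0 by (simp add: M_def power_diff)
 finally show ?thesis .
qed

text \<open>M times \<open>Y l\<close> is a convex combination of the rows up to the drift, so the
  best row has at least its value minus M/2.\<close>

lemma main_argmax:
 fixes a :: "nat => int"
 assumes I: "main_inv V t" and t: "t \<le> rounds" and Z: "\<And>j. j < n ==> \<bar>real_of_int (Z j)\<bar> \<le> 2 ^ (182 * x)"
  and a: "\<And>k. k < n ==> a k = (\<Sum>j<n. V k j * Z j)" and r: "\<And>k. k < n ==> a k \<le> a r" and l: "l < n"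
 shows "M * (\<Sum>j<n. Y l j * Z j) \<le> a r + M / 2"
proof -
 define \<epsilon> where "\<epsilon> = real (t * n)"
 obtain \<Lambda> D where "cone_inv n M Y \<epsilon> D V \<Lambda>" using I unfolding main_inv_def \<epsilon>_def by blast
 then have L: "\<And>k. k < n ==> 0 \<le> \<Lambda> l k" "(\<Sum>k<n. \<Lambda> l k) = 1"
  "\<And>j. j < n ==> \<bar>(\<Sum>k<n. \<Lambda> l k * V k j) - M * Y l j\<bar> \<le> \<epsilon>" using l unfolding cone_inv_def by blast+
 have "M * (\<Sum>j<n. Y l j * Z j) - (\<Sum>j<n. (\<Sum>k<n. \<Lambda> l k * V k j) * Z j) = (\<Sum>j<n. (M * Y l j - (\<Sum>k<n. \<Lambda> l k * V k j)) * Z j)"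
  by (simp add: sum_distrib_left sum_subtractf left_diff_distrib mult.assoc)
 also have "\<dots> \<le> (\<Sum>j<n. \<epsilon> * \<bar>real_of_int (Z j)\<bar>)"
 proof (rule sum_mono)
  fix j assume "j \<in> {..<n}"
  then have "\<bar>M * Y l j - (\<Sum>k<n. \<Lambda> l k * V k j)\<bar> \<le> \<epsilon>" using L(3)[of j] by (simp add: abs_minus_commute)
  then have "\<bar>M * Y l j - (\<Sum>k<n. \<Lambda> l k * V k j)\<bar> * \<bar>real_of_int (Z j)\<bar> \<le> \<epsilon> * \<bar>real_of_int (Z j)\<bar>" by (intro mult_right_mono) auto
  then have "\<bar>(M * Y l j - (\<Sum>k<n. \<Lambda> l k * V k j)) * Z j\<bar> \<le> \<epsilon> * \<bar>real_of_int (Z j)\<bar>" by (simp only: abs_mult)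
  then show "(M * Y l j - (\<Sum>k<n. \<Lambda> l k * V k j)) * Z j \<le> \<epsilon> * \<bar>real_of_int (Z j)\<bar>" by (rule abs_le_D1)
 qed
 also have "\<dots> = \<epsilon> * (\<Sum>j<n. \<bar>real_of_int (Z j)\<bar>)" by (simp add: sum_distrib_left)
 also have "\<dots> \<le> M / 2" unfolding \<epsilon>_def by (rule drift_bound[OF t Z])
 finally have 1: "M * (\<Sum>j<n. Y l j * Z j) - (\<Sum>j<n. (\<Sum>k<n. \<Lambda> l k * V k j) * Z j) \<le> M / 2" .
 have "(\<Sum>j<n. (\<Sum>k<n. \<Lambda> l k * V k j) * Z j) = (\<Sum>j<n. \<Sum>k<n. \<Lambda> l k * (V k j * Z j))"
  by (simp add: sum_distrib_right mult.assoc)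
 also have "\<dots> = (\<Sum>k<n. \<Sum>j<n. \<Lambda> l k * (V k j * Z j))" by (rule sum.swap)
 also have "\<dots> = (\<Sum>k<n. \<Lambda> l k * a k)" by (simp add: a sum_distrib_left)
 also have "\<dots> \<le> (\<Sum>k<n. \<Lambda> l k * a r)" using L(1) r by (intro sum_mono mult_left_mono) auto
 also have "\<dots> = a r" using L(2) by (simp flip: sum_distrib_right)
 finally show ?thesis using 1 by linarith
qed

lemma Y_sum: "l < n ==> (\<Sum>j<n. Y l j) = 1"
 by (cases "l = 0") (use qsum in \<open>simp_all add: Y_def sum.distrib flip: sum_distrib_left\<close>)

text \<open>Even the points pulled away from q retain half of q j0, and q j0 times 2^(10 x) is at
  least 2^(9 x); so this cut always beats the stopping threshold.\<close>

lemma low_direction_bounds: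
 assumes low: "low_direction P j0 Z" and tot: "(\<Sum>j<n. P j) = n * M"
 shows "\<And>j. j < n ==> \<bar>real_of_int (Z j)\<bar> \<le> 2 ^ (182 * x)" "(\<Sum>j<n. P j * Z j) \<le> 0"
  "\<And>l. l < n ==> 12 * real n + 1 < (\<Sum>j<n. Y l j * Z j)"
proof -
 have j0: "j0 < n" and Pj: "P j0 * 2 ^ (10 * x) \<le> n * M" and Z: "\<And>j. j < n ==> Z j = (if j = j0 then 2 ^ (10 * x) else 0) - 1"
  using low unfolding low_direction_def by auto
 show "\<bar>real_of_int (Z j)\<bar> \<le> 2 ^ (182 * x)" if "j < n" for j
 proof -
  have p: "(2::real) ^ (10 * x) \<le> 2 ^ (182 * x)" "(1::real) \<le> 2 ^ (10 * x)" "(1::real) \<le> 2 ^ (182 * x)" by (auto intro: power_increasing)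
  show ?thesis
  proof (cases "j = j0")
   case True
   then have "real_of_int (Z j) = 2 ^ (10 * x) - 1" using Z[OF that] by simp
   then show ?thesis using p by linarith
  next
   case False
   then have "real_of_int (Z j) = - 1" using Z[OF that] by simp
   then show ?thesis using p by linarith
  qed
 qed
 have "(\<Sum>j<n. P j * Z j) = (\<Sum>j<n. (if j = j0 then P j * 2 ^ (10 * x) else 0) - P j)"
  by (rule sum.cong[OF refl]) (auto simp: Z right_diff_distrib)
 also have "\<dots> = P j0 * 2 ^ (10 * x) - n * M" using j0 by (simp add: sum_subtractf sum.delta tot)
 finally show "(\<Sum>j<n. P j * Z j) \<le> 0" using Pj by simp
 show "12 * real n + 1 < (\<Sum>j<n. Y l j * Z j)" if l: "l < n" for l
 proof -
  have "(\<Sum>j<n. Y l j * Z j) = (\<Sum>j<n. (if j = j0 then Y l j * 2 ^ (10 * x) else 0) - Y l j)"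
   by (rule sum.cong[OF refl]) (auto simp: Z right_diff_distrib)
  also have "\<dots> = Y l j0 * 2 ^ (10 * x) - 1" using j0 by (simp add: sum_subtractf sum.delta Y_sum[OF l])
  finally have e: "(\<Sum>j<n. Y l j * Z j) = Y l j0 * 2 ^ (10 * x) - 1" .
  have "q j0 / 2 \<le> Y l j0"
  proof -
   have "1 / 2 * q j0 \<le> (1 - \<rho>) * q j0" using \<rho> qpos[OF j0] by (intro mult_right_mono) auto
   moreover have "(1 - \<rho>) * q j0 \<le> Y l j0 \<or> Y l j0 = q j0" using \<rho>(1) by (simp add: Y_def)
   ultimately show ?thesis using qpos[OF j0] by linarith
  qed
  then have "q j0 / 2 * 2 ^ (10 * x) \<le> Y l j0 * 2 ^ (10 * x)" by (intro mult_right_mono) auto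
  moreover have "2 ^ (9 * x) * (1 / 2) \<le> q j0 / 2 * 2 ^ (10 * x)"
  proof -
   have "2 ^ (9 * x) * (1 / 2) * 1 \<le> 2 ^ (9 * x) * (1 / 2) * (2 ^ x * q j0)" using q_ge[OF j0] by (intro mult_left_mono) auto
   also have "\<dots> = q j0 / 2 * (2 ^ (9 * x) * 2 ^ x)" by simp
   also have "2 ^ (9 * x) * 2 ^ x = (2::real) ^ (10 * x)" by (simp flip: power_add)
   finally show ?thesis by simp
  qed
  moreover have "12 * real n + 2 < 2 ^ (9 * x) * (1 / 2)"
  proof -
   have "2 ^ x * 2 ^ 5 \<le> (2::real) ^ x * 2 ^ (8 * x)" using x0 by (intro mult_left_mono power_increasing) auto
   also have "\<dots> = 2 ^ (9 * x)" by (simp flip: power_add)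
   finally have "2 ^ x * 32 \<le> (2::real) ^ (9 * x)" by simp
   moreover have "(2::real) ^ 1 \<le> 2 ^ x" using x0 by (intro power_increasing) auto
   then have "(2::real) \<le> 2 ^ x" by (simp only: power_one_right)
   ultimately show ?thesis using n_less by linarith
  qed
  ultimately show ?thesis using e by linarith
 qed
qed

text \<open>By Walras' law the exact excess has value 0 at P, so only the rounding offset of at most
  2 per unit of price remains there. At q the exact excess is nonnegative and the offset contributes
  at least 1, of which the pulled points lose at most 1/2.\<close>

lemma high_direction_bounds:
 assumes high: "high_direction P b Z" and tot: "(\<Sum>j<n. P j) = n * M"
 defines "z \<equiv> demand_excess n (\<lambda>j. real_of_int (P j)) b"
 shows "\<And>j. j < n ==> \<bar>real_of_int (Z j)\<bar> \<le> 2 ^ (182 * x)" "(\<Sum>j<n. P j * Z j) \<le> 2 * (n * M)"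
  "\<And>l. l < n ==> 1 / 2 \<le> (\<Sum>j<n. Y l j * Z j)" "2 ^ (170 * x) * (\<Sum>j<n. q j * z j) + 1 \<le> (\<Sum>j<n. Y 0 j * Z j)"
  "\<And>j. j < n ==> 0 < P j"
proof -
 define S where "S = (2::real) ^ (170 * x)"
 define D where "D j = (\<Sum>i | i < n \<and> b i = j. P i)" for j
 have big: "\<And>j. j < n ==> n * M < P j * 2 ^ (10 * x)" and b: "best_goods n u (\<lambda>j. real_of_int (P j)) b"
  and Z: "\<And>j. j < n ==> Z j = (2 ^ (170 * x) * D j) div P j + 2 - 2 ^ (170 * x)"
  using high unfolding high_direction_def D_def by auto
 have nM: "0 < n * M" using n0 M0 by simp
 show P: "0 < P j" if "j < n" for j
 proof -
  have "0 < P j * 2 ^ (10 * x)" using big[OF that] nM by linarith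
  then show ?thesis by (simp add: zero_less_mult_iff)
 qed
 have zj: "z j = D j / P j - 1" for j by (simp add: z_def demand_excess_def D_def)
 have ZS: "S * z j + 1 \<le> Z j" "Z j \<le> S * z j + 2" if j: "j < n" for j
 proof -
  have "real_of_int ((2 ^ (170 * x) * D j) div P j) = of_int \<lfloor>real_of_int (2 ^ (170 * x) * D j) / real_of_int (P j)\<rfloor>"
   by (simp only: floor_divide_of_int_eq)
  also have "real_of_int (2 ^ (170 * x) * D j) / real_of_int (P j) = S * (z j + 1)" by (simp add: S_def zj)
  finally have "real_of_int (Z j) = of_int \<lfloor>S * (z j + 1)\<rfloor> + 2 - S" by (simp add: Z[OF j] S_def)
  moreover have "S * (z j + 1) = S * z j + S" by (simp add: distrib_left)
  moreover have "S * (z j + 1) - 1 \<le> of_int \<lfloor>S * (z j + 1)\<rfloor>" "of_int \<lfloor>S * (z j + 1)\<rfloor> \<le> S * (z j + 1)" by linarith+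
  ultimately show "S * z j + 1 \<le> Z j" "Z j \<le> S * z j + 2" by linarith+
 qed
 have D0: "0 \<le> D j" for j unfolding D_def using P by (intro sum_nonneg) (auto intro: less_imp_le)
 have z1: "- 1 \<le> z j" if "j < n" for j using D0[of j] P[OF that] by (simp add: zj)
 have D1: "D j \<le> n * M" for j
  unfolding D_def tot[symmetric] using P by (intro sum_mono2) (auto intro: less_imp_le)
 have z2: "z j \<le> 2 ^ (10 * x)" if "j < n" for j
 proof -
  have "D j \<le> P j * 2 ^ (10 * x)" using D1[of j] big[OF that] by linarith
  then have "real_of_int (D j) \<le> real_of_int (P j * 2 ^ (10 * x))" by (simp only: of_int_le_iff)
  then have "D j / P j \<le> 2 ^ (10 * x)" using P[OF that] by (simp add: pos_divide_le_eq mult.commute)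
  then show ?thesis by (simp add: zj)
 qed
 have S1: "1 \<le> S" by (simp add: S_def)
 show "\<bar>real_of_int (Z j)\<bar> \<le> 2 ^ (182 * x)" if j: "j < n" for j
 proof -
  have "S * z j \<le> S * 2 ^ (10 * x)" "S * (- 1) \<le> S * z j" using z1[OF j] z2[OF j] S1 by (intro mult_left_mono; simp)+
  moreover have "S * 2 ^ (10 * x) = 2 ^ (180 * x)" by (simp add: S_def flip: power_add)
  moreover have "(2::real) ^ (180 * x) * 2 ^ 2 \<le> 2 ^ (180 * x) * 2 ^ (2 * x)" using x0 by (intro mult_left_mono power_increasing) auto
  then have "4 * (2::real) ^ (180 * x) \<le> 2 ^ (182 * x)" by (simp flip: power_add)
  moreover have "S \<le> 2 ^ (180 * x)" "(1::real) \<le> 2 ^ (180 * x)" unfolding S_def by (auto intro: power_increasing)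
  ultimately show ?thesis using ZS[OF j] by linarith
 qed
 show "(\<Sum>j<n. P j * Z j) \<le> 2 * (n * M)"
 proof -
  have bn: "b ` {..<n} \<subseteq> {..<n}" using b by (auto simp: best_goods_def)
  have "(\<Sum>j<n. D j) = (\<Sum>j<n. P j)"
   using sum.group[OF _ _ bn, of P] by (simp add: D_def)
  then have e: "(\<Sum>j<n. real_of_int (D j)) = (\<Sum>j<n. real_of_int (P j))" by (simp flip: of_int_sum)
  have "real_of_int (\<Sum>j<n. P j * Z j) = (\<Sum>j<n. real_of_int (P j) * Z j)" by simp
  also have "\<dots> \<le> (\<Sum>j<n. real_of_int (P j) * (S * z j + 2))" using ZS(2) P by (intro sum_mono mult_left_mono) (auto intro: less_imp_le)
  also have "\<dots> = (\<Sum>j<n. S * D j - S * P j + 2 * P j)"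
  proof (rule sum.cong[OF refl])
   fix j assume "j \<in> {..<n}"
   then have "P j * z j = D j - P j" using P[of j] by (simp add: zj right_diff_distrib)
   then have "S * (P j * z j) = S * D j - S * P j" by (simp add: right_diff_distrib)
   then show "real_of_int (P j) * (S * z j + 2) = S * D j - S * P j + 2 * P j" by (simp add: algebra_simps)
  qed
  also have "\<dots> = 2 * (\<Sum>j<n. real_of_int (P j))" by (simp add: sum.distrib sum_subtractf e flip: sum_distrib_left)
  also have "\<dots> = real_of_int (2 * (n * M))" using arg_cong[OF tot, of real_of_int] by simp
  finally show ?thesis by (simp only: of_int_le_iff)
 qed
 define A where "A = (\<Sum>j<n. q j * Z j)"
 have A: "S * (\<Sum>j<n. q j * z j) + 1 \<le> A"
 proof -
  have "S * (\<Sum>j<n. q j * z j) + (\<Sum>j<n. q j) = (\<Sum>j<n. q j * (S * z j + 1))"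
   by (simp add: sum.distrib sum_distrib_left distrib_left mult.left_commute)
  also have "\<dots> \<le> A" unfolding A_def using ZS(1) qpos by (intro sum_mono mult_left_mono) (auto intro: less_imp_le)
  finally show ?thesis using qsum by simp
 qed
 then show "2 ^ (170 * x) * (\<Sum>j<n. q j * z j) + 1 \<le> (\<Sum>j<n. Y 0 j * Z j)" by (simp add: S_def A_def Y_def)
 have "0 \<le> (\<Sum>j<n. q j * z j)" unfolding z_def
  by (rule equilibrium_value_of_excess_nonneg[OF market eq _ b]) (use P in auto)
 then have "0 \<le> S * (\<Sum>j<n. q j * z j)" using S1 by (intro mult_nonneg_nonneg) auto
 then have A1: "1 \<le> A" using A by linarith
 show "1 / 2 \<le> (\<Sum>j<n. Y l j * Z j)" if l: "l < n" for l
 proof (cases "l = 0")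
  case True then show ?thesis using A1 by (simp add: Y_def A_def)
 next
  case False
  have "(\<Sum>j<n. Y l j * Z j) = (\<Sum>j<n. (1 - \<rho>) * (q j * Z j) + (if j = l then \<rho> * Z j else 0))"
   using False by (intro sum.cong) (auto simp: Y_def distrib_right)
  also have "\<dots> = (1 - \<rho>) * A + \<rho> * Z l" using l by (simp add: sum.distrib sum.delta A_def flip: sum_distrib_left)
  finally have e: "(\<Sum>j<n. Y l j * Z j) = (1 - \<rho>) * A + \<rho> * Z l" .
  have "(1 - \<rho>) * 1 \<le> (1 - \<rho>) * A" using A1 \<rho> by (intro mult_left_mono) auto
  moreover have "\<rho> * (1 - S) \<le> \<rho> * Z l"
  proof -
   have "S * (- 1) \<le> S * z l" using z1[OF l] S1 by (intro mult_left_mono) auto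
   then show ?thesis using ZS(1)[OF l] \<rho> by (intro mult_left_mono) auto
  qed
  moreover have "\<rho> * (1 - S) = \<rho> - 1 / 2" using \<rho>(3) by (simp add: S_def right_diff_distrib mult.commute)
  ultimately have "1 - \<rho> \<le> (1 - \<rho>) * A" "\<rho> - 1 / 2 \<le> \<rho> * Z l" by (simp_all only: mult_1_right)
  then show ?thesis unfolding e by linarith
 qed
qed

text \<open>The row values sum to at most 2 n M in both cases. Above the threshold 12 n M the
  largest value is therefore more than four times the sum, as \<open>cut_growth\<close>
  requires.\<close>

lemma main_step:
 assumes I: "main_inv V t" and t: "t \<le> rounds" and P: "\<And>j. j < n ==> P j = (\<Sum>k<n. V k j)"
  and d: "low_direction P j0 Z \<or> high_direction P b Z"
  and a: "\<And>k. k < n ==> a k = (\<Sum>j<n. V k j * Z j)" and r: "r < n" "\<And>k. k < n ==> a k \<le> a r" and ar: "12 * n * M < a r"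
 shows "main_inv (cut_step n (8 * int n ^ 2) M V a r) (Suc t)"
proof -
 have tot: "(\<Sum>j<n. P j) = n * M" by (rule main_total[OF I]) (rule P)
 have nM: "0 < n * M" using n0 M0 by simp
 have ar0: "0 < a r" using ar nM by linarith
 have Zb: "\<bar>real_of_int (Z j)\<bar> \<le> 2 ^ (182 * x)" if "j < n" for j
  using d
 proof
  assume "low_direction P j0 Z" then show ?thesis by (rule low_direction_bounds(1)[OF _ tot that])
 next
  assume "high_direction P b Z" then show ?thesis by (rule high_direction_bounds(1)[OF _ tot that])
 qed
 have "(\<Sum>j<n. P j * Z j) \<le> 2 * (n * M)"
  using d
 proof
  assume "low_direction P j0 Z" then have "(\<Sum>j<n. P j * Z j) \<le> 0" by (rule low_direction_bounds(2)[OF _ tot])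
  then show ?thesis using nM by linarith
 next
  assume "high_direction P b Z" then show ?thesis by (rule high_direction_bounds(2)[OF _ tot])
 qed
 then have as: "4 * (\<Sum>k<n. a k) \<le> a r" using main_a_sum[OF P a] ar nM by linarith
 have Yz: "1 / 2 \<le> (\<Sum>j<n. Y l j * Z j)" if "l < n" for l
  using d
 proof
  assume "low_direction P j0 Z" then have "12 * real n + 1 < (\<Sum>j<n. Y l j * Z j)" by (rule low_direction_bounds(3)[OF _ tot that])
  then show ?thesis by linarith
 next
  assume "high_direction P b Z" then show ?thesis by (rule high_direction_bounds(3)[OF _ tot that])
 qed
 obtain \<Lambda> where \<Lambda>: "cone_inv n M Y (real (t * n)) (q 0 * \<rho> ^ (n - 1) * (1 + 1 / (16 * real n ^ 2)) ^ t) V \<Lambda>"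
  using I unfolding main_inv_def by blast
 have "real (t * n) * real_of_int (\<Sum>j<n. \<bar>Z j\<bar>) \<le> M * (\<Sum>j<n. Y l j * Z j)" if l: "l < n" for l
 proof -
  have "real (t * n) * (\<Sum>j<n. \<bar>real_of_int (Z j)\<bar>) \<le> M / 2" by (rule drift_bound[OF t Zb])
  also have "M / 2 = M * (1 / 2)" by simp
  also have "\<dots> \<le> M * (\<Sum>j<n. Y l j * Z j)" using Yz[OF l] M0 by (intro mult_left_mono) auto
  finally show ?thesis by simp
 qed
 then have "\<exists>\<Lambda>'. cone_inv n M Y (real (t * n) + n) (q 0 * \<rho> ^ (n - 1) * (1 + 1 / (16 * real n ^ 2)) ^ t * (1 + 1 / (16 * real n ^ 2)))
   (cut_step n (8 * int n ^ 2) M V a r) \<Lambda>'"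
  by (intro cone_inv_step[OF \<Lambda> n0, where Z = Z] a r ar0 as) (use q0_pos \<rho> in auto)
 then have "\<exists>\<Lambda>'. cone_inv n M Y (real (Suc t * n)) (q 0 * \<rho> ^ (n - 1) * (1 + 1 / (16 * real n ^ 2)) ^ Suc t)
   (cut_step n (8 * int n ^ 2) M V a r) \<Lambda>'"
  by (simp add: ac_simps)
 moreover have "\<bar>real_of_int (cut_step n (8 * int n ^ 2) M V a r k j)\<bar> \<le> M * (1 + 1 / real n ^ 2) ^ Suc t" if kj: "k < n" "j < n" for k j
 proof -
  define H where "H = M * (1 + 1 / real n ^ 2) ^ t"
  have "2 * real n ^ 3 \<le> 2 ^ x * (2 ^ x) ^ 3"
   using n_less two_pow[of 1] by (intro mult_mono power_mono) auto
  also have "\<dots> = 2 ^ (4 * x)" by (simp flip: power_mult power_add)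
  also have "\<dots> \<le> 2 ^ (210 * x) * 1" by (auto intro: power_increasing)
  also have "\<dots> \<le> 2 ^ (210 * x) * (1 + 1 / real n ^ 2) ^ t" by (intro mult_left_mono one_le_power) auto
  finally have "2 * real n ^ 3 \<le> H" by (simp add: H_def M_def)
  moreover have "\<And>k j. k < n ==> j < n ==> \<bar>real_of_int (V k j)\<bar> \<le> H" using I unfolding main_inv_def H_def by blast
  ultimately have "\<bar>real_of_int (cut_step n (8 * int n ^ 2) M V a r k j)\<bar> \<le> H * (1 + 1 / real n ^ 2)"
   using cut_step_bound[where V = V and a = a and M = M and H = H and r = r and c = "8 * int n ^ 2", OF n0 _ _ main_row_sum[OF I] r(1) ar0 r(2) kj refl] by blast
  then show ?thesis by (simp add: H_def ac_simps)
 qed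
 ultimately show ?thesis unfolding main_inv_def by blast
qed

text \<open>A coordinate cut always exceeds the threshold; hence when the iteration stops, the
  direction is an excess demand at positive prices.\<close>

lemma main_low:
 assumes I: "main_inv V t" and t: "t \<le> rounds" and P: "\<And>j. j < n ==> P j = (\<Sum>k<n. V k j)" and low: "low_direction P j0 Z"
  and a: "\<And>k. k < n ==> a k = (\<Sum>j<n. V k j * Z j)" and r: "\<And>k. k < n ==> a k \<le> a r"
 shows "12 * n * M < a r"
proof -
 have tot: "(\<Sum>j<n. P j) = n * M" by (rule main_total[OF I]) (rule P)
 note lo = low_direction_bounds[OF low tot]
 have "real_of_int M * (12 * real n + 1) < M * (\<Sum>j<n. Y 0 j * Z j)" using lo(3)[OF n0] M0 by (intro mult_strict_left_mono) auto
 also have "\<dots> \<le> a r + M / 2" by (rule main_argmax[OF I t lo(1) a r n0])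
 finally have "real_of_int (12 * n * M) < a r" using M0 by (simp add: algebra_simps)
 then show ?thesis by (simp only: of_int_less_iff)
qed

text \<open>If no row has value above 12 n M, the scaled value at q is at most about 12 n, and
  undoing the factor \<open>2 ^ (170 * x)\<close> makes the excess tiny.\<close>

lemma main_stop:
 assumes I: "main_inv V t" and t: "t \<le> rounds" and P: "\<And>j. j < n ==> P j = (\<Sum>k<n. V k j)" and high: "high_direction P b Z"
  and a: "\<And>k. k < n ==> a k = (\<Sum>j<n. V k j * Z j)" and r: "\<And>k. k < n ==> a k \<le> a r" and ar: "\<not> 12 * n * M < a r"
 shows "2 ^ (170 * x) * (\<Sum>j<n. q j * demand_excess n (\<lambda>j. real_of_int (P j)) b j) \<le> 12 * real n"
proof -
 have tot: "(\<Sum>j<n. P j) = n * M" by (rule main_total[OF I]) (rule P)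
 note hi = high_direction_bounds[OF high tot]
 define B where "B = (\<Sum>j<n. Y 0 j * Z j)"
 have "real_of_int (a r) \<le> real_of_int (12 * n * M)" using ar by (simp only: of_int_le_iff not_less)
 moreover have "M * B \<le> a r + M / 2" unfolding B_def by (rule main_argmax[OF I t hi(1) a r n0])
 ultimately have "M * B \<le> M * (12 * real n + 1 / 2)" by (simp add: algebra_simps)
 then have "B \<le> 12 * real n + 1 / 2" using M0 by simp
 then show ?thesis using hi(4) unfolding B_def by linarith
qed

text \<open>The stretching factor compounds to at most exp (4000 n x), below 2^(8000 n x); the
  initial entries have 210 x bits.\<close>

lemma main_bound:
 assumes I: "main_inv V t" and t: "t \<le> rounds" and kj: "k < n" "j < n"
 shows "\<bar>V k j\<bar> \<le> 2 ^ (8210 * n * x)"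
proof -
 have "(1 + 1 / real n ^ 2) ^ t \<le> (1 + 1 / real n ^ 2) ^ rounds" using t by (intro power_increasing) auto
 also have "\<dots> \<le> exp (1 / real n ^ 2) ^ rounds" by (intro power_mono) (auto simp: exp_ge_add_one_self)
 also have "\<dots> = exp (real (4000 * n * x) * 1)" using n0 by (simp add: rounds_def power2_eq_square power3_eq_cube flip: exp_of_nat_mult)
 also have "\<dots> = exp 1 ^ (4000 * n * x)" by (rule exp_of_nat_mult)
 also have "\<dots> \<le> (2 ^ 2) ^ (4000 * n * x)" using exp_le by (intro power_mono) auto
 also have "\<dots> = 2 ^ (8000 * n * x)" by (simp only: power_mult[symmetric] mult.assoc[symmetric]) simp
 finally have "real_of_int M * (1 + 1 / real n ^ 2) ^ t \<le> real_of_int M * (2::real) ^ (8000 * n * x)" using M0 by (intro mult_left_mono) auto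
 also have "\<dots> = 2 ^ (210 * x + 8000 * n * x)" by (simp add: M_def power_add)
 also have "\<dots> \<le> 2 ^ (8210 * n * x)" using n0 by (intro power_increasing) auto
 finally have "real_of_int \<bar>V k j\<bar> \<le> real_of_int (2 ^ (8210 * n * x))" using I kj unfolding main_inv_def by fastforce
 then show ?thesis by (simp only: of_int_le_iff)
qed

text \<open>After all rounds the determinant would have grown by 2^(250 n x), but the initial value
  and n! are only about (171 n) x bits apart from each other.\<close>

lemma main_end: "\<not> main_inv V rounds"
proof
 assume "main_inv V rounds"
 then obtain \<Lambda> \<epsilon> where "cone_inv n M Y \<epsilon> (q 0 * \<rho> ^ (n - 1) * (1 + 1 / (16 * real n ^ 2)) ^ rounds) V \<Lambda>" unfolding main_inv_def by blast
 then have 1: "q 0 * \<rho> ^ (n - 1) * (1 + 1 / (16 * real n ^ 2)) ^ rounds \<le> fact n" by (rule cone_inv_det_le)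
 have "rounds = 16 * n ^ 2 * (250 * n * x)" by (simp add: rounds_def power2_eq_square power3_eq_cube)
 moreover have "real (16 * n ^ 2) = 16 * real n ^ 2" by simp
 ultimately have "(1 + 1 / (16 * real n ^ 2)) ^ rounds = ((1 + 1 / real (16 * n ^ 2)) ^ (16 * n ^ 2)) ^ (250 * n * x)" by (simp only: power_mult[symmetric])
 moreover have "2 ^ (250 * n * x) \<le> ((1 + 1 / real (16 * n ^ 2)) ^ (16 * n ^ 2)) ^ (250 * n * x)"
  using n0 by (intro power_mono two_le_power) auto
 ultimately have "2 ^ (250 * n * x) \<le> (1 + 1 / (16 * real n ^ 2)) ^ rounds" by simp
 then have "q 0 * \<rho> ^ (n - 1) * 2 ^ (250 * n * x) \<le> q 0 * \<rho> ^ (n - 1) * (1 + 1 / (16 * real n ^ 2)) ^ rounds"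
  using q0_pos \<rho> by (intro mult_left_mono) auto
 then have "q 0 * \<rho> ^ (n - 1) * 2 ^ (250 * n * x) \<le> fact n" using 1 by (rule order_trans)
 then have i1: "2 ^ x * (2 ^ (170 * x + 1)) ^ (n - 1) * (q 0 * \<rho> ^ (n - 1) * 2 ^ (250 * n * x)) \<le> 2 ^ x * (2 ^ (170 * x + 1)) ^ (n - 1) * fact n"
  by (intro mult_left_mono) auto
 have "2 ^ (170 * x + 1) * \<rho> = 1" by (simp add: \<rho>_def)
 then have o: "(2 ^ (170 * x + 1)) ^ (n - 1) * \<rho> ^ (n - 1) = 1" by (simp only: power_mult_distrib[symmetric] power_one)
 have "2 ^ x * (2 ^ (170 * x + 1)) ^ (n - 1) * (q 0 * \<rho> ^ (n - 1) * 2 ^ (250 * n * x)) =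
  (2 ^ x * q 0) * 2 ^ (250 * n * x) * ((2 ^ (170 * x + 1)) ^ (n - 1) * \<rho> ^ (n - 1))" by (simp only: ac_simps)
 also have "\<dots> = (2 ^ x * q 0) * 2 ^ (250 * n * x)" unfolding o by (simp only: mult_1_right)
 finally have i2: "(2 ^ x * q 0) * 2 ^ (250 * n * x) = 2 ^ x * (2 ^ (170 * x + 1)) ^ (n - 1) * (q 0 * \<rho> ^ (n - 1) * 2 ^ (250 * n * x))" by (rule sym)
 have "1 * 2 ^ (250 * n * x) \<le> (2 ^ x * q 0) * 2 ^ (250 * n * x)" using q_ge[OF n0] by (intro mult_right_mono) auto
 also have "\<dots> \<le> 2 ^ x * (2 ^ (170 * x + 1)) ^ (n - 1) * fact n" unfolding i2 by (rule i1)
 finally have 2: "(2::real) ^ (250 * n * x) \<le> 2 ^ x * (2 ^ (170 * x + 1)) ^ (n - 1) * fact n" by (simp only: mult_1)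
 have "(fact n :: real) \<le> real n ^ n" by (simp add: fact_le_power flip: of_nat_power)
 also have "\<dots> \<le> (2 ^ x) ^ n" using n_less by (intro power_mono) auto
 finally have "(2::real) ^ x * (2 ^ (170 * x + 1)) ^ (n - 1) * fact n \<le> 2 ^ x * (2 ^ (170 * x + 1)) ^ (n - 1) * (2 ^ x) ^ n"
  by (intro mult_left_mono) auto
 also have "\<dots> = 2 ^ (x + (170 * x + 1) * (n - 1) + x * n)" by (simp only: power_mult power_add)
 also have "\<dots> < 2 ^ (250 * n * x)"
 proof (rule power_strict_increasing)
  define A where "A = (170 * x + 1) * (n - 1)"
  have "A \<le> 171 * x * n" unfolding A_def using x0 by (intro mult_le_mono) auto
  moreover have "x \<le> x * n" "0 < x * n" using n0 x0 by auto
  moreover have "n * x = x * n" by simp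
  ultimately have "x + A + x * n < 250 * (x * n)" "250 * (x * n) = 250 * n * x" by linarith+
  then show "x + (170 * x + 1) * (n - 1) + x * n < 250 * n * x" unfolding A_def by simp
 qed simp
 finally show False using 2 by simp
qed

text \<open>The prices relative to \<open>P (lab j)\<close> are close to fractions with numerator and denominator at most
  \<open>2 ^ (18 * x)\<close>, so the continued fraction expansion recovers them exactly.\<close>

lemma readout_equilibrium:
 fixes P h k :: "nat => int" and E :: int
 assumes P: "\<And>j. j < n ==> 0 < P j" and b: "best_goods n u (\<lambda>j. real_of_int (P j)) b"
  and z: "2 ^ (170 * x) * (\<Sum>j<n. q j * demand_excess n (\<lambda>j. real_of_int (P j)) b j) \<le> 12 * real n"
  and E: "1 \<le> E" "E \<le> 2 ^ (6 * x)"
  and G: "G = {(i, j). i < n \<and> j < n \<and> 2 ^ (70 * x) * (int (u i (b i)) * P j) \<le> (2 ^ (70 * x) + E) * (int (u i j) * P (b i))}"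
  and gap: "\<And>i j. i < n ==> j < n ==> (i, j) \<notin> G ==>
   (2 ^ (70 * x) + 10 * int n ^ 2 * E) * (int (u i j) * P (b i)) < 2 ^ (70 * x) * (int (u i (b i)) * P j)"
  and lab: "\<And>i j. (i, j) \<in> G ==> lab i = lab j" "\<And>j. j < n ==> (j, lab j) \<in> (G \<union> G\<inverse>)\<^sup>*"
  and hk: "\<And>j. j < n ==> good_convergent (P j) (P (lab j)) (2 ^ (20 * x)) (h j) (k j)"
 shows "equilibrium_prices n u (\<lambda>j. real_of_int (P (lab j) * h j) / k j)"
proof -
 define T where "T = (2::real) ^ (70 * x)"
 define \<epsilon> where "\<epsilon> = E / T"
 \<comment> \<open>The largest value with \<open>4 * \<kappa> \<le> \<epsilon>\<close> that is
   available for every E \<ge> 1.\<close>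
 define \<kappa> where "\<kappa> = 1 / (4 * T)"
 define p where "p j = real_of_int (P j)" for j
 have T0: "0 < T" by (simp add: T_def)
 have \<epsilon>0: "0 < \<epsilon>" using E T0 by (simp add: \<epsilon>_def)
 have Er: "real_of_int E \<le> 2 ^ (6 * x)"
 proof -
  have "real_of_int E \<le> real_of_int (2 ^ (6 * x))" using E(2) by (simp only: of_int_le_iff)
  then show ?thesis by simp
 qed
 have \<epsilon>T: "\<epsilon> \<le> 2 ^ (6 * x) / T" unfolding \<epsilon>_def using Er T0 by (intro divide_right_mono) auto
 have RB: "real_of_int (rational_bound n U) \<le> 2 ^ (18 * x)"
 proof -
  have "real_of_int (rational_bound n U) \<le> real_of_int (2 ^ (18 * x))" using rational_bound_le by (simp only: of_int_le_iff)
  then show ?thesis by simp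
 qed
 have RB0: "0 \<le> real_of_int (rational_bound n U)" by (simp add: rational_bound_def)
 have n2: "real n ^ 2 \<le> 2 ^ (2 * x)"
 proof -
  have "real n ^ 2 \<le> (2 ^ x) ^ 2" using n_less by (intro power_mono) auto
  then show ?thesis by (simp flip: power_mult add: mult.commute)
 qed
 have e8: "8 * real n ^ 2 * \<epsilon> \<le> 2 ^ (11 * x) / T"
 proof -
  have "8 * real n ^ 2 * \<epsilon> \<le> 2 ^ (3 * x) * 2 ^ (2 * x) * (2 ^ (6 * x) / T)"
   using two_pow[of 3] n2 \<epsilon>T \<epsilon>0 by (intro mult_mono) auto
  then show ?thesis by (simp flip: power_add)
 qed
 have e8s: "8 * real n ^ 2 * \<epsilon> * (real U * of_int (rational_bound n U)) < 1"
 proof -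
  have "8 * real n ^ 2 * \<epsilon> * (real U * of_int (rational_bound n U)) \<le> 2 ^ (11 * x) / T * (2 ^ x * 2 ^ (18 * x))"
   using e8 U_less RB RB0 T0 by (intro mult_mono) auto
  also have "\<dots> = 2 ^ (30 * x) / T" by (simp flip: power_add)
  also have "\<dots> < 1" using T0 x0 by (simp add: T_def power_strict_increasing)
  finally show ?thesis .
 qed
 have \<phi>: "1 / 2 ^ (19 * x) \<le> f i j" if "i < n" "j < n" "0 < f i j" for i j
  using flow_ge[OF that] by (simp add: divide_le_eq mult.commute)
 \<comment> \<open>\<open>\<kappa>\<^sup>2\<close> is 2^(-140 x)/16 and positive flows are at least
   2^(-19 x); their product still exceeds 12 n / 2^(170 x). This fixes the precision 170 x.\<close>
 have zz: "(\<Sum>j<n. q j * demand_excess n p b j) \<le> \<kappa>\<^sup>2 * (1 / 2 ^ (19 * x))"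
 proof -
  have "12 * real n * 16 * 2 ^ (159 * x) \<le> 2 ^ (10 * x) * 2 ^ x * 2 ^ (159 * x)"
   using two_pow[of 8] n_less
  proof -
   have "(2::real) ^ (8 * x) \<le> 2 ^ (10 * x)" by (auto intro: power_increasing)
   moreover have "(256::real) \<le> 2 ^ (8 * x)" using two_pow[of 8] by simp
   ultimately have "(192::real) \<le> 2 ^ (10 * x)" by linarith
   then have "192 * real n \<le> 2 ^ (10 * x) * 2 ^ x" using n_less by (intro mult_mono) auto
   then show ?thesis by (intro mult_right_mono) auto
  qed
  also have "\<dots> = 2 ^ (170 * x)" by (simp flip: power_add)
  finally have "12 * real n / 2 ^ (170 * x) \<le> 1 / (16 * 2 ^ (159 * x))" by (simp add: field_simps)
  moreover have "(\<Sum>j<n. q j * demand_excess n p b j) \<le> 12 * real n / 2 ^ (170 * x)"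
   using z by (simp add: p_def[abs_def] pos_le_divide_eq mult.commute)
  moreover have "\<kappa>\<^sup>2 * (1 / 2 ^ (19 * x)) = 1 / (16 * (T * T * 2 ^ (19 * x)))" by (simp add: \<kappa>_def power2_eq_square)
  moreover have "T * T * 2 ^ (19 * x) = 2 ^ (159 * x)" by (simp add: T_def flip: power_add)
  ultimately show ?thesis by simp
 qed
 have \<kappa>: "0 \<le> \<kappa>" "4 * \<kappa> \<le> \<epsilon>" using E T0 by (simp_all add: \<kappa>_def \<epsilon>_def divide_right_mono)
 have Gr: "G = {(i, j). i < n \<and> j < n \<and> u i (b i) * p j \<le> (1 + \<epsilon>) * (u i j * p (b i))}"
 proof -
  have "2 ^ (70 * x) * (int (u i (b i)) * P j) \<le> (2 ^ (70 * x) + E) * (int (u i j) * P (b i)) \<longleftrightarrow>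
   u i (b i) * p j \<le> (1 + \<epsilon>) * (u i j * p (b i))" for i j
  proof -
   have "2 ^ (70 * x) * (int (u i (b i)) * P j) \<le> (2 ^ (70 * x) + E) * (int (u i j) * P (b i)) \<longleftrightarrow>
    real_of_int (2 ^ (70 * x) * (int (u i (b i)) * P j)) \<le> real_of_int ((2 ^ (70 * x) + E) * (int (u i j) * P (b i)))" by (simp only: of_int_le_iff)
   also have "\<dots> \<longleftrightarrow> T * (u i (b i) * p j) \<le> T * ((1 + \<epsilon>) * (u i j * p (b i)))"
    using T0 by (simp add: T_def[symmetric] p_def \<epsilon>_def distrib_left distrib_right add_divide_distrib)
   finally show ?thesis using T0 by simp
  qed
  then show ?thesis unfolding G by blast
 qed
 have gapr: "(1 + 10 * real n ^ 2 * \<epsilon>) * (u i j * p (b i)) < u i (b i) * p j" if "i < n" "j < n" "(i, j) \<notin> G" for i j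
 proof -
  have "real_of_int ((2 ^ (70 * x) + 10 * int n ^ 2 * E) * (int (u i j) * P (b i))) < real_of_int (2 ^ (70 * x) * (int (u i (b i)) * P j))"
   using gap[OF that] by (simp only: of_int_less_iff)
  then have "T * ((1 + 10 * real n ^ 2 * \<epsilon>) * (u i j * p (b i))) < T * (u i (b i) * p j)"
   using T0 by (simp add: T_def[symmetric] p_def \<epsilon>_def distrib_left distrib_right)
  then show ?thesis using T0 by simp
 qed
 have "\<exists>p' f' N. meq n u p' f' \<and> (\<forall>j<n. (0::int) < N j \<and> N j \<le> rational_bound n U \<and> lab j < n \<and>
  p' j = p (lab j) * N j / N (lab j) \<and> \<bar>p j / p (lab j) - N j / N (lab j)\<bar> \<le> 8 * real n ^ 2 * \<epsilon> * (p j / p (lab j)))"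
  by (rule equilibrium_near_good_prices[OF market eq forest _ _ zz \<phi> _ \<kappa> \<epsilon>0 e8s Gr gapr lab]) (use P b in \<open>auto simp: p_def[abs_def]\<close>)
 then obtain p' f' N where m': "meq n u p' f'" and N: "\<And>j. j < n ==> (0::int) < N j" "\<And>j. j < n ==> N j \<le> rational_bound n U"
  and ln: "\<And>j. j < n ==> lab j < n" and p': "\<And>j. j < n ==> p' j = p (lab j) * N j / N (lab j)"
  and cl: "\<And>j. j < n ==> \<bar>p j / p (lab j) - N j / N (lab j)\<bar> \<le> 8 * real n ^ 2 * \<epsilon> * (p j / p (lab j))" by blast
 have hkN: "real_of_int (h j) / k j = N j / N (lab j)" if j: "j < n" for j
 proof -
  define y where "y = p j / p (lab j)"
  define m where "m = real_of_int (N j) / N (lab j)"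
  define d where "d = 8 * real n ^ 2 * \<epsilon>"
  have y0: "0 < y" using P[OF j] P[OF ln[OF j]] by (simp add: y_def p_def)
  have Nb: "real_of_int (N i) \<le> 2 ^ (18 * x)" if "i < n" for i
  proof -
   have "real_of_int (N i) \<le> real_of_int (rational_bound n U)" using N(2)[OF that] by (simp only: of_int_le_iff)
   then show ?thesis using RB by linarith
  qed
  have "1 \<le> real_of_int (N (lab j))" using N(1)[OF ln[OF j]] by simp
  then have "m \<le> real_of_int (N j) / 1" unfolding m_def using N(1)[OF j] by (intro divide_left_mono) auto
  then have "m \<le> real_of_int (N j)" by (simp only: div_by_1)
  then have mb: "m \<le> 2 ^ (18 * x)" using Nb[OF j] by linarith
  have d1: "d \<le> 1 / 2 ^ (59 * x)"
  proof -
   have "2 ^ (11 * x) / T = 1 / 2 ^ (59 * x)" by (simp add: T_def frac_eq_eq flip: power_add)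
   then show ?thesis using e8 by (simp add: d_def)
  qed
  have "(2::real) ^ 1 \<le> 2 ^ (59 * x)" using x0 by (intro power_increasing) auto
  then have "1 / 2 ^ (59 * x) \<le> (1 / 2 :: real)" by (intro divide_left_mono) auto
  then have d2: "d \<le> 1 / 2" using d1 by linarith
  have c: "\<bar>y - m\<bar> \<le> d * y" using cl[OF j] by (simp add: y_def m_def d_def)
  have "d * y \<le> 1 / 2 * y" using d2 y0 by (intro mult_right_mono) auto
  then have "y \<le> 2 * m" using c by linarith
  then have y2: "y \<le> 2 * 2 ^ (18 * x)" using mb by linarith
  have "d * y \<le> 1 / 2 ^ (59 * x) * (2 * 2 ^ (18 * x))" using d1 y2 y0 by (intro mult_mono) auto
  then have \<eta>: "\<bar>real_of_int (P j) / P (lab j) - N j / N (lab j)\<bar> \<le> 1 / 2 ^ (59 * x) * (2 * 2 ^ (18 * x))"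
   using c unfolding y_def m_def p_def by linarith
  show ?thesis
  proof (rule good_convergent_unique[OF hk[OF j] P[OF ln[OF j]] N(1)[OF ln[OF j]] _ \<eta>])
   have "(2::int) ^ 2 * 2 ^ (18 * x) \<le> 2 ^ (2 * x) * 2 ^ (18 * x)" using x0 by (intro mult_right_mono power_increasing) auto
   also have "\<dots> = 2 ^ (20 * x)" by (simp flip: power_add)
   finally show "4 * N (lab j) \<le> 2 ^ (20 * x)" using N(2)[OF ln[OF j]] rational_bound_le by simp
   have "real_of_int (2 ^ (20 * x)) * real_of_int (N (lab j)) * (1 / 2 ^ (59 * x) * (2 * 2 ^ (18 * x))) \<le>
    2 ^ (20 * x) * 2 ^ (18 * x) * (1 / 2 ^ (59 * x) * (2 * 2 ^ (18 * x)))"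
    using Nb[OF ln[OF j]] N(1)[OF ln[OF j]] by (intro mult_mono) auto
   also have "\<dots> = 2 * 2 ^ (56 * x) / 2 ^ (59 * x)" by (simp flip: power_add)
   also have "\<dots> \<le> 1 / 4"
   proof -
    have "(2::real) ^ (56 * x) * 2 ^ 3 \<le> 2 ^ (56 * x) * 2 ^ (3 * x)" using x0 by (intro mult_left_mono power_increasing) auto
    then have "8 * (2::real) ^ (56 * x) \<le> 2 ^ (59 * x)" by (simp flip: power_add)
    then show ?thesis by (simp add: divide_le_eq)
   qed
   finally show "real_of_int (2 ^ (20 * x)) * real_of_int (N (lab j)) * (1 / 2 ^ (59 * x) * (2 * 2 ^ (18 * x))) \<le> 1 / 4" .
  qed
 qed
 have "real_of_int (P (lab j) * h j) / k j = p' j" if "j < n" for j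
 proof -
  have "real_of_int (P (lab j) * h j) / k j = p (lab j) * (real_of_int (h j) / k j)" by (simp add: p_def)
  then show ?thesis unfolding hkN[OF that] p'[OF that] by simp
 qed
 then have "meq n u (\<lambda>j. real_of_int (P (lab j) * h j) / k j) f'" using m' unfolding meq_def by simp
 then show ?thesis by (rule meq_imp_equilibrium_prices)
qed

end

section \<open>A small imperative language and its compiler\<close>

datatype ex = N int | A nat ex | B arith_op ex ex

text \<open>Arrays are numbered, and a variable is the entry 0 of an array. \<open>For\<close> and
  \<open>Half\<close> count down: while the body runs, v already holds the decremented or halved
  value. The number after the loop bound is a tag that names the bound on iterations in
  \<open>cost\<close>.\<close>

datatype cm = Skp | St nat ex ex | Sq cm cm | If ex cm cm
 | For nat ex nat cm | Half nat ex nat cm | Rd nat ex | Wr ex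

record hst =
 sto :: "nat => nat => int"
 hin :: "int list"
 hout :: "int list"

definition set_sto :: "hst => nat => nat => int => hst" where
 "set_sto s k i v = s\<lparr>sto := (sto s)(k := (sto s k)(i := v))\<rparr>"

lemma set_sto_simps [simp]:
 "sto (set_sto s k i v) k i = v"
 "k' \<noteq> k ==> sto (set_sto s k i v) k' = sto s k'"
 "i' \<noteq> i ==> sto (set_sto s k i v) k i' = sto s k i'"
 "hin (set_sto s k i v) = hin s" "hout (set_sto s k i v) = hout s"
 by (simp_all add: set_sto_def)

lemma sto_set_sto: "sto (set_sto s k i v) k' i' = (if k' = k \<and> i' = i then v else sto s k' i')"
 by (simp add: set_sto_def)

fun ev :: "hst => ex => int" where
 "ev s (N c) = c"
| "ev s (A k e) = sto s k (nat (ev s e))"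
| "ev s (B f a b) = arith_val f (ev s a) (ev s b)"

fun okE :: "nat => hst => ex => bool" where
 "okE \<beta> s (N c) \<longleftrightarrow> \<bar>c\<bar> < 2 ^ \<beta>"
| "okE \<beta> s (A k e) \<longleftrightarrow> okE \<beta> s e \<and> 0 \<le> ev s e \<and> \<bar>sto s k (nat (ev s e))\<bar> < 2 ^ \<beta>"
| "okE \<beta> s (B f a b) \<longleftrightarrow> okE \<beta> s a \<and> okE \<beta> s b \<and> \<bar>arith_val f (ev s a) (ev s b)\<bar> < 2 ^ \<beta>"

fun szE :: "ex => nat" where
 "szE (N c) = 1" | "szE (A k e) = szE e + 3" | "szE (B f a b) = szE a + szE b + 1"

fun dpE :: "ex => nat" where
 "dpE (N c) = 0" | "dpE (A k e) = dpE e" | "dpE (B f a b) = max (dpE a) (Suc (dpE b))"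

fun arrE :: "ex => nat" where
 "arrE (N c) = 0" | "arrE (A k e) = max (Suc k) (arrE e)" | "arrE (B f a b) = max (arrE a) (arrE b)"

text \<open>Array \<open>k\<close> occupies the addresses congruent to \<open>k\<close> modulo 64; the registers
  \<open>48, \<dots>, 63\<close> are scratch space.\<close>

definition tmp :: nat where "tmp = 48"
definition nar :: nat where "nar = 64"

fun compE :: "nat => ex => prog" where
 "compE d (N c) = Move (Direct d) (Const c)"
| "compE d (A k e) = Seq (compE d e) (Seq (Arith MUL (Direct d) (Reg (Direct d)) (Const (int nar)))
   (Seq (Arith ADD (Direct d) (Reg (Direct d)) (Const (int k))) (Move (Direct d) (Reg (Indirect d)))))"
| "compE d (B f a b) = Seq (compE d a) (Seq (compE (Suc d) b)
   (Arith f (Direct d) (Reg (Direct d)) (Reg (Direct (Suc d)))))"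

definition reprs :: "hst => state => bool" where
 "reprs s \<sigma> \<longleftrightarrow> (\<forall>k<tmp. \<forall>i. reg \<sigma> (nar * i + k) = sto s k i) \<and> inp \<sigma> = hin s \<and> outp \<sigma> = hout s"

lemma len_le:
 assumes "\<bar>v\<bar> < 2 ^ \<beta>" shows "len v \<le> Suc \<beta>"
proof -
 have "nat \<bar>v\<bar> < 2 ^ \<beta>" using assms by (simp add: nat_less_iff)
 then have "floorlog 2 (nat \<bar>v\<bar>) \<le> \<beta>" by (intro floorlog_leI) auto
 then show ?thesis by (simp add: len_def)
qed

lemma len_small: "\<bar>v\<bar> < 2 ^ 7 ==> len v \<le> 8 + \<beta>"
 using len_le[of v 7] by simp

lemma len_nat: "d < nar ==> len (int d) \<le> 8 + \<beta>"
 by (rule len_small) (simp add: nar_def)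

lemma len_big: "\<bar>v\<bar> < 2 ^ \<beta> ==> len v \<le> 8 + \<beta>"
 using len_le[of v \<beta>] by simp

lemma len_addr:
 assumes "0 \<le> v" "v < 2 ^ \<beta>" "k < nar"
 shows "len (v * int nar) \<le> 8 + \<beta>" "len (v * int nar + int k) \<le> 8 + \<beta>"
proof -
 have "v * int nar + int k < (v + 1) * int nar" using assms by (simp add: algebra_simps)
 also have "\<dots> \<le> 2 ^ \<beta> * int nar" using assms by (intro mult_right_mono) auto
 also have "\<dots> \<le> 2 ^ (\<beta> + 7)" by (simp add: nar_def power_add)
 finally have *: "v * int nar + int k < 2 ^ (\<beta> + 7)" .
 have 0: "0 \<le> v * int nar" using assms by simp
 show "len (v * int nar) \<le> 8 + \<beta>" using len_le[of "v * int nar" "\<beta> + 7"] * 0 by simp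
 show "len (v * int nar + int k) \<le> 8 + \<beta>" using len_le[of "v * int nar + int k" "\<beta> + 7"] * 0 by simp
qed

lemma reprs_scratch:
 assumes "reprs s \<sigma>" "tmp \<le> d" "d < nar" shows "reprs s (\<sigma>\<lparr>reg := (reg \<sigma>)(d := v)\<rparr>)"
proof -
 have "nar * i + k \<noteq> d" if "k < tmp" for i k
  using assms(2,3) that by (cases i) (auto simp: nar_def)
 then show ?thesis using assms(1) by (auto simp: reprs_def)
qed

text \<open>Eight lengths of at most 8 + \<beta> each cover any single compiled instruction. The
  slack of 8 bits absorbs register numbers and address arithmetic.\<close>

definition W :: "nat => nat" where "W \<beta> = 8 * (8 + \<beta>)"

lemma okE_bound: "okE \<beta> s e ==> \<bar>ev s e\<bar> < 2 ^ \<beta>"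
 by (cases e) auto

text \<open>The last conjunct is needed for binary operators: the left operand waits in register d
  while the right one is computed above it.\<close>

lemma compE_correct:
 assumes "okE \<beta> s e" "reprs s \<sigma>" "tmp \<le> d" "d + dpE e < nar" "arrE e \<le> tmp"
 shows "\<exists>t \<sigma>'. exec (compE d e) \<sigma> t \<sigma>' \<and> t \<le> szE e * W \<beta> \<and> reprs s \<sigma>' \<and> reg \<sigma>' d = ev s e \<and>
  (\<forall>i. tmp \<le> i \<and> i < d --> reg \<sigma>' i = reg \<sigma> i)"
 using assms
proof (induction e arbitrary: d \<sigma>)
 case (N c)
 have "exec (compE d (N c)) \<sigma> (len c + len (int d)) (\<sigma>\<lparr>reg := (reg \<sigma>)(d := c)\<rparr>)"
  using exec.Move[of \<sigma> "Direct d" "Const c" c] by simp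
 moreover have "len c \<le> 8 + \<beta>" "len (int d) \<le> 8 + \<beta>" using N by (auto intro: len_big len_nat)
 then have "len c + len (int d) \<le> szE (N c) * W \<beta>" by (simp add: W_def)
 ultimately show ?case using reprs_scratch[OF N(2,3)] N(4)
  by (intro exI[of _ "len c + len (int d)"] exI[of _ "\<sigma>\<lparr>reg := (reg \<sigma>)(d := c)\<rparr>"]) auto
next
 case (A k e)
 have dn: "d < nar" and kt: "k < tmp" using A.prems by auto
 have k: "k < nar" using kt by (simp add: tmp_def nar_def)
 obtain t \<sigma>1 where 1: "exec (compE d e) \<sigma> t \<sigma>1" "t \<le> szE e * W \<beta>" "reprs s \<sigma>1" "reg \<sigma>1 d = ev s e"
  "\<forall>i. tmp \<le> i \<and> i < d --> reg \<sigma>1 i = reg \<sigma> i"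
  using A.IH[of \<sigma> d] A.prems by auto
 define v where "v = ev s e"
 have v: "0 \<le> v" "v < 2 ^ \<beta>" "\<bar>sto s k (nat v)\<bar> < 2 ^ \<beta>" using A.prems(1) okE_bound[of \<beta> s e] by (auto simp: v_def)
 define \<sigma>2 where "\<sigma>2 = \<sigma>1\<lparr>reg := (reg \<sigma>1)(d := v * int nar)\<rparr>"
 define \<sigma>3 where "\<sigma>3 = \<sigma>2\<lparr>reg := (reg \<sigma>2)(d := v * int nar + int k)\<rparr>"
 define \<sigma>4 where "\<sigma>4 = \<sigma>3\<lparr>reg := (reg \<sigma>3)(d := sto s k (nat v))\<rparr>"
 have r3: "reprs s \<sigma>3" unfolding \<sigma>3_def \<sigma>2_def by (intro reprs_scratch 1 A.prems dn)
 have ad: "nat (v * int nar + int k) = nar * nat v + k"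
  using v by (simp add: nat_add_distrib nat_mult_distrib)
 have rd: "reg \<sigma>3 (nar * nat v + k) = sto s k (nat v)" using r3 kt by (simp add: reprs_def)
 have e2: "exec (Arith MUL (Direct d) (Reg (Direct d)) (Const (int nar))) \<sigma>1
   (len (int d) + len v + len (int nar) + len (int d) + len (v * int nar)) \<sigma>2"
  using exec.Arith[of \<sigma>1 "Direct d" "Reg (Direct d)" "Const (int nar)" _ MUL, OF _ _ _ refl] 1(4)
  by (simp add: \<sigma>2_def v_def)
 have e3: "exec (Arith ADD (Direct d) (Reg (Direct d)) (Const (int k))) \<sigma>2
   (len (int d) + len (v * int nar) + len (int k) + len (int d) + len (v * int nar + int k)) \<sigma>3"
  using exec.Arith[of \<sigma>2 "Direct d" "Reg (Direct d)" "Const (int k)" _ ADD, OF _ _ _ refl]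
  by (simp add: \<sigma>3_def) (simp add: \<sigma>2_def)
 have e4: "exec (Move (Direct d) (Reg (Indirect d))) \<sigma>3
   (len (int d) + len (v * int nar + int k) + len (sto s k (nat v)) + len (int d)) \<sigma>4"
  using exec.Move[of \<sigma>3 "Direct d" "Reg (Indirect d)", OF _ _ refl] rd v ad
  by (simp add: \<sigma>4_def) (simp add: \<sigma>3_def)
 note L = len_addr[OF v(1,2) k] len_big[OF v(3)] len_nat[OF dn, of \<beta>] len_nat[OF k, of \<beta>]
  len_big[of v \<beta>] len_small[of "int nar" \<beta>]
 have "exec (compE d (A k e)) \<sigma> (t + ((len (int d) + len v + len (int nar) + len (int d) + len (v * int nar))
   + ((len (int d) + len (v * int nar) + len (int k) + len (int d) + len (v * int nar + int k))
   + (len (int d) + len (v * int nar + int k) + len (sto s k (nat v)) + len (int d))))) \<sigma>4" (is "exec _ _ ?t _")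
  using exec.Seq[OF 1(1) exec.Seq[OF e2 exec.Seq[OF e3 e4]]] by simp
 moreover have "?t \<le> szE (A k e) * W \<beta>" using L v 1(2) by (simp add: W_def nar_def algebra_simps)
 moreover have "reprs s \<sigma>4" unfolding \<sigma>4_def by (intro reprs_scratch r3 A.prems dn)
 moreover have "reg \<sigma>4 d = ev s (A k e)" by (simp add: \<sigma>4_def v_def)
 moreover have "\<forall>i. tmp \<le> i \<and> i < d --> reg \<sigma>4 i = reg \<sigma> i" using 1(5) by (simp add: \<sigma>4_def \<sigma>3_def \<sigma>2_def)
 ultimately show ?case by blast
next
 case (B f a b)
 have dp: "d + dpE a < nar" "Suc d + dpE b < nar" using B.prems(4) by simp_all
 obtain t1 \<sigma>1 where 1: "exec (compE d a) \<sigma> t1 \<sigma>1" "t1 \<le> szE a * W \<beta>" "reprs s \<sigma>1" "reg \<sigma>1 d = ev s a"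
  "\<forall>i. tmp \<le> i \<and> i < d --> reg \<sigma>1 i = reg \<sigma> i"
  using B.IH(1)[of \<sigma> d] B.prems dp by auto
 obtain t2 \<sigma>2 where 2: "exec (compE (Suc d) b) \<sigma>1 t2 \<sigma>2" "t2 \<le> szE b * W \<beta>" "reprs s \<sigma>2" "reg \<sigma>2 (Suc d) = ev s b"
  "\<forall>i. tmp \<le> i \<and> i < Suc d --> reg \<sigma>2 i = reg \<sigma>1 i"
  using B.IH(2)[of \<sigma>1 "Suc d"] B.prems 1 dp by auto
 have rd: "reg \<sigma>2 d = ev s a" using 2(5) 1(4) B.prems(3) by simp
 define v where "v = arith_val f (ev s a) (ev s b)"
 define \<sigma>3 where "\<sigma>3 = \<sigma>2\<lparr>reg := (reg \<sigma>2)(d := v)\<rparr>"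
 have dn: "d < nar" "Suc d < nar" using B.prems by auto
 have e3: "exec (Arith f (Direct d) (Reg (Direct d)) (Reg (Direct (Suc d)))) \<sigma>2
   (len (int d) + len (ev s a) + (len (int (Suc d)) + len (ev s b)) + len (int d) + len v) \<sigma>3"
  using exec.Arith[of \<sigma>2 "Direct d" "Reg (Direct d)" "Reg (Direct (Suc d))" _ f, OF _ _ _ refl] rd 2(4)
  by (simp add: \<sigma>3_def v_def)
 have bd: "\<bar>ev s a\<bar> < 2 ^ \<beta>" "\<bar>ev s b\<bar> < 2 ^ \<beta>" "\<bar>v\<bar> < 2 ^ \<beta>" using B.prems(1) okE_bound[of \<beta> s a] okE_bound[of \<beta> s b] by (auto simp: v_def)
 note L = len_nat[OF dn(1), of \<beta>] len_nat[OF dn(2), of \<beta>] bd[THEN len_big]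
 have "exec (compE d (B f a b)) \<sigma> (t1 + (t2 + (len (int d) + len (ev s a) + (len (int (Suc d)) + len (ev s b)) + len (int d) + len v))) \<sigma>3"
  (is "exec _ _ ?t _")
  using exec.Seq[OF 1(1) exec.Seq[OF 2(1) e3]] by simp
 moreover have "?t \<le> szE (B f a b) * W \<beta>" using L 1(2) 2(2) by (simp add: W_def algebra_simps)
 moreover have "reprs s \<sigma>3" unfolding \<sigma>3_def by (intro reprs_scratch 2 B.prems dn)
 moreover have "reg \<sigma>3 d = ev s (B f a b)" by (simp add: \<sigma>3_def v_def)
 moreover have "\<forall>i. tmp \<le> i \<and> i < d --> reg \<sigma>3 i = reg \<sigma> i" using 1(5) 2(5) by (simp add: \<sigma>3_def)
 ultimately show ?case by blast
qed


definition gtz :: "nat => test" where "gtz d = Gtz (Reg (Direct d))"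

fun compile :: "cm => prog" where
 "compile Skp = Nop"
| "compile (St k i e) = Seq (compE tmp (B ADD (B MUL i (N (int nar))) (N (int k))))
   (Seq (compE (Suc tmp) e) (Move (Indirect tmp) (Reg (Direct (Suc tmp)))))"
| "compile (Sq c1 c2) = Seq (compile c1) (compile c2)"
| "compile (If e c1 c2) = Seq (compE tmp e) (Cond (gtz tmp) (compile c1) (compile c2))"
| "compile (For v e r c) = Seq (compE tmp e) (Seq (Move (Direct v) (Reg (Direct tmp)))
   (Loop (gtz v) (Seq (Arith SUB (Direct v) (Reg (Direct v)) (Const 1)) (compile c))))"
| "compile (Half v e r c) = Seq (compE tmp e) (Seq (Move (Direct v) (Reg (Direct tmp)))
   (Loop (gtz v) (Seq (Arith DIV (Direct v) (Reg (Direct v)) (Const 2)) (compile c))))"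
| "compile (Rd k i) = Seq (compE tmp (B ADD (B MUL i (N (int nar))) (N (int k)))) (Input (Indirect tmp))"
| "compile (Wr e) = Seq (compE tmp e) (Output (Reg (Direct tmp)))"

fun wr :: "cm => nat set" where
 "wr Skp = {}" | "wr (St k i e) = {k}" | "wr (Sq c1 c2) = wr c1 \<union> wr c2" | "wr (If e c1 c2) = wr c1 \<union> wr c2"
| "wr (For v e r c) = insert v (wr c)" | "wr (Half v e r c) = insert v (wr c)" | "wr (Rd k i) = {k}" | "wr (Wr e) = {}"

fun io :: "cm => bool" where
 "io Skp = False" | "io (St k i e) = False" | "io (Sq c1 c2) = (io c1 \<or> io c2)" | "io (If e c1 c2) = (io c1 \<or> io c2)"
| "io (For v e r c) = io c" | "io (Half v e r c) = io c" | "io (Rd k i) = True" | "io (Wr e) = True"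

definition wfE :: "ex => bool" where "wfE e \<longleftrightarrow> dpE e < 12 \<and> arrE e \<le> tmp"

fun wf :: "cm => bool" where
 "wf Skp = True"
| "wf (St k i e) = (wfE i \<and> wfE e \<and> k < tmp)"
| "wf (Sq c1 c2) = (wf c1 \<and> wf c2)"
| "wf (If e c1 c2) = (wfE e \<and> wf c1 \<and> wf c2)"
| "wf (For v e r c) = (wfE e \<and> wf c \<and> v < tmp \<and> v \<notin> wr c)"
| "wf (Half v e r c) = (wfE e \<and> wf c \<and> v < tmp \<and> v \<notin> wr c)"
| "wf (Rd k i) = (wfE i \<and> k < tmp)"
| "wf (Wr e) = wfE e"

text \<open>\<open>\<rho> r\<close> bounds the number of iterations of the loops tagged \<open>r\<close>.\<close>

fun cost :: "(nat => nat) => cm => nat" where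
 "cost \<rho> Skp = 0"
| "cost \<rho> (St k i e) = szE i + szE e + 5"
| "cost \<rho> (Sq c1 c2) = cost \<rho> c1 + cost \<rho> c2"
| "cost \<rho> (If e c1 c2) = szE e + 1 + (cost \<rho> c1 + cost \<rho> c2)"
| "cost \<rho> (For v e r c) = szE e + 2 + \<rho> r * (cost \<rho> c + 2)"
| "cost \<rho> (Half v e r c) = szE e + 2 + \<rho> r * (cost \<rho> c + 2)"
| "cost \<rho> (Rd k i) = szE i + 5"
| "cost \<rho> (Wr e) = szE e + 1"

text \<open>The counter is a number of its own that is stored into v before each run of the body and
  never read back. For programs satisfying \<open>wf\<close> the body does not write v, so the
  machine loop behaves the same way.\<close>

fun wpl :: "((hst => bool) => hst => bool) => nat => nat => (hst => bool) => hst => bool" where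
 "wpl P v 0 Q s = Q s"
| "wpl P v (Suc m) Q s = P (wpl P v m Q) (set_sto s v 0 (int m))"

function wph :: "((hst => bool) => hst => bool) => nat => nat => (hst => bool) => hst => bool" where
 "wph P v x Q s = (if x = 0 then Q s else P (wph P v (x div 2) Q) (set_sto s v 0 (int (x div 2))))"
 by auto
termination by (relation "measure (\<lambda>(P, v, x, Q, s). x)") auto

declare wph.simps [simp del]

text \<open>A weakest precondition that also demands safe evaluation (\<open>ok\<close>), bounded
  stored values (\<open>bd\<close>) and the iteration bounds \<open>\<rho>\<close>. It has two
  instances: programs are verified with \<open>nnE\<close> and \<open>ble w\<close>, the compiler
  with \<open>okE\<close>; \<open>wp_bounded\<close> leads from the first to the second.\<close>

primrec wp :: "(hst => ex => bool) => (int => bool) => (nat => nat) => cm => (hst => bool) => hst => bool" where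
 "wp ok bd \<rho> Skp = (\<lambda>Q s. Q s)"
| "wp ok bd \<rho> (St k i e) = (\<lambda>Q s. ok s i \<and> ok s e \<and> 0 \<le> ev s i \<and> bd (ev s e) \<and> Q (set_sto s k (nat (ev s i)) (ev s e)))"
| "wp ok bd \<rho> (Sq c1 c2) = (\<lambda>Q. wp ok bd \<rho> c1 (wp ok bd \<rho> c2 Q))"
| "wp ok bd \<rho> (If e c1 c2) = (\<lambda>Q s. ok s e \<and> (if 0 < ev s e then wp ok bd \<rho> c1 Q s else wp ok bd \<rho> c2 Q s))"
| "wp ok bd \<rho> (For v e r c) = (\<lambda>Q s. ok s e \<and> bd (ev s e) \<and> ev s e \<le> int (\<rho> r) \<and> wpl (wp ok bd \<rho> c) v (nat (ev s e)) Q (set_sto s v 0 (ev s e)))"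
| "wp ok bd \<rho> (Half v e r c) = (\<lambda>Q s. ok s e \<and> bd (ev s e) \<and> ev s e < 2 ^ \<rho> r \<and> wph (wp ok bd \<rho> c) v (nat (ev s e)) Q (set_sto s v 0 (ev s e)))"
| "wp ok bd \<rho> (Rd k i) = (\<lambda>Q s. ok s i \<and> 0 \<le> ev s i \<and> hin s \<noteq> [] \<and> bd (hd (hin s)) \<and>
   Q ((set_sto s k (nat (ev s i)) (hd (hin s)))\<lparr>hin := tl (hin s)\<rparr>))"
| "wp ok bd \<rho> (Wr e) = (\<lambda>Q s. ok s e \<and> Q (s\<lparr>hout := hout s @ [ev s e]\<rparr>))"

lemma wpl_mono:
 assumes P: "\<And>Q Q' s. (\<And>s. Q s ==> Q' s) ==> P Q s ==> P Q' s" and Q: "\<And>s. Q s ==> Q' s"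
 shows "wpl P v m Q s ==> wpl P v m Q' s"
proof (induction m arbitrary: s)
 case 0 then show ?case using Q by simp
next
 case (Suc m)
 have "P (wpl P v m Q) (set_sto s v 0 (int m))" using Suc.prems by simp
 then have "P (wpl P v m Q') (set_sto s v 0 (int m))" by (rule P[of "wpl P v m Q", rotated]) (rule Suc.IH)
 then show ?case by simp
qed

lemma wph_mono:
 assumes P: "\<And>Q Q' s. (\<And>s. Q s ==> Q' s) ==> P Q s ==> P Q' s" and Q: "\<And>s. Q s ==> Q' s"
 shows "wph P v x Q s ==> wph P v x Q' s"
proof (induction x arbitrary: s rule: less_induct)
 case (less x)
 show ?case
 proof (cases "x = 0")
  case True then show ?thesis using less.prems Q by (simp add: wph.simps[of _ _ 0])
 next
  case False
  have "P (wph P v (x div 2) Q) (set_sto s v 0 (int (x div 2)))" using less.prems False by (simp add: wph.simps[of _ _ x])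
  then have "P (wph P v (x div 2) Q') (set_sto s v 0 (int (x div 2)))" by (rule P[of "wph P v (x div 2) Q", rotated]) (rule less.IH, use False in auto)
  then show ?thesis using False by (simp add: wph.simps[of _ _ x])
 qed
qed

lemma wp_mono: "wp ok bd \<rho> c Q s ==> (\<And>s. Q s ==> Q' s) ==> wp ok bd \<rho> c Q' s"
proof (induction c arbitrary: Q Q' s)
 case (Sq c1 c2)
 have "wp ok bd \<rho> c1 (wp ok bd \<rho> c2 Q) s" using Sq.prems(1) by simp
 then have "wp ok bd \<rho> c1 (wp ok bd \<rho> c2 Q') s" by (rule Sq.IH(1)) (rule Sq.IH(2)[OF _ Sq.prems(2)])
 then show ?case by simp
next
 case (For v e r c)
 have m: "\<And>Q Q' s. (\<And>s. Q s ==> Q' s) ==> wp ok bd \<rho> c Q s ==> wp ok bd \<rho> c Q' s" using For.IH by blast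
 have "wpl (wp ok bd \<rho> c) v m Q s ==> wpl (wp ok bd \<rho> c) v m Q' s" for m s
 proof (rule wpl_mono[where P = "wp ok bd \<rho> c" and Q = Q])
  fix Q Q' s assume "\<And>s. Q s ==> Q' s" "wp ok bd \<rho> c Q s"
  then show "wp ok bd \<rho> c Q' s" by (intro m[of Q Q'])
 qed (use For.prems(2) in blast)
 then show ?case using For.prems(1) by simp
next
 case (Half v e r c)
 have m: "\<And>Q Q' s. (\<And>s. Q s ==> Q' s) ==> wp ok bd \<rho> c Q s ==> wp ok bd \<rho> c Q' s" using Half.IH by blast
 have "wph (wp ok bd \<rho> c) v m Q s ==> wph (wp ok bd \<rho> c) v m Q' s" for m s
 proof (rule wph_mono[where P = "wp ok bd \<rho> c" and Q = Q])
  fix Q Q' s assume "\<And>s. Q s ==> Q' s" "wp ok bd \<rho> c Q s"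
  then show "wp ok bd \<rho> c Q' s" by (intro m[of Q Q'])
 qed (use Half.prems(2) in blast)
 then show ?case using Half.prems(1) by simp
qed (auto split: if_splits)

lemma wpl_rule:
 assumes "I m s" "\<And>k s. k < m ==> I (Suc k) s ==> wp ok bd \<rho> c (I k) (set_sto s v 0 (int k))" "\<And>s. I 0 s ==> Q s"
 shows "wpl (wp ok bd \<rho> c) v m Q s"
 using assms
proof (induction m arbitrary: s)
 case (Suc m)
 have "wp ok bd \<rho> c (I m) (set_sto s v 0 (int m))" by (rule Suc.prems(2)) (use Suc.prems(1) in auto)
 then show ?case
  by (simp, elim wp_mono, intro Suc.IH) (use Suc.prems in auto)
qed simp

lemma wph_rule:
 assumes "I x s" "\<And>x s. 0 < x ==> I x s ==> wp ok bd \<rho> c (I (x div 2)) (set_sto s v 0 (int (x div 2)))" "\<And>s. I 0 s ==> Q s"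
 shows "wph (wp ok bd \<rho> c) v x Q s"
 using assms(1)
proof (induction x arbitrary: s rule: less_induct)
 case (less x)
 show ?case
 proof (cases "x = 0")
  case False
  then have "wp ok bd \<rho> c (I (x div 2)) (set_sto s v 0 (int (x div 2)))" using assms(2) less.prems by simp
  then show ?thesis using False less.IH[of "x div 2"] by (subst wph.simps) (auto elim: wp_mono)
 qed (use less.prems assms(3) in \<open>simp add: wph.simps[of _ _ 0]\<close>)
qed

lemma wp_For:
 assumes "ok s e" "bd (ev s e)" "ev s e \<le> int (\<rho> r)" "ev s e = int m" "I m (set_sto s v 0 (int m))"
  "\<And>k s. k < m ==> I (Suc k) s ==> wp ok bd \<rho> c (I k) (set_sto s v 0 (int k))" "\<And>s. I 0 s ==> Q s"
 shows "wp ok bd \<rho> (For v e r c) Q s"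
 using assms(1-5) wpl_rule[of I m _ ok bd \<rho> c v Q, OF _ assms(6,7)] by simp

text \<open>A predicate that survives all writes the program may perform can be carried along; both
  frame lemmas are instances.\<close>

lemma wp_invariant:
 assumes "\<And>s k i v. k \<in> wr c ==> F s ==> F (set_sto s k i v)" "\<And>s x y. io c ==> F s ==> F (s\<lparr>hin := x\<rparr>) \<and> F (s\<lparr>hout := y\<rparr>)"
  and "wp ok bd \<rho> c Q s" "F s"
 shows "wp ok bd \<rho> c (\<lambda>s. Q s \<and> F s) s"
 using assms
proof (induction c arbitrary: Q s)
 case (Sq c1 c2)
 have "wp ok bd \<rho> c1 (\<lambda>s. wp ok bd \<rho> c2 Q s \<and> F s) s" using Sq.prems by (intro Sq.IH(1)) auto
 then show ?case unfolding wp.simps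
  by (rule wp_mono) (use Sq.prems in \<open>auto intro!: Sq.IH(2)\<close>)
next
 case (For v e r c)
 have *: "wpl (wp ok bd \<rho> c) v m Q s ==> F s ==> wpl (wp ok bd \<rho> c) v m (\<lambda>s. Q s \<and> F s) s" for m s
 proof (induction m arbitrary: s)
  case (Suc m)
  have "wp ok bd \<rho> c (\<lambda>s. wpl (wp ok bd \<rho> c) v m Q s \<and> F s) (set_sto s v 0 (int m))"
   using Suc.prems For.prems by (intro For.IH) auto
  then have "wp ok bd \<rho> c (wpl (wp ok bd \<rho> c) v m (\<lambda>s. Q s \<and> F s)) (set_sto s v 0 (int m))"
   by (rule wp_mono) (use Suc.IH in auto)
  then show ?case by simp
 qed simp
 show ?case using For.prems by (auto intro!: *)
next
 case (Half v e r c)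
 have *: "wph (wp ok bd \<rho> c) v m Q s ==> F s ==> wph (wp ok bd \<rho> c) v m (\<lambda>s. Q s \<and> F s) s" for m s
 proof (induction m arbitrary: s rule: less_induct)
  case (less m)
  show ?case
  proof (cases "m = 0")
   case False
   have "wp ok bd \<rho> c (\<lambda>s. wph (wp ok bd \<rho> c) v (m div 2) Q s \<and> F s) (set_sto s v 0 (int (m div 2)))"
    using less.prems Half.prems False by (intro Half.IH) (auto simp: wph.simps[of _ _ m])
   then have "wp ok bd \<rho> c (wph (wp ok bd \<rho> c) v (m div 2) (\<lambda>s. Q s \<and> F s)) (set_sto s v 0 (int (m div 2)))"
    by (rule wp_mono) (use less.IH[of "m div 2"] False in auto)
   then show ?thesis using False by (simp add: wph.simps[of _ _ m])
  qed (use less.prems in \<open>simp add: wph.simps[of _ _ 0]\<close>)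
 qed
 show ?case using Half.prems by (auto intro!: *)
qed (auto split: if_splits)

lemma wp_frame:
 assumes "wp ok bd \<rho> c Q s"
 shows "wp ok bd \<rho> c (\<lambda>s'. Q s' \<and> (\<forall>k. k \<notin> wr c --> sto s' k = sto s k)) s"
 by (rule wp_invariant[OF _ _ assms]) (auto simp: sto_set_sto fun_eq_iff)

lemma wp_frame_io:
 assumes "wp ok bd \<rho> c Q s" "\<not> io c"
 shows "wp ok bd \<rho> c (\<lambda>s'. Q s' \<and> hin s' = hin s \<and> hout s' = hout s) s"
 by (rule wp_invariant[OF _ _ assms(1)]) (use assms(2) in auto)

lemma reprs_set:
 assumes "reprs s \<sigma>" "k < tmp"
 shows "reprs (set_sto s k i v) (\<sigma>\<lparr>reg := (reg \<sigma>)(nar * i + k := v)\<rparr>)"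
proof -
 have "nar * i' + k' = nar * i + k \<longleftrightarrow> i' = i \<and> k' = k" if "k' < tmp" for i' k'
 proof
  assume e: "nar * i' + k' = nar * i + k"
  have "k' < nar" "k < nar" using that assms(2) by (auto simp: tmp_def nar_def)
  then have "(nar * i' + k') mod nar = k'" "(nar * i + k) mod nar = k" by simp_all
  then have "k' = k" using e by simp
  then show "i' = i \<and> k' = k" using e by (simp add: nar_def)
 qed simp
 then show ?thesis using assms by (auto simp: reprs_def sto_set_sto)
qed

text \<open>Multiplication by 64 and addition of the array number need up to 7 more bits, which at
  most doubles W. This is the factor 2 in all cost bounds.\<close>

lemma address_correct:
 assumes "okE \<beta> s i" "0 \<le> ev s i" "reprs s \<sigma>" "wfE i" "k < tmp"
 shows "\<exists>t \<sigma>'. exec (compE tmp (B ADD (B MUL i (N (int nar))) (N (int k)))) \<sigma> t \<sigma>' \<and> t \<le> (szE i + 4) * (2 * W \<beta>) \<and> reprs s \<sigma>'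
  \<and> reg \<sigma>' tmp = int (nar * nat (ev s i) + k)"
proof -
 let ?e = "B ADD (B MUL i (N (int nar))) (N (int k))" and ?v = "ev s i"
 have k: "k < nar" using assms(5) by (simp add: tmp_def nar_def)
 have v: "?v < 2 ^ \<beta>" using okE_bound[OF assms(1)] by simp
 have p: "(2::int) ^ (\<beta> + 7) = 2 ^ \<beta> * 128" by (simp add: power_add)
 have one: "(1::int) \<le> 2 ^ \<beta>" by simp
 have mono: "okE (\<beta> + 7) s i"
 proof -
  have "okE \<beta> s e ==> okE (\<beta> + 7) s e" for e
   by (induction e) (use p in \<open>auto intro: order.strict_trans2\<close>)
  then show ?thesis using assms(1) .
 qed
 have "okE (\<beta> + 7) s ?e"
  using mono assms(2) v k one p by (auto simp: nar_def)
 moreover have "tmp + dpE ?e < nar" "arrE ?e \<le> tmp"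
  using assms(4) by (auto simp: wfE_def tmp_def nar_def)
 ultimately obtain t \<sigma>' where *: "exec (compE tmp ?e) \<sigma> t \<sigma>'" "t \<le> szE ?e * W (\<beta> + 7)" "reprs s \<sigma>'" "reg \<sigma>' tmp = ev s ?e"
  using compE_correct[of "\<beta> + 7" s ?e \<sigma> tmp] assms(3) by auto
 have "W (\<beta> + 7) \<le> 2 * W \<beta>" by (simp add: W_def)
 then have "szE ?e * W (\<beta> + 7) \<le> (szE i + 4) * (2 * W \<beta>)" by (intro mult_mono) auto
 then show ?thesis using * assms(2) by (intro exI[of _ t] exI[of _ \<sigma>']) (auto simp: nat_mult_distrib)
qed

lemma reprs_var: "reprs s \<sigma> ==> v < tmp ==> reg \<sigma> v = sto s v 0"
 by (metis add_0 mult_0_right reprs_def)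

text \<open>Serves both loops: f and c are subtraction of 1 or division by 2.\<close>

lemma comp_loop_step:
 assumes "reprs s \<sigma>" "v < tmp" "sto s v 0 = x" "0 < x" "\<bar>x\<bar> < 2 ^ \<beta>" "\<bar>arith_val f x c\<bar> < 2 ^ \<beta>" "\<bar>c\<bar> < 4"
  and body: "exec b (\<sigma>\<lparr>reg := (reg \<sigma>)(v := arith_val f x c)\<rparr>) t \<sigma>'" and loop: "exec (Loop (gtz v) (Seq (Arith f (Direct v) (Reg (Direct v)) (Const c)) b)) \<sigma>' t' \<sigma>''"
 shows "\<exists>t''. exec (Loop (gtz v) (Seq (Arith f (Direct v) (Reg (Direct v)) (Const c)) b)) \<sigma> t'' \<sigma>'' \<and> t'' \<le> 2 * W \<beta> + t + t'"
proof -
 have r: "reg \<sigma> v = x" using reprs_var[OF assms(1,2)] assms(3) by simp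
 have vn: "v < nar" using assms(2) by (simp add: tmp_def nar_def)
 have e: "exec (Arith f (Direct v) (Reg (Direct v)) (Const c)) \<sigma> (len (int v) + len x + len c + len (int v) + len (arith_val f x c))
   (\<sigma>\<lparr>reg := (reg \<sigma>)(v := arith_val f x c)\<rparr>)"
  using exec.Arith[of \<sigma> "Direct v" "Reg (Direct v)" "Const c" _ f, OF _ _ _ refl] r by simp
 have "exec (Loop (gtz v) (Seq (Arith f (Direct v) (Reg (Direct v)) (Const c)) b)) \<sigma>
   (operand_cost (reg \<sigma>) (test_operand (gtz v)) + (len (int v) + len x + len c + len (int v) + len (arith_val f x c) + t) + t') \<sigma>''"
  by (rule exec.Loop_step[OF _ _ exec.Seq[OF e body] loop]) (use r assms(4) in \<open>auto simp: gtz_def\<close>)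
 moreover have "len c \<le> 8 + \<beta>" using assms(7) by (intro len_small) auto
 then have "operand_cost (reg \<sigma>) (test_operand (gtz v)) + (len (int v) + len x + len c + len (int v) + len (arith_val f x c) + t) + t' \<le> 2 * W \<beta> + t + t'"
  using len_nat[OF vn, of \<beta>] len_big[OF assms(5)] len_big[OF assms(6)] r by (simp add: W_def gtz_def)
 ultimately show ?thesis by blast
qed

lemma comp_loop_exit:
 assumes "reprs s \<sigma>" "v < tmp" "sto s v 0 = x" "x \<le> 0" "\<bar>x\<bar> < 2 ^ \<beta>"
 shows "\<exists>t. exec (Loop (gtz v) b) \<sigma> t \<sigma> \<and> t \<le> W \<beta>"
proof -
 have r: "reg \<sigma> v = x" using reprs_var[OF assms(1,2)] assms(3) by simp
 have vn: "v < nar" using assms(2) by (simp add: tmp_def nar_def)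
 have "exec (Loop (gtz v) b) \<sigma> (operand_cost (reg \<sigma>) (test_operand (gtz v))) \<sigma>"
  by (rule exec.Loop_exit) (use r assms(4) in \<open>auto simp: gtz_def\<close>)
 moreover have "operand_cost (reg \<sigma>) (test_operand (gtz v)) \<le> W \<beta>"
  using len_nat[OF vn, of \<beta>] len_big[OF assms(5)] r by (simp add: W_def gtz_def)
 ultimately show ?thesis by blast
qed

text \<open>For the loops, \<open>wp_frame\<close> shows that the body leaves the counter register
  alone, so the machine's count agrees with that of \<open>wpl\<close> and \<open>wph\<close>; an
  inner induction on the number of iterations bounds the time.\<close>

theorem comp_correct:
 assumes "wf c" "wp (okE \<beta>) (\<lambda>v. \<bar>v\<bar> < 2 ^ \<beta>) \<rho> c Q s" "reprs s \<sigma>"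
 shows "\<exists>t \<sigma>' s'. exec (compile c) \<sigma> t \<sigma>' \<and> t \<le> cost \<rho> c * (2 * W \<beta>) \<and> reprs s' \<sigma>' \<and> Q s'"
 using assms
proof (induction c arbitrary: Q s \<sigma>)
 case Skp
 then show ?case using exec.Nop by fastforce
next
 case (Sq c1 c2)
 obtain t \<sigma>' s' where 1: "exec (compile c1) \<sigma> t \<sigma>'" "t \<le> cost \<rho> c1 * (2 * W \<beta>)" "reprs s' \<sigma>'" "wp (okE \<beta>) (\<lambda>v. \<bar>v\<bar> < 2 ^ \<beta>) \<rho> c2 Q s'"
  using Sq.IH(1)[of "wp (okE \<beta>) (\<lambda>v. \<bar>v\<bar> < 2 ^ \<beta>) \<rho> c2 Q" s \<sigma>] Sq.prems by auto
 obtain t2 \<sigma>2 s2 where 2: "exec (compile c2) \<sigma>' t2 \<sigma>2" "t2 \<le> cost \<rho> c2 * (2 * W \<beta>)" "reprs s2 \<sigma>2" "Q s2"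
  using Sq.IH(2)[of Q s' \<sigma>'] Sq.prems 1 by auto
 have "t + t2 \<le> cost \<rho> (Sq c1 c2) * (2 * W \<beta>)" using 1 2 by (simp add: distrib_right)
 then show ?case using exec.Seq[OF 1(1) 2(1)] 2 by auto
next
 case (St k i e)
 then have w: "wfE i" "wfE e" "k < tmp" "okE \<beta> s i" "okE \<beta> s e" "0 \<le> ev s i" "Q (set_sto s k (nat (ev s i)) (ev s e))" by auto
 obtain t \<sigma>1 where 1: "exec (compE tmp (B ADD (B MUL i (N (int nar))) (N (int k)))) \<sigma> t \<sigma>1" "t \<le> (szE i + 4) * (2 * W \<beta>)" "reprs s \<sigma>1"
   "reg \<sigma>1 tmp = int (nar * nat (ev s i) + k)"
  using address_correct[OF w(4,6) St.prems(3) w(1,3)] by blast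
 have "Suc tmp + dpE e < nar" "arrE e \<le> tmp" using w by (auto simp: wfE_def tmp_def nar_def)
 then obtain t2 \<sigma>2 where 2: "exec (compE (Suc tmp) e) \<sigma>1 t2 \<sigma>2" "t2 \<le> szE e * W \<beta>" "reprs s \<sigma>2" "reg \<sigma>2 (Suc tmp) = ev s e"
   "reg \<sigma>2 tmp = reg \<sigma>1 tmp"
  using compE_correct[OF w(5) 1(3), of "Suc tmp"] by auto
 define ad where "ad = nar * nat (ev s i) + k"
 have rt: "reg \<sigma>2 tmp = int ad" using 1(4) 2(5) by (simp add: ad_def)
 have e3: "exec (Move (Indirect tmp) (Reg (Direct (Suc tmp)))) \<sigma>2 (len (int (Suc tmp)) + len (ev s e) + (len (int tmp) + len (int ad)))
   (\<sigma>2\<lparr>reg := (reg \<sigma>2)(ad := ev s e)\<rparr>)"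
  using exec.Move[of \<sigma>2 "Indirect tmp" "Reg (Direct (Suc tmp))", OF _ _ refl] rt 2(4) by simp
 have "len (int ad) \<le> 8 + \<beta>"
  using len_addr(2)[of "ev s i" \<beta> k] w okE_bound[OF w(4)] by (simp add: ad_def nat_mult_distrib tmp_def nar_def mult.commute)
 then have 4: "len (int (Suc tmp)) + len (ev s e) + (len (int tmp) + len (int ad)) \<le> W \<beta>"
  using len_nat[of tmp \<beta>] len_nat[of "Suc tmp" \<beta>] len_big[OF okE_bound[OF w(5)]] by (simp add: tmp_def nar_def W_def)
 have "t + (t2 + (len (int (Suc tmp)) + len (ev s e) + (len (int tmp) + len (int ad)))) \<le> cost \<rho> (St k i e) * (2 * W \<beta>)"
  using 1(2) 2(2) 4 by (simp add: algebra_simps)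
 moreover have "reprs (set_sto s k (nat (ev s i)) (ev s e)) (\<sigma>2\<lparr>reg := (reg \<sigma>2)(ad := ev s e)\<rparr>)"
  unfolding ad_def by (rule reprs_set[OF 2(3) w(3)])
 moreover have "exec (compile (St k i e)) \<sigma> (t + (t2 + (len (int (Suc tmp)) + len (ev s e) + (len (int tmp) + len (int ad)))))
   (\<sigma>2\<lparr>reg := (reg \<sigma>2)(ad := ev s e)\<rparr>)"
  using exec.Seq[OF 1(1) exec.Seq[OF 2(1) e3]] by simp
 ultimately show ?case using w(7) by blast
next
 case (If e c1 c2)
 then have w: "wfE e" "okE \<beta> s e" by auto
 obtain t \<sigma>1 where 1: "exec (compE tmp e) \<sigma> t \<sigma>1" "t \<le> szE e * W \<beta>" "reprs s \<sigma>1" "reg \<sigma>1 tmp = ev s e"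
  using compE_correct[OF w(2) If.prems(3), of tmp] w(1) by (auto simp: wfE_def tmp_def nar_def)
 obtain t2 \<sigma>2 s2 where 2: "exec (if 0 < ev s e then compile c1 else compile c2) \<sigma>1 t2 \<sigma>2" "t2 \<le> (cost \<rho> c1 + cost \<rho> c2) * (2 * W \<beta>)" "reprs s2 \<sigma>2" "Q s2"
 proof (cases "0 < ev s e")
  case True
  then obtain t2 \<sigma>2 s2 where "exec (compile c1) \<sigma>1 t2 \<sigma>2" "t2 \<le> cost \<rho> c1 * (2 * W \<beta>)" "reprs s2 \<sigma>2" "Q s2"
   using If.IH(1)[of Q s \<sigma>1] If.prems 1 by auto
  then show thesis using True by (intro that) (auto simp: distrib_right)
 next
  case False
  then obtain t2 \<sigma>2 s2 where "exec (compile c2) \<sigma>1 t2 \<sigma>2" "t2 \<le> cost \<rho> c2 * (2 * W \<beta>)" "reprs s2 \<sigma>2" "Q s2"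
   using If.IH(2)[of Q s \<sigma>1] If.prems 1 by auto
  then show thesis using False by (intro that) (auto simp: distrib_right)
 qed
 have "exec (Cond (gtz tmp) (compile c1) (compile c2)) \<sigma>1 (operand_cost (reg \<sigma>1) (test_operand (gtz tmp)) + t2) \<sigma>2"
  by (rule exec.Cond) (use 2(1) 1(4) in \<open>auto simp: gtz_def\<close>)
 from exec.Seq[OF 1(1) this]
 have "exec (compile (If e c1 c2)) \<sigma> (t + (operand_cost (reg \<sigma>1) (test_operand (gtz tmp)) + t2)) \<sigma>2" by simp
 moreover have "operand_cost (reg \<sigma>1) (test_operand (gtz tmp)) \<le> W \<beta>"
  using len_nat[of tmp \<beta>] len_big[OF okE_bound[OF w(2)]] 1(4) by (simp add: gtz_def tmp_def nar_def W_def)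
 then have "t + (operand_cost (reg \<sigma>1) (test_operand (gtz tmp)) + t2) \<le> cost \<rho> (If e c1 c2) * (2 * W \<beta>)"
  using 1(2) 2(2) by (simp add: algebra_simps)
 ultimately show ?case using 2 by blast
next
 case (For v e r c)
 then have w: "wfE e" "wf c" "v < tmp" "v \<notin> wr c" "okE \<beta> s e" "ev s e \<le> int (\<rho> r)"
  "wpl (wp (okE \<beta>) (\<lambda>v. \<bar>v\<bar> < 2 ^ \<beta>) \<rho> c) v (nat (ev s e)) Q (set_sto s v 0 (ev s e))" by auto
 let ?L = "Loop (gtz v) (Seq (Arith SUB (Direct v) (Reg (Direct v)) (Const 1)) (compile c))"
 have bd: "\<bar>ev s e\<bar> < 2 ^ \<beta>" by (rule okE_bound[OF w(5)])
 obtain t \<sigma>1 where 1: "exec (compE tmp e) \<sigma> t \<sigma>1" "t \<le> szE e * W \<beta>" "reprs s \<sigma>1" "reg \<sigma>1 tmp = ev s e"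
  using compE_correct[OF w(5) For.prems(3), of tmp] w(1) by (auto simp: wfE_def tmp_def nar_def)
 have e2: "exec (Move (Direct v) (Reg (Direct tmp))) \<sigma>1 (len (int tmp) + len (ev s e) + len (int v)) (\<sigma>1\<lparr>reg := (reg \<sigma>1)(v := ev s e)\<rparr>)"
  using exec.Move[of \<sigma>1 "Direct v" "Reg (Direct tmp)", OF _ _ refl] 1(4) by simp
 have r2: "reprs (set_sto s v 0 (ev s e)) (\<sigma>1\<lparr>reg := (reg \<sigma>1)(v := ev s e)\<rparr>)"
  using reprs_set[OF 1(3) w(3), of 0 "ev s e"] by simp
 have *: "\<exists>t \<sigma>' s'. exec ?L \<sigma> t \<sigma>' \<and> t \<le> m * (cost \<rho> c * (2 * W \<beta>) + 2 * W \<beta>) + W \<beta> \<and> reprs s' \<sigma>' \<and> Q s'"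
  if "wpl (wp (okE \<beta>) (\<lambda>v. \<bar>v\<bar> < 2 ^ \<beta>) \<rho> c) v m Q s" "reprs s \<sigma>" "m = nat (sto s v 0)" "\<bar>sto s v 0\<bar> < 2 ^ \<beta>" for m s \<sigma>
  using that
 proof (induction m arbitrary: s \<sigma>)
  case 0
  then show ?case using comp_loop_exit[OF 0(2) w(3) refl, of \<beta> "Seq (Arith SUB (Direct v) (Reg (Direct v)) (Const 1)) (compile c)"] by auto
 next
  case (Suc m)
  have x: "sto s v 0 = int m + 1" using Suc.prems(3) by linarith
  have "wp (okE \<beta>) (\<lambda>v. \<bar>v\<bar> < 2 ^ \<beta>) \<rho> c (wpl (wp (okE \<beta>) (\<lambda>v. \<bar>v\<bar> < 2 ^ \<beta>) \<rho> c) v m Q) (set_sto s v 0 (int m))" using Suc.prems(1) by simp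
  then have wc: "wp (okE \<beta>) (\<lambda>v. \<bar>v\<bar> < 2 ^ \<beta>) \<rho> c (\<lambda>s'. wpl (wp (okE \<beta>) (\<lambda>v. \<bar>v\<bar> < 2 ^ \<beta>) \<rho> c) v m Q s' \<and> (\<forall>k. k \<notin> wr c --> sto s' k = sto (set_sto s v 0 (int m)) k)) (set_sto s v 0 (int m))"
   by (rule wp_frame)
  have r': "reprs (set_sto s v 0 (int m)) (\<sigma>\<lparr>reg := (reg \<sigma>)(v := int m)\<rparr>)"
   using reprs_set[OF Suc.prems(2) w(3), of 0 "int m"] by simp
  obtain t1 \<sigma>1 s1 where 1: "exec (compile c) (\<sigma>\<lparr>reg := (reg \<sigma>)(v := int m)\<rparr>) t1 \<sigma>1" "t1 \<le> cost \<rho> c * (2 * W \<beta>)" "reprs s1 \<sigma>1"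
   "wpl (wp (okE \<beta>) (\<lambda>v. \<bar>v\<bar> < 2 ^ \<beta>) \<rho> c) v m Q s1" "\<forall>k. k \<notin> wr c --> sto s1 k = sto (set_sto s v 0 (int m)) k"
   using For.IH[OF w(2) wc r'] by blast
  have s1: "sto s1 v 0 = int m" using 1(5) w(4) by simp
  have b1: "m = nat (sto s1 v 0)" "\<bar>sto s1 v 0\<bar> < 2 ^ \<beta>" using s1 x Suc.prems(4) by linarith+
  have im: "\<bar>int m\<bar> < 2 ^ \<beta>" "0 < int m + 1" "\<bar>int m + 1\<bar> < 2 ^ \<beta>" using x Suc.prems(4) by linarith+
  have "arith_val SUB (int m + 1) 1 = int m" by simp
  then have b2: "\<bar>int m + 1\<bar> < 2 ^ \<beta>" "\<bar>arith_val SUB (int m + 1) 1\<bar> < 2 ^ \<beta>" "0 < int m + 1" using im by (simp_all only:)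
  obtain t2 \<sigma>2 s2 where 2: "exec ?L \<sigma>1 t2 \<sigma>2" "t2 \<le> m * (cost \<rho> c * (2 * W \<beta>) + 2 * W \<beta>) + W \<beta>" "reprs s2 \<sigma>2" "Q s2"
   using Suc.IH[OF 1(4,3)] b1 by blast
  have av: "arith_val SUB (int m + 1) 1 = int m" by simp
  obtain t'' where "exec ?L \<sigma> t'' \<sigma>2" "t'' \<le> 2 * W \<beta> + t1 + t2"
   using comp_loop_step[OF Suc.prems(2) w(3) x b2(3,1,2) _ _ 2(1), of t1] 1(1) unfolding av by auto
  then show ?case using 1(2) 2 by (intro exI[of _ t''] exI[of _ \<sigma>2] exI[of _ s2]) auto
 qed
 obtain t3 \<sigma>3 s3 where 3: "exec ?L (\<sigma>1\<lparr>reg := (reg \<sigma>1)(v := ev s e)\<rparr>) t3 \<sigma>3"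
  "t3 \<le> nat (ev s e) * (cost \<rho> c * (2 * W \<beta>) + 2 * W \<beta>) + W \<beta>" "reprs s3 \<sigma>3" "Q s3"
  using *[OF w(7) r2] bd by auto
 have "nat (ev s e) * (cost \<rho> c * (2 * W \<beta>) + 2 * W \<beta>) \<le> \<rho> r * (cost \<rho> c * (2 * W \<beta>) + 2 * W \<beta>)"
  using w(6) by (intro mult_right_mono) auto
 moreover have "len (int tmp) + len (ev s e) + len (int v) \<le> W \<beta>"
  using len_nat[of tmp \<beta>] len_nat[of v \<beta>] len_big[OF bd] w(3) by (simp add: tmp_def nar_def W_def)
 ultimately have "t + (len (int tmp) + len (ev s e) + len (int v) + t3) \<le> cost \<rho> (For v e r c) * (2 * W \<beta>)"
  using 1(2) 3(2) by (simp add: algebra_simps)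
 then show ?case using exec.Seq[OF 1(1) exec.Seq[OF e2 3(1)]] 3 by auto
next
 case (Half v e r c)
 then have w: "wfE e" "wf c" "v < tmp" "v \<notin> wr c" "okE \<beta> s e" "ev s e < 2 ^ \<rho> r"
  "wph (wp (okE \<beta>) (\<lambda>v. \<bar>v\<bar> < 2 ^ \<beta>) \<rho> c) v (nat (ev s e)) Q (set_sto s v 0 (ev s e))" by auto
 let ?L = "Loop (gtz v) (Seq (Arith DIV (Direct v) (Reg (Direct v)) (Const 2)) (compile c))"
 have bd: "\<bar>ev s e\<bar> < 2 ^ \<beta>" by (rule okE_bound[OF w(5)])
 obtain t \<sigma>1 where 1: "exec (compE tmp e) \<sigma> t \<sigma>1" "t \<le> szE e * W \<beta>" "reprs s \<sigma>1" "reg \<sigma>1 tmp = ev s e"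
  using compE_correct[OF w(5) Half.prems(3), of tmp] w(1) by (auto simp: wfE_def tmp_def nar_def)
 have e2: "exec (Move (Direct v) (Reg (Direct tmp))) \<sigma>1 (len (int tmp) + len (ev s e) + len (int v)) (\<sigma>1\<lparr>reg := (reg \<sigma>1)(v := ev s e)\<rparr>)"
  using exec.Move[of \<sigma>1 "Direct v" "Reg (Direct tmp)", OF _ _ refl] 1(4) by simp
 have r2: "reprs (set_sto s v 0 (ev s e)) (\<sigma>1\<lparr>reg := (reg \<sigma>1)(v := ev s e)\<rparr>)"
  using reprs_set[OF 1(3) w(3), of 0 "ev s e"] by simp
 have *: "\<exists>t \<sigma>' s'. exec ?L \<sigma> t \<sigma>' \<and> t \<le> m * (cost \<rho> c * (2 * W \<beta>) + 2 * W \<beta>) + W \<beta> \<and> reprs s' \<sigma>' \<and> Q s'"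
  if "wph (wp (okE \<beta>) (\<lambda>v. \<bar>v\<bar> < 2 ^ \<beta>) \<rho> c) v x Q s" "reprs s \<sigma>" "x = nat (sto s v 0)" "\<bar>sto s v 0\<bar> < 2 ^ \<beta>" "x < 2 ^ m" for m x s \<sigma>
  using that
 proof (induction m arbitrary: x s \<sigma>)
  case 0
  then have "x = 0" by simp
  then show ?case using 0 comp_loop_exit[OF 0(2) w(3) refl, of \<beta> "Seq (Arith DIV (Direct v) (Reg (Direct v)) (Const 2)) (compile c)"] by (auto simp: wph.simps[of _ _ 0])
 next
  case (Suc m)
  show ?case
  proof (cases "x = 0")
   case True
   then have 0: "sto s v 0 \<le> 0" using Suc.prems(3) by simp
   obtain t where t: "exec ?L \<sigma> t \<sigma>" "t \<le> W \<beta>" using comp_loop_exit[OF Suc.prems(2) w(3) refl 0 Suc.prems(4)] by blast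
   have "Q s" using Suc.prems(1) True by (simp add: wph.simps[of _ _ 0])
   then show ?thesis using t Suc.prems(2) trans_le_add2 by blast
  next
   case False
   define y where "y = x div 2"
   have x: "sto s v 0 = int x" "0 < x" using Suc.prems(3) False by linarith+
   have y: "y < 2 ^ m" using Suc.prems(5) by (simp add: y_def)
   have yb: "\<bar>int y\<bar> < 2 ^ \<beta>" using Suc.prems(4) x by (simp add: y_def)
   have "wp (okE \<beta>) (\<lambda>v. \<bar>v\<bar> < 2 ^ \<beta>) \<rho> c (wph (wp (okE \<beta>) (\<lambda>v. \<bar>v\<bar> < 2 ^ \<beta>) \<rho> c) v y Q) (set_sto s v 0 (int y))" using Suc.prems(1) False by (simp add: wph.simps[of _ _ x] y_def)
   then have wc: "wp (okE \<beta>) (\<lambda>v. \<bar>v\<bar> < 2 ^ \<beta>) \<rho> c (\<lambda>s'. wph (wp (okE \<beta>) (\<lambda>v. \<bar>v\<bar> < 2 ^ \<beta>) \<rho> c) v y Q s' \<and> (\<forall>k. k \<notin> wr c --> sto s' k = sto (set_sto s v 0 (int y)) k)) (set_sto s v 0 (int y))"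
    by (rule wp_frame)
   have r': "reprs (set_sto s v 0 (int y)) (\<sigma>\<lparr>reg := (reg \<sigma>)(v := int y)\<rparr>)"
    using reprs_set[OF Suc.prems(2) w(3), of 0 "int y"] by simp
   obtain t1 \<sigma>1 s1 where 1: "exec (compile c) (\<sigma>\<lparr>reg := (reg \<sigma>)(v := int y)\<rparr>) t1 \<sigma>1" "t1 \<le> cost \<rho> c * (2 * W \<beta>)" "reprs s1 \<sigma>1"
    "wph (wp (okE \<beta>) (\<lambda>v. \<bar>v\<bar> < 2 ^ \<beta>) \<rho> c) v y Q s1" "\<forall>k. k \<notin> wr c --> sto s1 k = sto (set_sto s v 0 (int y)) k"
    using Half.IH[OF w(2) wc r'] by blast
   have s1: "sto s1 v 0 = int y" using 1(5) w(4) by simp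
   obtain t2 \<sigma>2 s2 where 2: "exec ?L \<sigma>1 t2 \<sigma>2" "t2 \<le> m * (cost \<rho> c * (2 * W \<beta>) + 2 * W \<beta>) + W \<beta>" "reprs s2 \<sigma>2" "Q s2"
    using Suc.IH[OF 1(4,3)] s1 yb y by (metis nat_int)
   have av: "arith_val DIV (int x) 2 = int y" by (simp add: y_def zdiv_int)
   have b2: "0 < int x" "\<bar>int x\<bar> < 2 ^ \<beta>" "\<bar>arith_val DIV (int x) 2\<bar> < 2 ^ \<beta>"
    using x Suc.prems(4) yb unfolding av by auto
   obtain t'' where "exec ?L \<sigma> t'' \<sigma>2" "t'' \<le> 2 * W \<beta> + t1 + t2"
    using comp_loop_step[OF Suc.prems(2) w(3) x(1) b2(1,2,3) _ _ 2(1), of t1] 1(1) unfolding av by auto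
   then show ?thesis using 1(2) 2 by (intro exI[of _ t''] exI[of _ \<sigma>2] exI[of _ s2]) auto
  qed
 qed
 have lt: "nat (ev s e) < 2 ^ \<rho> r" using w(6) by (simp add: nat_less_iff)
 have "nat (ev s e) = nat (sto (set_sto s v 0 (ev s e)) v 0)" "\<bar>sto (set_sto s v 0 (ev s e)) v 0\<bar> < 2 ^ \<beta>" using bd by simp_all
 then obtain t3 \<sigma>3 s3 where 3: "exec ?L (\<sigma>1\<lparr>reg := (reg \<sigma>1)(v := ev s e)\<rparr>) t3 \<sigma>3"
  "t3 \<le> \<rho> r * (cost \<rho> c * (2 * W \<beta>) + 2 * W \<beta>) + W \<beta>" "reprs s3 \<sigma>3" "Q s3"
  using *[OF w(7) r2 _ _ lt] by blast
 have "len (int tmp) + len (ev s e) + len (int v) \<le> W \<beta>"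
  using len_nat[of tmp \<beta>] len_nat[of v \<beta>] len_big[OF bd] w(3) by (simp add: tmp_def nar_def W_def)
 then have "t + (len (int tmp) + len (ev s e) + len (int v) + t3) \<le> cost \<rho> (Half v e r c) * (2 * W \<beta>)"
  using 1(2) 3(2) by (simp add: algebra_simps)
 then show ?case using exec.Seq[OF 1(1) exec.Seq[OF e2 3(1)]] 3 by auto
next
 case (Rd k i)
 then have w: "wfE i" "k < tmp" "okE \<beta> s i" "0 \<le> ev s i" "hin s \<noteq> []" "\<bar>hd (hin s)\<bar> < 2 ^ \<beta>"
   "Q ((set_sto s k (nat (ev s i)) (hd (hin s)))\<lparr>hin := tl (hin s)\<rparr>)" by auto
 obtain t \<sigma>1 where 1: "exec (compE tmp (B ADD (B MUL i (N (int nar))) (N (int k)))) \<sigma> t \<sigma>1" "t \<le> (szE i + 4) * (2 * W \<beta>)" "reprs s \<sigma>1"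
   "reg \<sigma>1 tmp = int (nar * nat (ev s i) + k)"
  using address_correct[OF w(3,4) Rd.prems(3) w(1,2)] by blast
 define ad where "ad = nar * nat (ev s i) + k"
 have rt: "reg \<sigma>1 tmp = int ad" using 1(4) by (simp add: ad_def)
 have ins: "inp \<sigma>1 = hd (hin s) # tl (hin s)" using 1(3) w(5) by (simp add: reprs_def)
 have e3: "exec (Input (Indirect tmp)) \<sigma>1 (len (hd (hin s)) + (len (int tmp) + len (int ad)))
   (\<sigma>1\<lparr>reg := (reg \<sigma>1)(ad := hd (hin s)), inp := tl (hin s)\<rparr>)"
  using exec.Input[of \<sigma>1 "Indirect tmp", OF _ ins] rt by simp
 have "len (int ad) \<le> 8 + \<beta>"
  using len_addr(2)[of "ev s i" \<beta> k] w okE_bound[OF w(3)] by (simp add: ad_def nat_mult_distrib tmp_def nar_def mult.commute)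
 then have 4: "len (hd (hin s)) + (len (int tmp) + len (int ad)) \<le> W \<beta>"
  using len_nat[of tmp \<beta>] len_big[OF w(6)] by (simp add: tmp_def nar_def W_def)
 have "reprs (set_sto s k (nat (ev s i)) (hd (hin s))) (\<sigma>1\<lparr>reg := (reg \<sigma>1)(ad := hd (hin s))\<rparr>)"
  unfolding ad_def by (rule reprs_set[OF 1(3) w(2)])
 then have "reprs ((set_sto s k (nat (ev s i)) (hd (hin s)))\<lparr>hin := tl (hin s)\<rparr>) (\<sigma>1\<lparr>reg := (reg \<sigma>1)(ad := hd (hin s)), inp := tl (hin s)\<rparr>)"
  by (simp add: reprs_def)
 moreover have "t + (len (hd (hin s)) + (len (int tmp) + len (int ad))) \<le> cost \<rho> (Rd k i) * (2 * W \<beta>)"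
  using 1(2) 4 by (simp add: algebra_simps)
 ultimately show ?case using exec.Seq[OF 1(1) e3] w(7) by auto
next
 case (Wr e)
 then have w: "wfE e" "okE \<beta> s e" "Q (s\<lparr>hout := hout s @ [ev s e]\<rparr>)" by auto
 obtain t \<sigma>1 where 1: "exec (compE tmp e) \<sigma> t \<sigma>1" "t \<le> szE e * W \<beta>" "reprs s \<sigma>1" "reg \<sigma>1 tmp = ev s e"
  using compE_correct[OF w(2) Wr.prems(3), of tmp] w(1) by (auto simp: wfE_def tmp_def nar_def)
 have e2: "exec (Output (Reg (Direct tmp))) \<sigma>1 (len (int tmp) + len (ev s e)) (\<sigma>1\<lparr>outp := outp \<sigma>1 @ [ev s e]\<rparr>)"
  using exec.Output[of \<sigma>1 "Reg (Direct tmp)"] 1(4) by simp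
 have "reprs (s\<lparr>hout := hout s @ [ev s e]\<rparr>) (\<sigma>1\<lparr>outp := outp \<sigma>1 @ [ev s e]\<rparr>)"
  using 1(3) by (simp add: reprs_def)
 moreover have "t + (len (int tmp) + len (ev s e)) \<le> cost \<rho> (Wr e) * (2 * W \<beta>)"
  using len_nat[of tmp \<beta>] len_big[OF okE_bound[OF w(2)]] 1(2) by (simp add: algebra_simps tmp_def nar_def W_def)
 ultimately show ?case using exec.Seq[OF 1(1) e2] w(3) by auto
qed

section \<open>Static control of intermediate values\<close>

fun nnE :: "hst => ex => bool" where
 "nnE s (N c) = True" | "nnE s (A k e) = (nnE s e \<and> 0 \<le> ev s e)" | "nnE s (B f a b) = (nnE s a \<and> nnE s b)"

text \<open>If stored values are at most 2^w, an expression evaluates to at most 2^(w times its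
  degree). A sum costs one unit because 2 \<le> 2^w.\<close>

fun mdeg :: "ex => nat" where
 "mdeg (N c) = 1" | "mdeg (A k e) = max 1 (mdeg e)"
| "mdeg (B f a b) = (case f of MUL => mdeg a + mdeg b | DIV => max (mdeg a) (mdeg b) | _ => Suc (max (mdeg a) (mdeg b)))"

fun constE :: "ex => bool" where
 "constE (N c) = (\<bar>c\<bar> \<le> 2 ^ 12)" | "constE (A k e) = constE e" | "constE (B f a b) = (constE a \<and> constE b)"

definition statE :: "ex => bool" where "statE e \<longleftrightarrow> constE e \<and> mdeg e < 16"

fun stat :: "cm => bool" where
 "stat Skp = True" | "stat (St k i e) = (statE i \<and> statE e)" | "stat (Sq c1 c2) = (stat c1 \<and> stat c2)"
| "stat (If e c1 c2) = (statE e \<and> stat c1 \<and> stat c2)" | "stat (For v e r c) = (statE e \<and> stat c)"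
| "stat (Half v e r c) = (statE e \<and> stat c)" | "stat (Rd k i) = statE i" | "stat (Wr e) = statE e"

definition bnds :: "nat => hst => bool" where "bnds w s \<longleftrightarrow> (\<forall>k i. \<bar>sto s k i\<bar> \<le> 2 ^ w)"

abbreviation "ble w \<equiv> (\<lambda>v::int. \<bar>v\<bar> \<le> 2 ^ w)"

lemma mdeg_pos: "1 \<le> mdeg e"
 by (induction e) (auto split: arith_op.splits)

lemma abs_div_le: "\<bar>a div b\<bar> \<le> \<bar>a::int\<bar>"
proof (cases "b = 0")
 case False
 define x where "x = real_of_int a / real_of_int b"
 have "\<bar>real_of_int a\<bar> / \<bar>real_of_int b\<bar> \<le> \<bar>real_of_int a\<bar> / 1" using False by (intro divide_left_mono) auto
 then have "\<bar>x\<bar> \<le> \<bar>real_of_int a\<bar>" by (simp add: x_def abs_divide)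
 then have x: "x \<le> real_of_int \<bar>a\<bar>" "- real_of_int \<bar>a\<bar> \<le> x" by (simp_all only: of_int_abs abs_le_iff) linarith+
 have "\<lfloor>x\<rfloor> \<le> \<bar>a\<bar>" using floor_mono[OF x(1)] by (simp only: floor_of_int)
 moreover have "real_of_int (- \<bar>a\<bar>) \<le> x" using x(2) by (simp only: of_int_minus)
 then have "- \<bar>a\<bar> \<le> \<lfloor>x\<rfloor>" by (simp only: le_floor_iff)
 moreover have "a div b = \<lfloor>x\<rfloor>" unfolding x_def by (rule floor_divide_of_int_eq[symmetric])
 ultimately show ?thesis by linarith
qed simp

lemma ev_bound:
 assumes "bnds w s" "constE e" "12 \<le> w"
 shows "\<bar>ev s e\<bar> \<le> 2 ^ (w * mdeg e)"
 using assms(2)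
proof (induction e)
 case (N c)
 have "(2::int) ^ 12 \<le> 2 ^ w" using assms(3) by (intro power_increasing) auto
 then show ?case using N by simp
next
 case (A k e)
 have "\<bar>ev s (A k e)\<bar> \<le> 2 ^ w" using assms(1) by (simp add: bnds_def)
 also have "\<dots> \<le> 2 ^ (w * mdeg (A k e))" by (intro power_increasing) auto
 finally show ?case .
next
 case (B f a b)
 have a: "\<bar>ev s a\<bar> \<le> 2 ^ (w * mdeg a)" and b: "\<bar>ev s b\<bar> \<le> 2 ^ (w * mdeg b)" using B by auto
 have m: "(2::int) ^ (w * mdeg a) \<le> 2 ^ (w * max (mdeg a) (mdeg b))" "(2::int) ^ (w * mdeg b) \<le> 2 ^ (w * max (mdeg a) (mdeg b))"
  by (intro power_increasing mult_left_mono; simp)+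
 have d: "2 * (2::int) ^ (w * max (mdeg a) (mdeg b)) \<le> 2 ^ (w * Suc (max (mdeg a) (mdeg b)))"
 proof -
  have "(2::int) ^ 1 \<le> 2 ^ w" using assms(3) by (intro power_increasing) auto
  then have "2 * (2::int) ^ (w * max (mdeg a) (mdeg b)) \<le> 2 ^ w * 2 ^ (w * max (mdeg a) (mdeg b))" by (intro mult_right_mono) auto
  then show ?thesis by (simp add: power_add)
 qed
 show ?case
 proof (cases f)
  case ADD
  have "\<bar>ev s a + ev s b\<bar> \<le> 2 * 2 ^ (w * max (mdeg a) (mdeg b))" using a b m by linarith
  then show ?thesis using ADD d by (simp del: mult_Suc_right)
 next
  case SUB
  have "\<bar>ev s a - ev s b\<bar> \<le> 2 * 2 ^ (w * max (mdeg a) (mdeg b))" using a b m by linarith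
  then show ?thesis using SUB d by (simp del: mult_Suc_right)
 next
  case MUL
  have "\<bar>ev s a\<bar> * \<bar>ev s b\<bar> \<le> 2 ^ (w * mdeg a) * 2 ^ (w * mdeg b)" using a b by (intro mult_mono) auto
  then show ?thesis using MUL by (simp add: abs_mult power_add distrib_left)
 next
  case DIV
  have "\<bar>ev s a div ev s b\<bar> \<le> 2 ^ (w * max (mdeg a) (mdeg b))" using abs_div_le[of "ev s a" "ev s b"] a m by linarith
  then show ?thesis using DIV by simp
 qed
qed

lemma okE_bnds:
 assumes "bnds w s" "12 \<le> w" "constE e" "mdeg e < 16" "nnE s e"
 shows "okE (16 * w) s e"
proof -
 have lt: "\<bar>ev s e\<bar> < 2 ^ (16 * w)" if "constE e" "mdeg e < 16" for e
 proof -
  have "\<bar>ev s e\<bar> \<le> 2 ^ (w * mdeg e)" by (rule ev_bound[OF assms(1) that(1) assms(2)])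
  also have "\<dots> < 2 ^ (16 * w)" using that(2) assms(2) by (intro power_strict_increasing) auto
  finally show ?thesis .
 qed
 show ?thesis using assms(3-5)
 proof (induction e)
  case (N c) then show ?case using lt[of "N c"] by simp
 next
  case (A k e) then show ?case using lt[of "A k e"] by simp
 next
  case (B f a b)
  have "mdeg a < 16" "mdeg b < 16" using B.prems(2) mdeg_pos[of a] mdeg_pos[of b] by (auto split: arith_op.splits)
  then show ?case using B lt[of "B f a b"] by simp
 qed
qed

lemma bnds_set: "bnds w s ==> \<bar>v\<bar> \<le> 2 ^ w ==> bnds w (set_sto s k i v)"
 by (simp add: bnds_def sto_set_sto)

text \<open>Program proofs have to bound stored values only. Expressions of degree below 16 keep
  every intermediate result below 2^(16 w), which \<open>stat\<close> checks on the program
  text.\<close>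

lemma wp_bounded:
 assumes "12 \<le> w"
 shows "stat c ==> bnds w s ==> wp nnE (ble w) \<rho> c Q s ==>
  wp (okE (16 * w)) (\<lambda>v. \<bar>v\<bar> < 2 ^ (16 * w)) \<rho> c (\<lambda>s. Q s \<and> bnds w s) s"
proof (induction c arbitrary: Q s)
 case Skp then show ?case by simp
next
 have lt: "\<bar>v\<bar> < 2 ^ (16 * w)" if "\<bar>v\<bar> \<le> 2 ^ w" for v :: int
 proof -
  have "(2::int) ^ w < 2 ^ (16 * w)" using assms by (intro power_strict_increasing) auto
  then show ?thesis using that by linarith
 qed
 note ok = okE_bnds[OF _ assms]
 {
  case (St k i e) then show ?case by (auto simp: statE_def intro: ok lt bnds_set)
 next
  case (Sq c1 c2)
  have "wp nnE (ble w) \<rho> c1 (wp nnE (ble w) \<rho> c2 Q) s" using Sq.prems by simp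
  then have "wp (okE (16 * w)) (\<lambda>v. \<bar>v\<bar> < 2 ^ (16 * w)) \<rho> c1 (\<lambda>s. wp nnE (ble w) \<rho> c2 Q s \<and> bnds w s) s"
   using Sq.IH(1) Sq.prems by simp
  then show ?case unfolding wp.simps by (rule wp_mono) (use Sq.IH(2) Sq.prems in auto)
 next
  case (If e c1 c2) then show ?case by (auto simp: statE_def intro: ok)
 next
  case (For v e r c)
  have *: "wpl (wp nnE (ble w) \<rho> c) v m Q s ==> bnds w s ==> int m \<le> 2 ^ w ==>
   wpl (wp (okE (16 * w)) (\<lambda>v. \<bar>v\<bar> < 2 ^ (16 * w)) \<rho> c) v m (\<lambda>s. Q s \<and> bnds w s) s" for m s
  proof (induction m arbitrary: s)
   case (Suc m)
   have im: "\<bar>int m\<bar> \<le> 2 ^ w" using Suc.prems(3) by linarith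
   have "wp nnE (ble w) \<rho> c (wpl (wp nnE (ble w) \<rho> c) v m Q) (set_sto s v 0 (int m))" using Suc.prems(1) by simp
   then have "wp (okE (16 * w)) (\<lambda>v. \<bar>v\<bar> < 2 ^ (16 * w)) \<rho> c (\<lambda>s. wpl (wp nnE (ble w) \<rho> c) v m Q s \<and> bnds w s) (set_sto s v 0 (int m))"
    using For.prems(1) by (intro For.IH bnds_set[OF Suc.prems(2) im]) auto
   then have "wp (okE (16 * w)) (\<lambda>v. \<bar>v\<bar> < 2 ^ (16 * w)) \<rho> c (wpl (wp (okE (16 * w)) (\<lambda>v. \<bar>v\<bar> < 2 ^ (16 * w)) \<rho> c) v m (\<lambda>s. Q s \<and> bnds w s)) (set_sto s v 0 (int m))"
   proof (rule wp_mono)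
    fix s' assume "wpl (wp nnE (ble w) \<rho> c) v m Q s' \<and> bnds w s'"
    moreover have "int m \<le> 2 ^ w" using im by linarith
    ultimately show "wpl (wp (okE (16 * w)) (\<lambda>v. \<bar>v\<bar> < 2 ^ (16 * w)) \<rho> c) v m (\<lambda>s. Q s \<and> bnds w s) s'"
     using Suc.IH by blast
   qed
   then show ?case by simp
  qed simp
  have "int (nat (ev s e)) \<le> 2 ^ w" using For.prems by auto
  then show ?case using For.prems by (auto simp: statE_def intro!: ok lt * bnds_set)
 next
  case (Half v e r c)
  have *: "wph (wp nnE (ble w) \<rho> c) v m Q s ==> bnds w s ==> int m \<le> 2 ^ w ==>
   wph (wp (okE (16 * w)) (\<lambda>v. \<bar>v\<bar> < 2 ^ (16 * w)) \<rho> c) v m (\<lambda>s. Q s \<and> bnds w s) s" for m s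
  proof (induction m arbitrary: s rule: less_induct)
   case (less m)
   show ?case
   proof (cases "m = 0")
    case True then show ?thesis using less.prems by (simp add: wph.simps[of _ _ 0])
   next
    case False
    define y where "y = m div 2"
    have "int y \<le> int m" by (simp add: y_def)
    then have h: "int y \<le> 2 ^ w" "\<bar>int y\<bar> \<le> 2 ^ w" using less.prems(3) by linarith+
    have "wp nnE (ble w) \<rho> c (wph (wp nnE (ble w) \<rho> c) v (y) Q) (set_sto s v 0 (int (y)))"
     using less.prems(1) False by (simp add: wph.simps[of _ _ m, folded y_def])
    then have "wp (okE (16 * w)) (\<lambda>v. \<bar>v\<bar> < 2 ^ (16 * w)) \<rho> c (\<lambda>s. wph (wp nnE (ble w) \<rho> c) v (y) Q s \<and> bnds w s) (set_sto s v 0 (int (y)))"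
     using Half.prems(1) h by (intro Half.IH bnds_set[OF less.prems(2) h(2)]) auto
    then have "wp (okE (16 * w)) (\<lambda>v. \<bar>v\<bar> < 2 ^ (16 * w)) \<rho> c (wph (wp (okE (16 * w)) (\<lambda>v. \<bar>v\<bar> < 2 ^ (16 * w)) \<rho> c) v (y) (\<lambda>s. Q s \<and> bnds w s)) (set_sto s v 0 (int (y)))"
    proof (rule wp_mono)
     fix s' assume "wph (wp nnE (ble w) \<rho> c) v (y) Q s' \<and> bnds w s'"
     moreover have "y < m" using False by (simp add: y_def)
     ultimately show "wph (wp (okE (16 * w)) (\<lambda>v. \<bar>v\<bar> < 2 ^ (16 * w)) \<rho> c) v (y) (\<lambda>s. Q s \<and> bnds w s) s'"
      using less.IH h(1) by blast
    qed
    then show ?thesis using False by (simp add: wph.simps[of _ _ m, folded y_def])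
   qed
  qed
  have "int (nat (ev s e)) \<le> 2 ^ w" using Half.prems by auto
  then show ?case using Half.prems by (auto simp: statE_def intro!: ok lt * bnds_set)
 next
  case (Rd k i) then show ?case using bnds_set by (auto simp: statE_def bnds_def sto_set_sto intro!: ok lt)
 next
  case (Wr e) then show ?case by (auto simp: statE_def bnds_def intro!: ok)
 }
qed

section \<open>The program: cutting\<close>

abbreviation adde (infixl "+." 65) where "a +. b \<equiv> B ADD a b"
abbreviation sube (infixl "-." 65) where "a -. b \<equiv> B SUB a b"
abbreviation mule (infixl "*." 70) where "a *. b \<equiv> B MUL a b"
abbreviation dive (infixl "div." 70) where "a div. b \<equiv> B DIV a b"
abbreviation Va :: "nat => ex" where "Va k \<equiv> A k (N 0)"
abbreviation Set :: "nat => ex => cm" where "Set k e \<equiv> St k (N 0) e"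
abbreviation Loopn :: "nat => cm => cm" where "Loopn v c \<equiv> For v (Va 0) 0 c"

declare wp.simps(5,6) [simp del]

definition frame :: "cm => hst => hst => bool" where
 "frame c s s' \<longleftrightarrow> (\<forall>k. k \<notin> wr c --> sto s' k = sto s k) \<and> (\<not> io c --> hin s' = hin s \<and> hout s' = hout s)"

lemma frame_sto: "frame c s s' ==> k \<notin> wr c ==> sto s' k = sto s k"
 by (simp add: frame_def)

lemma frame_io: "frame c s s' ==> \<not> io c ==> hin s' = hin s" "frame c s s' ==> \<not> io c ==> hout s' = hout s"
 by (simp_all add: frame_def)

lemma wp_frame_rule:
 assumes "wp ok bd \<rho> c R s" "\<And>s'. R s' ==> frame c s s' ==> Q s'"
 shows "wp ok bd \<rho> c Q s"
proof (cases "io c")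
 case True
 show ?thesis by (rule wp_mono[OF wp_frame[OF assms(1)]]) (use assms(2) True in \<open>auto simp: frame_def\<close>)
next
 case False
 show ?thesis
  by (rule wp_mono[OF wp_frame_io[OF wp_frame[OF assms(1)] False]]) (use assms(2) in \<open>auto simp: frame_def\<close>)
qed

lemma wp_SqI: "wp ok bd \<rho> c1 (wp ok bd \<rho> c2 Q) s ==> wp ok bd \<rho> (Sq c1 c2) Q s"
 by simp

lemma wp_Sq_rule:
 assumes "wp ok bd \<rho> c1 R s" "\<And>s'. R s' ==> frame c1 s s' ==> wp ok bd \<rho> c2 Q s'"
 shows "wp ok bd \<rho> (Sq c1 c2) Q s"
 using wp_frame_rule[OF assms] by simp

lemma wp_For_frame:
 assumes e: "ok s e" "bd (ev s e)" "ev s e \<le> int (\<rho> r)" "ev s e = int m" and i: "I m (set_sto s v 0 (int m))"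
  and step: "\<And>k s'. k < m ==> I (Suc k) s' ==> frame (For v e r c) s s' ==> wp ok bd \<rho> c (I k) (set_sto s' v 0 (int k))"
  and Q: "\<And>s'. I 0 s' ==> frame (For v e r c) s s' ==> Q s'"
 shows "wp ok bd \<rho> (For v e r c) Q s"
proof (rule wp_For[where I = "\<lambda>k s'. I k s' \<and> frame (For v e r c) s s'" and m = m])
 show "I m (set_sto s v 0 (int m)) \<and> frame (For v e r c) s (set_sto s v 0 (int m))" using i by (auto simp: frame_def sto_set_sto fun_eq_iff)
next
 fix k s' assume k: "k < m" and I: "I (Suc k) s' \<and> frame (For v e r c) s s'"
 show "wp ok bd \<rho> c (\<lambda>s'. I k s' \<and> frame (For v e r c) s s') (set_sto s' v 0 (int k))"
 proof (rule wp_frame_rule[OF step[OF k conjunct1[OF I] conjunct2[OF I]]])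
  fix s2 assume "I k s2" "frame c (set_sto s' v 0 (int k)) s2"
  then show "I k s2 \<and> frame (For v e r c) s s2" using I by (auto simp: frame_def)
 qed
qed (use e Q in auto)

lemma wp_Half_frame:
 assumes e: "ok s e" "bd (ev s e)" "ev s e < 2 ^ \<rho> r" "ev s e = int m" and i: "I m (set_sto s v 0 (int m))"
  and step: "\<And>k s'. 0 < k ==> I k s' ==> frame (Half v e r c) s s' ==> wp ok bd \<rho> c (I (k div 2)) (set_sto s' v 0 (int (k div 2)))"
  and Q: "\<And>s'. I 0 s' ==> frame (Half v e r c) s s' ==> Q s'"
 shows "wp ok bd \<rho> (Half v e r c) Q s"
proof -
 have "wph (wp ok bd \<rho> c) v m Q (set_sto s v 0 (int m))"
 proof (rule wph_rule[where I = "\<lambda>k s'. I k s' \<and> frame (Half v e r c) s s'"])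
  show "I m (set_sto s v 0 (int m)) \<and> frame (Half v e r c) s (set_sto s v 0 (int m))" using i by (auto simp: frame_def sto_set_sto fun_eq_iff)
 next
  fix k s' assume k: "0 < k" and I: "I k s' \<and> frame (Half v e r c) s s'"
  show "wp ok bd \<rho> c (\<lambda>s'. I (k div 2) s' \<and> frame (Half v e r c) s s') (set_sto s' v 0 (int (k div 2)))"
  proof (rule wp_frame_rule[OF step[OF k conjunct1[OF I] conjunct2[OF I]]])
   fix s2 assume "I (k div 2) s2" "frame c (set_sto s' v 0 (int (k div 2))) s2"
   then show "I (k div 2) s2 \<and> frame (Half v e r c) s s2" using I by (auto simp: frame_def)
  qed
 qed (use Q in blast)
 then show ?thesis using e by (simp add: wp.simps(6))
qed

lemma nat_index [simp]: "nat (int i * int n + int j) = i * n + j"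
 by (metis nat_int of_nat_add of_nat_mult)

lemma nat_int_diff_one [simp]: "nat (int i + 1 - 1) = i" by simp

lemma index_inj: "j < n ==> j' < n ==> i * n + j = i' * n + j' \<longleftrightarrow> i = i' \<and> j = (j'::nat)"
proof
 assume j: "j < n" "j' < n" and e: "i * n + j = i' * n + j'"
 have "(i * n + j) div n = i" "(i' * n + j') div n = i'" "(i * n + j) mod n = j" "(i' * n + j') mod n = j'" using j by auto
 then show "i = i' \<and> j = j'" using e by metis
qed simp

lemma atLeast_Suc_insert: "k < n ==> {k..<n} = insert k {Suc k..<(n::nat)}" by auto

text \<open>Storage: 0 n, 1 largest utility, 2 L, 3 to 8 powers of two with M in 8, 9 flag of the
  main loop, 10 low good plus one, 11 row r, 12 E, 13 flag of the gap search, 14 accumulator, 15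
  utilities, 16 rows V, 17 prices P, 18 best goods, 19 demand, 20 direction Z, 21 row values, 22
  labels, 23 to 28 state of Euclid's algorithm, 29 its flag, 30 and 31 temporaries, 32 to 38
  counters and indices.\<close>

definition colsums :: cm where
 "colsums = Loopn 33 (Sq (Set 14 (N 0)) (Sq (Loopn 34 (Set 14 (Va 14 +. A 16 (Va 34 *. Va 0 +. Va 33)))) (St 17 (Va 33) (Va 14))))"

lemma wr_colsums [simp]: "wr colsums = {33, 14, 34, 17}" "\<not> io colsums" by (auto simp: colsums_def)

definition products :: cm where
 "products = Loopn 34 (Sq (Set 14 (N 0)) (Sq (Loopn 33 (Set 14 (Va 14 +. A 16 (Va 34 *. Va 0 +. Va 33) *. A 20 (Va 33)))) (St 21 (Va 34) (Va 14))))"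

lemma wr_products [simp]: "wr products = {33, 14, 34, 21}" "\<not> io products" by (auto simp: products_def)

text \<open>The index is stored plus one, so that 0 means that no price is too low. The summand
  \<open>N 1\<close> turns the strict test into a weak inequality between integers.\<close>

definition find_low :: cm where
 "find_low = Sq (Set 10 (N 0)) (Loopn 33 (If (Va 0 *. Va 8 +. N 1 -. A 17 (Va 33) *. Va 4) (Set 10 (Va 33 +. N 1)) Skp))"

lemma wr_find_low [simp]: "wr find_low = {10, 33}" "\<not> io find_low" by (auto simp: find_low_def)

definition low_dir :: cm where
 "low_dir = Sq (Loopn 33 (St 20 (Va 33) (N 0 -. N 1))) (St 20 (Va 10 -. N 1) (Va 4 -. N 1))"

lemma wr_low_dir [simp]: "wr low_dir = {20, 33}" "\<not> io low_dir" by (auto simp: low_dir_def)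

definition best :: cm where
 "best = Loopn 32 (Sq (St 18 (Va 32) (N 0)) (Loopn 33 (If (A 15 (Va 32 *. Va 0 +. Va 33) *. A 17 (A 18 (Va 32)) -. A 15 (Va 32 *. Va 0 +. A 18 (Va 32)) *. A 17 (Va 33))
   (St 18 (Va 32) (Va 33)) Skp)))"

lemma wr_best [simp]: "wr best = {32, 18, 33}" "\<not> io best" by (auto simp: best_def)


definition demands :: cm where
 "demands = Sq (Loopn 33 (St 19 (Va 33) (N 0))) (Loopn 32 (St 19 (A 18 (Va 32)) (A 19 (A 18 (Va 32)) +. A 17 (Va 32))))"

lemma wr_demands [simp]: "wr demands = {19, 32, 33}" "\<not> io demands" by (auto simp: demands_def)

definition high_dir :: cm where
 "high_dir = Loopn 33 (St 20 (Va 33) ((Va 7 *. A 19 (Va 33)) div. A 17 (Va 33) +. N 2 -. Va 7))"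

lemma wr_high_dir [simp]: "wr high_dir = {20, 33}" "\<not> io high_dir" by (auto simp: high_dir_def)

definition argmax :: cm where
 "argmax = Sq (Set 11 (N 0)) (Loopn 34 (If (A 21 (Va 34) -. A 21 (Va 11)) (Set 11 (Va 34)) Skp))"

lemma wr_argmax [simp]: "wr argmax = {11, 34}" "\<not> io argmax" by (auto simp: argmax_def)

locale machine =
 fixes n w :: nat and \<rho> :: "nat => nat"
 assumes n0: "0 < n" and r0: "\<rho> 0 = n" and nw: "int (n * n) \<le> 2 ^ w"
begin

abbreviation WP :: "cm => (hst => bool) => hst => bool" where "WP \<equiv> wp nnE (ble w) \<rho>"

lemma small: "i \<le> n ==> int i \<le> 2 ^ w" "i \<le> n ==> \<bar>int i\<bar> \<le> 2 ^ w"
proof -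
 assume "i \<le> n"
 then have "i \<le> n * n" using n0 by (metis le_trans le_square)
 then have "int i \<le> int (n * n)" by (simp only: of_nat_le_iff)
 then show "int i \<le> 2 ^ w" "\<bar>int i\<bar> \<le> 2 ^ w" using nw by linarith+
qed

lemma wp_loop:
 assumes "sto s 0 0 = int n" "I n (set_sto s v 0 (int n))"
  "\<And>k s'. k < n ==> I (Suc k) s' ==> frame (Loopn v c) s s' ==> WP c (I k) (set_sto s' v 0 (int k))"
  "\<And>s'. I 0 s' ==> frame (Loopn v c) s s' ==> Q s'"
 shows "WP (Loopn v c) Q s"
 by (rule wp_For_frame[where I = I and m = n]) (use assms small(2)[of n] r0 in simp_all)

lemma wp_StI:
 assumes "ev s i = int a" "ev s e = x" "nnE s i" "nnE s e" "\<bar>x\<bar> \<le> 2 ^ w" "Q (set_sto s k a x)"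
 shows "WP (St k i e) Q s"
 using assms by simp

lemma wp_accum:
 assumes n: "sto s 0 0 = int n" and v: "v \<noteq> 14" and s: "sto s 14 0 = 0"
  and g: "\<And>k s'. k < n ==> frame (Loopn v (Set 14 (Va 14 +. e))) s s' ==>
   nnE (set_sto s' v 0 (int k)) e \<and> ev (set_sto s' v 0 (int k)) e = g k"
  and b: "(\<Sum>k<n. \<bar>g k\<bar>) \<le> 2 ^ w"
  and Q: "\<And>s'. frame (Loopn v (Set 14 (Va 14 +. e))) s s' ==> sto s' 14 0 = (\<Sum>k<n. g k) ==> Q s'"
 shows "WP (Loopn v (Set 14 (Va 14 +. e))) Q s"
proof (rule wp_loop[where I = "\<lambda>k s'. sto s' 14 0 = (\<Sum>l\<in>{k..<n}. g l)"])
 fix k s' assume k: "k < n" and I: "sto s' 14 0 = (\<Sum>l\<in>{Suc k..<n}. g l)" and f: "frame (Loopn v (Set 14 (Va 14 +. e))) s s'"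
 have sm: "(\<Sum>l\<in>{k..<n}. g l) = (\<Sum>l\<in>{Suc k..<n}. g l) + g k" using k by (simp add: atLeast_Suc_insert)
 have "\<bar>\<Sum>l\<in>{k..<n}. g l\<bar> \<le> (\<Sum>l\<in>{k..<n}. \<bar>g l\<bar>)" by (rule sum_abs)
 also have "\<dots> \<le> (\<Sum>l<n. \<bar>g l\<bar>)" by (intro sum_mono2) auto
 finally have "\<bar>\<Sum>l\<in>{k..<n}. g l\<bar> \<le> 2 ^ w" using b by linarith
 then show "WP (Set 14 (Va 14 +. e)) (\<lambda>s'. sto s' 14 0 = (\<Sum>l\<in>{k..<n}. g l)) (set_sto s' v 0 (int k))"
  using g[OF k f] I v by (intro wp_StI[where a = 0 and x = "\<Sum>l\<in>{k..<n}. g l"]) (auto simp: sm sto_set_sto)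
next
 fix s' assume "sto s' 14 0 = (\<Sum>l\<in>{0..<n}. g l)" "frame (Loopn v (Set 14 (Va 14 +. e))) s s'"
 then show "Q s'" by (intro Q) (simp_all add: atLeast0LessThan)
qed (use n s v in \<open>auto simp: sto_set_sto\<close>)

lemma wp_colsums:
 assumes n: "sto s 0 0 = int n" and b: "\<And>j. j < n ==> (\<Sum>k<n. \<bar>sto s 16 (k * n + j)\<bar>) \<le> 2 ^ w"
 shows "WP colsums (\<lambda>s'. \<forall>j<n. sto s' 17 j = (\<Sum>k<n. sto s 16 (k * n + j))) s"
 unfolding colsums_def
proof (rule wp_loop[where I = "\<lambda>j s'. \<forall>j'<n. j \<le> j' --> sto s' 17 j' = (\<Sum>k<n. sto s 16 (k * n + j'))", OF n])
 fix j s' assume j: "j < n" and I: "\<forall>j'<n. Suc j \<le> j' --> sto s' 17 j' = (\<Sum>k<n. sto s 16 (k * n + j'))"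
  and f: "frame (Loopn 33 (Sq (Set 14 (N 0)) (Sq (Loopn 34 (Set 14 (Va 14 +. A 16 (Va 34 *. Va 0 +. Va 33)))) (St 17 (Va 33) (Va 14))))) s s'"
 note fs = frame_sto[OF f]
 have main: "WP (Loopn 34 (Set 14 (Va 14 +. A 16 (Va 34 *. Va 0 +. Va 33))))
   (WP (St 17 (Va 33) (Va 14)) (\<lambda>s'. \<forall>j'<n. j \<le> j' --> sto s' 17 j' = (\<Sum>k<n. sto s 16 (k * n + j'))))
   (set_sto (set_sto s' 33 0 (int j)) 14 0 0)"
 proof (rule wp_accum[where g = "\<lambda>k. sto s 16 (k * n + j)"])
  fix k s2 assume "k < n" and f2: "frame (Loopn 34 (Set 14 (Va 14 +. A 16 (Va 34 *. Va 0 +. Va 33)))) (set_sto (set_sto s' 33 0 (int j)) 14 0 0) s2"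
  note fs2 = frame_sto[OF f2]
  show "nnE (set_sto s2 34 0 (int k)) (A 16 (Va 34 *. Va 0 +. Va 33)) \<and> ev (set_sto s2 34 0 (int k)) (A 16 (Va 34 *. Va 0 +. Va 33)) = sto s 16 (k * n + j)"
   by (simp add: sto_set_sto fs2 fs n)
 next
  fix s2 assume f2: "frame (Loopn 34 (Set 14 (Va 14 +. A 16 (Va 34 *. Va 0 +. Va 33)))) (set_sto (set_sto s' 33 0 (int j)) 14 0 0) s2"
   and r: "sto s2 14 0 = (\<Sum>k<n. sto s 16 (k * n + j))"
  note fs2 = frame_sto[OF f2]
  have "\<bar>\<Sum>k<n. sto s 16 (k * n + j)\<bar> \<le> 2 ^ w" using b[OF j] sum_abs[of "\<lambda>k. sto s 16 (k * n + j)" "{..<n}"] by linarith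
  then show "WP (St 17 (Va 33) (Va 14)) (\<lambda>s'. \<forall>j'<n. j \<le> j' --> sto s' 17 j' = (\<Sum>k<n. sto s 16 (k * n + j'))) s2"
   using I r by (intro wp_StI[where a = j and x = "sto s2 14 0"]) (auto simp: fs2 sto_set_sto)
 qed (use b[OF j] in \<open>simp_all add: sto_set_sto fs n\<close>)
 show "WP (Sq (Set 14 (N 0)) (Sq (Loopn 34 (Set 14 (Va 14 +. A 16 (Va 34 *. Va 0 +. Va 33)))) (St 17 (Va 33) (Va 14))))
   (\<lambda>s'. \<forall>j'<n. j \<le> j' --> sto s' 17 j' = (\<Sum>k<n. sto s 16 (k * n + j'))) (set_sto s' 33 0 (int j))"
  by (rule wp_SqI, rule wp_StI[where a = 0 and x = 0], simp, simp, simp, simp, simp, rule wp_SqI, rule main)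
qed auto

lemma wp_products:
 assumes n: "sto s 0 0 = int n" and b: "\<And>k. k < n ==> (\<Sum>j<n. \<bar>sto s 16 (k * n + j) * sto s 20 j\<bar>) \<le> 2 ^ w"
 shows "WP products (\<lambda>s'. \<forall>k<n. sto s' 21 k = (\<Sum>j<n. sto s 16 (k * n + j) * sto s 20 j)) s"
 unfolding products_def
proof (rule wp_loop[where I = "\<lambda>k s'. \<forall>k'<n. k \<le> k' --> sto s' 21 k' = (\<Sum>j<n. sto s 16 (k' * n + j) * sto s 20 j)", OF n])
 fix k s' assume k: "k < n" and I: "\<forall>k'<n. Suc k \<le> k' --> sto s' 21 k' = (\<Sum>j<n. sto s 16 (k' * n + j) * sto s 20 j)"
  and f: "frame (Loopn 34 (Sq (Set 14 (N 0)) (Sq (Loopn 33 (Set 14 (Va 14 +. A 16 (Va 34 *. Va 0 +. Va 33) *. A 20 (Va 33)))) (St 21 (Va 34) (Va 14))))) s s'"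
 note fs = frame_sto[OF f]
 have main: "WP (Loopn 33 (Set 14 (Va 14 +. A 16 (Va 34 *. Va 0 +. Va 33) *. A 20 (Va 33))))
   (WP (St 21 (Va 34) (Va 14)) (\<lambda>s'. \<forall>k'<n. k \<le> k' --> sto s' 21 k' = (\<Sum>j<n. sto s 16 (k' * n + j) * sto s 20 j)))
   (set_sto (set_sto s' 34 0 (int k)) 14 0 0)"
 proof (rule wp_accum[where g = "\<lambda>j. sto s 16 (k * n + j) * sto s 20 j"])
  fix j s2 assume "j < n" and f2: "frame (Loopn 33 (Set 14 (Va 14 +. A 16 (Va 34 *. Va 0 +. Va 33) *. A 20 (Va 33)))) (set_sto (set_sto s' 34 0 (int k)) 14 0 0) s2"
  note fs2 = frame_sto[OF f2]
  show "nnE (set_sto s2 33 0 (int j)) (A 16 (Va 34 *. Va 0 +. Va 33) *. A 20 (Va 33)) \<and> ev (set_sto s2 33 0 (int j)) (A 16 (Va 34 *. Va 0 +. Va 33) *. A 20 (Va 33)) = sto s 16 (k * n + j) * sto s 20 j"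
   by (simp add: sto_set_sto fs2 fs n)
 next
  fix s2 assume f2: "frame (Loopn 33 (Set 14 (Va 14 +. A 16 (Va 34 *. Va 0 +. Va 33) *. A 20 (Va 33)))) (set_sto (set_sto s' 34 0 (int k)) 14 0 0) s2"
   and r: "sto s2 14 0 = (\<Sum>j<n. sto s 16 (k * n + j) * sto s 20 j)"
  note fs2 = frame_sto[OF f2]
  have "\<bar>\<Sum>j<n. sto s 16 (k * n + j) * sto s 20 j\<bar> \<le> 2 ^ w" using b[OF k] sum_abs[of "\<lambda>j. sto s 16 (k * n + j) * sto s 20 j" "{..<n}"] by linarith
  then show "WP (St 21 (Va 34) (Va 14)) (\<lambda>s'. \<forall>k'<n. k \<le> k' --> sto s' 21 k' = (\<Sum>j<n. sto s 16 (k' * n + j) * sto s 20 j)) s2"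
   using I r by (intro wp_StI[where a = k and x = "sto s2 14 0"]) (auto simp: fs2 sto_set_sto)
 qed (use b[OF k] in \<open>simp_all add: sto_set_sto fs n\<close>)
 show "WP (Sq (Set 14 (N 0)) (Sq (Loopn 33 (Set 14 (Va 14 +. A 16 (Va 34 *. Va 0 +. Va 33) *. A 20 (Va 33)))) (St 21 (Va 34) (Va 14))))
   (\<lambda>s'. \<forall>k'<n. k \<le> k' --> sto s' 21 k' = (\<Sum>j<n. sto s 16 (k' * n + j) * sto s 20 j)) (set_sto s' 34 0 (int k))"
  by (rule wp_SqI, rule wp_StI[where a = 0 and x = 0], simp, simp, simp, simp, simp, rule wp_SqI, rule main)
qed auto

lemma wp_find_low:
 fixes P :: "nat => int" and M H :: int
 assumes n: "sto s 0 0 = int n" and P: "\<And>j. j < n ==> sto s 17 j = P j" and M: "sto s 8 0 = M" "sto s 4 0 = H"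
 shows "WP find_low (\<lambda>s'. sto s' 10 0 = 0 \<and> (\<forall>j<n. n * M < P j * H) \<or> (\<exists>j<n. sto s' 10 0 = int j + 1 \<and> P j * H \<le> n * M)) s"
 unfolding find_low_def
proof (rule wp_SqI, rule wp_StI[where a = 0 and x = 0], simp, simp, simp, simp, simp,
  rule wp_loop[where I = "\<lambda>k s'. sto s' 10 0 = 0 \<and> (\<forall>j<n. k \<le> j --> n * M < P j * H) \<or> (\<exists>j<n. sto s' 10 0 = int j + 1 \<and> P j * H \<le> n * M)"])
 fix k s'
 assume k: "k < n" and I: "sto s' 10 0 = 0 \<and> (\<forall>j<n. Suc k \<le> j --> n * M < P j * H) \<or> (\<exists>j<n. sto s' 10 0 = int j + 1 \<and> P j * H \<le> n * M)"
  and f: "frame (Loopn 33 (If (Va 0 *. Va 8 +. N 1 -. A 17 (Va 33) *. Va 4) (Set 10 (Va 33 +. N 1)) Skp)) (set_sto s 10 0 0) s'"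
 note fs = frame_sto[OF f]
 have b: "\<bar>int k + 1\<bar> \<le> 2 ^ w" using small(2)[of "Suc k"] k by simp
 show "WP (If (Va 0 *. Va 8 +. N 1 -. A 17 (Va 33) *. Va 4) (Set 10 (Va 33 +. N 1)) Skp)
  (\<lambda>s'. sto s' 10 0 = 0 \<and> (\<forall>j<n. k \<le> j --> n * M < P j * H) \<or> (\<exists>j<n. sto s' 10 0 = int j + 1 \<and> P j * H \<le> n * M)) (set_sto s' 33 0 (int k))"
 proof (cases "P k * H \<le> n * M")
  case True
  then show ?thesis using k b by (auto simp: fs sto_set_sto n M P)
 next
  case False
  moreover have "n * M < P j * H" if "\<forall>j<n. Suc k \<le> j --> n * M < P j * H" "j < n" "k \<le> j" for j
   using that False by (cases "j = k") auto
  ultimately show ?thesis using k I by (auto simp: fs sto_set_sto n M P)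
 qed
qed (use n in \<open>auto simp: sto_set_sto\<close>)

lemma wp_low_dir:
 assumes n: "sto s 0 0 = int n" and j0: "sto s 10 0 = int j0 + 1" "j0 < n" and H: "sto s 4 0 = H" "\<bar>H - 1\<bar> \<le> 2 ^ w"
 shows "WP low_dir (\<lambda>s'. \<forall>j<n. sto s' 20 j = (if j = j0 then H - 1 else - 1)) s"
 unfolding low_dir_def
proof (rule wp_Sq_rule[where R = "\<lambda>s'. \<forall>j<n. sto s' 20 j = - 1"])
 show "WP (Loopn 33 (St 20 (Va 33) (N 0 -. N 1))) (\<lambda>s'. \<forall>j<n. sto s' 20 j = - 1) s"
  by (rule wp_loop[where I = "\<lambda>k s'. \<forall>j<n. k \<le> j --> sto s' 20 j = - 1", OF n]) (auto simp: sto_set_sto)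
next
 fix s' assume a: "\<forall>j<n. sto s' 20 j = - 1" and f: "frame (Loopn 33 (St 20 (Va 33) (N 0 -. N 1))) s s'"
 show "WP (St 20 (Va 10 -. N 1) (Va 4 -. N 1)) (\<lambda>s'. \<forall>j<n. sto s' 20 j = (if j = j0 then H - 1 else - 1)) s'"
  by (rule wp_StI[where a = j0 and x = "H - 1"]) (use a H j0 in \<open>auto simp: frame_sto[OF f] sto_set_sto\<close>)
qed

text \<open>Transitivity of the cross-multiplied comparison of utility per unit of money; the middle
  price Pc cancels.\<close>

lemma better_good:
 fixes ul uc uj Pl Pc Pj :: int
 assumes 1: "ul * Pc \<le> uc * Pl" and 2: "uc * Pj < uj * Pc" and p: "0 < Pl" "0 < Pc" "0 < Pj"
 shows "ul * Pj \<le> uj * Pl"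
proof -
 have "(ul * Pc) * Pj \<le> (uc * Pl) * Pj" using 1 p by (intro mult_right_mono) auto
 also have "\<dots> = (uc * Pj) * Pl" by (simp only: ac_simps)
 also have "\<dots> \<le> (uj * Pc) * Pl" using 2 p by (intro mult_right_mono) auto
 finally have "Pc * (ul * Pj) \<le> Pc * (uj * Pl)" by (simp only: ac_simps)
 then show ?thesis using p by simp
qed

lemma wp_best:
 assumes n: "sto s 0 0 = int n" and P: "\<And>j. j < n ==> sto s 17 j = P j" "\<And>j. j < n ==> 0 < P j"
  and u: "\<And>i j. i < n ==> j < n ==> sto s 15 (i * n + j) = int (u i j)"
 shows "WP best (\<lambda>s'. \<exists>b. (\<forall>i<n. sto s' 18 i = int (b i)) \<and> best_goods n u (\<lambda>j. real_of_int (P j)) b) s"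
proof -
 define ok where "ok s' i k \<longleftrightarrow> (\<exists>c<n. sto s' 18 i = int c \<and> (\<forall>l<n. k \<le> l --> int (u i l) * P c \<le> int (u i c) * P l))" for s' :: hst and i k
 show ?thesis
  unfolding best_def
 proof (rule wp_loop[where I = "\<lambda>i s'. \<forall>i'<n. i \<le> i' --> ok s' i' 0", OF n])
  fix i s' assume i: "i < n" and I: "\<forall>i'<n. Suc i \<le> i' --> ok s' i' 0"
   and f: "frame (Loopn 32 (Sq (St 18 (Va 32) (N 0)) (Loopn 33 (If (A 15 (Va 32 *. Va 0 +. Va 33) *. A 17 (A 18 (Va 32)) -. A 15 (Va 32 *. Va 0 +. A 18 (Va 32)) *. A 17 (Va 33))
    (St 18 (Va 32) (Va 33)) Skp)))) s s'"
  note fs = frame_sto[OF f]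
  show "WP (Sq (St 18 (Va 32) (N 0)) (Loopn 33 (If (A 15 (Va 32 *. Va 0 +. Va 33) *. A 17 (A 18 (Va 32)) -. A 15 (Va 32 *. Va 0 +. A 18 (Va 32)) *. A 17 (Va 33))
    (St 18 (Va 32) (Va 33)) Skp))) (\<lambda>s'. \<forall>i'<n. i \<le> i' --> ok s' i' 0) (set_sto s' 32 0 (int i))"
  proof (rule wp_SqI, rule wp_StI[where a = i and x = 0], simp, simp, simp, simp, simp,
    rule wp_loop[where I = "\<lambda>k s2. (\<forall>i'<n. Suc i \<le> i' --> ok s2 i' 0) \<and> ok s2 i k"])
   fix j s2 assume j: "j < n" and I2: "(\<forall>i'<n. Suc i \<le> i' --> ok s2 i' 0) \<and> ok s2 i (Suc j)"
    and f2: "frame (Loopn 33 (If (A 15 (Va 32 *. Va 0 +. Va 33) *. A 17 (A 18 (Va 32)) -. A 15 (Va 32 *. Va 0 +. A 18 (Va 32)) *. A 17 (Va 33))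
    (St 18 (Va 32) (Va 33)) Skp)) (set_sto (set_sto s' 32 0 (int i)) 18 i 0) s2"
   note fs2 = frame_sto[OF f2]
   obtain c where c: "c < n" "sto s2 18 i = int c" "\<And>l. l < n ==> Suc j \<le> l ==> int (u i l) * P c \<le> int (u i c) * P l"
    using I2 unfolding ok_def by blast
   have o: "ok (set_sto (set_sto s2 33 0 (int j)) 18 i (int j)) i' 0" "ok (set_sto s2 33 0 (int j)) i' 0" if "i' < n" "Suc i \<le> i'" for i'
    using I2 that by (auto simp: ok_def sto_set_sto)
   show "WP (If (A 15 (Va 32 *. Va 0 +. Va 33) *. A 17 (A 18 (Va 32)) -. A 15 (Va 32 *. Va 0 +. A 18 (Va 32)) *. A 17 (Va 33))
    (St 18 (Va 32) (Va 33)) Skp) (\<lambda>s2. (\<forall>i'<n. Suc i \<le> i' --> ok s2 i' 0) \<and> ok s2 i j) (set_sto s2 33 0 (int j))"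
   proof (cases "int (u i c) * P j < int (u i j) * P c")
    case True
    have "int (u i l) * P j \<le> int (u i j) * P l" if l: "l < n" "j \<le> l" for l
    proof (cases "l = j")
     case False
     then have "Suc j \<le> l" using l by simp
     then show ?thesis using better_good[OF c(3)[OF l(1)] True] P(2) l c j by blast
    qed simp
    then have "ok (set_sto (set_sto s2 33 0 (int j)) 18 i (int j)) i j" using j unfolding ok_def by (intro exI[of _ j]) (simp add: sto_set_sto)
    then show ?thesis using True c j i o small(2)[of j] by (simp add: sto_set_sto fs2 fs n P u)
   next
    case False
    have "int (u i l) * P c \<le> int (u i c) * P l" if l: "l < n" "j \<le> l" for l
    proof (cases "l = j")
     case True then show ?thesis using False by simp
    next
     case F: False
     then show ?thesis using c(3) l by simp
    qed
    then have "ok (set_sto s2 33 0 (int j)) i j" using c unfolding ok_def by (intro exI[of _ c]) (simp add: sto_set_sto)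
    then show ?thesis using False c j i o by (simp add: sto_set_sto fs2 fs n P u)
   qed
  next
   fix s2 assume I2: "(\<forall>i'<n. Suc i \<le> i' --> ok s2 i' 0) \<and> ok s2 i 0"
   have "ok s2 i' 0" if "i' < n" "i \<le> i'" for i' using I2 that by (cases "i' = i") auto
   then show "\<forall>i'<n. i \<le> i' --> ok s2 i' 0" by blast
  qed (use I n0 in \<open>auto simp: sto_set_sto fs n ok_def\<close>)
 next
  fix s' assume "\<forall>i'<n. 0 \<le> i' --> ok s' i' 0"
  then have "\<forall>i. \<exists>c. i < n --> c < n \<and> sto s' 18 i = int c \<and> (\<forall>l<n. int (u i l) * P c \<le> int (u i c) * P l)" unfolding ok_def by auto
  then obtain b where b: "\<And>i. i < n ==> b i < n \<and> sto s' 18 i = int (b i) \<and> (\<forall>l<n. int (u i l) * P (b i) \<le> int (u i (b i)) * P l)" by metis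
  have "real (u i l) * real_of_int (P (b i)) \<le> real (u i (b i)) * real_of_int (P l)" if "i < n" "l < n" for i l
  proof -
   have "real_of_int (int (u i l) * P (b i)) \<le> real_of_int (int (u i (b i)) * P l)" using b[OF that(1)] that(2) by (simp only: of_int_le_iff)
   then show ?thesis by simp
  qed
  then show "\<exists>b. (\<forall>i<n. sto s' 18 i = int (b i)) \<and> best_goods n u (\<lambda>j. real_of_int (P j)) b"
   using b unfolding best_goods_def by blast
 qed auto
qed

lemma wp_demands:
 assumes n: "sto s 0 0 = int n" and P: "\<And>j. j < n ==> sto s 17 j = P j" "\<And>j. j < n ==> 0 < P j" "(\<Sum>j<n. P j) \<le> 2 ^ w"
  and b: "\<And>i. i < n ==> sto s 18 i = int (b i)" "\<And>i. i < n ==> b i < n"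
 shows "WP demands (\<lambda>s'. \<forall>j<n. sto s' 19 j = (\<Sum>i | i < n \<and> b i = j. P i)) s"
 unfolding demands_def
proof (rule wp_Sq_rule[where R = "\<lambda>s'. \<forall>j<n. sto s' 19 j = 0"])
 show "WP (Loopn 33 (St 19 (Va 33) (N 0))) (\<lambda>s'. \<forall>j<n. sto s' 19 j = 0) s"
  by (rule wp_loop[where I = "\<lambda>k s'. \<forall>j<n. k \<le> j --> sto s' 19 j = 0", OF n]) (auto simp: sto_set_sto)
next
 fix s1 assume z: "\<forall>j<n. sto s1 19 j = 0" and f: "frame (Loopn 33 (St 19 (Va 33) (N 0))) s s1"
 note fs = frame_sto[OF f]
 show "WP (Loopn 32 (St 19 (A 18 (Va 32)) (A 19 (A 18 (Va 32)) +. A 17 (Va 32)))) (\<lambda>s'. \<forall>j<n. sto s' 19 j = (\<Sum>i | i < n \<and> b i = j. P i)) s1"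
 proof (rule wp_loop[where I = "\<lambda>k s'. \<forall>j<n. sto s' 19 j = (\<Sum>i | k \<le> i \<and> i < n \<and> b i = j. P i)"])
  fix k s2 assume k: "k < n" and I: "\<forall>j<n. sto s2 19 j = (\<Sum>i | Suc k \<le> i \<and> i < n \<and> b i = j. P i)"
   and f2: "frame (Loopn 32 (St 19 (A 18 (Va 32)) (A 19 (A 18 (Va 32)) +. A 17 (Va 32)))) s1 s2"
  note fs2 = frame_sto[OF f2]
  have e: "(\<Sum>i | k \<le> i \<and> i < n \<and> b i = j. P i) = (\<Sum>i | Suc k \<le> i \<and> i < n \<and> b i = j. P i) + (if j = b k then P k else 0)" for j
  proof (cases "j = b k")
   case True
   then have "{i. k \<le> i \<and> i < n \<and> b i = j} = insert k {i. Suc k \<le> i \<and> i < n \<and> b i = j}" using k by auto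
   moreover have "finite {i. Suc k \<le> i \<and> i < n \<and> b i = j}" by (rule finite_subset[of _ "{..<n}"]) auto
   ultimately show ?thesis using True by simp
  next
   case False
   then have "{i. k \<le> i \<and> i < n \<and> b i = j} = {i. Suc k \<le> i \<and> i < n \<and> b i = j}" using le_eq_less_or_eq by auto
   then show ?thesis using False by simp
  qed
  have le: "(\<Sum>i | k \<le> i \<and> i < n \<and> b i = j. P i) \<le> (\<Sum>j<n. P j)" for j using P(2) by (intro sum_mono2) (auto intro: less_imp_le)
  have nn: "0 \<le> (\<Sum>i | k \<le> i \<and> i < n \<and> b i = j. P i)" for j using P(2) by (intro sum_nonneg) (auto intro: less_imp_le)
  have bd: "\<bar>(\<Sum>i | Suc k \<le> i \<and> i < n \<and> b i = b k. P i) + P k\<bar> \<le> 2 ^ w"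
   using e[of "b k"] le[of "b k"] nn[of "b k"] P(3) by simp
  show "WP (St 19 (A 18 (Va 32)) (A 19 (A 18 (Va 32)) +. A 17 (Va 32))) (\<lambda>s'. \<forall>j<n. sto s' 19 j = (\<Sum>i | k \<le> i \<and> i < n \<and> b i = j. P i)) (set_sto s2 32 0 (int k))"
   by (rule wp_StI[where a = "b k" and x = "(\<Sum>i | Suc k \<le> i \<and> i < n \<and> b i = b k. P i) + P k"])
    (use I k bd in \<open>simp_all add: sto_set_sto fs2 fs b P e\<close>)
 next
  show "sto s1 0 0 = int n" by (simp add: fs n)
 next
  have em: "{i. n \<le> i \<and> i < n \<and> b i = j} = {}" for j by auto
  show "\<forall>j<n. sto (set_sto s1 32 0 (int n)) 19 j = (\<Sum>i | n \<le> i \<and> i < n \<and> b i = j. P i)" using z unfolding em by simp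
 qed auto
qed

lemma wp_high_dir:
 assumes n: "sto s 0 0 = int n" and P: "\<And>j. j < n ==> sto s 17 j = P j" and D: "\<And>j. j < n ==> sto s 19 j = D j" and S: "sto s 7 0 = S"
  and b: "\<And>j. j < n ==> \<bar>(S * D j) div P j + 2 - S\<bar> \<le> 2 ^ w"
 shows "WP high_dir (\<lambda>s'. \<forall>j<n. sto s' 20 j = (S * D j) div P j + 2 - S) s"
 unfolding high_dir_def
proof (rule wp_loop[where I = "\<lambda>k s'. \<forall>j<n. k \<le> j --> sto s' 20 j = (S * D j) div P j + 2 - S", OF n])
 fix k s' assume k: "k < n" and I: "\<forall>j<n. Suc k \<le> j --> sto s' 20 j = (S * D j) div P j + 2 - S"
  and f: "frame (Loopn 33 (St 20 (Va 33) ((Va 7 *. A 19 (Va 33)) div. A 17 (Va 33) +. N 2 -. Va 7))) s s'"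
 show "WP (St 20 (Va 33) ((Va 7 *. A 19 (Va 33)) div. A 17 (Va 33) +. N 2 -. Va 7)) (\<lambda>s'. \<forall>j<n. k \<le> j --> sto s' 20 j = (S * D j) div P j + 2 - S) (set_sto s' 33 0 (int k))"
  by (rule wp_StI[where a = k and x = "(S * D k) div P k + 2 - S"]) (use I k b[OF k] in \<open>auto simp: sto_set_sto frame_sto[OF f] P D S\<close>)
qed auto

lemma wp_argmax:
 assumes n: "sto s 0 0 = int n"
 shows "WP argmax (\<lambda>s'. \<exists>r<n. sto s' 11 0 = int r \<and> (\<forall>k<n. sto s 21 k \<le> sto s 21 r)) s"
 unfolding argmax_def
proof (rule wp_SqI, rule wp_StI[where a = 0 and x = 0], simp, simp, simp, simp, simp,
  rule wp_loop[where I = "\<lambda>k s'. \<exists>r<n. sto s' 11 0 = int r \<and> (\<forall>l<n. k \<le> l --> sto s 21 l \<le> sto s 21 r)"])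
 fix k s' assume k: "k < n" and I: "\<exists>r<n. sto s' 11 0 = int r \<and> (\<forall>l<n. Suc k \<le> l --> sto s 21 l \<le> sto s 21 r)"
  and f: "frame (Loopn 34 (If (A 21 (Va 34) -. A 21 (Va 11)) (Set 11 (Va 34)) Skp)) (set_sto s 11 0 0) s'"
 note fs = frame_sto[OF f]
 obtain r where r: "r < n" "sto s' 11 0 = int r" "\<And>l. l < n ==> Suc k \<le> l ==> sto s 21 l \<le> sto s 21 r" using I by blast
 show "WP (If (A 21 (Va 34) -. A 21 (Va 11)) (Set 11 (Va 34)) Skp) (\<lambda>s'. \<exists>r<n. sto s' 11 0 = int r \<and> (\<forall>l<n. k \<le> l --> sto s 21 l \<le> sto s 21 r)) (set_sto s' 34 0 (int k))"
 proof (cases "sto s 21 r < sto s 21 k")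
  case True
  have "sto s 21 l \<le> sto s 21 k" if "l < n" "k \<le> l" for l
   using r(3)[OF that(1)] True that(2) by (cases "l = k") auto
  then have "\<exists>r'<n. int k = int r' \<and> (\<forall>l<n. k \<le> l --> sto s 21 l \<le> sto s 21 r')" using k by blast
  then show ?thesis using True r k small(2)[of k] by (simp add: sto_set_sto fs)
 next
  case False
  have "sto s 21 l \<le> sto s 21 r" if "l < n" "k \<le> l" for l
   using r(3)[OF that(1)] False that(2) by (cases "l = k") auto
  then have "\<exists>r'<n. int r = int r' \<and> (\<forall>l<n. k \<le> l --> sto s 21 l \<le> sto s 21 r')" using r by blast
  then show ?thesis using False r k by (simp add: sto_set_sto fs)
 qed
qed (use n n0 in \<open>auto simp: sto_set_sto\<close>)

end

lemma nat_index0 [simp]: "nat (int i * int n) = i * n"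
 by (metis nat_int of_nat_mult)

lemma wp_IfI:
 "nnE s e ==> 0 < ev s e ==> wp nnE bd \<rho> c1 Q s ==> wp nnE bd \<rho> (If e c1 c2) Q s"
 "nnE s e ==> \<not> 0 < ev s e ==> wp nnE bd \<rho> c2 Q s ==> wp nnE bd \<rho> (If e c1 c2) Q s"
 by simp_all

definition cut_entry :: ex where
 "cut_entry = (N 8 *. Va 0 *. Va 0 *. A 21 (Va 11) *. A 16 (Va 34 *. Va 0 +. Va 33) -. A 21 (Va 34) *. A 16 (Va 11 *. Va 0 +. Va 33))
  div. (N 8 *. Va 0 *. Va 0 *. A 21 (Va 11) -. A 21 (Va 34))"

text \<open>The test on the counter skips coordinate 0. Array 14 starts at M and loses every new
  entry, so at the end it is the corrected entry for coordinate 0.\<close>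

definition cut_inner :: cm where
 "cut_inner = Loopn 33 (If (Va 33) (Sq (St 16 (Va 34 *. Va 0 +. Va 33) cut_entry) (Set 14 (Va 14 -. A 16 (Va 34 *. Va 0 +. Va 33)))) Skp)"

text \<open>The squared difference is positive exactly when the row is not row r.\<close>

definition cut_all :: cm where
 "cut_all = Loopn 34 (If ((Va 34 -. Va 11) *. (Va 34 -. Va 11)) (Sq (Set 14 (Va 8)) (Sq cut_inner (St 16 (Va 34 *. Va 0) (Va 14)))) Skp)"

lemma wr_cut [simp]: "wr cut_inner = {33, 16, 14}" "\<not> io cut_inner" "wr cut_all = {34, 14, 33, 16}" "\<not> io cut_all"
 by (auto simp: cut_all_def cut_inner_def)

definition direction :: cm where "direction = If (Va 10) low_dir (Sq best (Sq demands high_dir))"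

lemma wr_direction [simp]: "wr direction = {20, 33, 32, 18, 19}" "\<not> io direction" by (auto simp: direction_def)

text \<open>Once the flag 9 is set, all later rounds are skipped, and arrays 17 and 18 retain the
  final prices and best goods.\<close>

definition cut_round :: cm where
 "cut_round = If (N 1 -. Va 9) (Sq colsums (Sq find_low (Sq direction (Sq products (Sq argmax
   (If (A 21 (Va 11) -. N 12 *. Va 0 *. Va 8) cut_all (Set 9 (N 1)))))))) Skp"

lemma wr_cut_round [simp]: "wr cut_round = {33, 14, 34, 17, 10, 20, 32, 18, 19, 21, 11, 16, 9}" "\<not> io cut_round" by (auto simp: cut_round_def)

text \<open>The loop bound is 4000 n^5 L, which is \<open>rounds\<close> because x = n^2 L.\<close>

definition main_loop :: cm where "main_loop = For 35 (N 4000 *. Va 0 *. Va 0 *. Va 0 *. Va 0 *. Va 0 *. Va 2) 3 cut_round"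

lemma wr_main_loop [simp]: "wr main_loop = {35, 33, 14, 34, 17, 10, 20, 32, 18, 19, 21, 11, 16, 9}" "\<not> io main_loop" by (auto simp: main_loop_def)

context machine
begin

definition Vrep :: "hst => (nat => nat => int) => bool" where
 "Vrep s f \<longleftrightarrow> (\<forall>k<n. \<forall>j<n. sto s 16 (k * n + j) = f k j)"

lemma Vrep_get: "Vrep s f ==> k < n ==> j < n ==> sto s 16 (k * n + j) = f k j"
 by (simp add: Vrep_def)

lemma Vrep_other: "v \<noteq> 16 ==> Vrep (set_sto s v i y) f = Vrep s f"
 by (simp add: Vrep_def sto_set_sto)

lemma Vrep_set:
 assumes "Vrep s f" "k < n" "j < n" "\<And>k' j'. k' < n ==> j' < n ==> g k' j' = (if k' = k \<and> j' = j then y else f k' j')"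
 shows "Vrep (set_sto s 16 (k * n + j) y) g"
 unfolding Vrep_def
proof (intro allI impI)
 fix k' j' assume kj: "k' < n" "j' < n"
 have "k' * n + j' = k * n + j \<longleftrightarrow> k' = k \<and> j' = j" by (rule index_inj[OF kj(2) assms(3)])
 then show "sto (set_sto s 16 (k * n + j) y) 16 (k' * n + j') = g k' j'"
  using Vrep_get[OF assms(1) kj] assms(4)[OF kj] by (simp only: sto_set_sto) auto
qed

lemma Vrep_cong: "Vrep s f ==> (\<And>k j. k < n ==> j < n ==> f k j = g k j) ==> Vrep s g"
 by (simp add: Vrep_def)

text \<open>Updating in place is safe: entry (k, j) depends only on the old entries (k, j) and (r,
  j), and row r never changes. In coordinate 0 the correction of \<open>cut_step\<close> cancels the
  rounded entry, leaving M minus the other entries.\<close>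

lemma wp_cut:
 fixes V :: "nat => nat => int" and a :: "nat => int"
 assumes n: "sto s 0 0 = int n" and M: "sto s 8 0 = M" and r: "sto s 11 0 = int r" "r < n" and V: "Vrep s V" and a: "\<And>k. k < n ==> sto s 21 k = a k"
  and b: "\<And>k j. k < n ==> j < n ==> \<bar>cut_step n (8 * int n ^ 2) M V a r k j\<bar> \<le> H" and H: "\<bar>M\<bar> + int n * H \<le> 2 ^ w"
 shows "WP cut_all (\<lambda>s'. Vrep s' (cut_step n (8 * int n ^ 2) M V a r)) s"
proof -
 define C where "C = cut_step n (8 * int n ^ 2) M V a r"
 have Cr: "C r j = V r j" for j by (simp add: C_def cut_step_def)
 have Cj: "C k j = (8 * int n * int n * a r * V k j - a k * V r j) div (8 * int n * int n * a r - a k)" if "k \<noteq> r" "0 < j" for k j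
  using that by (simp add: C_def cut_step_def cut_row_def power2_eq_square mult.assoc)
 have C0: "C k 0 = M - (\<Sum>l\<in>{1..<n}. C k l)" if "k \<noteq> r" for k
 proof -
  have "(\<Sum>l<n. cut_row n (8 * int n ^ 2) V a r k l) = cut_row n (8 * int n ^ 2) V a r k 0 + (\<Sum>l\<in>{1..<n}. cut_row n (8 * int n ^ 2) V a r k l)"
   using n0 by (simp add: atLeast0LessThan[symmetric] sum.atLeast_Suc_lessThan)
  moreover have "(\<Sum>l\<in>{1..<n}. C k l) = (\<Sum>l\<in>{1..<n}. cut_row n (8 * int n ^ 2) V a r k l)"
   using that by (intro sum.cong) (auto simp: C_def cut_step_def)
  ultimately show ?thesis using that by (simp add: C_def cut_step_def)
 qed
 have H0: "0 \<le> H" using b[OF n0 n0] by linarith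
 have acc: "\<bar>M - (\<Sum>l\<in>{m..<n}. C k l)\<bar> \<le> 2 ^ w" if "k < n" for k m
 proof -
  have "\<bar>\<Sum>l\<in>{m..<n}. C k l\<bar> \<le> (\<Sum>l\<in>{m..<n}. \<bar>C k l\<bar>)" by (rule sum_abs)
  also have "\<dots> \<le> (\<Sum>l\<in>{m..<n}. H)" using b[OF that] by (intro sum_mono) (auto simp: C_def)
  also have "\<dots> \<le> (\<Sum>l<n. H)" using H0 by (intro sum_mono2) auto
  finally have "\<bar>\<Sum>l\<in>{m..<n}. C k l\<bar> \<le> int n * H" by simp
  then show ?thesis using H by linarith
 qed
 have Cb: "\<bar>C k j\<bar> \<le> 2 ^ w" if "k < n" "j < n" for k j
 proof -
  have "1 * H \<le> int n * H" using n0 H0 by (intro mult_right_mono) auto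
  then show ?thesis using b[OF that] H unfolding C_def by linarith
 qed
 have Mb: "\<bar>M\<bar> \<le> 2 ^ w" using H H0 mult_nonneg_nonneg[of "int n" H] by linarith
 show ?thesis
  unfolding cut_all_def C_def[symmetric]
 proof (rule wp_loop[where I = "\<lambda>k s'. Vrep s' (\<lambda>k' j. if k \<le> k' then C k' j else V k' j)", OF n])
  show "Vrep (set_sto s 34 0 (int n)) (\<lambda>k' j. if n \<le> k' then C k' j else V k' j)"
   by (rule Vrep_cong[of _ V]) (use V in \<open>simp_all add: Vrep_other\<close>)
 next
  fix k s' assume k: "k < n" and I: "Vrep s' (\<lambda>k' j. if Suc k \<le> k' then C k' j else V k' j)"
   and f: "frame (Loopn 34 (If ((Va 34 -. Va 11) *. (Va 34 -. Va 11)) (Sq (Set 14 (Va 8)) (Sq cut_inner (St 16 (Va 34 *. Va 0) (Va 14)))) Skp)) s s'"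
  note fs = frame_sto[OF f]
  let ?J = "\<lambda>j s'. Vrep s' (\<lambda>k' l. if k < k' \<or> k' = k \<and> j \<le> l \<and> 0 < l then C k' l else V k' l) \<and> sto s' 14 0 = M - (\<Sum>l\<in>{max j 1..<n}. C k l)"
  show "WP (If ((Va 34 -. Va 11) *. (Va 34 -. Va 11)) (Sq (Set 14 (Va 8)) (Sq cut_inner (St 16 (Va 34 *. Va 0) (Va 14)))) Skp)
   (\<lambda>s'. Vrep s' (\<lambda>k' j. if k \<le> k' then C k' j else V k' j)) (set_sto s' 34 0 (int k))"
  proof (cases "k = r")
   case True
   have "Vrep s' (\<lambda>k' j. if k \<le> k' then C k' j else V k' j)"
    by (rule Vrep_cong[OF I]) (use True Cr in \<open>auto simp: Suc_le_eq le_eq_less_or_eq\<close>)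
   then show ?thesis using True by (intro wp_IfI(2)) (simp_all add: sto_set_sto fs r Vrep_other)
  next
   case False
   have sq: "0 < (int k - int r) * (int k - int r)" using False by (simp add: zero_less_mult_iff) linarith
   define s1 where "s1 = set_sto (set_sto s' 34 0 (int k)) 14 0 M"
   have "WP cut_inner (?J 0) s1"
    unfolding cut_inner_def
   proof (rule wp_loop[where I = ?J])
    show "sto s1 0 0 = int n" by (simp add: s1_def sto_set_sto fs n)
   next
    have "Vrep (set_sto s1 33 0 (int n)) (\<lambda>k' l. if k < k' \<or> k' = k \<and> n \<le> l \<and> 0 < l then C k' l else V k' l)"
     by (rule Vrep_cong[of _ "\<lambda>k' j. if Suc k \<le> k' then C k' j else V k' j"]) (use I in \<open>auto simp: s1_def Vrep_other Suc_le_eq\<close>)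
    then show "?J n (set_sto s1 33 0 (int n))" using n0 by (simp add: s1_def sto_set_sto)
   next
    fix j s2 assume j: "j < n" and J: "?J (Suc j) s2"
     and f2: "frame (Loopn 33 (If (Va 33) (Sq (St 16 (Va 34 *. Va 0 +. Va 33) cut_entry) (Set 14 (Va 14 -. A 16 (Va 34 *. Va 0 +. Va 33)))) Skp)) s1 s2"
    note fs2 = frame_sto[OF f2]
    have regs: "sto s2 0 0 = int n" "sto s2 34 0 = int k" "sto s2 11 0 = int r" "\<And>l. sto s2 21 l = sto s 21 l"
     by (simp_all add: fs2 s1_def sto_set_sto fs n r)
    show "WP (If (Va 33) (Sq (St 16 (Va 34 *. Va 0 +. Va 33) cut_entry) (Set 14 (Va 14 -. A 16 (Va 34 *. Va 0 +. Va 33)))) Skp) (?J j) (set_sto s2 33 0 (int j))"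
    proof (cases "j = 0")
     case True
     have "Vrep s2 (\<lambda>k' l. if k < k' \<or> k' = k \<and> j \<le> l \<and> 0 < l then C k' l else V k' l)"
      by (rule Vrep_cong[OF conjunct1[OF J]]) (use True in auto)
     then show ?thesis using True J by (intro wp_IfI(2)) (simp_all add: sto_set_sto Vrep_other)
    next
     case jn: False
     have vk: "sto s2 16 (k * n + j) = V k j" and vr: "sto s2 16 (r * n + j) = V r j"
      using Vrep_get[OF conjunct1[OF J] k j] Vrep_get[OF conjunct1[OF J] r(2) j] Cr False by (auto split: if_splits)
     have e: "ev (set_sto s2 33 0 (int j)) cut_entry = C k j" "nnE (set_sto s2 33 0 (int j)) cut_entry"
      unfolding Cj[OF False jn[unfolded neq0_conv]] using regs vk vr a[OF k] a[OF r(2)] by (simp_all add: cut_entry_def sto_set_sto)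
     have sm: "M - (\<Sum>l\<in>{max (Suc j) 1..<n}. C k l) - C k j = M - (\<Sum>l\<in>{max j 1..<n}. C k l)"
     proof -
      have "max j 1 = j" "max (Suc j) 1 = Suc j" "{j..<n} = insert j {Suc j..<n}" using j jn by auto
      then show ?thesis by simp
     qed
     show ?thesis
     proof (rule wp_IfI(1), simp, use jn in simp, rule wp_SqI, rule wp_StI[where a = "k * n + j" and x = "C k j"])
      have "Vrep (set_sto (set_sto s2 33 0 (int j)) 16 (k * n + j) (C k j)) (\<lambda>k' l. if k < k' \<or> k' = k \<and> j \<le> l \<and> 0 < l then C k' l else V k' l)"
       by (rule Vrep_set[of _ "\<lambda>k' l. if k < k' \<or> k' = k \<and> Suc j \<le> l \<and> 0 < l then C k' l else V k' l"])
        (use J k j jn in \<open>auto simp: Vrep_other\<close>)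
      then show "WP (Set 14 (Va 14 -. A 16 (Va 34 *. Va 0 +. Va 33))) (?J j) (set_sto (set_sto s2 33 0 (int j)) 16 (k * n + j) (C k j))"
       using acc[OF k, of "max j 1"] J sm regs by (intro wp_StI[where a = 0 and x = "M - (\<Sum>l\<in>{max j 1..<n}. C k l)"]) (simp_all add: sto_set_sto Vrep_other)
     qed (use regs e Cb[OF k j] in \<open>simp_all add: sto_set_sto\<close>)
    qed
   qed simp
   then have "WP (Sq cut_inner (St 16 (Va 34 *. Va 0) (Va 14))) (\<lambda>s'. Vrep s' (\<lambda>k' j. if k \<le> k' then C k' j else V k' j)) s1"
   proof (rule wp_Sq_rule)
    fix s2 assume J: "?J 0 s2" and f2: "frame cut_inner s1 s2"
    note fs2 = frame_sto[OF f2]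
    have "sto s2 14 0 = C k 0" using J C0[OF False] by simp
    moreover have "Vrep (set_sto s2 16 (k * n + 0) (C k 0)) (\<lambda>k' j. if k \<le> k' then C k' j else V k' j)"
     by (rule Vrep_set[OF conjunct1[OF J] k n0]) auto
    ultimately show "WP (St 16 (Va 34 *. Va 0) (Va 14)) (\<lambda>s'. Vrep s' (\<lambda>k' j. if k \<le> k' then C k' j else V k' j)) s2"
     using Cb[OF k n0] by (intro wp_StI[where a = "k * n" and x = "C k 0"]) (simp_all add: fs2 s1_def sto_set_sto fs n)
   qed
   then have "WP (Set 14 (Va 8)) (WP (Sq cut_inner (St 16 (Va 34 *. Va 0) (Va 14))) (\<lambda>s'. Vrep s' (\<lambda>k' j. if k \<le> k' then C k' j else V k' j))) (set_sto s' 34 0 (int k))"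
    by (intro wp_StI[where a = 0 and x = M]) (use Mb in \<open>simp_all add: sto_set_sto fs M s1_def[symmetric] del: wp.simps\<close>)
   then show ?thesis using sq by (intro wp_IfI(1) wp_SqI) (simp_all add: sto_set_sto fs r del: wp.simps)
  qed
 next
  fix s' assume "Vrep s' (\<lambda>k' j. if 0 \<le> k' then C k' j else V k' j)"
  then show "Vrep s' C" by simp
 qed
qed

end

text \<open>Tags: 0 loops over agents, 1 doublings up to 2^x, 3 cuts, 4 bits of n U, 5 pairs of
  agents and goods, 6 division steps.\<close>

locale solver = sized_equilibrium +
 fixes \<rho> :: "nat => nat"
 assumes rho: "\<rho> 0 = n" "\<rho> 1 = x" "\<rho> 3 = rounds" "\<rho> 4 = L" "\<rho> 5 = n * n" "\<rho> 6 = 500 * x"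
begin

text \<open>Room for entries of 8210 n x bits, their column sums, and their products with directions
  of 182 x bits.\<close>

abbreviation w :: nat where "w \<equiv> 9000 * n * x"

lemma pow_w: "k \<le> 9000 * n ==> (2::int) ^ (k * x) \<le> 2 ^ w"
 by (intro power_increasing) auto

lemma nx: "int n \<le> 2 ^ x"
proof -
 have "real n \<le> real (2 ^ x)" using n_less by simp
 then have "n \<le> 2 ^ x" by (simp only: of_nat_le_iff)
 then show ?thesis by (metis of_nat_le_iff of_nat_numeral of_nat_power)
qed

sublocale mc: machine n w \<rho>
proof
 have "int n * int n \<le> 2 ^ x * 2 ^ x" using nx by (intro mult_mono) auto
 also have "\<dots> = 2 ^ (2 * x)" by (simp flip: power_add)
 also have "\<dots> \<le> 2 ^ w" using n0 by (intro pow_w) auto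
 finally show "int (n * n) \<le> 2 ^ w" by simp
qed (use n0 rho in auto)

definition loaded :: "hst => bool" where
 "loaded s \<longleftrightarrow> sto s 0 0 = int n \<and> sto s 2 0 = int L \<and> sto s 4 0 = 2 ^ (10 * x) \<and> sto s 5 0 = 2 ^ (20 * x) \<and> sto s 6 0 = 2 ^ (70 * x) \<and>
   sto s 7 0 = 2 ^ (170 * x) \<and> sto s 8 0 = M \<and> (\<forall>i<n. \<forall>j<n. sto s 15 (i * n + j) = int (u i j))"

lemma loaded_frame: "frame c s s' ==> loaded s ==> wr c \<inter> {0, 2, 4, 5, 6, 7, 8, 15} = {} ==> loaded s'"
 by (simp add: loaded_def frame_def)

lemma loaded_set: "loaded s ==> v \<notin> {0, 2, 4, 5, 6, 7, 8, 15} ==> loaded (set_sto s v i y)"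
 by (simp add: loaded_def sto_set_sto)

lemma loadedD:
 assumes "loaded s"
 shows "sto s 0 0 = int n" "sto s 2 0 = int L" "sto s 4 0 = 2 ^ (10 * x)" "sto s 5 0 = 2 ^ (20 * x)" "sto s 6 0 = 2 ^ (70 * x)"
  "sto s 7 0 = 2 ^ (170 * x)" "sto s 8 0 = M" "\<And>i j. i < n ==> j < n ==> sto s 15 (i * n + j) = int (u i j)"
 using assms by (simp_all add: loaded_def)

lemma Zbound: "\<bar>real_of_int z\<bar> \<le> 2 ^ (182 * x) ==> \<bar>z\<bar> \<le> 2 ^ (182 * x)"
proof -
 assume "\<bar>real_of_int z\<bar> \<le> 2 ^ (182 * x)"
 then have "real_of_int \<bar>z\<bar> \<le> real_of_int (2 ^ (182 * x))" by simp
 then show ?thesis by (simp only: of_int_le_iff)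
qed

lemma wp_direction:
 assumes c: "loaded s" and P: "\<And>j. j < n ==> sto s 17 j = P j" and tot: "(\<Sum>j<n. P j) = n * M"
  and lo: "sto s 10 0 = 0 \<and> (\<forall>j<n. n * M < P j * 2 ^ (10 * x)) \<or> (\<exists>j<n. sto s 10 0 = int j + 1 \<and> P j * 2 ^ (10 * x) \<le> n * M)"
 shows "mc.WP direction (\<lambda>s'. \<exists>Z. (\<forall>j<n. sto s' 20 j = Z j) \<and> ((\<exists>j0. low_direction P j0 Z) \<or>
  (\<exists>b. high_direction P b Z \<and> (\<forall>i<n. sto s' 18 i = int (b i))))) s"
 (is "mc.WP direction ?Q s")
 using lo
proof
 assume "\<exists>j<n. sto s 10 0 = int j + 1 \<and> P j * 2 ^ (10 * x) \<le> n * M"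
 then obtain j0 where j0: "j0 < n" "sto s 10 0 = int j0 + 1" "P j0 * 2 ^ (10 * x) \<le> n * M" by blast
 have "(2::int) ^ (10 * x) \<le> 2 ^ w" using n0 by (intro pow_w) auto
 then have b: "\<bar>(2::int) ^ (10 * x) - 1\<bar> \<le> 2 ^ w" by (simp del: power_increasing_iff)
 have "mc.WP low_dir ?Q s"
 proof (rule wp_frame_rule[OF mc.wp_low_dir[OF loadedD(1)[OF c] j0(2,1) loadedD(3)[OF c] b]])
  fix s' :: hst assume "\<forall>j<n. sto s' 20 j = (if j = j0 then 2 ^ (10 * x) - 1 else - 1)"
  then have "low_direction P j0 (sto s' 20)" using j0 by (simp add: low_direction_def)
  then show "?Q s'" by blast
 qed
 then show ?thesis unfolding direction_def using j0 by (intro wp_IfI(1)) simp_all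
next
 assume hi: "sto s 10 0 = 0 \<and> (\<forall>j<n. n * M < P j * 2 ^ (10 * x))"
 have nM: "0 < n * M" using n0 M0 by simp
 have P0: "0 < P j" if "j < n" for j
 proof -
  have "0 < P j * 2 ^ (10 * x)" using hi that nM by fastforce
  then show ?thesis by (simp add: zero_less_mult_iff)
 qed
 have tw: "(\<Sum>j<n. P j) \<le> 2 ^ w"
 proof -
  have "n * M \<le> 2 ^ x * 2 ^ (210 * x)" unfolding M_def using nx by (intro mult_right_mono) auto
  also have "\<dots> = 2 ^ (211 * x)" by (simp flip: power_add)
  also have "\<dots> \<le> 2 ^ w" using n0 by (intro pow_w) auto
  finally show ?thesis using tot by simp
 qed
 have "mc.WP (Sq best (Sq demands high_dir)) ?Q s"
 proof (rule wp_Sq_rule[OF mc.wp_best[where P = P and u = u]])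
  fix s1 assume "\<exists>b. (\<forall>i<n. sto s1 18 i = int (b i)) \<and> best_goods n u (\<lambda>j. real_of_int (P j)) b" and f1: "frame best s s1"
  then obtain b where b: "\<And>i. i < n ==> sto s1 18 i = int (b i)" "best_goods n u (\<lambda>j. real_of_int (P j)) b" by blast
  define D where "D j = (\<Sum>i | i < n \<and> b i = j. P i)" for j
  define Z where "Z j = (2 ^ (170 * x) * D j) div P j + 2 - 2 ^ (170 * x)" for j
  have high: "high_direction P b Z" using hi b(2) by (simp add: high_direction_def Z_def D_def)
  have Zb: "\<bar>Z j\<bar> \<le> 2 ^ w" if "j < n" for j
  proof -
   have "\<bar>Z j\<bar> \<le> 2 ^ (182 * x)" by (rule Zbound[OF high_direction_bounds(1)[OF high tot that]])
   also have "\<dots> \<le> 2 ^ w" using n0 by (intro pow_w) auto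
   finally show ?thesis .
  qed
  have c1: "loaded s1" by (rule loaded_frame[OF f1 c]) simp
  have P1: "sto s1 17 j = P j" if "j < n" for j using P[OF that] by (simp add: frame_sto[OF f1])
  show "mc.WP (Sq demands high_dir) ?Q s1"
  proof (rule wp_Sq_rule[OF mc.wp_demands[where P = P and b = b]])
   fix s2 assume D: "\<forall>j<n. sto s2 19 j = (\<Sum>i | i < n \<and> b i = j. P i)" and f2: "frame demands s1 s2"
   have c2: "loaded s2" by (rule loaded_frame[OF f2 c1]) simp
   show "mc.WP high_dir ?Q s2"
   proof (rule wp_frame_rule[OF mc.wp_high_dir[where P = P and D = D and S = "2 ^ (170 * x)"]])
    fix s3 assume "\<forall>j<n. sto s3 20 j = (2 ^ (170 * x) * D j) div P j + 2 - 2 ^ (170 * x)" and f3: "frame high_dir s2 s3"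
    then have "\<forall>j<n. sto s3 20 j = Z j" by (simp add: Z_def)
    moreover have "\<forall>i<n. sto s3 18 i = int (b i)" using b(1) by (simp add: frame_sto[OF f3] frame_sto[OF f2])
    ultimately show "?Q s3" using high by blast
   qed (use Zb P1 D loadedD[OF c2] in \<open>simp_all add: frame_sto[OF f2] D_def Z_def\<close>)
  qed (use P1 P0 tw b loadedD[OF c1] in \<open>simp_all add: best_goods_def\<close>)
 qed (use P P0 loadedD[OF c] in simp_all)
 then show ?thesis unfolding direction_def using hi by (intro wp_IfI(2)) simp_all
qed

definition running :: "hst => nat => bool" where
 "running s t \<longleftrightarrow> sto s 9 0 = 0 \<and> (\<exists>V. main_inv V t \<and> mc.Vrep s V)"

definition solution :: "(nat => int) => (nat => nat) => bool" where
 "solution P b \<longleftrightarrow> (\<forall>j<n. 0 < P j) \<and> (\<Sum>j<n. P j) = n * M \<and> best_goods n u (\<lambda>j. real_of_int (P j)) b \<and>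
   2 ^ (170 * x) * (\<Sum>j<n. q j * demand_excess n (\<lambda>j. real_of_int (P j)) b j) \<le> 12 * real n"

definition solved :: "hst => bool" where
 "solved s \<longleftrightarrow> sto s 9 0 = 1 \<and> (\<exists>P b. solution P b \<and> (\<forall>j<n. sto s 17 j = P j) \<and> (\<forall>i<n. sto s 18 i = int (b i)))"

text \<open>Above the threshold \<open>main_step\<close> advances the invariant; otherwise
  \<open>main_low\<close> excludes a coordinate cut and \<open>main_stop\<close> shows that the
  current prices are good.\<close>

lemma wp_cut_round:
 assumes c: "loaded s" and run: "running s t" and t: "t < rounds"
 shows "mc.WP cut_round (\<lambda>s'. running s' (Suc t) \<or> solved s') s" (is "mc.WP cut_round ?Q s")
proof -
 obtain V where I: "main_inv V t" and V: "mc.Vrep s V" and s9: "sto s 9 0 = 0" using run unfolding running_def by blast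
 have tl: "t \<le> rounds" using t by simp
 define P where "P j = (\<Sum>k<n. V k j)" for j
 have tot: "(\<Sum>j<n. P j) = n * M" by (rule main_total[OF I]) (rule P_def)
 note Vg = mc.Vrep_get[OF V]
 note bd = main_bound[OF I tl]
 have nH: "int n * 2 ^ (8210 * n * x) \<le> 2 ^ (8211 * n * x)"
 proof -
  have "int n * 2 ^ (8210 * n * x) \<le> 2 ^ x * 2 ^ (8210 * n * x)" using nx by (intro mult_right_mono) auto
  also have "\<dots> = 2 ^ (x + 8210 * n * x)" by (simp add: power_add)
  also have "\<dots> \<le> 2 ^ (8211 * n * x)" using n0 by (intro power_increasing) auto
  finally show ?thesis .
 qed
 have b1: "(\<Sum>k<n. \<bar>sto s 16 (k * n + j)\<bar>) \<le> 2 ^ w" if j: "j < n" for j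
 proof -
  have "(\<Sum>k<n. \<bar>sto s 16 (k * n + j)\<bar>) \<le> (\<Sum>k<n. 2 ^ (8210 * n * x))" using bd Vg j by (intro sum_mono) auto
  also have "\<dots> \<le> 2 ^ (8211 * n * x)" using nH by simp
  also have "\<dots> \<le> 2 ^ w" by (intro pow_w) auto
  finally show ?thesis .
 qed
 have "mc.WP (Sq colsums (Sq find_low (Sq direction (Sq products (Sq argmax
   (If (A 21 (Va 11) -. N 12 *. Va 0 *. Va 8) cut_all (Set 9 (N 1)))))))) ?Q s"
 proof (rule wp_Sq_rule[OF mc.wp_colsums[OF loadedD(1)[OF c] b1]])
  fix s1 assume P1: "\<forall>j<n. sto s1 17 j = (\<Sum>k<n. sto s 16 (k * n + j))" and f1: "frame colsums s s1"
  have c1: "loaded s1" by (rule loaded_frame[OF f1 c]) simp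
  have P: "sto s1 17 j = P j" if "j < n" for j using P1 that Vg by (simp add: P_def)
  show "mc.WP (Sq find_low (Sq direction (Sq products (Sq argmax (If (A 21 (Va 11) -. N 12 *. Va 0 *. Va 8) cut_all (Set 9 (N 1))))))) ?Q s1"
  proof (rule wp_Sq_rule[OF mc.wp_find_low[OF loadedD(1)[OF c1] P loadedD(7)[OF c1] loadedD(3)[OF c1]]])
   fix s2 assume lo: "sto s2 10 0 = 0 \<and> (\<forall>j<n. n * M < P j * 2 ^ (10 * x)) \<or> (\<exists>j<n. sto s2 10 0 = int j + 1 \<and> P j * 2 ^ (10 * x) \<le> n * M)"
    and f2: "frame find_low s1 s2"
   have c2: "loaded s2" by (rule loaded_frame[OF f2 c1]) simp
   have P2: "sto s2 17 j = P j" if "j < n" for j using P[OF that] by (simp add: frame_sto[OF f2])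
   show "mc.WP (Sq direction (Sq products (Sq argmax (If (A 21 (Va 11) -. N 12 *. Va 0 *. Va 8) cut_all (Set 9 (N 1)))))) ?Q s2"
   proof (rule wp_Sq_rule[OF wp_direction[OF c2 P2 tot lo]])
    fix s3 assume "\<exists>Z. (\<forall>j<n. sto s3 20 j = Z j) \<and> ((\<exists>j0. low_direction P j0 Z) \<or> (\<exists>b. high_direction P b Z \<and> (\<forall>i<n. sto s3 18 i = int (b i))))"
     and f3: "frame direction s2 s3"
    then obtain Z where Z: "\<And>j. j < n ==> sto s3 20 j = Z j"
     and d: "(\<exists>j0. low_direction P j0 Z) \<or> (\<exists>b. high_direction P b Z \<and> (\<forall>i<n. sto s3 18 i = int (b i)))" by blast
    have c3: "loaded s3" by (rule loaded_frame[OF f3 c2]) simp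
    have V3: "sto s3 16 l = sto s 16 l" for l by (simp add: frame_sto[OF f3] frame_sto[OF f2] frame_sto[OF f1])
    define a where "a k = (\<Sum>j<n. V k j * Z j)" for k
    have Zb: "\<bar>Z j\<bar> \<le> 2 ^ (182 * x)" if "j < n" for j
     using d
    proof
     assume "\<exists>j0. low_direction P j0 Z" then show ?thesis using Zbound[OF low_direction_bounds(1)[OF _ tot that]] by blast
    next
     assume "\<exists>b. high_direction P b Z \<and> (\<forall>i<n. sto s3 18 i = int (b i))" then show ?thesis using Zbound[OF high_direction_bounds(1)[OF _ tot that]] by blast
    qed
    have b3: "(\<Sum>j<n. \<bar>sto s3 16 (k * n + j) * sto s3 20 j\<bar>) \<le> 2 ^ w" if k: "k < n" for k
    proof -
     have "(\<Sum>j<n. \<bar>sto s3 16 (k * n + j) * sto s3 20 j\<bar>) \<le> (\<Sum>j<n. 2 ^ (8210 * n * x) * 2 ^ (182 * x))"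
     proof (rule sum_mono)
      fix j assume "j \<in> {..<n}"
      then have j: "j < n" by simp
      have "\<bar>V k j\<bar> * \<bar>Z j\<bar> \<le> 2 ^ (8210 * n * x) * 2 ^ (182 * x)" using bd[OF k j] Zb[OF j] by (intro mult_mono) auto
      then show "\<bar>sto s3 16 (k * n + j) * sto s3 20 j\<bar> \<le> 2 ^ (8210 * n * x) * 2 ^ (182 * x)" using j k by (simp only: V3 Vg Z abs_mult)
     qed
     also have "\<dots> = int n * 2 ^ (8210 * n * x) * 2 ^ (182 * x)" by simp
     also have "\<dots> \<le> 2 ^ (8211 * n * x) * 2 ^ (182 * x)" using nH by (intro mult_right_mono) auto
     also have "\<dots> = 2 ^ ((8211 * n + 182) * x)" by (simp add: distrib_right flip: power_add)
     also have "\<dots> \<le> 2 ^ w" using n0 by (intro pow_w) auto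
     finally show ?thesis .
    qed
    show "mc.WP (Sq products (Sq argmax (If (A 21 (Va 11) -. N 12 *. Va 0 *. Va 8) cut_all (Set 9 (N 1))))) ?Q s3"
    proof (rule wp_Sq_rule[OF mc.wp_products[OF loadedD(1)[OF c3] b3]])
     fix s4 assume a4: "\<forall>k<n. sto s4 21 k = (\<Sum>j<n. sto s3 16 (k * n + j) * sto s3 20 j)" and f4: "frame products s3 s4"
     have c4: "loaded s4" by (rule loaded_frame[OF f4 c3]) simp
     have a4': "sto s4 21 k = a k" if "k < n" for k using a4 that Vg Z by (simp add: a_def V3)
     show "mc.WP (Sq argmax (If (A 21 (Va 11) -. N 12 *. Va 0 *. Va 8) cut_all (Set 9 (N 1)))) ?Q s4"
     proof (rule wp_Sq_rule[OF mc.wp_argmax[OF loadedD(1)[OF c4]]])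
      fix s5 assume "\<exists>r<n. sto s5 11 0 = int r \<and> (\<forall>k<n. sto s4 21 k \<le> sto s4 21 r)" and f5: "frame argmax s4 s5"
      then obtain r where r: "r < n" "sto s5 11 0 = int r" and ra: "\<And>k. k < n ==> a k \<le> a r" using a4' by fastforce
      have c5: "loaded s5" by (rule loaded_frame[OF f5 c4]) simp
      have bk: "sto s5 16 l = sto s 16 l" "sto s5 9 0 = 0" "sto s5 21 l = sto s4 21 l" "sto s5 17 l = sto s1 17 l" "sto s5 18 l = sto s3 18 l" for l
       by (simp_all add: frame_sto[OF f5] frame_sto[OF f4] V3 frame_sto[OF f3] frame_sto[OF f2] frame_sto[OF f1] s9)
      have V5: "mc.Vrep s5 V" using V by (simp add: mc.Vrep_def bk)
      have a5: "sto s5 21 k = a k" if "k < n" for k using a4'[OF that] by (simp add: bk)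
      have e5: "nnE s5 (A 21 (Va 11) -. N 12 *. Va 0 *. Va 8)" "ev s5 (A 21 (Va 11) -. N 12 *. Va 0 *. Va 8) = a r - 12 * n * M"
       using r a5[OF r(1)] loadedD[OF c5] by simp_all
      show "mc.WP (If (A 21 (Va 11) -. N 12 *. Va 0 *. Va 8) cut_all (Set 9 (N 1))) ?Q s5"
      proof (cases "12 * n * M < a r")
       case True
       have "\<exists>j0 b. low_direction P j0 Z \<or> high_direction P b Z" using d by blast
       then obtain j0 b where d': "low_direction P j0 Z \<or> high_direction P b Z" by blast
       have I': "main_inv (cut_step n (8 * int n ^ 2) M V a r) (Suc t)"
        by (rule main_step[where P = P and a = a and V = V and Z = Z and r = r, OF I tl]) (use d' r(1) ra True in \<open>simp_all add: P_def a_def\<close>)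
       have Hb: "\<bar>M\<bar> + int n * 2 ^ (8210 * n * x) \<le> 2 ^ w"
       proof -
        have "M \<le> 2 ^ (8211 * n * x)" unfolding M_def using n0 by (intro power_increasing) auto
        then have "\<bar>M\<bar> + int n * 2 ^ (8210 * n * x) \<le> 2 * 2 ^ (8211 * n * x)" using nH M0 by linarith
        also have "\<dots> = 2 ^ (1 + 8211 * n * x)" by simp
        also have "\<dots> \<le> 2 ^ w"
        proof (intro power_increasing)
         have "1 \<le> n * x" using n0 x0 by simp
         then show "1 + 8211 * n * x \<le> w" by (simp add: mult.assoc)
        qed simp
        finally show ?thesis .
       qed
       have "mc.WP cut_all ?Q s5"
       proof (rule wp_frame_rule[OF mc.wp_cut[where V = V and a = a and r = r and H = "2 ^ (8210 * n * x)", OF loadedD(1)[OF c5] loadedD(7)[OF c5] r(2,1) V5 a5 main_bound[OF I'] Hb]])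
        fix s6 assume V6: "mc.Vrep s6 (cut_step n (8 * int n ^ 2) M V a r)" and f6: "frame cut_all s5 s6"
        have "sto s6 9 0 = 0" by (simp add: frame_sto[OF f6] bk)
        then show "?Q s6" using V6 I' unfolding running_def by blast
       qed (use t in auto)
       then show ?thesis using True e5 by (intro wp_IfI(1)) (simp_all del: ev.simps nnE.simps)
      next
       case False
       have "\<not> low_direction P j0 Z" for j0
       proof
        assume lw: "low_direction P j0 Z"
        have "12 * n * M < a r"
         by (rule main_low[where P = P and a = a and V = V and Z = Z and r = r, OF I tl _ lw]) (use ra in \<open>simp_all add: P_def a_def\<close>)
        then show False using False by simp
       qed
       then obtain b where b: "high_direction P b Z" "\<forall>i<n. sto s3 18 i = int (b i)" using d by blast
       have "2 ^ (170 * x) * (\<Sum>j<n. q j * demand_excess n (\<lambda>j. real_of_int (P j)) b j) \<le> 12 * real n"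
        by (rule main_stop[where P = P and a = a and V = V and Z = Z and r = r, OF I tl _ b(1)]) (use ra False in \<open>simp_all add: P_def a_def\<close>)
       then have "solution P b"
        unfolding solution_def using high_direction_bounds(5)[OF b(1) tot] tot b(1) by (simp add: high_direction_def)
       then have "solved (set_sto s5 9 0 1)" unfolding solved_def using P b(2) by (auto simp: sto_set_sto bk)
       then have "mc.WP (Set 9 (N 1)) ?Q s5" by (intro mc.wp_StI[where a = 0 and x = 1]) simp_all
       then show ?thesis using False e5 by (intro wp_IfI(2)) (simp_all del: ev.simps nnE.simps wp.simps)
      qed
     qed
    qed
   qed
  qed
 qed
 then show ?thesis unfolding cut_round_def using s9 by (intro wp_IfI(1)) (simp_all del: wp.simps)
qed

lemma rounds_eq: "4000 * int n * int n * int n * int n * int n * int L = int rounds"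
 by (simp add: rounds_def x_def power3_eq_cube)

lemma rounds_le: "int rounds \<le> 2 ^ w"
proof -
 have "rounds = 4000 * n ^ 3 * x" by (rule rounds_def)
 have xx: "int x \<le> 2 ^ x" using of_nat_le_iff[of x "2 ^ x", where 'a = int] less_exp[of x] by simp
 have "(2::int) ^ 12 \<le> 2 ^ (12 * x)" using x0 by (intro power_increasing) auto
 then have "4000 * (int n ^ 3 * int x) \<le> 2 ^ (12 * x) * ((2 ^ x) ^ 3 * 2 ^ x)" using nx xx by (intro mult_mono power_mono) auto
 also have "\<dots> = 2 ^ (16 * x)" by (simp flip: power_mult power_add)
 also have "\<dots> \<le> 2 ^ w" using n0 by (intro pow_w) auto
 finally show ?thesis by (simp add: rounds_def)
qed

text \<open>By \<open>main_end\<close> the invariant cannot survive all rounds, so the other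
  alternative, a solution, must hold at the end.\<close>

lemma wp_main_loop:
 assumes c: "loaded s" and run: "running s 0"
 shows "mc.WP main_loop (\<lambda>s'. \<exists>P b. solution P b \<and> (\<forall>j<n. sto s' 17 j = P j) \<and> (\<forall>i<n. sto s' 18 i = int (b i))) s"
 unfolding main_loop_def
proof (rule wp_For_frame[where m = rounds and I = "\<lambda>k s'. running s' (rounds - k) \<or> solved s'"])
 fix k s' assume k: "k < rounds" and I: "running s' (rounds - Suc k) \<or> solved s'"
  and f: "frame (For 35 (N 4000 *. Va 0 *. Va 0 *. Va 0 *. Va 0 *. Va 0 *. Va 2) 3 cut_round) s s'"
 have c': "loaded (set_sto s' 35 0 (int k))" by (rule loaded_set[OF loaded_frame[OF f c]]) auto
 show "mc.WP cut_round (\<lambda>s'. running s' (rounds - k) \<or> solved s') (set_sto s' 35 0 (int k))"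
  using I
 proof
  assume r: "running s' (rounds - Suc k)"
  then have "running (set_sto s' 35 0 (int k)) (rounds - Suc k)" by (simp add: running_def mc.Vrep_other sto_set_sto)
  from wp_cut_round[OF c' this] show ?thesis using k by (simp add: Suc_diff_Suc)
 next
  assume "solved s'"
  then have "solved (set_sto s' 35 0 (int k))" "sto (set_sto s' 35 0 (int k)) 9 0 = 1" by (simp_all add: solved_def sto_set_sto)
  then show ?thesis unfolding cut_round_def by (intro wp_IfI(2)) simp_all
 qed
next
 fix s' assume "running s' (rounds - 0) \<or> solved s'"
 then have "solved s'" using main_end unfolding running_def by auto
 then show "\<exists>P b. solution P b \<and> (\<forall>j<n. sto s' 17 j = P j) \<and> (\<forall>i<n. sto s' 18 i = int (b i))" unfolding solved_def by blast
next
 show "running (set_sto s 35 0 (int rounds)) (rounds - rounds) \<or> solved (set_sto s 35 0 (int rounds))"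
  using run by (simp add: running_def mc.Vrep_other sto_set_sto)
qed (use loadedD[OF c] rounds_eq rounds_le rho in simp_all)

end

section \<open>The program: reading out the equilibrium\<close>

definition lhs_ex :: ex where "lhs_ex = Va 6 *. (A 15 (Va 32 *. Va 0 +. A 18 (Va 32)) *. A 17 (Va 33))"

definition base_ex :: ex where "base_ex = A 15 (Va 32 *. Va 0 +. Va 33) *. A 17 (A 18 (Va 32))"

text \<open>Detects a pair beyond the tolerance E but still within the tolerance 10 n^2 E, that is,
  a violation of the gap required by \<open>readout_equilibrium\<close>.\<close>

definition gap_test :: cm where
 "gap_test = If (lhs_ex -. (Va 6 +. Va 12) *. base_ex) (If ((Va 6 +. N 10 *. Va 0 *. Va 0 *. Va 12) *. base_ex +. N 1 -. lhs_ex) (Set 13 (N 1)) Skp) Skp"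

definition gap_round :: cm where
 "gap_round = Sq (Set 13 (N 0)) (Sq (Loopn 32 (Loopn 33 gap_test)) (If (Va 13) (Set 12 (N 10 *. Va 0 *. Va 0 *. Va 12)) Skp))"

text \<open>Pigeonhole: a pair in the window joins \<open>near\<close> when E is multiplied by 10
  n^2, and there are only n^2 pairs, so n^2 rounds reach a tolerance with an empty window.\<close>

definition find_gap :: cm where "find_gap = Sq (Set 12 (N 1)) (For 36 (Va 0 *. Va 0) 5 gap_round)"

text \<open>One minus a square of integers is positive only if the square is 0, so this is an
  equality test.\<close>

definition relabel_step :: cm where
 "relabel_step = If (N 1 -. (A 22 (Va 34) -. Va 31) *. (A 22 (Va 34) -. Va 31)) (St 22 (Va 34) (Va 30)) Skp"

text \<open>For an edge of \<open>near\<close> two classes are merged by overwriting the label of i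
  everywhere with that of j.\<close>

definition relabel :: cm where
 "relabel = If ((Va 6 +. Va 12) *. base_ex +. N 1 -. lhs_ex) (Sq (Set 31 (A 22 (Va 32))) (Sq (Set 30 (A 22 (Va 33))) (Loopn 34 relabel_step))) Skp"

definition labels :: cm where "labels = Sq (Loopn 32 (St 22 (Va 32) (Va 32))) (Loopn 32 (Loopn 33 relabel))"

definition euclid_shift :: cm where
 "euclid_shift = Sq (Set 31 (Va 23 -. Va 30 *. Va 24)) (Sq (Set 23 (Va 24)) (Sq (Set 24 (Va 31)) (Sq (Set 31 (Va 30 *. Va 26 +. Va 25)) (Sq (Set 25 (Va 26)) (Sq (Set 26 (Va 31))
   (Sq (Set 31 (Va 30 *. Va 28 +. Va 27)) (Sq (Set 27 (Va 28)) (Set 28 (Va 31)))))))))"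

definition euclid_step :: cm where
 "euclid_step = If (N 1 -. Va 29) (If (Va 24) (Sq (Set 30 (Va 23 div. Va 24)) (If (Va 30 *. Va 28 +. Va 27 -. Va 5) (Set 29 (N 1)) euclid_shift)) (Set 29 (N 1))) Skp"

definition euclid_loop :: cm where "euclid_loop = For 36 (N 500 *. Va 0 *. Va 0 *. Va 2) 6 euclid_step"

definition euclid :: cm where
 "euclid = Sq (Set 23 (A 17 (Va 38))) (Sq (Set 24 (A 17 (A 22 (Va 38)))) (Sq (Set 25 (N 0)) (Sq (Set 26 (N 1)) (Sq (Set 27 (N 1)) (Sq (Set 28 (N 0)) (Sq (Set 29 (N 0)) euclid_loop))))))"

definition write_out :: cm where
 "write_out = Loopn 37 (Sq (Set 38 (Va 0 -. N 1 -. Va 37)) (Sq euclid (Sq (Wr (A 17 (A 22 (Va 38)) *. Va 26)) (Wr (Va 28)))))"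

lemma wr_gap [simp]: "wr gap_test = {13}" "\<not> io gap_test" "wr gap_round = {13, 32, 33, 12}" "\<not> io gap_round" "wr find_gap = {12, 36, 13, 32, 33}" "\<not> io find_gap"
 by (auto simp: gap_test_def gap_round_def find_gap_def)

lemma wr_labels [simp]: "wr relabel_step = {22}" "\<not> io relabel_step" "wr relabel = {31, 30, 34, 22}" "\<not> io relabel" "wr labels = {32, 22, 33, 31, 30, 34}" "\<not> io labels"
 by (auto simp: relabel_step_def relabel_def labels_def)

lemma wr_euclid [simp]: "wr euclid_shift = {31, 23, 24, 25, 26, 27, 28}" "\<not> io euclid_shift" "wr euclid_step = {29, 30, 31, 23, 24, 25, 26, 27, 28}" "\<not> io euclid_step"
 "wr euclid_loop = {36, 29, 30, 31, 23, 24, 25, 26, 27, 28}" "\<not> io euclid_loop" "wr euclid = {36, 29, 30, 31, 23, 24, 25, 26, 27, 28}" "\<not> io euclid"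
 by (auto simp: euclid_shift_def euclid_step_def euclid_loop_def euclid_def)

lemma wr_write_out [simp]: "wr write_out = {37, 38, 36, 29, 30, 31, 23, 24, 25, 26, 27, 28}" by (auto simp: write_out_def)

lemma frame_trans: "frame c s s' ==> frame c' s' s2 ==> wr c' \<subseteq> wr c ==> (io c' ==> io c) ==> frame c s s2"
 unfolding frame_def by (metis subsetD)

lemma frame_set_sto: "frame c s s' ==> v \<in> wr c ==> frame c s (set_sto s' v i y)"
 unfolding frame_def by (auto simp: sto_set_sto fun_eq_iff)

context machine
begin

lemma wp_loop2:
 assumes n: "sto s 0 0 = int n" and v: "32 \<notin> wr c" and I0: "I {} s"
  and st: "\<And>D s' v k. v \<in> {32, 33} ==> I D s' ==> I D (set_sto s' v 0 k)"
  and step: "\<And>i j D s'. i < n ==> j < n ==> I D s' ==> frame (Loopn 32 (Loopn 33 c)) s s' ==> sto s' 32 0 = int i ==> sto s' 33 0 = int j ==>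
   WP c (I (insert (i, j) D)) s'"
  and Q: "\<And>s'. I ({..<n} \<times> {..<n}) s' ==> frame (Loopn 32 (Loopn 33 c)) s s' ==> Q s'"
  and z: "0 \<notin> wr c"
 shows "WP (Loopn 32 (Loopn 33 c)) Q s"
proof (rule wp_loop[where I = "\<lambda>k s'. I ({k..<n} \<times> {..<n}) s'", OF n])
 fix k s' assume k: "k < n" and I: "I ({Suc k..<n} \<times> {..<n}) s'" and f: "frame (Loopn 32 (Loopn 33 c)) s s'"
 have f1: "frame (Loopn 32 (Loopn 33 c)) s (set_sto s' 32 0 (int k))" by (rule frame_set_sto[OF f]) simp
 show "WP (Loopn 33 c) (\<lambda>s'. I ({k..<n} \<times> {..<n}) s') (set_sto s' 32 0 (int k))"
 proof (rule wp_loop[where I = "\<lambda>j s2. I ({Suc k..<n} \<times> {..<n} \<union> {k} \<times> {j..<n}) s2"])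
  show "sto (set_sto s' 32 0 (int k)) 0 0 = int n" using n z by (simp add: frame_sto[OF f])
 next
  show "I ({Suc k..<n} \<times> {..<n} \<union> {k} \<times> {n..<n}) (set_sto (set_sto s' 32 0 (int k)) 33 0 (int n))" using I by (simp add: st)
 next
  fix j s2 assume j: "j < n" and I2: "I ({Suc k..<n} \<times> {..<n} \<union> {k} \<times> {Suc j..<n}) s2" and f2: "frame (Loopn 33 c) (set_sto s' 32 0 (int k)) s2"
  have "sto s2 32 = sto (set_sto s' 32 0 (int k)) 32" using v by (intro frame_sto[OF f2]) simp
  then have s32: "sto s2 32 0 = int k" by simp
  have f3: "frame (Loopn 32 (Loopn 33 c)) s (set_sto s2 33 0 (int j))"
   by (intro frame_set_sto frame_trans[OF f1 f2]) auto
  have "WP c (I (insert (k, j) ({Suc k..<n} \<times> {..<n} \<union> {k} \<times> {Suc j..<n}))) (set_sto s2 33 0 (int j))"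
   by (rule step[OF k j st[OF _ I2] f3]) (simp_all add: s32)
  moreover have "insert (k, j) ({Suc k..<n} \<times> {..<n} \<union> {k} \<times> {Suc j..<n}) = {Suc k..<n} \<times> {..<n} \<union> {k} \<times> {j..<n}" using j by auto
  ultimately show "WP c (\<lambda>s2. I ({Suc k..<n} \<times> {..<n} \<union> {k} \<times> {j..<n}) s2) (set_sto s2 33 0 (int j))" by simp
 next
  fix s2 assume I2: "I ({Suc k..<n} \<times> {..<n} \<union> {k} \<times> {0..<n}) s2"
  have "{Suc k..<n} \<times> {..<n} \<union> {k} \<times> {0..<n} = {k..<n} \<times> {..<n}" using k by (auto simp: le_eq_less_or_eq Suc_le_eq)
  then show "I ({k..<n} \<times> {..<n}) s2" using I2 by simp
 qed
next
 fix s' assume I: "I ({0..<n} \<times> {..<n}) s'" and f: "frame (Loopn 32 (Loopn 33 c)) s s'"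
 then show "Q s'" by (intro Q) (simp_all add: atLeast0LessThan)
qed (simp add: st I0)

end

context solver
begin

definition lhs :: "(nat => int) => (nat => nat) => nat => nat => int" where "lhs P b i j = 2 ^ (70 * x) * (int (u i (b i)) * P j)"

definition base :: "(nat => int) => (nat => nat) => nat => nat => int" where "base P b i j = int (u i j) * P (b i)"

definition near :: "(nat => int) => (nat => nat) => int => (nat \<times> nat) set" where
 "near P b E = {(i, j). i < n \<and> j < n \<and> lhs P b i j \<le> (2 ^ (70 * x) + E) * base P b i j}"

definition holds :: "(nat => int) => (nat => nat) => hst => bool" where
 "holds P b s \<longleftrightarrow> loaded s \<and> (\<forall>j<n. sto s 17 j = P j) \<and> (\<forall>i<n. sto s 18 i = int (b i))"

lemma holds_frame: "frame c s s' ==> holds P b s ==> wr c \<inter> {0, 2, 4, 5, 6, 7, 8, 15, 17, 18} = {} ==> holds P b s'"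
 using loaded_frame[of c s s'] by (auto simp: holds_def frame_def)

lemma holds_set: "holds P b s ==> v \<notin> {0, 2, 4, 5, 6, 7, 8, 15, 17, 18} ==> holds P b (set_sto s v i y)"
 by (auto simp: holds_def loaded_set sto_set_sto)

lemma ev_lhs_base:
 assumes h: "holds P b s" and b: "\<And>i. i < n ==> b i < n" and ij: "i < n" "j < n" and s: "sto s 32 0 = int i" "sto s 33 0 = int j"
 shows "ev s lhs_ex = lhs P b i j" "nnE s lhs_ex" "ev s base_ex = base P b i j" "nnE s base_ex"
 using h b[OF ij(1)] ij s by (simp_all add: holds_def loaded_def lhs_ex_def base_ex_def lhs_def base_def)

text \<open>10 n^2 is at most 2^(6 L), and n^2 factors give 2^(6 x); so the final tolerance stays
  far below 2^(70 x).\<close>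

lemma E_bound: "k \<le> n * n ==> (10 * int n * int n) ^ k \<le> 2 ^ (6 * x)"
proof -
 assume k: "k \<le> n * n"
 have "n * 1 \<le> n * U" using U0 by (intro mult_left_mono) auto
 then have "n < 2 ^ L" using size by linarith
 then have nl: "int n \<le> 2 ^ L" by (metis less_imp_le of_nat_le_iff of_nat_numeral of_nat_power)
 have "(2::int) ^ 4 \<le> 2 ^ (4 * L)" using L0 by (intro power_increasing) auto
 then have "10 * int n * int n \<le> 2 ^ (4 * L) * 2 ^ L * 2 ^ L" using nl by (intro mult_mono) auto
 also have "\<dots> = 2 ^ (6 * L)" by (simp flip: power_add)
 finally have "(10 * int n * int n) ^ k \<le> (2 ^ (6 * L)) ^ k" by (intro power_mono) auto
 also have "\<dots> = 2 ^ (6 * L * k)" by (simp only: power_mult)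
 also have "\<dots> \<le> 2 ^ (6 * x)"
 proof (intro power_increasing)
  have "6 * L * k \<le> 6 * L * (n * n)" using k by (intro mult_left_mono) auto
  then show "6 * L * k \<le> 6 * x" by (simp add: x_def ac_simps)
 qed simp
 finally show ?thesis .
qed

definition gap_at :: "(nat => int) => (nat => nat) => int => nat => nat => bool" where
 "gap_at P b E i j \<longleftrightarrow> (2 ^ (70 * x) + E) * base P b i j < lhs P b i j \<and> lhs P b i j \<le> (2 ^ (70 * x) + 10 * int n * int n * E) * base P b i j"

lemma wp_gap_scan:
 assumes h: "holds P b s" and b: "\<And>i. i < n ==> b i < n" and E: "sto s 12 0 = E" and z: "sto s 13 0 = 0"
 shows "mc.WP (Loopn 32 (Loopn 33 gap_test)) (\<lambda>s'. sto s' 13 0 = (if \<exists>i<n. \<exists>j<n. gap_at P b E i j then 1 else 0)) s"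
proof (rule mc.wp_loop2[where I = "\<lambda>D s'. sto s' 13 0 = (if \<exists>(i, j)\<in>D. gap_at P b E i j then 1 else 0)"])
 fix i j D s' assume ij: "i < n" "j < n" and I: "sto s' 13 0 = (if \<exists>(i, j)\<in>D. gap_at P b E i j then 1 else 0)"
  and f: "frame (Loopn 32 (Loopn 33 gap_test)) s s'" and v: "sto s' 32 0 = int i" "sto s' 33 0 = int j"
 have h': "holds P b s'" by (rule holds_frame[OF f h]) simp
 note e = ev_lhs_base[OF h' b ij v]
 have c: "sto s' 0 0 = int n" "sto s' 6 0 = 2 ^ (70 * x)" "sto s' 12 0 = E" using h' by (simp_all add: holds_def loaded_def frame_sto[OF f] E)
 show "mc.WP gap_test (\<lambda>s'. sto s' 13 0 = (if \<exists>(i, j)\<in>insert (i, j) D. gap_at P b E i j then 1 else 0)) s'"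
 proof (cases "gap_at P b E i j")
  case True
  then show ?thesis unfolding gap_test_def gap_at_def by (intro wp_IfI(1) mc.wp_StI[where a = 0 and x = 1]) (auto simp: e c gap_at_def)
 next
  case False
  then have g: "(\<exists>(i, j)\<in>insert (i, j) D. gap_at P b E i j) \<longleftrightarrow> (\<exists>(i, j)\<in>D. gap_at P b E i j)" by auto
  show ?thesis
  proof (cases "(2 ^ (70 * x) + E) * base P b i j < lhs P b i j")
   case True
   then have "\<not> lhs P b i j \<le> (2 ^ (70 * x) + 10 * int n * int n * E) * base P b i j" using False by (simp add: gap_at_def)
   then have "mc.WP (If ((Va 6 +. N 10 *. Va 0 *. Va 0 *. Va 12) *. base_ex +. N 1 -. lhs_ex) (Set 13 (N 1)) Skp)
    (\<lambda>s'. sto s' 13 0 = (if \<exists>(i, j)\<in>D. gap_at P b E i j then 1 else 0)) s'"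
    using I by (intro wp_IfI(2)) (simp_all add: e c)
   then show ?thesis using True unfolding gap_test_def g by (subst wp.simps(4)) (simp add: e c del: wp.simps)
  next
   case False
   then show ?thesis using I unfolding gap_test_def g by (intro wp_IfI(2)) (simp_all add: e c)
  qed
 qed
next
 fix s' assume I: "sto s' 13 0 = (if \<exists>(i, j)\<in>{..<n} \<times> {..<n}. gap_at P b E i j then 1 else 0)"
 have "(\<exists>(i, j)\<in>{..<n} \<times> {..<n}. gap_at P b E i j) \<longleftrightarrow> (\<exists>i<n. \<exists>j<n. gap_at P b E i j)" by auto
 then show "sto s' 13 0 = (if \<exists>i<n. \<exists>j<n. gap_at P b E i j then 1 else 0)" using I by simp
qed (use h z in \<open>auto simp: holds_def loaded_def sto_set_sto\<close>)

definition gap_found :: "(nat => int) => (nat => nat) => int => bool" where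
 "gap_found P b E \<longleftrightarrow> 1 \<le> E \<and> E \<le> 2 ^ (6 * x) \<and> (\<forall>i<n. \<forall>j<n. \<not> gap_at P b E i j)"

lemma near_finite: "finite (near P b E)" "card (near P b E) \<le> n * n"
proof -
 have s: "near P b E \<subseteq> {..<n} \<times> {..<n}" by (auto simp: near_def)
 then show "finite (near P b E)" by (rule finite_subset) auto
 show "card (near P b E) \<le> n * n" using card_mono[OF _ s] by (simp add: card_cartesian_product)
qed

lemma wp_find_gap:
 assumes h: "holds P b s" and b: "\<And>i. i < n ==> b i < n" and P: "\<And>j. j < n ==> 0 < P j"
 shows "mc.WP find_gap (\<lambda>s'. gap_found P b (sto s' 12 0)) s"
proof -
 \<comment> \<open>After n^2 - k rounds either the window is empty or \<open>near\<close> has more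
   than n^2 - k elements; it starts with the pair (0, b 0). At k = 0 the second alternative is
   impossible.\<close>
 define I where "I k s' \<longleftrightarrow> 1 \<le> sto s' 12 0 \<and> sto s' 12 0 \<le> (10 * int n * int n) ^ (n * n - k) \<and>
  ((\<forall>i<n. \<forall>j<n. \<not> gap_at P b (sto s' 12 0) i j) \<or> n * n - k < card (near P b (sto s' 12 0)))" for k and s' :: hst
 have nn: "1 \<le> int n * int n" using mult_mono[of 1 "int n" 1 "int n"] n0 by simp
 have base0: "0 \<le> base P b i j" if "i < n" for i j using P[OF b[OF that]] by (simp add: base_def)
 have h1: "holds P b (set_sto s 12 0 1)" by (rule holds_set[OF h]) simp
 have c: "sto s 0 0 = int n" using h by (simp add: holds_def loaded_def)
 show ?thesis
  unfolding find_gap_def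
 proof (rule wp_SqI, rule mc.wp_StI[where a = 0 and x = 1], simp, simp, simp, simp, simp, rule wp_For_frame[where m = "n * n" and I = I])
  have "(0, b 0) \<in> near P b 1" using n0 b[OF n0] base0[OF n0, of "b 0"] by (simp add: near_def lhs_def base_def distrib_right)
  then have "0 < card (near P b 1)" using near_finite(1) card_gt_0_iff by blast
  then show "I (n * n) (set_sto (set_sto s 12 0 1) 36 0 (int (n * n)))" by (simp add: I_def sto_set_sto)
 next
  fix k s' assume k: "k < n * n" and I1: "I (Suc k) s'" and f: "frame (For 36 (Va 0 *. Va 0) 5 gap_round) (set_sto s 12 0 1) s'"
  define E where "E = sto s' 12 0"
  have h': "holds P b s'" by (rule holds_frame[OF f h1]) simp
  define s1 where "s1 = set_sto (set_sto s' 36 0 (int k)) 13 0 0"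
  have h2: "holds P b s1" unfolding s1_def by (intro holds_set h') auto
  have E1: "1 \<le> E" "E \<le> (10 * int n * int n) ^ (n * n - Suc k)"
   and E2: "(\<forall>i<n. \<forall>j<n. \<not> gap_at P b E i j) \<or> n * n - Suc k < card (near P b E)" using I1 by (simp_all add: I_def E_def)
  define N2 where "N2 = n * n"
  define D where "D = 10 * int n * int n"
  have kk: "n * n - k = Suc (n * n - Suc k)" using k unfolding N2_def[symmetric] by linarith
  have D1: "1 \<le> D" using nn unfolding D_def mult.assoc by linarith
  have "D * E \<le> D * D ^ (n * n - Suc k)" using E1(2) D1 unfolding D_def[symmetric] by (intro mult_left_mono) auto
  then have pw: "10 * int n * int n * E \<le> (10 * int n * int n) ^ (n * n - k)" unfolding D_def[symmetric] kk power_Suc .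
  have ee: "10 * int n * int n * E = 10 * ((int n * int n) * E)" by (simp only: mult.assoc)
  have "1 * E \<le> (int n * int n) * E" using nn E1 by (intro mult_right_mono) auto
  then have E3: "1 \<le> 10 * int n * int n * E" and E4: "E \<le> 10 * int n * int n * E" unfolding ee using E1 by linarith+
  have "mc.WP (Sq (Loopn 32 (Loopn 33 gap_test)) (If (Va 13) (Set 12 (N 10 *. Va 0 *. Va 0 *. Va 12)) Skp)) (I k) s1"
  proof (rule wp_Sq_rule[OF wp_gap_scan[where E = E, OF h2 b]])
   fix s2 assume r: "sto s2 13 0 = (if \<exists>i<n. \<exists>j<n. gap_at P b E i j then 1 else 0)" and f2: "frame (Loopn 32 (Loopn 33 gap_test)) s1 s2"
   have s2: "sto s2 12 0 = E" by (simp add: frame_sto[OF f2] s1_def sto_set_sto E_def)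
   have h3: "holds P b s2" by (rule holds_frame[OF f2 h2]) simp
   have c2: "sto s2 0 0 = int n" using h3 by (simp add: holds_def loaded_def)
   show "mc.WP (If (Va 13) (Set 12 (N 10 *. Va 0 *. Va 0 *. Va 12)) Skp) (I k) s2"
   proof (cases "\<exists>i<n. \<exists>j<n. gap_at P b E i j")
    case True
    then obtain i j where ij: "i < n" "j < n" "gap_at P b E i j" by blast
    define E' where "E' = 10 * int n * int n * E"
    have sub: "insert (i, j) (near P b E) \<subseteq> near P b E'"
    proof -
     have le: "(2 ^ (70 * x) + E) * base P b i' j' \<le> (2 ^ (70 * x) + E') * base P b i' j'" if "i' < n" for i' j'
      using E4 base0[OF that] by (intro mult_right_mono) (auto simp: E'_def)
     have "near P b E \<subseteq> near P b E'"
     proof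
      fix p assume "p \<in> near P b E"
      then obtain i' j' where p: "p = (i', j')" "i' < n" "j' < n" "lhs P b i' j' \<le> (2 ^ (70 * x) + E) * base P b i' j'"
       unfolding near_def by blast
      have "lhs P b i' j' \<le> (2 ^ (70 * x) + E') * base P b i' j'" by (rule order_trans[OF p(4) le[OF p(2)]])
      then show "p \<in> near P b E'" using p(1-3) by (simp add: near_def)
     qed
     moreover have "(i, j) \<in> near P b E'" using ij by (simp add: near_def gap_at_def E'_def)
     ultimately show ?thesis by simp
    qed
    have "(i, j) \<notin> near P b E" using ij by (simp add: near_def gap_at_def)
    then have "Suc (card (near P b E)) \<le> card (near P b E')" using card_mono[OF near_finite(1) sub] near_finite(1) by simp
    moreover have "n * n - Suc k < card (near P b E)" using E2 ij by blast
    ultimately have "n * n - k < card (near P b E')" unfolding kk by linarith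
    moreover have "sto (set_sto s2 12 0 E') 12 0 = E'" by simp
    ultimately have I': "I k (set_sto s2 12 0 E')" unfolding I_def using E3 pw unfolding E'_def[symmetric] by presburger
    have "E' \<le> 2 ^ (6 * x)" unfolding E'_def by (rule order_trans[OF pw E_bound]) simp
    also have "\<dots> \<le> 2 ^ w" using n0 by (intro pow_w) auto
    finally have "\<bar>E'\<bar> \<le> 2 ^ w" using E3 unfolding E'_def by linarith
    then show ?thesis using r True I' unfolding E'_def by (intro wp_IfI(1) mc.wp_StI[where a = 0 and x = "10 * int n * int n * E"]) (simp_all add: s2 c2)
   next
    case False
    have "(10 * int n * int n) ^ (n * n - Suc k) \<le> (10 * int n * int n) ^ (n * n - k)"
     using nn by (intro power_increasing) auto
    then have "I k s2" using False E1 by (simp add: I_def s2)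
    then show ?thesis using r False by (intro wp_IfI(2)) simp_all
   qed
  qed (simp_all add: s1_def sto_set_sto E_def)
  then show "mc.WP gap_round (I k) (set_sto s' 36 0 (int k))"
   unfolding gap_round_def by (intro wp_SqI mc.wp_StI[where a = 0 and x = 0]) (simp_all add: s1_def)
 next
  fix s' assume I0: "I 0 s'"
  have "\<not> n * n < card (near P b (sto s' 12 0))" using near_finite(2)[of P b "sto s' 12 0"] by simp
  then show "gap_found P b (sto s' 12 0)" using I0 E_bound[of "n * n"] by (simp add: I_def gap_found_def)
 qed (use c mc.nw rho in \<open>simp_all add: sto_set_sto\<close>)
qed

definition labelled :: "(nat \<times> nat) set => (nat => nat) => hst => bool" where
 "labelled G lab s \<longleftrightarrow> (\<forall>l<n. sto s 22 l = int (lab l) \<and> lab l < n \<and> (l, lab l) \<in> (G \<union> G\<inverse>)\<^sup>*)"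

lemma wp_relabel_loop:
 assumes n: "sto s 0 0 = int n" and l: "\<And>l. l < n ==> sto s 22 l = int (lab l)" and s: "sto s 31 0 = int p" "sto s 30 0 = int r" and r: "r < n"
 shows "mc.WP (Loopn 34 relabel_step) (\<lambda>s'. \<forall>l<n. sto s' 22 l = int (if lab l = p then r else lab l)) s"
proof (rule mc.wp_loop[where I = "\<lambda>k s'. \<forall>l<n. sto s' 22 l = int (if k \<le> l \<and> lab l = p then r else lab l)", OF n])
 fix k s' assume k: "k < n" and I: "\<forall>l<n. sto s' 22 l = int (if Suc k \<le> l \<and> lab l = p then r else lab l)"
  and f: "frame (Loopn 34 relabel_step) s s'"
 note fs = frame_sto[OF f]
 have lk: "sto s' 22 k = int (lab k)" using I k by simp
 show "mc.WP relabel_step (\<lambda>s'. \<forall>l<n. sto s' 22 l = int (if k \<le> l \<and> lab l = p then r else lab l)) (set_sto s' 34 0 (int k))"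
 proof (cases "lab k = p")
  case True
  have up: "\<forall>l<n. sto (set_sto (set_sto s' 34 0 (int k)) 22 k (int r)) 22 l = int (if k \<le> l \<and> lab l = p then r else lab l)"
   using I True by (auto simp: Suc_le_eq sto_set_sto)
  have "mc.WP (St 22 (Va 34) (Va 30)) (\<lambda>s'. \<forall>l<n. sto s' 22 l = int (if k \<le> l \<and> lab l = p then r else lab l)) (set_sto s' 34 0 (int k))"
  proof (rule mc.wp_StI[where a = k and x = "int r"])
   show "\<forall>l<n. sto (set_sto (set_sto s' 34 0 (int k)) 22 k (int r)) 22 l = int (if k \<le> l \<and> lab l = p then r else lab l)" by (rule up)
  qed (use s r mc.small(2)[of r] in \<open>simp_all add: sto_set_sto fs\<close>)
  then show ?thesis unfolding relabel_step_def using True lk s by (intro wp_IfI(1)) (simp_all add: sto_set_sto fs del: wp.simps)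
 next
  case False
  have "0 < (int (lab k) - int p) * (int (lab k) - int p)" using False by (simp add: zero_less_mult_iff) linarith
  moreover have "\<forall>l<n. sto s' 22 l = int (if k \<le> l \<and> lab l = p then r else lab l)"
   using I False by (auto simp: Suc_le_eq le_eq_less_or_eq)
  ultimately show ?thesis unfolding relabel_step_def using lk s
   by (intro wp_IfI(2)) (simp_all add: sto_set_sto fs)
 qed
qed (use l in \<open>simp_all add: sto_set_sto\<close>)

text \<open>A merge replaces labels by a function of the old labels, so equalities for pairs already
  treated persist, and a merged label is connected to its agents through the edge just used.\<close>

lemma wp_labels:
 assumes h: "holds P b s" and b: "\<And>i. i < n ==> b i < n" and E: "sto s 12 0 = E"
 defines "G \<equiv> near P b E"
 shows "mc.WP labels (\<lambda>s'. \<exists>lab. labelled G lab s' \<and> (\<forall>(i, j)\<in>G. lab i = lab j)) s"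
 unfolding labels_def
proof (rule wp_Sq_rule[where R = "\<lambda>s'. \<forall>l<n. sto s' 22 l = int l"])
 have c: "sto s 0 0 = int n" using h by (simp add: holds_def loaded_def)
 show "mc.WP (Loopn 32 (St 22 (Va 32) (Va 32))) (\<lambda>s'. \<forall>l<n. sto s' 22 l = int l) s"
 proof (rule mc.wp_loop[where I = "\<lambda>k s'. \<forall>l<n. k \<le> l --> sto s' 22 l = int l", OF c])
  fix k and s' :: hst assume "k < n" "\<forall>l<n. Suc k \<le> l --> sto s' 22 l = int l"
  then show "mc.WP (St 22 (Va 32) (Va 32)) (\<lambda>s'. \<forall>l<n. k \<le> l --> sto s' 22 l = int l) (set_sto s' 32 0 (int k))"
   using mc.small(2)[of k] by (intro mc.wp_StI[where a = k and x = "int k"]) (auto simp: sto_set_sto)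
 qed auto
next
 fix s1 assume l1: "\<forall>l<n. sto s1 22 l = int l" and f1: "frame (Loopn 32 (St 22 (Va 32) (Va 32))) s s1"
 have h1: "holds P b s1" by (rule holds_frame[OF f1 h]) simp
 have E1: "sto s1 12 0 = E" by (simp add: frame_sto[OF f1] E)
 show "mc.WP (Loopn 32 (Loopn 33 relabel)) (\<lambda>s'. \<exists>lab. labelled G lab s' \<and> (\<forall>(i, j)\<in>G. lab i = lab j)) s1"
 proof (rule mc.wp_loop2[where I = "\<lambda>D s'. \<exists>lab. labelled G lab s' \<and> (\<forall>(i, j)\<in>D \<inter> G. lab i = lab j)"])
  show "\<exists>lab. labelled G lab s1 \<and> (\<forall>(i, j)\<in>{} \<inter> G. lab i = lab j)" using l1 by (intro exI[of _ id]) (auto simp: labelled_def)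
 next
  fix i j D s' assume ij: "i < n" "j < n" and ex: "\<exists>lab. labelled G lab s' \<and> (\<forall>(i, j)\<in>D \<inter> G. lab i = lab j)"
   and f: "frame (Loopn 32 (Loopn 33 relabel)) s1 s'" and v: "sto s' 32 0 = int i" "sto s' 33 0 = int j"
  obtain lab where LD: "labelled G lab s' \<and> (\<forall>(i, j)\<in>D \<inter> G. lab i = lab j)" using ex by (rule exE)
  note lab = conjunct1[OF LD]
  have D: "lab i' = lab j'" if "(i', j') \<in> D" "(i', j') \<in> G" for i' j' using conjunct2[OF LD] that by auto
  have lb0: "sto s' 22 l = int (lab l) \<and> lab l < n \<and> (l, lab l) \<in> (G \<union> G\<inverse>)\<^sup>*" if "l < n" for l
   using lab that by (simp only: labelled_def)
  then have lb: "\<And>l. l < n ==> sto s' 22 l = int (lab l)" "\<And>l. l < n ==> lab l < n" "\<And>l. l < n ==> (l, lab l) \<in> (G \<union> G\<inverse>)\<^sup>*"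
   by simp_all
  have h': "holds P b s'" by (rule holds_frame[OF f h1]) simp
  note e = ev_lhs_base[OF h' b ij v]
  have c: "sto s' 0 0 = int n" "sto s' 6 0 = 2 ^ (70 * x)" "sto s' 12 0 = E" using h' by (simp_all add: holds_def loaded_def frame_sto[OF f] E1)
  show "mc.WP relabel (\<lambda>s'. \<exists>lab. labelled G lab s' \<and> (\<forall>(i, j)\<in>insert (i, j) D \<inter> G. lab i = lab j)) s'" (is "mc.WP relabel ?Q s'")
  proof (cases "(i, j) \<in> G")
   case False
   then have "\<not> lhs P b i j \<le> (2 ^ (70 * x) + E) * base P b i j" using ij by (simp add: G_def near_def)
   moreover have "?Q s'" using lab D False by (intro exI[of _ lab]) auto
   ultimately show ?thesis unfolding relabel_def by (intro wp_IfI(2)) (simp_all add: e c)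
  next
   case True
   then have t: "lhs P b i j \<le> (2 ^ (70 * x) + E) * base P b i j" by (simp add: G_def near_def)
   define s2 where "s2 = set_sto (set_sto s' 31 0 (int (lab i))) 30 0 (int (lab j))"
   define lab' where "lab' l = (if lab l = lab i then lab j else lab l)" for l
   have "mc.WP (Loopn 34 relabel_step) ?Q s2"
   proof (rule wp_frame_rule[OF wp_relabel_loop[where lab = lab and p = "lab i" and r = "lab j"]])
    fix s3 :: hst assume s3: "\<forall>l<n. sto s3 22 l = int (if lab l = lab i then lab j else lab l)"
    have sy: "sym ((G \<union> G\<inverse>)\<^sup>*)" by (intro sym_rtrancl sym_Un_converse)
    have "(l, lab' l) \<in> (G \<union> G\<inverse>)\<^sup>*" if l: "l < n" for l
    proof (cases "lab l = lab i")
     case True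
     have "(l, lab i) \<in> (G \<union> G\<inverse>)\<^sup>*" using lb(3)[OF l] True by simp
     also have "(lab i, i) \<in> (G \<union> G\<inverse>)\<^sup>*" by (rule symD[OF sy lb(3)[OF ij(1)]])
     also have "(i, j) \<in> (G \<union> G\<inverse>)\<^sup>*" using \<open>(i, j) \<in> G\<close> by auto
     also have "(j, lab j) \<in> (G \<union> G\<inverse>)\<^sup>*" by (rule lb(3)[OF ij(2)])
     finally show ?thesis using True by (simp add: lab'_def)
    qed (use lb(3)[OF l] in \<open>simp add: lab'_def\<close>)
    moreover have "lab' l < n" if "l < n" for l using lb(2)[OF that] lb(2)[OF ij(2)] by (simp add: lab'_def)
    ultimately have "labelled G lab' s3" using s3 unfolding labelled_def by (simp add: lab'_def[symmetric])
    moreover have "\<forall>(i, j)\<in>insert (i, j) D \<inter> G. lab' i = lab' j" using D by (auto simp: lab'_def)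
    ultimately show "?Q s3" by (intro exI[of _ lab'] conjI)
   qed (use lb ij c in \<open>auto simp: s2_def sto_set_sto\<close>)
   then have "mc.WP (Sq (Set 31 (A 22 (Va 32))) (Sq (Set 30 (A 22 (Va 33))) (Loopn 34 relabel_step))) ?Q s'"
    using lb ij mc.small(2)[of "lab i"] mc.small(2)[of "lab j"]
    by (intro wp_SqI, intro mc.wp_StI[where a = 0 and x = "int (lab i)"], (simp_all add: v less_imp_le)[5], intro wp_SqI,
     intro mc.wp_StI[where a = 0 and x = "int (lab j)"]) (simp_all add: v sto_set_sto s2_def less_imp_le)
   then show ?thesis unfolding relabel_def using t by (intro wp_IfI(1)) (simp_all add: e c del: wp.simps)
  qed
 next
  fix s' assume "\<exists>lab. labelled G lab s' \<and> (\<forall>(i, j)\<in>({..<n} \<times> {..<n}) \<inter> G. lab i = lab j)"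
  moreover have "({..<n} \<times> {..<n}) \<inter> G = G" by (auto simp: G_def near_def)
  ultimately show "\<exists>lab. labelled G lab s' \<and> (\<forall>(i, j)\<in>G. lab i = lab j)" by simp
 qed (use h1 in \<open>auto simp: holds_def loaded_def labelled_def sto_set_sto\<close>)
qed

definition euclid_state :: "int => int => nat => hst => bool" where
 "euclid_state a c t s \<longleftrightarrow> euclid_inv a c (2 ^ (20 * x)) t (sto s 23 0) (sto s 24 0) (sto s 25 0) (sto s 26 0) (sto s 27 0) (sto s 28 0)"

lemma euclid_bounds:
 assumes I: "euclid_inv a c (2 ^ (20 * x)) t r0 r1 h0 h1 k0 k1" and a: "0 < a" "a \<le> 2 ^ (211 * x)" and c: "0 < c" "c \<le> 2 ^ (211 * x)"
 shows "\<bar>r0\<bar> \<le> 2 ^ w" "\<bar>r1\<bar> \<le> 2 ^ w" "\<bar>h0\<bar> \<le> 2 ^ w" "\<bar>h1\<bar> \<le> 2 ^ w" "\<bar>k0\<bar> \<le> 2 ^ w" "\<bar>k1\<bar> \<le> 2 ^ w" "\<bar>r0 div r1\<bar> \<le> 2 ^ w"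
proof -
 have r: "0 \<le> r0" "0 \<le> r1" "r0 \<le> a + c" "r1 \<le> a + c" "0 \<le> h0" "0 \<le> h1" "0 \<le> k0" "0 \<le> k1" "k1 \<le> 2 ^ (20 * x)" "k0 \<le> 2 ^ (20 * x)"
  using I unfolding euclid_inv_def by blast+
 have ak: "a * 2 ^ (20 * x) \<le> 2 ^ (211 * x) * 2 ^ (20 * x)" using a by (intro mult_right_mono) auto
 have e: "(2::int) ^ (211 * x) * 2 ^ (20 * x) = 2 ^ (231 * x)" by (simp flip: power_add)
 have m: "(2::int) ^ (211 * x) \<le> 2 ^ (231 * x)" by (intro power_increasing) auto
 have q: "(2::int) ^ 2 * 2 ^ (231 * x) \<le> 2 ^ (2 * x) * 2 ^ (231 * x)" using x0 by (intro mult_right_mono power_increasing) auto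
 have q2: "(2::int) ^ (2 * x) * 2 ^ (231 * x) = 2 ^ (233 * x)" by (simp flip: power_add)
 have w: "(2::int) ^ (233 * x) \<le> 2 ^ w" "(2::int) ^ (20 * x) \<le> 2 ^ w" using n0 by (intro pow_w; simp)+
 have pos: "(0::int) < 2 ^ (231 * x)" by simp
 have big: "4 * (2::int) ^ (231 * x) \<le> 2 ^ w"
 proof -
  have "4 * (2::int) ^ (231 * x) \<le> 2 ^ (233 * x)" using q unfolding q2 by simp
  then show ?thesis using w(1) by linarith
 qed
 have hb: "h0 \<le> a * 2 ^ (20 * x) + (a + c)" "h1 \<le> a * 2 ^ (20 * x) + (a + c)" using euclid_inv_h_bound[OF I c(1)] a(1) by auto
 show b0: "\<bar>r0\<bar> \<le> 2 ^ w" "\<bar>r1\<bar> \<le> 2 ^ w" using r a c m big pos by linarith+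
 show "\<bar>h0\<bar> \<le> 2 ^ w" "\<bar>h1\<bar> \<le> 2 ^ w" using hb r a c m big pos ak unfolding e by linarith+
 show "\<bar>k0\<bar> \<le> 2 ^ w" "\<bar>k1\<bar> \<le> 2 ^ w" using r w by linarith+
 show "\<bar>r0 div r1\<bar> \<le> 2 ^ w" using abs_div_le[of r0 r1] b0 by linarith
qed

lemma wp_euclid_step:
 assumes I: "euclid_state a c t s" and a: "0 < a" "a \<le> 2 ^ (211 * x)" and c: "0 < c" "c \<le> 2 ^ (211 * x)" and K: "sto s 5 0 = 2 ^ (20 * x)" and d: "sto s 29 0 = 0"
 shows "mc.WP euclid_step (\<lambda>s'. sto s' 29 0 = 0 \<and> euclid_state a c (Suc t) s' \<or> sto s' 29 0 = 1 \<and> good_convergent a c (2 ^ (20 * x)) (sto s' 26 0) (sto s' 28 0)) s"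
  (is "mc.WP euclid_step ?Q s")
proof -
 let ?r0 = "sto s 23 0" and ?r1 = "sto s 24 0" and ?h0 = "sto s 25 0" and ?h1 = "sto s 26 0" and ?k0 = "sto s 27 0" and ?k1 = "sto s 28 0"
 have I': "euclid_inv a c (2 ^ (20 * x)) t ?r0 ?r1 ?h0 ?h1 ?k0 ?k1" using I by (simp add: euclid_state_def)
 have K1: "(1::int) \<le> 2 ^ (20 * x)" by simp
 have r1: "0 \<le> ?r1" using I' unfolding euclid_inv_def by blast
 show ?thesis
 proof (cases "?r1 = 0")
  case True
  have "good_convergent a c (2 ^ (20 * x)) ?h1 ?k1" by (rule euclid_inv_final[OF I' a(1) c(1) K1], rule disjI1, rule True)
  then show ?thesis unfolding euclid_step_def using d True by (simp add: sto_set_sto)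
 next
  case False
  then have r1: "0 < ?r1" using r1 by simp
  define q where "q = ?r0 div ?r1"
  note bd = euclid_bounds[OF I' a c]
  have "mc.WP (If (Va 30 *. Va 28 +. Va 27 -. Va 5) (Set 29 (N 1)) euclid_shift) ?Q (set_sto s 30 0 q)"
  proof (cases "2 ^ (20 * x) < q * ?k1 + ?k0")
   case True
   have "good_convergent a c (2 ^ (20 * x)) ?h1 ?k1" by (rule euclid_inv_final[OF I' a(1) c(1) K1], rule disjI2, rule disjI1, rule True[unfolded q_def])
   then have "mc.WP (Set 29 (N 1)) ?Q (set_sto s 30 0 q)" by (intro mc.wp_StI[where a = 0 and x = 1]) (simp_all add: sto_set_sto)
   then show ?thesis using True K by (intro wp_IfI(1)) (simp_all add: sto_set_sto del: wp.simps)
  next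
   case False
   have N: "euclid_inv a c (2 ^ (20 * x)) (Suc t) ?r1 (?r0 - q * ?r1) ?h1 (q * ?h1 + ?h0) ?k1 (q * ?k1 + ?k0)"
    unfolding q_def by (rule euclid_inv_step[OF I' r1 False[unfolded q_def not_less] less_imp_le[OF a(1)] less_imp_le[OF c(1)]])
   note bd' = euclid_bounds[OF N a c]
   have "mc.WP euclid_shift ?Q (set_sto s 30 0 q)"
    unfolding euclid_shift_def
    by (rule wp_SqI, rule mc.wp_StI[where a = 0 and x = "?r0 - q * ?r1"], simp, simp add: sto_set_sto, simp, simp, rule bd'(2),
     rule wp_SqI, rule mc.wp_StI[where a = 0 and x = "?r1"], simp, simp add: sto_set_sto, simp, simp, rule bd'(1),
     rule wp_SqI, rule mc.wp_StI[where a = 0 and x = "?r0 - q * ?r1"], simp, simp add: sto_set_sto, simp, simp, rule bd'(2),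
     rule wp_SqI, rule mc.wp_StI[where a = 0 and x = "q * ?h1 + ?h0"], simp, simp add: sto_set_sto, simp, simp, rule bd'(4),
     rule wp_SqI, rule mc.wp_StI[where a = 0 and x = "?h1"], simp, simp add: sto_set_sto, simp, simp, rule bd'(3),
     rule wp_SqI, rule mc.wp_StI[where a = 0 and x = "q * ?h1 + ?h0"], simp, simp add: sto_set_sto, simp, simp, rule bd'(4),
     rule wp_SqI, rule mc.wp_StI[where a = 0 and x = "q * ?k1 + ?k0"], simp, simp add: sto_set_sto, simp, simp, rule bd'(6),
     rule wp_SqI, rule mc.wp_StI[where a = 0 and x = "?k1"], simp, simp add: sto_set_sto, simp, simp, rule bd'(5),
     rule mc.wp_StI[where a = 0 and x = "q * ?k1 + ?k0"], simp, simp add: sto_set_sto, simp, simp, rule bd'(6),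
     simp add: sto_set_sto euclid_state_def d N)
   then show ?thesis using False K by (intro wp_IfI(2)) (simp_all add: sto_set_sto del: wp.simps)
  qed
  then have "mc.WP (Sq (Set 30 (Va 23 div. Va 24)) (If (Va 30 *. Va 28 +. Va 27 -. Va 5) (Set 29 (N 1)) euclid_shift)) ?Q s"
   using bd(7) by (intro wp_SqI mc.wp_StI[where a = 0 and x = q]) (simp_all add: q_def del: wp.simps)
  then show ?thesis unfolding euclid_step_def using d r1 by (intro wp_IfI(1)) (simp_all del: wp.simps)
 qed
qed

text \<open>Both inputs have at most 211 x bits, so their product is below 2^(500 x - 1) and the
  third stopping condition holds after 500 x steps at the latest.\<close>

lemma wp_euclid_loop:
 assumes I: "euclid_state a c 0 s" and a: "0 < a" "a \<le> 2 ^ (211 * x)" and c: "0 < c" "c \<le> 2 ^ (211 * x)" and l: "loaded s" and d: "sto s 29 0 = 0"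
 shows "mc.WP euclid_loop (\<lambda>s'. good_convergent a c (2 ^ (20 * x)) (sto s' 26 0) (sto s' 28 0)) s"
 unfolding euclid_loop_def
proof (rule wp_For_frame[where m = "500 * x" and I = "\<lambda>k s'. sto s' 29 0 = 0 \<and> euclid_state a c (500 * x - k) s' \<or>
  sto s' 29 0 = 1 \<and> good_convergent a c (2 ^ (20 * x)) (sto s' 26 0) (sto s' 28 0)"])
 have xe: "500 * int n * int n * int L = int (500 * x)" by (simp add: x_def)
 show "ev s (N 500 *. Va 0 *. Va 0 *. Va 2) = int (500 * x)" using loadedD[OF l] xe by simp
 show "ev s (N 500 *. Va 0 *. Va 0 *. Va 2) \<le> int (\<rho> 6)" using loadedD[OF l] xe rho by simp
 have "int x \<le> 2 ^ x" using of_nat_le_iff[of x "2 ^ x", where 'a = int] less_exp[of x] by simp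
 moreover have "(2::int) ^ 9 \<le> 2 ^ (9 * x)" using x0 by (intro power_increasing) auto
 ultimately have "500 * int x \<le> 2 ^ (9 * x) * 2 ^ x" by (intro mult_mono) auto
 also have "\<dots> = 2 ^ (10 * x)" by (simp flip: power_add)
 also have "\<dots> \<le> 2 ^ w" using n0 by (intro pow_w) auto
 finally show "\<bar>ev s (N 500 *. Va 0 *. Va 0 *. Va 2)\<bar> \<le> 2 ^ w" using loadedD[OF l] xe by simp
next
 fix k s' assume k: "k < 500 * x" and J: "sto s' 29 0 = 0 \<and> euclid_state a c (500 * x - Suc k) s' \<or> sto s' 29 0 = 1 \<and> good_convergent a c (2 ^ (20 * x)) (sto s' 26 0) (sto s' 28 0)"
  and f: "frame (For 36 (N 500 *. Va 0 *. Va 0 *. Va 2) 6 euclid_step) s s'"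
 have ks: "500 * x - k = Suc (500 * x - Suc k)" using k by simp
 show "mc.WP euclid_step (\<lambda>s'. sto s' 29 0 = 0 \<and> euclid_state a c (500 * x - k) s' \<or> sto s' 29 0 = 1 \<and> good_convergent a c (2 ^ (20 * x)) (sto s' 26 0) (sto s' 28 0)) (set_sto s' 36 0 (int k))"
  using J
 proof
  assume "sto s' 29 0 = 0 \<and> euclid_state a c (500 * x - Suc k) s'"
  then show ?thesis unfolding ks using loadedD(4)[OF l] by (intro wp_euclid_step a c) (simp_all add: euclid_state_def sto_set_sto frame_sto[OF f])
 next
  assume "sto s' 29 0 = 1 \<and> good_convergent a c (2 ^ (20 * x)) (sto s' 26 0) (sto s' 28 0)"
  then show ?thesis unfolding euclid_step_def by (intro wp_IfI(2)) (simp_all add: sto_set_sto)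
 qed
next
 fix s' assume J: "sto s' 29 0 = 0 \<and> euclid_state a c (500 * x - 0) s' \<or> sto s' 29 0 = 1 \<and> good_convergent a c (2 ^ (20 * x)) (sto s' 26 0) (sto s' 28 0)"
 show "good_convergent a c (2 ^ (20 * x)) (sto s' 26 0) (sto s' 28 0)"
  using J
 proof
  assume e: "sto s' 29 0 = 0 \<and> euclid_state a c (500 * x - 0) s'"
  have "a * c \<le> 2 ^ (211 * x) * 2 ^ (211 * x)" using a c by (intro mult_mono) auto
  also have "\<dots> = 2 ^ (422 * x)" by (simp flip: power_add)
  also have "\<dots> < 2 ^ (500 * x - 0 - 1)" using x0 by (intro power_strict_increasing) auto
  finally show ?thesis using e a c by (intro euclid_inv_final[of a c _ "500 * x - 0" "sto s' 23 0" "sto s' 24 0" "sto s' 25 0" _ "sto s' 27 0"]) (auto simp: euclid_state_def)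
 qed simp
qed (use I d in \<open>auto simp: euclid_state_def sto_set_sto\<close>)

end

section \<open>The whole program\<close>

text \<open>The power is written out as a product, so it is one expression with a static degree;
  \<open>powE 10\<close> has degree 11, below the limit 16.\<close>

primrec powE :: "nat => ex" where
 "powE 0 = N 1" | "powE (Suc k) = powE k *. Va 3"

lemma powE_props: "ev s (powE k) = sto s 3 0 ^ k" "nnE s (powE k)" "mdeg (powE k) = Suc k" "constE (powE k)" "dpE (powE k) \<le> 1" "arrE (powE k) \<le> 4"
 by (induction k) auto

text \<open>Counters run downwards but the input arrives in increasing order, hence the reversed
  index.\<close>

definition read_market :: cm where
 "read_market = Sq (Rd 0 (N 0)) (For 32 (Va 0 *. Va 0) 5 (Rd 15 (Va 0 *. Va 0 -. N 1 -. Va 32)))"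

definition find_max :: cm where
 "find_max = For 32 (Va 0 *. Va 0) 5 (If (A 15 (Va 32) -. Va 1) (Set 1 (A 15 (Va 32))) Skp)"

text \<open>Halving n times the largest utility down to 0 counts its binary digits. The largest
  utility has to be computed because the input does not contain U.\<close>

definition find_length :: cm where "find_length = Half 32 (Va 0 *. Va 1) 4 (Set 2 (Va 2 +. N 1))"

text \<open>Multiples of x as sums of earlier exponents: 70 = 3 * 20 + 10, 170 = 2 * 70 + 20 + 10
  and 210 = 170 + 2 * 20.\<close>

definition powers :: cm where
 "powers = Sq (Set 3 (N 1)) (Sq (For 32 (Va 0 *. Va 0 *. Va 2) 1 (Set 3 (Va 3 *. N 2))) (Sq (Set 4 (powE 10)) (Sq (Set 5 (Va 4 *. Va 4))
   (Sq (Set 6 (Va 5 *. Va 5 *. Va 5 *. Va 4)) (Sq (Set 7 (Va 6 *. Va 6 *. Va 5 *. Va 4)) (Set 8 (Va 7 *. Va 5 *. Va 5)))))))"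

definition diagonal :: cm where "diagonal = Loopn 34 (St 16 (Va 34 *. Va 0 +. Va 34) (Va 8))"

definition solve :: cm where
 "solve = Sq read_market (Sq find_max (Sq find_length (Sq powers (Sq diagonal (Sq main_loop (Sq find_gap (Sq labels write_out)))))))"

lemma wr_init [simp]: "wr read_market = {0, 32, 15}" "wr find_max = {32, 1}" "\<not> io find_max" "wr find_length = {32, 2}" "\<not> io find_length"
 "wr powers = {3, 32, 4, 5, 6, 7, 8}" "\<not> io powers" "wr diagonal = {34, 16}" "\<not> io diagonal"
 by (auto simp: read_market_def find_max_def find_length_def powers_def diagonal_def)

lemma length_concat_rows: "length (concat (map (\<lambda>i. map (f i) [0..<n]) [0..<m])) = m * n"
 by (induction m) auto

lemma nth_concat_rows: "i < m ==> j < n ==> concat (map (\<lambda>i. map (f i) [0..<n]) [0..<m]) ! (i * n + j) = f i j"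
proof (induction m)
 case (Suc m)
 show ?case
 proof (cases "i = m")
  case True
  then show ?thesis using Suc.prems by (simp add: nth_append length_concat_rows)
 next
  case False
  then have i: "i < m" using Suc.prems by simp
  have "i * n + j < (i + 1) * n" using Suc.prems by simp
  also have "\<dots> \<le> m * n" using i by (intro mult_right_mono) auto
  finally show ?thesis using Suc.IH[OF i Suc.prems(2)] by (simp add: nth_append length_concat_rows)
 qed
qed simp

lemma wp_WrI: "nnE s e ==> Q (s\<lparr>hout := hout s @ [ev s e]\<rparr>) ==> wp nnE bd \<rho> (Wr e) Q s"
 by simp

context solver
begin

lemma Ux: "int U \<le> 2 ^ x"
proof -
 have "real U \<le> real (2 ^ x)" using U_less by simp
 then have "U \<le> 2 ^ x" by (simp only: of_nat_le_iff)
 then show ?thesis by (metis of_nat_le_iff of_nat_numeral of_nat_power)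
qed

lemma nn_w: "\<bar>int n * int n\<bar> \<le> 2 ^ w" using mc.nw by simp

lemma wp_read_market:
 assumes i: "hin s = int n # us" and l: "length us = n * n" and b: "\<And>m. m < n * n ==> \<bar>us ! m\<bar> \<le> 2 ^ w"
 shows "mc.WP read_market (\<lambda>s'. sto s' 0 0 = int n \<and> (\<forall>m<n * n. sto s' 15 m = us ! m) \<and> hout s' = hout s) s"
proof -
 define s1 where "s1 = (set_sto s 0 0 (int n))\<lparr>hin := us\<rparr>"
 have s1: "sto s1 0 0 = int n" "hin s1 = us" "hout s1 = hout s" by (simp_all add: s1_def)
 have "mc.WP (For 32 (Va 0 *. Va 0) 5 (Rd 15 (Va 0 *. Va 0 -. N 1 -. Va 32))) (\<lambda>s'. sto s' 0 0 = int n \<and> (\<forall>m<n * n. sto s' 15 m = us ! m) \<and> hout s' = hout s) s1"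
 proof (rule wp_For_frame[where m = "n * n" and I = "\<lambda>k s'. hin s' = drop (n * n - k) us \<and> (\<forall>m<n * n - k. sto s' 15 m = us ! m) \<and> hout s' = hout s"])
  fix k s' assume k: "k < n * n" and I: "hin s' = drop (n * n - Suc k) us \<and> (\<forall>m<n * n - Suc k. sto s' 15 m = us ! m) \<and> hout s' = hout s"
   and f: "frame (For 32 (Va 0 *. Va 0) 5 (Rd 15 (Va 0 *. Va 0 -. N 1 -. Va 32))) s1 s'"
  define p where "p = n * n - Suc k"
  have p: "p < n * n" "n * n - k = Suc p" "int n * int n - 1 - int k = int p" using k by (simp_all add: p_def Suc_diff_Suc of_nat_diff)
  have d: "drop p us = us ! p # drop (Suc p) us" using p(1) l by (simp add: Cons_nth_drop_Suc)
  have z: "sto s' 0 0 = int n" using s1 by (simp add: frame_sto[OF f])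
  have I': "hin s' = drop p us" "\<And>m. m < p ==> sto s' 15 m = us ! m" "hout s' = hout s" using I by (simp_all add: p_def)
  show "mc.WP (Rd 15 (Va 0 *. Va 0 -. N 1 -. Va 32)) (\<lambda>s'. hin s' = drop (n * n - k) us \<and> (\<forall>m<n * n - k. sto s' 15 m = us ! m) \<and> hout s' = hout s) (set_sto s' 32 0 (int k))"
   unfolding p(2) using b[OF p(1)] I' z d p(3) by (simp add: sto_set_sto less_Suc_eq)
 next
  fix s' assume "hin s' = drop (n * n - 0) us \<and> (\<forall>m<n * n - 0. sto s' 15 m = us ! m) \<and> hout s' = hout s"
   and f: "frame (For 32 (Va 0 *. Va 0) 5 (Rd 15 (Va 0 *. Va 0 -. N 1 -. Va 32))) s1 s'"
  then show "sto s' 0 0 = int n \<and> (\<forall>m<n * n. sto s' 15 m = us ! m) \<and> hout s' = hout s" using s1 by (simp add: frame_sto[OF f])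
 qed (use s1 nn_w rho in \<open>simp_all add: sto_set_sto\<close>)
 then show ?thesis unfolding read_market_def using i mc.small(2)[of n] by (intro wp_SqI) (simp add: s1_def)
qed

lemma wp_find_max:
 assumes n: "sto s 0 0 = int n" and u: "\<And>m. m < n * n ==> sto s 15 m = us ! m" and z: "sto s 1 0 = 0"
  and U: "\<And>m. m < n * n ==> 0 \<le> us ! m \<and> us ! m \<le> int U" "m0 < n * n" "us ! m0 = int U"
 shows "mc.WP find_max (\<lambda>s'. sto s' 1 0 = int U) s"
 unfolding find_max_def
proof (rule wp_For_frame[where m = "n * n" and I = "\<lambda>k s'. 0 \<le> sto s' 1 0 \<and> sto s' 1 0 \<le> int U \<and> (\<forall>m<n * n. k \<le> m --> us ! m \<le> sto s' 1 0)"])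
 fix k s' assume k: "k < n * n" and I: "0 \<le> sto s' 1 0 \<and> sto s' 1 0 \<le> int U \<and> (\<forall>m<n * n. Suc k \<le> m --> us ! m \<le> sto s' 1 0)"
  and f: "frame (For 32 (Va 0 *. Va 0) 5 (If (A 15 (Va 32) -. Va 1) (Set 1 (A 15 (Va 32))) Skp)) s s'"
 have "int U \<le> 2 ^ x" by (rule Ux)
 also have "(2::int) ^ x \<le> 2 ^ w" using pow_w[of 1] n0 by simp
 finally have b: "\<bar>us ! k\<bar> \<le> 2 ^ w" using U(1)[OF k] by linarith
 have v: "sto s' 15 k = us ! k" using u[OF k] by (simp add: frame_sto[OF f])
 show "mc.WP (If (A 15 (Va 32) -. Va 1) (Set 1 (A 15 (Va 32))) Skp) (\<lambda>s'. 0 \<le> sto s' 1 0 \<and> sto s' 1 0 \<le> int U \<and> (\<forall>m<n * n. k \<le> m --> us ! m \<le> sto s' 1 0)) (set_sto s' 32 0 (int k))"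
 proof (cases "sto s' 1 0 < us ! k")
  case True
  have "us ! m \<le> us ! k" if "m < n * n" "k \<le> m" for m
  proof (cases "m = k")
   case False
   then have "us ! m \<le> sto s' 1 0" using I that by simp
   then show ?thesis using True by simp
  qed simp
  then show ?thesis using True v b U(1)[OF k] by (intro wp_IfI(1) mc.wp_StI[where a = 0 and x = "us ! k"]) (simp_all add: sto_set_sto)
 next
  case False
  have "us ! m \<le> sto s' 1 0" if "m < n * n" "k \<le> m" for m
   using I False that by (cases "m = k") auto
  then show ?thesis using False v I by (intro wp_IfI(2)) (simp_all add: sto_set_sto)
 qed
next
 fix s' :: hst assume "0 \<le> sto s' 1 0 \<and> sto s' 1 0 \<le> int U \<and> (\<forall>m<n * n. 0 \<le> m --> us ! m \<le> sto s' 1 0)"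
 then show "sto s' 1 0 = int U" using U(2,3) by force
qed (use n z nn_w rho in \<open>simp_all add: sto_set_sto\<close>)

lemma wp_find_length:
 assumes s: "sto s 0 0 = int n" "sto s 1 0 = int U" "sto s 2 0 = 0" and L: "L = floorlog 2 (n * U)"
 shows "mc.WP find_length (\<lambda>s'. sto s' 2 0 = int L) s"
 unfolding find_length_def
proof (rule wp_Half_frame[where m = "n * U" and I = "\<lambda>k s'. 0 \<le> sto s' 2 0 \<and> sto s' 2 0 + int (floorlog 2 k) = int L"])
 have Lw: "int L \<le> 2 ^ w"
 proof -
  have "int L \<le> int x" using Lx by simp
  also have "int x \<le> 2 ^ x" using of_nat_le_iff[of x "2 ^ x", where 'a = int] less_exp[of x] by simp
  also have "(2::int) ^ x \<le> 2 ^ w" using pow_w[of 1] n0 by simp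
  finally show ?thesis .
 qed
 fix k s' assume k: "0 < k" and I: "0 \<le> sto s' 2 0 \<and> sto s' 2 0 + int (floorlog 2 k) = int L"
  and f: "frame (Half 32 (Va 0 *. Va 1) 4 (Set 2 (Va 2 +. N 1))) s s'"
 have fl: "floorlog 2 k = floorlog 2 (k div 2) + 1" using k by (subst compute_floorlog) simp
 have "\<bar>sto s' 2 0 + 1\<bar> \<le> 2 ^ w" using I Lw unfolding fl by linarith
 then show "mc.WP (Set 2 (Va 2 +. N 1)) (\<lambda>s'. 0 \<le> sto s' 2 0 \<and> sto s' 2 0 + int (floorlog 2 (k div 2)) = int L) (set_sto s' 32 0 (int (k div 2)))"
  using I fl by (intro mc.wp_StI[where a = 0 and x = "sto s' 2 0 + 1"]) (simp_all add: sto_set_sto)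
next
 have "int (n * U) < int (2 ^ L)" using size by (simp only: of_nat_less_iff)
 then have a: "int n * int U < 2 ^ L" by simp
 then show "ev s (Va 0 *. Va 1) < 2 ^ \<rho> 4" using s rho by simp
 have "(2::int) ^ L \<le> 2 ^ x" by (rule pow_L)
 also have "(2::int) ^ x \<le> 2 ^ w" using pow_w[of 1] n0 by simp
 finally have "int n * int U \<le> 2 ^ w" using a by linarith
 then show "\<bar>ev s (Va 0 *. Va 1)\<bar> \<le> 2 ^ w" using s by simp
next
 fix s' :: hst assume "0 \<le> sto s' 2 0 \<and> sto s' 2 0 + int (floorlog 2 0) = int L"
 then show "sto s' 2 0 = int L" by (simp add: floorlog_def)
qed (use s L in \<open>simp_all add: sto_set_sto\<close>)

lemma wp_powers:
 assumes s: "sto s 0 0 = int n" "sto s 2 0 = int L" and u: "\<And>i j. i < n ==> j < n ==> sto s 15 (i * n + j) = int (u i j)"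
 shows "mc.WP powers loaded s"
proof -
 have pw: "(2::int) ^ (k * x) \<le> 2 ^ w" if "k \<le> 9000" for k
 proof -
  have "k * 1 \<le> 9000 * n" using that n0 by (intro mult_mono) auto
  then show ?thesis by (intro pow_w) simp
 qed
 have pw1: "(2::int) ^ x \<le> 2 ^ w" using pow_w[of 1] n0 by simp
 have xe: "int n * int n * int L = int x" by (simp add: x_def)
 have xw: "\<bar>int x\<bar> \<le> 2 ^ w"
 proof -
  have "int x \<le> 2 ^ x" using of_nat_le_iff[of x "2 ^ x", where 'a = int] less_exp[of x] by simp
  then show ?thesis using pw1 by linarith
 qed
 have "mc.WP (For 32 (Va 0 *. Va 0 *. Va 2) 1 (Set 3 (Va 3 *. N 2))) (\<lambda>s'. sto s' 3 0 = 2 ^ x) (set_sto s 3 0 1)"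
 proof (rule wp_For_frame[where m = x and I = "\<lambda>k s'. sto s' 3 0 = 2 ^ (x - k)"])
  fix k and s' :: hst assume k: "k < x" and I: "sto s' 3 0 = 2 ^ (x - Suc k)"
  have e: "x - k = Suc (x - Suc k)" using k by simp
  have "(2::int) ^ (x - k) \<le> 2 ^ x" by (intro power_increasing) auto
  moreover have "(0::int) \<le> 2 ^ (x - k)" by simp
  ultimately have b: "\<bar>(2::int) ^ (x - k)\<bar> \<le> 2 ^ w" using pw1 by linarith
  show "mc.WP (Set 3 (Va 3 *. N 2)) (\<lambda>s'. sto s' 3 0 = 2 ^ (x - k)) (set_sto s' 32 0 (int k))"
   by (rule mc.wp_StI[where a = 0 and x = "2 ^ (x - k)"]) (use b I in \<open>simp_all add: sto_set_sto e\<close>)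
 qed (use s xe xw rho in \<open>simp_all add: sto_set_sto\<close>)
 then have "mc.WP (Sq (For 32 (Va 0 *. Va 0 *. Va 2) 1 (Set 3 (Va 3 *. N 2))) (Sq (Set 4 (powE 10)) (Sq (Set 5 (Va 4 *. Va 4))
   (Sq (Set 6 (Va 5 *. Va 5 *. Va 5 *. Va 4)) (Sq (Set 7 (Va 6 *. Va 6 *. Va 5 *. Va 4)) (Set 8 (Va 7 *. Va 5 *. Va 5))))))) loaded (set_sto s 3 0 1)"
 proof (rule wp_Sq_rule)
  fix s' assume X: "sto s' 3 0 = 2 ^ x" and f: "frame (For 32 (Va 0 *. Va 0 *. Va 2) 1 (Set 3 (Va 3 *. N 2))) (set_sto s 3 0 1) s'"
  define s4 where "s4 = set_sto (set_sto (set_sto (set_sto (set_sto s' 4 0 (2 ^ (10 * x))) 5 0 (2 ^ (20 * x))) 6 0 (2 ^ (70 * x))) 7 0 (2 ^ (170 * x))) 8 0 (2 ^ (210 * x))"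
  have l: "loaded s4" unfolding loaded_def using s u by (simp add: s4_def sto_set_sto M_def frame_sto[OF f])
  have p4: "(2 ^ x) ^ 10 = (2::int) ^ (10 * x)" by (simp flip: power_mult add: mult.commute)
  show "mc.WP (Sq (Set 4 (powE 10)) (Sq (Set 5 (Va 4 *. Va 4)) (Sq (Set 6 (Va 5 *. Va 5 *. Va 5 *. Va 4))
   (Sq (Set 7 (Va 6 *. Va 6 *. Va 5 *. Va 4)) (Set 8 (Va 7 *. Va 5 *. Va 5)))))) loaded s'"
   apply (rule wp_SqI, rule mc.wp_StI[where a = 0 and x = "2 ^ (10 * x)"])
      apply (simp, simp add: powE_props X p4, simp, simp add: powE_props, use pw[of 10] in simp)
   apply (rule wp_SqI, rule mc.wp_StI[where a = 0 and x = "2 ^ (20 * x)"])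
      apply (simp, simp flip: power_add, simp, simp, use pw[of 20] in simp)
   apply (rule wp_SqI, rule mc.wp_StI[where a = 0 and x = "2 ^ (70 * x)"])
      apply (simp, simp add: sto_set_sto flip: power_add, simp, simp, use pw[of 70] in simp)
   apply (rule wp_SqI, rule mc.wp_StI[where a = 0 and x = "2 ^ (170 * x)"])
      apply (simp, simp add: sto_set_sto flip: power_add, simp, simp, use pw[of 170] in simp)
   apply (rule mc.wp_StI[where a = 0 and x = "2 ^ (210 * x)"])
      apply (simp, simp add: sto_set_sto flip: power_add, simp, simp, use pw[of 210] in simp)
   using l unfolding s4_def .
 qed
 then show ?thesis unfolding powers_def by (intro wp_SqI mc.wp_StI[where a = 0 and x = 1]) simp_all
qed

lemma wp_diagonal:
 assumes l: "loaded s" and z: "\<And>m. sto s 16 m = 0" and s9: "sto s 9 0 = 0"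
 shows "mc.WP diagonal (\<lambda>s'. running s' 0) s"
 unfolding diagonal_def
proof (rule mc.wp_loop[where I = "\<lambda>k s'. mc.Vrep s' (\<lambda>k' j. if k \<le> k' \<and> k' = j then M else 0)", OF loadedD(1)[OF l]])
 fix k s' assume k: "k < n" and I: "mc.Vrep s' (\<lambda>k' j. if Suc k \<le> k' \<and> k' = j then M else 0)"
  and f: "frame (Loopn 34 (St 16 (Va 34 *. Va 0 +. Va 34) (Va 8))) s s'"
 have "M \<le> 2 ^ w" unfolding M_def using n0 by (intro pow_w) auto
 then have Mw: "\<bar>M\<bar> \<le> 2 ^ w" using M0 by simp
 have "mc.Vrep (set_sto (set_sto s' 34 0 (int k)) 16 (k * n + k) M) (\<lambda>k' j. if k \<le> k' \<and> k' = j then M else 0)"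
  by (rule mc.Vrep_set[of _ "\<lambda>k' j. if Suc k \<le> k' \<and> k' = j then M else 0"]) (use I k in \<open>auto simp: mc.Vrep_other Suc_le_eq\<close>)
 then show "mc.WP (St 16 (Va 34 *. Va 0 +. Va 34) (Va 8)) (\<lambda>s'. mc.Vrep s' (\<lambda>k' j. if k \<le> k' \<and> k' = j then M else 0)) (set_sto s' 34 0 (int k))"
  using Mw loadedD[OF l] by (intro mc.wp_StI[where a = "k * n + k" and x = M]) (simp_all add: sto_set_sto frame_sto[OF f])
next
 fix s' assume I: "mc.Vrep s' (\<lambda>k' j. if 0 \<le> k' \<and> k' = j then M else 0)" and f: "frame (Loopn 34 (St 16 (Va 34 *. Va 0 +. Va 34) (Va 8))) s s'"
 then show "running s' 0" unfolding running_def using main_init s9 by (auto simp: frame_sto[OF f])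
qed (use z in \<open>simp add: mc.Vrep_def sto_set_sto\<close>)

text \<open>The price of j is the price of its representative times the recovered ratio h/k, so
  numerator and denominator are \<open>P (lab j) * h j\<close> and \<open>k j\<close>.\<close>

lemma wp_write_out:
 assumes l: "loaded s" and P: "\<And>j. j < n ==> sto s 17 j = P j" "\<And>j. j < n ==> 0 < P j \<and> P j \<le> 2 ^ (211 * x)"
  and lab: "\<And>j. j < n ==> sto s 22 j = int (lab j)" "\<And>j. j < n ==> lab j < n" and o: "hout s = []"
 shows "mc.WP write_out (\<lambda>s'. \<exists>h k. hout s' = concat (map (\<lambda>j. [P (lab j) * h j, k j]) [0..<n]) \<and>
  (\<forall>j<n. good_convergent (P j) (P (lab j)) (2 ^ (20 * x)) (h j) (k j))) s"
 unfolding write_out_def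
proof (rule mc.wp_loop[where I = "\<lambda>m s'. \<exists>h k. hout s' = concat (map (\<lambda>j. [P (lab j) * h j, k j]) [0..<n - m]) \<and>
  (\<forall>j<n - m. good_convergent (P j) (P (lab j)) (2 ^ (20 * x)) (h j) (k j))", OF loadedD(1)[OF l]])
 fix m s' assume m: "m < n" and "\<exists>h k. hout s' = concat (map (\<lambda>j. [P (lab j) * h j, k j]) [0..<n - Suc m]) \<and>
   (\<forall>j<n - Suc m. good_convergent (P j) (P (lab j)) (2 ^ (20 * x)) (h j) (k j))"
  and f: "frame (Loopn 37 (Sq (Set 38 (Va 0 -. N 1 -. Va 37)) (Sq euclid (Sq (Wr (A 17 (A 22 (Va 38)) *. Va 26)) (Wr (Va 28)))))) s s'"
 then obtain h k where hk: "hout s' = concat (map (\<lambda>j. [P (lab j) * h j, k j]) [0..<n - Suc m])"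
  "\<And>j. j < n - Suc m ==> good_convergent (P j) (P (lab j)) (2 ^ (20 * x)) (h j) (k j)" by blast
 note fs = frame_sto[OF f]
 define j where "j = n - Suc m"
 have j: "j < n" "n - m = Suc j" "int n - 1 - int m = int j" using m by (simp_all add: j_def Suc_diff_Suc of_nat_diff)
 define s1 where "s1 = set_sto (set_sto s' 37 0 (int m)) 38 0 (int j)"
 have l': "loaded s'" by (rule loaded_frame[OF f l]) auto
 have l1: "loaded s1" unfolding s1_def by (intro loaded_set l') auto
 have v1: "sto s1 17 i = sto s 17 i" "sto s1 22 i = sto s 22 i" "sto s1 38 0 = int j" for i by (simp_all add: s1_def sto_set_sto fs)
 define s2 where "s2 = set_sto (set_sto (set_sto (set_sto (set_sto (set_sto (set_sto s1 23 0 (P j)) 24 0 (P (lab j))) 25 0 0) 26 0 1) 27 0 1) 28 0 0) 29 0 0"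
 have l2: "loaded s2" unfolding s2_def by (intro loaded_set l1) auto
 have pj: "0 < P j" "P j \<le> 2 ^ (211 * x)" "0 < P (lab j)" "P (lab j) \<le> 2 ^ (211 * x)" using P(2) lab(2) j(1) by auto
 have Pw: "\<bar>P j\<bar> \<le> 2 ^ w" "\<bar>P (lab j)\<bar> \<le> 2 ^ w"
 proof -
  have "(2::int) ^ (211 * x) \<le> 2 ^ w" using n0 by (intro pow_w) auto
  then show "\<bar>P j\<bar> \<le> 2 ^ w" "\<bar>P (lab j)\<bar> \<le> 2 ^ w" using pj by linarith+
 qed
 have e2: "euclid_state (P j) (P (lab j)) 0 s2"
  unfolding euclid_state_def using euclid_inv_init[of "P j" "P (lab j)" "2 ^ (20 * x)"] pj by (simp add: s2_def sto_set_sto)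
 have "mc.WP euclid_loop (\<lambda>s3. good_convergent (P j) (P (lab j)) (2 ^ (20 * x)) (sto s3 26 0) (sto s3 28 0)) s2"
  by (rule wp_euclid_loop[OF e2 pj l2]) (simp add: s2_def)
 then have "mc.WP euclid (\<lambda>s3. good_convergent (P j) (P (lab j)) (2 ^ (20 * x)) (sto s3 26 0) (sto s3 28 0)) s1"
  unfolding euclid_def using Pw v1 P(1) lab j(1) by (simp add: s2_def sto_set_sto)
 then have "mc.WP (Sq euclid (Sq (Wr (A 17 (A 22 (Va 38)) *. Va 26)) (Wr (Va 28)))) (\<lambda>s'. \<exists>h k. hout s' = concat (map (\<lambda>j. [P (lab j) * h j, k j]) [0..<n - m]) \<and>
   (\<forall>j<n - m. good_convergent (P j) (P (lab j)) (2 ^ (20 * x)) (h j) (k j))) s1"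
 proof (rule wp_Sq_rule)
  fix s3 assume g: "good_convergent (P j) (P (lab j)) (2 ^ (20 * x)) (sto s3 26 0) (sto s3 28 0)" and f3: "frame euclid s1 s3"
  define h' where "h' = h(j := sto s3 26 0)"
  define k' where "k' = k(j := sto s3 28 0)"
  have hj: "h' j = sto s3 26 0" "k' j = sto s3 28 0" by (simp_all add: h'_def k'_def)
  have "map (\<lambda>j. [P (lab j) * h j, k j]) [0..<j] = map (\<lambda>j. [P (lab j) * h' j, k' j]) [0..<j]"
   by (rule map_cong[OF refl]) (simp add: h'_def k'_def)
  moreover have "hout s3 = hout s1" by (rule frame_io(2)[OF f3]) simp
  moreover have "hout s1 = hout s'" by (simp add: s1_def)
  ultimately have o3: "hout s3 = concat (map (\<lambda>j. [P (lab j) * h' j, k' j]) [0..<j])" using hk(1) unfolding j_def[symmetric] by (simp only:)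
  have v3: "sto s3 17 (lab j) = P (lab j)" "sto s3 22 j = int (lab j)" "sto s3 38 0 = int j" using v1 P(1) lab j(1) by (simp_all add: frame_sto[OF f3])
  have g': "\<forall>i<Suc j. good_convergent (P i) (P (lab i)) (2 ^ (20 * x)) (h' i) (k' i)"
  proof (intro allI impI)
   fix i assume i: "i < Suc j"
   show "good_convergent (P i) (P (lab i)) (2 ^ (20 * x)) (h' i) (k' i)"
   proof (cases "i = j")
    case True then show ?thesis using g by (simp only: hj)
   next
    case False
    then have "i < n - Suc m" using i by (simp add: j_def)
    then show ?thesis using hk(2)[of i] False by (simp add: h'_def k'_def)
   qed
  qed
  show "mc.WP (Sq (Wr (A 17 (A 22 (Va 38)) *. Va 26)) (Wr (Va 28))) (\<lambda>s'. \<exists>h k. hout s' = concat (map (\<lambda>j. [P (lab j) * h j, k j]) [0..<n - m]) \<and>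
   (\<forall>j<n - m. good_convergent (P j) (P (lab j)) (2 ^ (20 * x)) (h j) (k j))) s3"
   unfolding j(2)
  proof (rule wp_SqI, rule wp_WrI, simp add: v3, rule wp_WrI, simp, rule exI[of _ h'], rule exI[of _ k'], rule conjI)
   show "\<forall>i<Suc j. good_convergent (P i) (P (lab i)) (2 ^ (20 * x)) (h' i) (k' i)" by (rule g')
  qed (simp add: v3 o3 hj)
 qed
 then show "mc.WP (Sq (Set 38 (Va 0 -. N 1 -. Va 37)) (Sq euclid (Sq (Wr (A 17 (A 22 (Va 38)) *. Va 26)) (Wr (Va 28))))) (\<lambda>s'. \<exists>h k. hout s' = concat (map (\<lambda>j. [P (lab j) * h j, k j]) [0..<n - m]) \<and>
   (\<forall>j<n - m. good_convergent (P j) (P (lab j)) (2 ^ (20 * x)) (h j) (k j))) (set_sto s' 37 0 (int m))"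
  using j loadedD(1)[OF l'] mc.small(2)[of j] by (intro wp_SqI[of _ _ _ "Set 38 (Va 0 -. N 1 -. Va 37)"] mc.wp_StI[where a = 0 and x = "int j"]) (simp_all add: s1_def sto_set_sto del: wp.simps)
qed (use o in auto)

lemma wp_solve:
 assumes s: "sto s = (\<lambda>_ _. 0)" "hin s = encode_market n u" "hout s = []" and L: "L = floorlog 2 (n * U)" and U: "\<exists>i<n. \<exists>j<n. u i j = U"
 shows "mc.WP solve (\<lambda>s'. \<exists>p. encodes_vector n (hout s') p \<and> equilibrium_prices n u p) s"
proof -
 define us where "us = concat (map (\<lambda>i. map (\<lambda>j. int (u i j)) [0..<n]) [0..<n])"
 have us: "hin s = int n # us" "length us = n * n" by (simp_all add: s us_def encode_market_def length_concat_rows)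
 have usn: "us ! (i * n + j) = int (u i j)" if "i < n" "j < n" for i j unfolding us_def by (rule nth_concat_rows[OF that])
 have usb: "0 \<le> us ! m \<and> us ! m \<le> int U" if "m < n * n" for m
 proof -
  have "m div n < n" "m mod n < n" "m div n * n + m mod n = m" using that n0 by (simp_all add: less_mult_imp_div_less)
  then show ?thesis using usn[of "m div n" "m mod n"] market_bound[OF market, of "m div n" "m mod n"] by simp
 qed
 have Uw: "int U \<le> 2 ^ w"
 proof -
  have "int U \<le> 2 ^ x" by (rule Ux)
  also have "(2::int) ^ x \<le> 2 ^ w" using pow_w[of 1] n0 by simp
  finally show ?thesis .
 qed
 obtain i0 j0 where ij0: "i0 < n" "j0 < n" "u i0 j0 = U" using U by blast
 have m0: "i0 * n + j0 < n * n"
 proof -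
  have "i0 * n + j0 < (i0 + 1) * n" using ij0 by simp
  also have "\<dots> \<le> n * n" using ij0 by (intro mult_right_mono) auto
  finally show ?thesis .
 qed
 have usw: "\<bar>us ! m\<bar> \<le> 2 ^ w" if "m < n * n" for m using usb[OF that] Uw by linarith
 let ?Q = "\<lambda>s'. \<exists>p. encodes_vector n (hout s') p \<and> equilibrium_prices n u p"
 have fin: "mc.WP (Sq find_gap (Sq labels write_out)) ?Q s6" if l6: "loaded s6" and o6: "hout s6 = []" and sol: "solution P b"
  and P6: "\<forall>j<n. sto s6 17 j = P j" and b6: "\<forall>i<n. sto s6 18 i = int (b i)" for s6 P b
 proof -
  have h6: "holds P b s6" using l6 P6 b6 by (simp add: holds_def)
  have P0: "\<And>j. j < n ==> 0 < P j" and tot: "(\<Sum>j<n. P j) = n * M" and bg: "best_goods n u (\<lambda>j. real_of_int (P j)) b"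
   and z: "2 ^ (170 * x) * (\<Sum>j<n. q j * demand_excess n (\<lambda>j. real_of_int (P j)) b j) \<le> 12 * real n" using sol by (auto simp: solution_def)
  have bn: "\<And>i. i < n ==> b i < n" using bg by (simp add: best_goods_def)
  have Pb: "P j \<le> 2 ^ (211 * x)" if j: "j < n" for j
  proof -
   have "P j \<le> (\<Sum>j<n. P j)" using j P0 by (intro member_le_sum) (auto intro: less_imp_le)
   also have "\<dots> \<le> 2 ^ x * 2 ^ (210 * x)" unfolding tot M_def using nx by (intro mult_right_mono) auto
   also have "\<dots> = 2 ^ (211 * x)" by (simp flip: power_add)
   finally show ?thesis .
  qed
  show ?thesis
  proof (rule wp_Sq_rule[OF wp_find_gap[OF h6 bn P0]])
   fix s7 assume g: "gap_found P b (sto s7 12 0)" and f7: "frame find_gap s6 s7"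
   define E where "E = sto s7 12 0"
   define G where "G = near P b E"
   have h7: "holds P b s7" by (rule holds_frame[OF f7 h6]) simp
   show "mc.WP (Sq labels write_out) ?Q s7"
   proof (rule wp_Sq_rule[OF wp_labels[where E = E, OF h7 bn]])
    fix s8 assume "\<exists>lab. labelled (near P b E) lab s8 \<and> (\<forall>(i, j)\<in>near P b E. lab i = lab j)" and f8: "frame labels s7 s8"
    then obtain lab where lab: "labelled G lab s8" "\<And>i j. (i, j) \<in> G ==> lab i = lab j" unfolding G_def by blast
    have h8: "holds P b s8" by (rule holds_frame[OF f8 h7]) simp
    have o8: "hout s8 = []" using o6 frame_io(2)[OF f7] frame_io(2)[OF f8] by simp
    show "mc.WP write_out ?Q s8"
    proof (rule wp_mono[OF wp_write_out[where P = P and lab = lab]])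
     fix s9 assume "\<exists>h k. hout s9 = concat (map (\<lambda>j. [P (lab j) * h j, k j]) [0..<n]) \<and> (\<forall>j<n. good_convergent (P j) (P (lab j)) (2 ^ (20 * x)) (h j) (k j))"
     then obtain h k where o: "hout s9 = concat (map (\<lambda>j. [P (lab j) * h j, k j]) [0..<n])"
      and hk: "\<And>j. j < n ==> good_convergent (P j) (P (lab j)) (2 ^ (20 * x)) (h j) (k j)" by blast
     define p where "p j = real_of_int (P (lab j) * h j) / k j" for j
     have "equilibrium_prices n u p"
      unfolding p_def
     proof (rule readout_equilibrium[OF P0 bg z, of E G lab h k])
      show "1 \<le> E" "E \<le> 2 ^ (6 * x)" using g by (simp_all add: gap_found_def E_def)
      show "G = {(i, j). i < n \<and> j < n \<and> 2 ^ (70 * x) * (int (u i (b i)) * P j) \<le> (2 ^ (70 * x) + E) * (int (u i j) * P (b i))}"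
       by (simp add: G_def near_def lhs_def base_def)
      show "(2 ^ (70 * x) + 10 * int n ^ 2 * E) * (int (u i j) * P (b i)) < 2 ^ (70 * x) * (int (u i (b i)) * P j)"
       if "i < n" "j < n" "(i, j) \<notin> G" for i j
      proof -
       have "\<not> gap_at P b E i j" using g that by (simp add: gap_found_def E_def)
       then show ?thesis using that by (simp add: gap_at_def G_def near_def lhs_def base_def power2_eq_square mult.assoc)
      qed
     qed (use lab hk in \<open>auto simp: labelled_def\<close>)
     moreover have "encodes_vector n (hout s9) p"
     proof -
      have r: "[P (lab j) * h j, k j] = map (\<lambda>i. if i = 0 then P (lab j) * h j else k j) [0..<2]" for j by (simp add: numeral_2_eq_2)
      define F where "F j i = (if i = (0::nat) then P (lab j) * h j else k j)" for j i
      have o': "hout s9 = concat (map (\<lambda>j. map (F j) [0..<2]) [0..<n])" unfolding o r F_def ..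
      have "hout s9 ! (i * 2 + 0) = F i 0" "hout s9 ! (i * 2 + 1) = F i 1" if "i < n" for i
       unfolding o' by (rule nth_concat_rows[OF that]; simp)+
      then have "hout s9 ! (2 * i) = P (lab i) * h i" "hout s9 ! (2 * i + 1) = k i" if "i < n" for i
       using that by (simp_all add: F_def mult.commute)
      moreover have "length (hout s9) = 2 * n" unfolding o' length_concat_rows by simp
      moreover have "k i \<noteq> 0" if "i < n" for i using hk[OF that] by (simp add: good_convergent_def)
      ultimately show ?thesis by (simp add: encodes_vector_def p_def)
     qed
     ultimately show "?Q s9" by blast
    qed (use h8 P0 Pb lab o8 in \<open>auto simp: holds_def labelled_def\<close>)
   qed (simp_all add: E_def)
  qed
 qed
 show ?thesis
  unfolding solve_def
 proof (rule wp_Sq_rule[OF wp_read_market[OF us usw]])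
  fix s1 assume r1: "sto s1 0 0 = int n \<and> (\<forall>m<n * n. sto s1 15 m = us ! m) \<and> hout s1 = hout s" and f1: "frame read_market s s1"
  have z1: "sto s1 v i = 0" if "v \<notin> {0, 32, 15}" for v i using that s by (simp add: frame_sto[OF f1])
  show "mc.WP (Sq find_max (Sq find_length (Sq powers (Sq diagonal (Sq main_loop (Sq find_gap (Sq labels write_out))))))) ?Q s1"
  proof (rule wp_Sq_rule[OF wp_find_max[where us = us, OF _ _ _ usb m0]])
   fix s2 assume r2: "sto s2 1 0 = int U" and f2: "frame find_max s1 s2"
   show "mc.WP (Sq find_length (Sq powers (Sq diagonal (Sq main_loop (Sq find_gap (Sq labels write_out)))))) ?Q s2"
   proof (rule wp_Sq_rule[OF wp_find_length[OF _ r2 _ L]])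
    fix s3 assume r3: "sto s3 2 0 = int L" and f3: "frame find_length s2 s3"
    have u3: "sto s3 15 (i * n + j) = int (u i j)" if ij: "i < n" "j < n" for i j
    proof -
     have "i * n + j < (i + 1) * n" using ij by simp
     also have "\<dots> \<le> n * n" using ij by (intro mult_right_mono) auto
     finally show ?thesis using r1 usn[OF ij] by (simp add: frame_sto[OF f3] frame_sto[OF f2])
    qed
    have n3: "sto s3 0 0 = int n" using r1 by (simp add: frame_sto[OF f3] frame_sto[OF f2])
    show "mc.WP (Sq powers (Sq diagonal (Sq main_loop (Sq find_gap (Sq labels write_out))))) ?Q s3"
    proof (rule wp_Sq_rule[OF wp_powers[OF n3 r3 u3]])
     fix s4 assume l4: "loaded s4" and f4: "frame powers s3 s4"
     have z4: "sto s4 v i = 0" if "v \<notin> {0, 32, 15, 1, 2, 3, 4, 5, 6, 7, 8}" for v i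
      using that z1 by (simp add: frame_sto[OF f4] frame_sto[OF f3] frame_sto[OF f2])
     show "mc.WP (Sq diagonal (Sq main_loop (Sq find_gap (Sq labels write_out)))) ?Q s4"
     proof (rule wp_Sq_rule[OF wp_diagonal[OF l4]])
      fix s5 assume r5: "running s5 0" and f5: "frame diagonal s4 s5"
      have l5: "loaded s5" by (rule loaded_frame[OF f5 l4]) simp
      show "mc.WP (Sq main_loop (Sq find_gap (Sq labels write_out))) ?Q s5"
      proof (rule wp_Sq_rule[OF wp_main_loop[OF l5 r5]])
       fix s6 assume "\<exists>P b. solution P b \<and> (\<forall>j<n. sto s6 17 j = P j) \<and> (\<forall>i<n. sto s6 18 i = int (b i))" and f6: "frame main_loop s5 s6"
       then obtain P b where sol: "solution P b" "\<forall>j<n. sto s6 17 j = P j" "\<forall>i<n. sto s6 18 i = int (b i)" by blast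
       have l6: "loaded s6" by (rule loaded_frame[OF f6 l5]) simp
       have "hout s6 = []" using r1 s frame_io(2)[OF f2] frame_io(2)[OF f3] frame_io(2)[OF f4] frame_io(2)[OF f5] frame_io(2)[OF f6] by simp
       then show "mc.WP (Sq find_gap (Sq labels write_out)) ?Q s6" by (rule fin[OF l6 _ sol])
      qed
     qed (simp_all add: z4)
    qed
   qed (use r1 z1 in \<open>simp_all add: frame_sto[OF f2]\<close>)
  qed (use r1 z1 ij0 usn in auto)
 qed
qed

end

section \<open>Running time\<close>

text \<open>This is \<open>cost\<close> with every iteration bound set to 1, so it is a constant of
  the program text.\<close>

fun step_cost :: "cm => nat" where
 "step_cost Skp = 0"
| "step_cost (St k i e) = szE i + szE e + 5"
| "step_cost (Sq c1 c2) = step_cost c1 + step_cost c2"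
| "step_cost (If e c1 c2) = szE e + 1 + (step_cost c1 + step_cost c2)"
| "step_cost (For v e r c) = szE e + 4 + step_cost c"
| "step_cost (Half v e r c) = szE e + 4 + step_cost c"
| "step_cost (Rd k i) = szE i + 5"
| "step_cost (Wr e) = szE e + 1"

text \<open>Together with the next two functions: a loop with tag r runs at most
  \<open>tag_factor r * n ^ tag_n r * x ^ tag_x r\<close> times.\<close>

definition tag_factor :: "nat => nat" where "tag_factor r = (if r = 3 then 4000 else if r = 6 then 500 else 1)"
definition tag_n :: "nat => nat" where "tag_n r = (if r = 0 then 1 else if r = 3 then 3 else if r = 5 then 2 else 0)"
definition tag_x :: "nat => nat" where "tag_x r = (if r = 1 \<or> r = 3 \<or> r = 4 \<or> r = 6 then 1 else 0)"

fun deg :: "(nat => nat) => cm => nat" where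
 "deg d (Sq c1 c2) = max (deg d c1) (deg d c2)"
| "deg d (If e c1 c2) = max (deg d c1) (deg d c2)"
| "deg d (For v e r c) = d r + deg d c"
| "deg d (Half v e r c) = d r + deg d c"
| "deg d c = 0"

fun fac :: "cm => nat" where
 "fac (Sq c1 c2) = max (fac c1) (fac c2)"
| "fac (If e c1 c2) = max (fac c1) (fac c2)"
| "fac (For v e r c) = tag_factor r * fac c"
| "fac (Half v e r c) = tag_factor r * fac c"
| "fac c = 1"

text \<open>Monomials are multiplied at loops and replaced by a common upper bound at sequences and
  branches, which is possible as n and x are at least 1.\<close>

lemma cost_le:
 fixes n x :: nat
 assumes n: "1 \<le> n" and x: "1 \<le> x" and \<rho>: "\<And>r. \<rho> r \<le> tag_factor r * n ^ tag_n r * x ^ tag_x r"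
 defines "m \<equiv> \<lambda>c. fac c * n ^ deg tag_n c * x ^ deg tag_x c"
 shows "cost \<rho> c \<le> step_cost c * m c \<and> 1 \<le> m c"
proof (induction c)
 have loop: "szE e + 2 + \<rho> r * (cost \<rho> c + 2) \<le> (szE e + 4 + step_cost c) * ((tag_factor r * n ^ tag_n r * x ^ tag_x r) * m c)"
  "1 \<le> (tag_factor r * n ^ tag_n r * x ^ tag_x r) * m c"
  if "cost \<rho> c \<le> step_cost c * m c \<and> 1 \<le> m c" for c r e
 proof -
  define T where "T = tag_factor r * n ^ tag_n r * x ^ tag_x r"
  have T: "1 \<le> T" unfolding T_def using n x by (simp add: tag_factor_def Suc_le_eq)
  show one: "1 \<le> (tag_factor r * n ^ tag_n r * x ^ tag_x r) * m c" unfolding T_def[symmetric] using T that mult_le_mono[of 1 T 1 "m c"] by simp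
  have h2: "\<rho> r * (cost \<rho> c + 2) \<le> T * (step_cost c * m c + 2 * m c)" using \<rho>[of r] that unfolding T_def[symmetric] by (intro mult_le_mono add_mono) auto
  have "(szE e + 2) * 1 \<le> (szE e + 2) * (T * m c)" using one unfolding T_def[symmetric] by (intro mult_le_mono) auto
  then have h1: "szE e + 2 \<le> (szE e + 2) * (T * m c)" by (simp only: mult_1_right)
  have eq: "(szE e + 4 + step_cost c) * (T * m c) = (szE e + 2) * (T * m c) + T * (step_cost c * m c + 2 * m c)" by (simp add: algebra_simps)
  show "szE e + 2 + \<rho> r * (cost \<rho> c + 2) \<le> (szE e + 4 + step_cost c) * ((tag_factor r * n ^ tag_n r * x ^ tag_x r) * m c)"
   unfolding T_def[symmetric] eq by (rule add_mono[OF h1 h2])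
 qed
 have mx: "f1 * n ^ d1 * x ^ e1 \<le> max f1 f2 * n ^ max d1 d2 * x ^ max e1 e2" "f2 * n ^ d2 * x ^ e2 \<le> max f1 f2 * n ^ max d1 d2 * x ^ max e1 e2" for f1 f2 d1 d2 e1 e2
  using n x by (intro mult_le_mono power_increasing; simp)+
 {
  case (Sq c1 c2)
  have h: "m c1 \<le> m (Sq c1 c2)" "m c2 \<le> m (Sq c1 c2)" unfolding m_def by (simp_all add: mx del: max.bounded_iff)
  have "cost \<rho> c1 \<le> step_cost c1 * m (Sq c1 c2)" by (rule order_trans[OF conjunct1[OF Sq(1)] mult_le_mono2[OF h(1)]])
  moreover have "cost \<rho> c2 \<le> step_cost c2 * m (Sq c1 c2)" by (rule order_trans[OF conjunct1[OF Sq(2)] mult_le_mono2[OF h(2)]])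
  moreover have "1 \<le> m (Sq c1 c2)" by (rule order_trans[OF conjunct2[OF Sq(1)] h(1)])
  ultimately show ?case unfolding cost.simps step_cost.simps distrib_right by linarith
 next
  case (If e c1 c2)
  have m: "m c1 \<le> m (If e c1 c2)" "m c2 \<le> m (If e c1 c2)" unfolding m_def by (simp_all add: mx del: max.bounded_iff)
  have one: "1 \<le> m (If e c1 c2)" by (rule order_trans[OF conjunct2[OF If(1)] m(1)])
  have "(szE e + 1) * 1 \<le> (szE e + 1) * m (If e c1 c2)" by (rule mult_le_mono2[OF one])
  moreover have "cost \<rho> c1 \<le> step_cost c1 * m (If e c1 c2)" by (rule order_trans[OF conjunct1[OF If(1)] mult_le_mono2[OF m(1)]])
  moreover have "cost \<rho> c2 \<le> step_cost c2 * m (If e c1 c2)" by (rule order_trans[OF conjunct1[OF If(2)] mult_le_mono2[OF m(2)]])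
  ultimately show ?case using one unfolding cost.simps step_cost.simps distrib_right by linarith
 next
  case (For v e r c)
  have "m (For v e r c) = (tag_factor r * n ^ tag_n r * x ^ tag_x r) * m c" by (simp add: m_def power_add)
  then show ?case using loop[OF For] by simp
 next
  case (Half v e r c)
  have "m (Half v e r c) = (tag_factor r * n ^ tag_n r * x ^ tag_x r) * m c" by (simp add: m_def power_add)
  then show ?case using loop[OF Half] by simp
 }
qed (simp_all add: m_def)

lemmas program_defs = solve_def read_market_def find_max_def find_length_def powers_def diagonal_def main_loop_def cut_round_def
 colsums_def find_low_def direction_def low_dir_def best_def demands_def high_dir_def products_def argmax_def cut_all_def cut_inner_def cut_entry_def
 find_gap_def gap_round_def gap_test_def lhs_ex_def base_ex_def labels_def relabel_def relabel_step_def
 write_out_def euclid_def euclid_loop_def euclid_step_def euclid_shift_def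

lemma solve_wf: "wf solve"
 using powE_props(5,6)[of 10] by (auto simp: program_defs wfE_def tmp_def)

lemma solve_stat: "stat solve"
 by (simp add: program_defs statE_def powE_props)

text \<open>The main loop dominates: n^3 x cuts, each treating n^2 matrix entries.\<close>

lemma solve_degrees: "deg tag_n solve = 5" "deg tag_x solve = 1" "fac solve = 4000"
 by (simp_all add: program_defs tag_n_def tag_x_def tag_factor_def)

text \<open>Passing to a forest changes the flow only, so prices can be normalised before the
  support is reduced.\<close>

lemma normalized_equilibrium:
 assumes m: "linear_market n U u"
 shows "\<exists>q f. meq n u q f \<and> support_forest n f \<and> (\<Sum>j<n. q j) = 1"
proof -
 obtain p f where p: "meq n u p f" using market_flow_exists[OF m] by blast
 define s where "s = (\<Sum>j<n. p j)"
 have s: "0 < s" unfolding s_def using meq_pos[OF p] market_nonempty[OF m] by (intro sum_pos) auto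
 have "meq n u (\<lambda>j. p j / s) (\<lambda>i j. f i j / s)"
  using p s unfolding meq_def by (auto simp: sum_divide_distrib[symmetric] zero_less_divide_iff divide_right_mono)
 then obtain g where "meq n u (\<lambda>j. p j / s) g" "support_forest n g" using meq_forest_exists by blast
 moreover have "(\<Sum>j<n. p j / s) = 1" using s by (simp add: s_def flip: sum_divide_distrib)
 ultimately show ?thesis by blast
qed

theorem theorem7:
  shows "\<exists>(c :: prog) (C :: real). \<forall>(n :: nat) (U :: nat) (u :: nat \<Rightarrow> nat \<Rightarrow> nat).
    linear_market n U u \<longrightarrow>
      (\<exists>t ys p. runs c (encode_market n u) t ys \<and>
         encodes_vector n ys p \<and>
         equilibrium_prices n u p \<and>
         (2 \<le> n * U \<longrightarrow> real t \<le> C * real n ^ 10 * (log 2 (real (n * U)))\<^sup>2))"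
proof -
  \<comment> \<open>\<open>step_cost solve * 4000\<close> counts steps in units of n^5 x, and
    \<open>16 * 144008\<close> bounds the cost of a step in units of n x.\<close>
  define C0 where "C0 = step_cost solve * 4000 * 16 * 144008"
  have main: "\<exists>t ys p. runs (compile solve) (encode_market n u) t ys \<and> encodes_vector n ys p \<and> equilibrium_prices n u p \<and>
      (2 \<le> n * U --> real t \<le> (real C0 * 4) * real n ^ 10 * (log 2 (real (n * U)))\<^sup>2)" if mk: "linear_market n U u" for n U u
  proof -
    have n: "0 < n" by (rule market_nonempty[OF mk])
    \<comment> \<open>The input does not reveal U, and the program uses the largest utility instead.
      The whole analysis is run with V, and V \<le> U carries the bound over.\<close>
    define V where "V = Max ((\<lambda>(i, j). u i j) ` ({..<n} \<times> {..<n}))"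
    have fin: "finite ((\<lambda>(i, j). u i j) ` ({..<n} \<times> {..<n}))" by simp
    have Vge: "u i j \<le> V" if "i < n" "j < n" for i j unfolding V_def using that by (intro Max_ge[OF fin]) auto
    have "V \<in> (\<lambda>(i, j). u i j) ` ({..<n} \<times> {..<n})" unfolding V_def by (rule Max_in[OF fin]) (use n in auto)
    then obtain i0 j0 where V: "i0 < n" "j0 < n" "u i0 j0 = V" by auto
    have VU: "V \<le> U" using market_bound[OF mk V(1,2)] V(3) by simp
    have mV: "linear_market n V u" using mk Vge unfolding linear_market_def by simp
    obtain j1 where "j1 < n" "0 < u 0 j1" using market_likes[OF mk n] by blast
    then have V0: "0 < V" using Vge[OF n, of j1] by simp
    define L where "L = floorlog 2 (n * V)"
    have nV: "0 < n * V" using n V0 by simp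
    have Lb: "2 ^ (L - 1) \<le> n * V" "n * V < 2 ^ L" using floorlog_bounds[OF nV, of 2] by (simp_all add: L_def)
    obtain q f where qf: "meq n u q f" "support_forest n f" "(\<Sum>j<n. q j) = 1" using normalized_equilibrium[OF mV] by blast
    interpret sized_equilibrium n V L u q f by unfold_locales (use mV Lb(2) qf in auto)
    define \<rho> where "\<rho> r = (if r = 0 then n else if r = 1 then x else if r = 3 then rounds else if r = 4 then L else if r = 5 then n * n else if r = 6 then 500 * x else 1)" for r :: nat
    interpret solver n V L u q f \<rho> by unfold_locales (simp_all add: \<rho>_def)
    define s0 :: hst where "s0 = \<lparr>sto = (\<lambda>_ _. 0), hin = encode_market n u, hout = []\<rparr>"
    let ?Q = "\<lambda>s'. \<exists>p. encodes_vector n (hout s') p \<and> equilibrium_prices n u p"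
    have wps: "mc.WP solve ?Q s0" by (rule wp_solve) (use V L_def in \<open>auto simp: s0_def\<close>)
    have w12: "12 \<le> w"
    proof -
      have "1 \<le> n * x" using n0 x0 by simp
      then show ?thesis by (simp add: mult.assoc)
    qed
    have "wp (okE (16 * w)) (\<lambda>v. \<bar>v\<bar> < 2 ^ (16 * w)) \<rho> solve (\<lambda>s. ?Q s \<and> bnds w s) s0"
      by (rule wp_bounded[OF w12 solve_stat _ wps]) (simp add: bnds_def s0_def)
    moreover have "reprs s0 \<lparr>reg = (\<lambda>_. 0), inp = encode_market n u, outp = []\<rparr>" by (simp add: reprs_def s0_def)
    ultimately obtain t \<sigma>' s' where e: "exec (compile solve) \<lparr>reg = (\<lambda>_. 0), inp = encode_market n u, outp = []\<rparr> t \<sigma>'"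
      and t: "t \<le> cost \<rho> solve * (2 * W (16 * w))" and r: "reprs s' \<sigma>'" and Q: "?Q s'"
      using comp_correct[OF solve_wf] by blast
    obtain p where p: "encodes_vector n (hout s') p" "equilibrium_prices n u p" using Q by blast
    have "runs (compile solve) (encode_market n u) t (hout s')" unfolding runs_def using e r by (auto simp: reprs_def)
    moreover have "real t \<le> (real C0 * 4) * real n ^ 10 * (log 2 (real (n * U)))\<^sup>2" if nU: "2 \<le> n * U"
    proof -
      have "\<rho> r \<le> tag_factor r * n ^ tag_n r * x ^ tag_x r" for r
        using n0 x0 Lx by (simp add: \<rho>_def tag_factor_def tag_n_def tag_x_def rounds_def power2_eq_square)
      then have c: "cost \<rho> solve \<le> step_cost solve * (4000 * n ^ 5 * x ^ 1)"
        using cost_le[of n x \<rho> solve] n0 x0 unfolding solve_degrees by simp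
      have one: "1 \<le> n * x" using n0 x0 by simp
      have "2 * W (16 * w) = 16 * (8 + 144000 * (n * x))" by (simp add: W_def mult.assoc)
      also have "\<dots> \<le> 16 * (144008 * (n * x))" using one by simp
      finally have Wb: "2 * W (16 * w) \<le> 16 * (144008 * (n * x))" .
      have "t \<le> step_cost solve * (4000 * n ^ 5 * x ^ 1) * (16 * (144008 * (n * x)))"
        by (rule order_trans[OF t mult_le_mono[OF c Wb]])
      also have "\<dots> = C0 * (n ^ 5 * n * (x * x))" by (simp only: C0_def power_one_right ac_simps)
      also have "n ^ 5 * n * (x * x) = n ^ 10 * L ^ 2" unfolding x_def by (simp add: eval_nat_numeral ac_simps)
      finally have "real t \<le> real (C0 * (n ^ 10 * L ^ 2))" by (simp only: of_nat_le_iff)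
      then have tr: "real t \<le> real C0 * (real n ^ 10 * real L ^ 2)" by simp
      define l where "l = log 2 (real (n * U))"
      have l1: "1 \<le> l" unfolding l_def using nU le_log2_of_power[of 1 "n * U"] by simp
      \<comment> \<open>L exceeds the logarithm by at most 1; as the logarithm is at least 1 here, L
        is at most twice it, hence the factor 4 in the constant.\<close>
      have "2 ^ (L - 1) \<le> n * U" using Lb(1) VU mult_le_mono2[OF VU, of n] by linarith
      then have "real (L - 1) \<le> l" unfolding l_def by (rule le_log2_of_power)
      then have "real L \<le> 2 * l" using l1 L0 by (simp add: of_nat_diff)
      then have "real L ^ 2 \<le> (2 * l) ^ 2" by (intro power_mono) auto
      then have "real C0 * (real n ^ 10 * real L ^ 2) \<le> real C0 * (real n ^ 10 * (2 * l) ^ 2)" by (intro mult_left_mono) auto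
      also have "\<dots> = (real C0 * 4) * real n ^ 10 * l\<^sup>2" by (simp add: power2_eq_square)
      finally show ?thesis using tr unfolding l_def by linarith
    qed
    ultimately show ?thesis using p by blast
  qed
  show ?thesis by (rule exI[of _ "compile solve"], rule exI[of _ "real C0 * 4"]) (use main in blast)
qed

end
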